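(* Let $f\in\mathbb{C}[T]$ be of degree $d\ge2$ and postcritically finite, with exponential core entropy $\rho(f)<d$. For every $\nu>0$ there exists $\kappa(f,\nu)>0$, depending only on $f$ and $\nu$, with the following property. Let $s\in\mathbb{N}_0$ and let $\mathcal{V}$ be a subset of $V_f^{(s)}$ with $\#\mathcal{V}\le\kappa(f,\nu)d^s$. Then the convex hull of $\mathcal{V}$ in $H_f^{(s)}$ has at most $\nu d^s$ edges.
   Context: $\mathbb{N}=\{1,2,\dots\}$, $\mathbb{N}_0=\mathbb{N}\cup\{0\}$; $f^{(n)}$ is the $n$-th iterate. $f$ is postcritically finite if all roots of $f'$ have finite forward orbit. $J_f$ and $K_f$ are the Julia set and filled Julia set in $\mathbb{C}$. Hubbard tree (Douady–Hubbard). Let $f$ be postcritically finite. The connected components of $K_f\setminus J_f$ (bounded Fatou components) are open, simply connected, and mapped by $f$ onto such components. With $\Delta$ the open unit disk, one can choose biholomorphic maps $\varphi_U\colon U\to\Delta$, one for each component $U$, such that $\varphi_{f(U)}(f(z))=\varphi_U(z)^{d(U)}$ on $U$ for some $d(U)\in\mathbb{N}$; each $\varphi_U$ extends to a homeomorphism $\overline U\to\overline\Delta$, and the notions below do not depend on the choice. A ray in $\overline\Delta$ is a set $\{t\zeta:t\in[0,1]\}$ with $|\zeta|=1$. An arc is the image of an injective continuous map $[0,1]\to\mathbb{C}$. An arc $\Gamma\subset K_f$ is allowable if for every $U$ the set $\varphi_U(\Gamma\cap\overline U)$ is contained in the union of two rays. Any two distinct $x,y\in K_f$ are the endpoints of a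 unique allowable arc $[x,y]_f$; put $[x,x]_f=\{x\}$. Let $\mathrm{PCO}_{\ge0}(f)=\{f^{(n)}(z):n\in\mathbb{N}_0,\ f'(z)=0\}$, a finite set. The Hubbard tree $H_f$ is the union of all $[z',z'']_f$ with $z',z''\in\mathrm{PCO}_{\ge0}(f)$; it is a finite topological tree. Its vertex set $V_f$ is the union of $\mathrm{PCO}_{\ge0}(f)$ and the set of branching points ($z\in H_f$ such that $H_f\setminus\{z\}$ has more than two connected components). Its edges, forming the finite set $E_f$, are the closures of the connected components of $H_f\setminus V_f$, each parametrized by an injective continuous map $e\colon[0,1]\to H_f$ with $e(0),e(1)\in V_f$. Core entropy. One has $f(H_f)\subset H_f$ and $f(V_f)\subset V_f$, and for each $e\in E_f$ the path $f\circ e$ is a simple path in $H_f$ traversing pairwise distinct edges $e_1,\ldots,e_m$; put $L(e)=e_1+\cdots+e_m$ and extend linearly to an endomorphism $L$ of the free abelian group $\mathbb{Z}[E_f]$. The exponential core entropy $\rho(f)$ is the spectral radius of $L\otimes\mathbb{C}$ if $E_f\ne\emptyset$, and $\rho(f)=1$ if $E_f=\emptyset$. Preimage trees. For $s\in\mathbb{N}_0$ let $H_f^{(s)}=(f^{(s)})^{-1}(H_f)$ and $V_f^{(s)}=(f^{(s)})^{-1}(V_f)$. Then $H_f^{(s)}$ is a finite topological tree with vertex set $V_f^{(s)}$, whose edges are the lifts under $f^{(s)}$ of edges of $H_f$ (continuous maps $\tilde e\colon[0,1]\to H_f^{(s)}$ with $f^{(s)}\circ\tilde e=e\in E_f$);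 there are $d^s\,\#E_f$ of them. The convex hull of a set $\mathcal{V}\subset V_f^{(s)}$ is the smallest subtree of $H_f^{(s)}$ whose vertex set contains $\mathcal{V}$ (it has no edges if $\mathcal{V}=\emptyset$). *)

theory Defs
  imports
    "HOL-Analysis.Analysis"
    "HOL-Library.Poly_Mapping"
    "Jordan_Normal_Form.Spectral_Radius"
begin

abbreviation iter :: "complex poly \<Rightarrow> nat \<Rightarrow> complex \<Rightarrow> complex" where
  "iter f n \<equiv> poly f ^^ n"

definition postcritically_finite :: "complex poly \<Rightarrow> bool" where
  "postcritically_finite f \<longleftrightarrow>
     (\<forall>z. poly (pderiv f) z = 0 \<longrightarrow> finite (range (\<lambda>n. iter f n z)))"

definition postcritical_set :: "complex poly \<Rightarrow> complex set" where
  "postcritical_set f = {iter f n z | n z. poly (pderiv f) z = 0}"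

definition filled_Julia :: "complex poly \<Rightarrow> complex set" where
  "filled_Julia f = {z. bounded (range (\<lambda>n. iter f n z))}"

definition Julia :: "complex poly \<Rightarrow> complex set" where
  "Julia f = frontier (filled_Julia f)"

definition bounded_Fatou_components :: "complex poly \<Rightarrow> complex set set" where
  "bounded_Fatou_components f = components (filled_Julia f - Julia f)"

text \<open>Here \<open>\<phi> U\<close> denotes the biholomorphic map from \<open>U\<close> to the open unit disk together with
  its homeomorphic extension to the closures.\<close>

definition Fatou_coordinates :: "complex poly \<Rightarrow> (complex set \<Rightarrow> complex \<Rightarrow> complex) \<Rightarrow> bool" where
  "Fatou_coordinates f \<phi> \<longleftrightarrow>
     (\<forall>U \<in> bounded_Fatou_components f.
        \<phi> U holomorphic_on U \<and> \<phi> U ` U = ball 0 1 \<and>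
        (\<exists>\<psi>. homeomorphism (closure U) (cball 0 1) (\<phi> U) \<psi> \<and> \<psi> holomorphic_on ball 0 1) \<and>
        (\<exists>d\<ge>1. \<forall>z\<in>U. \<phi> (poly f ` U) (poly f z) = \<phi> U z ^ d))"

text \<open>For postcritically finite \<open>f\<close> of degree at least 2 such coordinates exist, and two systems
  of them differ by rotations of the disk, which permute its rays; so the notions below do not
  depend on the system selected here.\<close>

definition Fatou_coord :: "complex poly \<Rightarrow> complex set \<Rightarrow> complex \<Rightarrow> complex" where
  "Fatou_coord f = (SOME \<phi>. Fatou_coordinates f \<phi>)"

definition disk_ray :: "complex \<Rightarrow> complex set" where
  "disk_ray \<zeta> = {of_real t * \<zeta> | t. t \<in> {0..1}}"

definition allowable :: "complex poly \<Rightarrow> complex set \<Rightarrow> bool" where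
  "allowable f \<Gamma> \<longleftrightarrow> \<Gamma> \<subseteq> filled_Julia f \<and>
     (\<forall>U \<in> bounded_Fatou_components f. \<exists>\<zeta> \<xi>. norm \<zeta> = 1 \<and> norm \<xi> = 1 \<and>
        Fatou_coord f U ` (\<Gamma> \<inter> closure U) \<subseteq> disk_ray \<zeta> \<union> disk_ray \<xi>)"

definition allowable_arc :: "complex poly \<Rightarrow> complex \<Rightarrow> complex \<Rightarrow> complex set" where
  "allowable_arc f x y =
     (if x = y then {x}
      else THE \<Gamma>. allowable f \<Gamma> \<and>
             (\<exists>g. arc g \<and> path_image g = \<Gamma> \<and> pathstart g = x \<and> pathfinish g = y))"

definition Hubbard_tree :: "complex poly \<Rightarrow> complex set" where
  "Hubbard_tree f = (\<Union>x \<in> postcritical_set f. \<Union>y \<in> postcritical_set f. allowable_arc f x y)"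

definition branching_points :: "complex set \<Rightarrow> complex set" where
  "branching_points H =
     {z \<in> H. infinite (components (H - {z})) \<or> card (components (H - {z})) > 2}"

definition Hubbard_vertices :: "complex poly \<Rightarrow> complex set" where
  "Hubbard_vertices f = postcritical_set f \<union> branching_points (Hubbard_tree f)"

text \<open>Edges are represented by their underlying sets.\<close>

definition Hubbard_edges :: "complex poly \<Rightarrow> complex set set" where
  "Hubbard_edges f = closure ` components (Hubbard_tree f - Hubbard_vertices f)"

definition edge_parametrization :: "complex poly \<Rightarrow> (real \<Rightarrow> complex) \<Rightarrow> bool" where
  "edge_parametrization f e \<longleftrightarrow> arc e \<and> path_image e \<in> Hubbard_edges f \<and>
     pathstart e \<in> Hubbard_vertices f \<and> pathfinish e \<in> Hubbard_vertices f"

text \<open>The path \<open>f \<circ> e\<close> is simple and is a concatenation of pairwise distinct edges, so the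
  edges it traverses, each of them once, are exactly those contained in its image.\<close>

definition edge_map :: "complex poly \<Rightarrow> (complex set \<Rightarrow>\<^sub>0 int) \<Rightarrow> (complex set \<Rightarrow>\<^sub>0 int)" where
  "edge_map f =
     frag_extend (\<lambda>e. \<Sum>e' \<in> {e' \<in> Hubbard_edges f. e' \<subseteq> poly f ` e}. frag_of e')"

text \<open>The matrix of \<open>edge_map f\<close> on the free abelian group generated by the edges, extended to
  the complex numbers; the numbering of the finitely many edges by \<open>from_nat_into\<close> is arbitrary
  and does not affect the spectral radius.\<close>

definition edge_matrix :: "complex poly \<Rightarrow> complex mat" where
  "edge_matrix f =
     (let E = Hubbard_edges f; n = card E in
      mat n n (\<lambda>(i, j).
        of_int (Poly_Mapping.lookup (edge_map f (frag_of (from_nat_into E j))) (from_nat_into E i))))"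

definition exp_core_entropy :: "complex poly \<Rightarrow> real" where
  "exp_core_entropy f =
     (if Hubbard_edges f = {} then 1 else spectral_radius (edge_matrix f))"

definition preimage_tree :: "complex poly \<Rightarrow> nat \<Rightarrow> complex set" where
  "preimage_tree f s = iter f s -` Hubbard_tree f"

definition preimage_vertices :: "complex poly \<Rightarrow> nat \<Rightarrow> complex set" where
  "preimage_vertices f s = iter f s -` Hubbard_vertices f"

definition preimage_edges :: "complex poly \<Rightarrow> nat \<Rightarrow> complex set set" where
  "preimage_edges f s =
     {path_image g | g. path g \<and> path_image g \<subseteq> preimage_tree f s \<and>
        edge_parametrization f (iter f s \<circ> g)}"

text \<open>Since the preimage tree is a finite tree, its subtrees are the connected unions of
  vertices and (closed) edges. The empty subtree is admitted; it is the convex hull of the empty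
  set of vertices.\<close>

definition is_subtree :: "complex poly \<Rightarrow> nat \<Rightarrow> complex set \<Rightarrow> bool" where
  "is_subtree f s T \<longleftrightarrow>
     (\<exists>W F. W \<subseteq> preimage_vertices f s \<and> F \<subseteq> preimage_edges f s \<and> T = W \<union> \<Union>F) \<and> connected T"

definition tree_hull :: "complex poly \<Rightarrow> nat \<Rightarrow> complex set \<Rightarrow> complex set" where
  "tree_hull f s \<V> = is_subtree f s hull \<V>"

definition subtree_edges :: "complex poly \<Rightarrow> nat \<Rightarrow> complex set \<Rightarrow> complex set set" where
  "subtree_edges f s T = {e \<in> preimage_edges f s. e \<subseteq> T}"

end

theory Submission
  imports Defs "HOL-Complex_Analysis.Complex_Analysis"
begin

text \<open>The interior of the filled Julia set \<open>K\<close> is the superattracting basin, and off the superattracting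
  cycles pullbacks under iterates shrink exponentially. Hence the Fatou coordinates exist up to the
  boundary and \<open>K\<close> is path-connected. A simple closed curve in \<open>K\<close> bounds a region inside a single Fatou
  component, so a set meeting each component in finitely many rays contains none: allowable arcs are
  unique, and the preimage trees are convex hulls.

  Put \<open>t = s - k\<close>. The hull of \<open>\<V>\<close> lies in the union of the level \<open>t\<close> tree and one arc from each point
  of \<open>\<V>\<close> to it. The \<open>t\<close>-th iterate is injective on such an arc, which thus has at most \<open>d ^ k * card E\<close>
  edges. The level \<open>t\<close> tree has at most \<open>d ^ t\<close> times as many edges as the Hubbard tree has at level \<open>k\<close>,
  and this number grows at most like \<open>r ^ k\<close> with \<open>r < d\<close>. Choose first \<open>k\<close>, then \<open>\<kappa>\<close>.\<close>

subsection \<open>Ramified lifts\<close>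

text \<open>The tree is defined through a chosen system of Fatou coordinates and a definite
  description of allowable arcs, so nothing can be said about it before such coordinates and unique
  arcs are shown to exist. No expanding metric is built for this. An orbit segment that ends outside
  the superattracting cycles meets no critical point twice, so the local degrees of all iterates
  along it are bounded by one number \<open>Mx\<close>. Pullbacks of a small disc are therefore
  parametrised by disc maps in which the iterate reads w -> w^m with m at most \<open>Mx\<close>;
  normality shows that they collapse, and the Schwarz lemma turns this into halving after a fixed
  time.

  For the count, f maps an edge of the Hubbard tree injectively over whole edges, so the number of
  level k edges inside it is at most a column sum of the k-th power of the edge matrix. Such powers
  may exceed those of the spectral radius by polynomial factors; a number r strictly between the
  spectral radius and d absorbs them. The two summands of the final bound get \<nu> / 2
  each.\<close>

lemma holomorphic_on_poly [holomorphic_intros]: "poly p holomorphic_on S" for p :: "complex poly"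
  using holomorphic_on_ident[of S] by (metis (no_types, lifting) field_differentiable_at_within field_differentiable_def holomorphic_on_def poly_DERIV)

lemma closedin_seqI:
  fixes S :: "'a::metric_space set"
  assumes "S \<subseteq> U" "\<And>t l. \<forall>n. t n \<in> S \<Longrightarrow> l \<in> U \<Longrightarrow> t \<longlonglongrightarrow> l \<Longrightarrow> l \<in> S"
  shows "closedin (top_of_set U) S"
proof -
  have "x \<in> S" if "x \<in> U" "x \<in> closure S" for x using that(2) assms(2)[OF _ that(1)] unfolding closure_sequential by blast
  then have "S = U \<inter> closure S" using assms(1) closure_subset[of S] by blast
  then show ?thesis using closedin_closed by blast
qed

text \<open>Polynomials are proper: their modulus tends to infinity, so preimages of a convergent
  sequence stay bounded and accumulate in the closed set C.\<close>

lemma poly_closed_image: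
  fixes p :: "complex poly"
  assumes "degree p > 0" "closed C"
  shows "closed (poly p ` C)"
  unfolding closed_sequential_limits
proof (intro allI impI, elim conjE)
  fix s l assume s: "\<forall>n. s n \<in> poly p ` C" and l: "s \<longlonglongrightarrow> l"
  then have "\<forall>n. \<exists>c. c \<in> C \<and> s n = poly p c" by blast
  then obtain c where c: "\<And>n. c n \<in> C" "\<And>n. s n = poly p (c n)" by metis
  have "bounded (range s)" using l by (rule convergent_imp_bounded)
  then obtain B where B: "\<And>n. norm (s n) \<le> B" by (auto simp: bounded_iff)
  have "filterlim (poly p) at_infinity at_infinity" using assms(1) by (intro filterlim_poly_at_infinity) auto
  then have "eventually (\<lambda>z. norm (poly p z) > B) at_infinity"
    using filterlim_at_infinity_imp_norm_at_top unfolding filterlim_at_top_dense by blast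
  then obtain b where b: "\<And>z. norm z \<ge> b \<Longrightarrow> norm (poly p z) > B" by (auto simp: eventually_at_infinity)
  have "c n \<in> cball 0 b" for n using b[of "c n"] B[of n] c(2)[of n] by (cases "norm (c n) \<ge> b") auto
  then obtain z r where z: "strict_mono r" "(c \<circ> r) \<longlonglongrightarrow> z" using compact_cball[of "0::complex" b] unfolding compact_def by metis
  have "z \<in> C" using z(2) assms(2) c(1) unfolding closed_sequential_limits by (auto simp: o_def) (metis c(1))
  moreover have "(\<lambda>n. poly p ((c \<circ> r) n)) \<longlonglongrightarrow> poly p z" using z(2) by (intro tendsto_intros)
  then have "(s \<circ> r) \<longlonglongrightarrow> poly p z" using c(2) by (simp add: o_def)
  then have "l = poly p z" using LIMSEQ_subseq_LIMSEQ[OF l z(1)] LIMSEQ_unique by blast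
  ultimately show "l \<in> poly p ` C" by blast
qed

lemma poly_has_preimage:
  fixes p :: "complex poly"
  assumes "degree p > 0" obtains z where "poly p z = x"
proof -
  have "degree (p - [:x:]) = degree p"
    using degree_add_eq_left[of "- [:x:]" p] assms by (simp only: degree_minus degree_pCons_0 add_uminus_conv_diff)
  then have "\<not> constant (poly (p - [:x:]))" using assms by (simp add: constant_degree)
  from Fundamental_Theorem_Algebra.fundamental_theorem_of_algebra[OF this] obtain z where "poly (p - [:x:]) z = 0" ..
  then show ?thesis by (intro that[of z]) simp
qed

lemma finite_poly_fibre:
  fixes p :: "complex poly"
  assumes "degree p > 0" shows "finite {z. poly p z = x}"
proof -
  have "p - [:x:] \<noteq> 0" using assms by auto
  then have "finite {z. poly (p - [:x:]) z = 0}" by (rule poly_roots_finite)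
  then show ?thesis by (simp add: algebra_simps)
qed

text \<open>The factor 2 makes the balls of radius d about distinct points disjoint.\<close>

lemma finite_separated:
  fixes Z :: "complex set"
  assumes "finite Z" "\<And>z. z \<in> Z \<Longrightarrow> r z > 0"
  obtains d where "d > (0::real)" "\<And>z. z \<in> Z \<Longrightarrow> d \<le> r z"
    "\<And>z z'. z \<in> Z \<Longrightarrow> z' \<in> Z \<Longrightarrow> z \<noteq> z' \<Longrightarrow> 2 * d \<le> dist z z'"
proof -
  define D where "D = insert 1 (r ` Z \<union> (\<lambda>(z,z'). dist z z' / 2) ` {(z,z') \<in> Z \<times> Z. z \<noteq> z'})"
  have fin: "finite D" unfolding D_def using assms(1) by (auto intro!: finite_imageI intro: finite_subset[of _ "Z \<times> Z"])
  have "Min D > 0" using fin assms(2) by (subst Min_gr_iff) (auto simp: D_def)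
  moreover have "Min D \<le> r z" if "z \<in> Z" for z using fin that by (auto simp: D_def)
  moreover have "2 * Min D \<le> dist z z'" if "z \<in> Z" "z' \<in> Z" "z \<noteq> z'" for z z'
  proof -
    have "dist z z' / 2 \<in> D" unfolding D_def using that by (intro insertI2 UnI2 image_eqI[of _ _ "(z,z')"]) auto
    then show ?thesis using fin Min_le by fastforce
  qed
  ultimately show ?thesis using that by blast
qed

lemma poly_locally_inj:
  fixes p :: "complex poly"
  assumes "poly (pderiv p) z \<noteq> 0" obtains r where "r > 0" "inj_on (poly p) (ball z r)"
proof -
  have "deriv (poly p) z \<noteq> 0" using assms DERIV_imp_deriv[OF poly_DERIV[of p z]] by simp
  then show ?thesis using has_complex_derivative_locally_injective[of "poly p" UNIV z] that
    by (metis UNIV_I holomorphic_on_poly open_UNIV)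
qed

text \<open>Off Q, p is injective near each point of a fibre; a neighbourhood of x whose full
  preimage lies in finitely many such discs is evenly covered.\<close>

lemma poly_covering_space:
  fixes p :: "complex poly"
  assumes deg: "degree p > 0" and Q: "finite Q" "\<And>z. poly (pderiv p) z = 0 \<Longrightarrow> poly p z \<in> Q"
  shows "covering_space (- (poly p -` Q)) (poly p) (- Q)"
proof
  show "continuous_on (- (poly p -` Q)) (poly p)" by (intro continuous_intros)
  show "poly p ` (- poly p -` Q) = - Q"
  proof (intro equalityI subsetI)
    fix x assume x: "x \<in> - Q"
    obtain z where "poly p z = x" using poly_has_preimage[OF deg] .
    then show "x \<in> poly p ` (- poly p -` Q)" using x by (intro image_eqI[of _ _ z]) auto
  qed auto
  fix x assume x: "x \<in> - Q"
  define Z where "Z = {z. poly p z = x}"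
  have finZ: "finite Z" unfolding Z_def by (rule finite_poly_fibre[OF deg])
  have "\<exists>r>0. inj_on (poly p) (ball z r)" if "z \<in> Z" for z
  proof -
    have "poly (pderiv p) z \<noteq> 0" using Q(2) x that by (auto simp: Z_def)
    then show ?thesis using poly_locally_inj by metis
  qed
  then obtain r where r: "\<And>z. z \<in> Z \<Longrightarrow> r z > 0" "\<And>z. z \<in> Z \<Longrightarrow> inj_on (poly p) (ball z (r z))" by metis
  obtain d where d: "d > 0" "\<And>z. z \<in> Z \<Longrightarrow> d \<le> r z"
    "\<And>z z'. z \<in> Z \<Longrightarrow> z' \<in> Z \<Longrightarrow> z \<noteq> z' \<Longrightarrow> 2 * d \<le> dist z z'" using finite_separated[OF finZ, of r] r(1) by metis
  define N where "N z = ball z d" for z :: complex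
  have injN: "inj_on (poly p) (N z)" if "z \<in> Z" for z
    using r(2)[OF that] d(2)[OF that] unfolding N_def by (meson inj_on_subset subset_ball)
  have openN: "open (N z)" for z by (simp add: N_def)
  have opN: "open (poly p ` N z)" if "z \<in> Z" for z
    using injN[OF that] openN by (intro open_mapping_thm3) (auto intro!: holomorphic_intros)
  \<comment> \<open>Removing the image of the complement of the discs forces every preimage of a
    point of T into one of them; the removed set is closed because p is proper.\<close>
  define T where "T = (\<Inter>z\<in>Z. poly p ` N z) - poly p ` (- (\<Union>z\<in>Z. N z)) - Q"
  have "closed (poly p ` (- (\<Union>z\<in>Z. N z)))" by (intro poly_closed_image[OF deg] closed_Compl open_UN ballI openN)
  then have opT: "open T" unfolding T_def using opN finZ Q(1)
    by (intro open_Diff open_INT ballI) (auto intro: finite_imp_closed simp del: Compl_UN)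
  have "z \<in> N z" for z using d(1) by (simp add: N_def)
  then have xT: "x \<in> T" unfolding T_def using x by (auto simp: Z_def image_iff)
  let ?v = "(\<lambda>z. N z \<inter> poly p -` T) ` Z"
  have opv: "open (N z \<inter> poly p -` T)" for z using opT openN by (intro open_Int open_vimage continuous_intros) auto
  show "\<exists>T. x \<in> T \<and> openin (top_of_set (- Q)) T \<and>
             (\<exists>v. \<Union>v = - poly p -` Q \<inter> poly p -` T \<and> (\<forall>u \<in> v. openin (top_of_set (- poly p -` Q)) u) \<and>
             pairwise disjnt v \<and> (\<forall>u \<in> v. \<exists>q. homeomorphism u T (poly p) q))"
  proof (intro exI[of _ T] conjI exI[of _ ?v] ballI xT)
    have TQ: "T \<subseteq> - Q" by (auto simp: T_def)
    show "openin (top_of_set (- Q)) T" using opT TQ by (simp add: open_subset)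
    show "\<Union>?v = - poly p -` Q \<inter> poly p -` T" by (auto simp: T_def)
    show "openin (top_of_set (- poly p -` Q)) u" if "u \<in> ?v" for u using that opv TQ by (auto intro!: open_subset)
    have "N z \<inter> N z' = {}" if "z \<in> Z" "z' \<in> Z" "z \<noteq> z'" for z z'
    proof -
      { fix a assume "a \<in> N z" "a \<in> N z'"
        then have "dist z z' < d + d" unfolding N_def mem_ball by (metis dist_commute dist_triangle_less_add)
        then have False using d(3)[OF that] by simp }
      then show ?thesis by auto
    qed
    then show "pairwise disjnt ?v" unfolding pairwise_def disjnt_def by blast
    fix u assume "u \<in> ?v"
    then obtain z where z: "z \<in> Z" "u = N z \<inter> poly p -` T" by auto
    have "T \<subseteq> poly p ` N z" using z(1) by (auto simp: T_def)
    then have "poly p ` u = T" unfolding z(2) by auto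
    moreover have "inj_on (poly p) u" using injN[OF z(1)] z(2) by (auto simp: inj_on_def)
    ultimately show "\<exists>q. homeomorphism u T (poly p) q" using invariance_of_domain_homeomorphism[of u "poly p"] opv[of z] z(2)
        continuous_on_poly[OF continuous_on_id, of u p] by (auto simp del: vimage_eq) metis
  qed
qed

text \<open>Locally g is a holomorphic branch of the inverse of p, applied to the given holomorphic
  function.\<close>

lemma holomorphic_lift:
  fixes p :: "complex poly"
  assumes "open S" "continuous_on S g" "(\<lambda>z. poly p (g z)) holomorphic_on S"
    "\<And>z. z \<in> S \<Longrightarrow> poly (pderiv p) (g z) \<noteq> 0"
  shows "g holomorphic_on S"
  unfolding holomorphic_on_open[OF assms(1)]
proof
  fix z assume z: "z \<in> S"
  obtain r where r: "r > 0" "inj_on (poly p) (ball (g z) r)" using poly_locally_inj[OF assms(4)[OF z]] .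
  obtain h where h: "h holomorphic_on (poly p ` ball (g z) r)" "\<And>w. w \<in> ball (g z) r \<Longrightarrow> h (poly p w) = w"
    using holomorphic_has_inverse[OF holomorphic_on_poly open_ball r(2)] by metis
  define S' where "S' = S \<inter> g -` ball (g z) r"
  have S': "open S'" "z \<in> S'" unfolding S'_def using assms(1,2) z r(1) continuous_open_preimage[of S g] by auto
  have "(h \<circ> (\<lambda>z. poly p (g z))) holomorphic_on S'"
    by (rule holomorphic_on_compose_gen[OF holomorphic_on_subset[OF assms(3)] h(1)]) (auto simp: S'_def)
  then have "g holomorphic_on S'" by (rule holomorphic_transform) (auto simp: S'_def h(2))
  then show "\<exists>f'. (g has_field_derivative f') (at z)" using S' holomorphic_on_open by blast
qed

text \<open>\<open>\<psi>\<close> is a disc coordinate, centred at a preimage of \<open>x\<close>, of a component of the preimage of a ball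
  in which only \<open>x\<close> may be a critical value.\<close>

definition rlift :: "complex poly \<Rightarrow> complex \<Rightarrow> real \<Rightarrow> nat \<Rightarrow> (complex \<Rightarrow> complex) \<Rightarrow> bool" where
  "rlift p x r m \<psi> \<longleftrightarrow> \<psi> holomorphic_on ball 0 1 \<and>
     (\<forall>w\<in>ball 0 1. poly p (\<psi> w) = x + of_real r * w ^ m)"

text \<open>Near y, p - x is (z - y)^m times a nonvanishing q. A holomorphic logarithm of q provides
  an m-th root, so p - x is the m-th power of a locally invertible function; k is the inverse of
  that function.\<close>

lemma local_power_coordinate:
  fixes p :: "complex poly"
  assumes p0: "degree p > 0" and py: "poly p y = x"
  obtains k e where "e > 0" "k holomorphic_on ball 0 e" "k 0 = y"
     "\<And>w. w \<in> ball 0 e \<Longrightarrow> poly p (k w) = x + w ^ order y (p - [:x:])"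
proof -
  define m where "m = order y (p - [:x:])"
  have nz: "p - [:x:] \<noteq> 0" using p0 by auto
  obtain q where q: "p - [:x:] = [:-y, 1:] ^ m * q" "\<not> [:-y, 1:] dvd q" using order_decomp[OF nz, of y] m_def by auto
  have m0: "m > 0" unfolding m_def using nz py order_root[of "p - [:x:]" y] by (auto intro: gr0I)
  have qy: "poly q y \<noteq> 0" using q(2) by (simp add: poly_eq_0_iff_dvd)
  have peq: "poly p z = x + (z - y) ^ m * poly q z" for z
  proof -
    have "poly (p - [:x:]) z = (z - y) ^ m * poly q z" unfolding q(1) by simp
    then show ?thesis by (simp add: algebra_simps)
  qed
  have "isCont (poly q) y" by (intro continuous_intros)
  then have "\<exists>d>0. \<forall>z. dist z y < d \<longrightarrow> dist (poly q z) (poly q y) < norm (poly q y)"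
    using qy unfolding continuous_at_eps_delta by (auto simp: dist_commute)
  then obtain d where d: "d > 0" "\<And>z. z \<in> ball y d \<Longrightarrow> dist (poly q z) (poly q y) < norm (poly q y)" by (auto simp: dist_commute)
  have "poly q z \<noteq> 0" if "z \<in> ball y d" for z using d(2)[OF that] by auto
  then obtain l where l: "l holomorphic_on ball y d" "\<And>z. z \<in> ball y d \<Longrightarrow> poly q z = exp (l z)"
    using contractible_imp_holomorphic_log[OF holomorphic_on_poly convex_imp_contractible[OF convex_ball]] by metis
  define u where "u z = (z - y) * exp (l z / of_nat m)" for z
  have um: "u z ^ m = (z - y) ^ m * poly q z" if "z \<in> ball y d" for z
    using that m0 by (simp add: u_def power_mult_distrib l(2) flip: exp_of_nat_mult)
  have hu: "u holomorphic_on ball y d" unfolding u_def using l(1) m0 by (intro holomorphic_intros) auto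
  have y: "y \<in> ball y d" using d(1) by simp
  have "(l has_field_derivative deriv l y) (at y)" using l(1) y holomorphic_derivI by blast
  then have "(u has_field_derivative exp (l y / of_nat m)) (at y)" unfolding u_def using m0 by (auto intro!: derivative_eq_intros)
  then have "deriv u y \<noteq> 0" by (simp add: DERIV_imp_deriv)
  then obtain r where r: "r > 0" "ball y r \<subseteq> ball y d" "open (u ` ball y r)" "inj_on u (ball y r)"
    using has_complex_derivative_locally_invertible[OF hu y open_ball] by metis
  obtain k where k: "k holomorphic_on (u ` ball y r)" "\<And>z. z \<in> ball y r \<Longrightarrow> k (u z) = z"
    using holomorphic_has_inverse[OF holomorphic_on_subset[OF hu r(2)] open_ball r(4)] by metis
  have "0 \<in> u ` ball y r" using r(1) by (auto simp: u_def image_iff intro!: bexI[of _ y])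
  then obtain e where e: "e > 0" "ball 0 e \<subseteq> u ` ball y r" using r(3) openE by blast
  have "k 0 = y" using k(2)[of y] r(1) by (simp add: u_def)
  moreover have "poly p (k w) = x + w ^ m" if w: "w \<in> ball 0 e" for w
  proof -
    obtain z where z: "z \<in> ball y r" "w = u z" using e(2) w by auto
    then show ?thesis using k(2)[OF z(1)] um[of z] r(2) peq[of z] by auto
  qed
  ultimately show ?thesis using that[of e k] e k(1) holomorphic_on_subset m_def by blast
qed

text \<open>The punctured ball is uniformised by the left half-plane through exp. The half-plane is
  simply connected, so the map lifts through the covering; with m equal to the local degree at y,
  the lift is invariant under the periods of exp, descends to the punctured disc and closes up with
  the value y at 0.\<close>

lemma ramified_lift:
  fixes p :: "complex poly"
  assumes deg: "degree p > 0" and Q: "finite Q" "\<And>z. poly (pderiv p) z = 0 \<Longrightarrow> poly p z \<in> Q"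
    and r: "r > 0" "Q \<inter> ball x r \<subseteq> {x}" and py: "poly p y = x"
  obtains \<psi> where "rlift p x r (order y (p - [:x:])) \<psi>" "\<psi> 0 = y"
proof -
  define m where "m = order y (p - [:x:])"
  have nz: "p - [:x:] \<noteq> 0" using deg by auto
  have m0: "m > 0" unfolding m_def using nz py order_root[of "p - [:x:]" y] by (auto intro: gr0I)
  obtain k e where k: "e > 0" "k holomorphic_on ball 0 e" "k 0 = y"
     "\<And>w. w \<in> ball 0 e \<Longrightarrow> poly p (k w) = x + w ^ m" using local_power_coordinate[OF deg py] m_def by metis
  \<comment> \<open>Scaling by the m-th root of r turns the local equation with w^m into the one
    with r w^m.\<close>
  define \<rho> where "\<rho> = root m r"
  have \<rho>: "\<rho> > 0" "\<rho> ^ m = r" using r(1) m0 by (auto simp: \<rho>_def)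
  define L where "L = {\<zeta>::complex. Re \<zeta> < 0}"
  define g where "g \<zeta> = x + of_real r * exp (of_nat m * \<zeta>)" for \<zeta>
  define C where "C = - (poly p -` Q)"
  have cov: "covering_space C (poly p) (- Q)" unfolding C_def by (rule poly_covering_space[OF deg Q])
  have gQ: "g \<zeta> \<in> - Q" if "\<zeta> \<in> L" for \<zeta>
  proof -
    have "exp (of_nat m * Re \<zeta>) < 1" using that m0 by (simp add: L_def mult_less_0_iff)
    then have "g \<zeta> \<in> ball x r" using r(1) by (simp add: g_def dist_norm norm_mult)
    moreover have "g \<zeta> \<noteq> x" using r(1) by (simp add: g_def)
    ultimately show ?thesis using r(2) by blast
  qed
  have contg: "continuous_on L g" unfolding g_def by (intro continuous_intros)
  \<comment> \<open>Left of T the point \<rho> exp \<zeta> lies in the domain of the local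
    coordinate k, which provides an explicit lift there.\<close>
  define T where "T = min 0 (ln (e / \<rho>))"
  define D where "D = {\<zeta>::complex. Re \<zeta> < T}"
  have DL: "D \<subseteq> L" by (auto simp: D_def L_def T_def)
  have De: "of_real \<rho> * exp \<zeta> \<in> ball 0 e" if "\<zeta> \<in> D" for \<zeta>
  proof -
    have "exp (Re \<zeta>) < exp (ln (e / \<rho>))" using that by (simp add: D_def T_def)
    then have "\<rho> * exp (Re \<zeta>) < e" using \<rho>(1) k(1) by (simp add: field_simps)
    then show ?thesis using \<rho>(1) by (simp add: norm_mult)
  qed
  have kg: "poly p (k (of_real \<rho> * exp \<zeta>)) = g \<zeta>" if "\<zeta> \<in> D" for \<zeta>
    using k(4)[OF De[OF that]] \<rho>(2) by (simp add: g_def power_mult_distrib flip: exp_of_nat_mult of_real_power)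
  have cvxL: "convex L" "open L" unfolding L_def using convex_halfspace_Re_lt open_halfspace_Re_lt by auto
  have cvxD: "convex D" unfolding D_def using convex_halfspace_Re_lt by auto
  define \<zeta>0 where "\<zeta>0 = complex_of_real (T - 1)"
  have \<zeta>0: "\<zeta>0 \<in> D" "\<zeta>0 \<in> L" using DL by (auto simp: \<zeta>0_def D_def)
  define a where "a = k (of_real \<rho> * exp \<zeta>0)"
  have pa: "poly p a = g \<zeta>0" unfolding a_def by (rule kg[OF \<zeta>0(1)])
  have aC: "a \<in> C" using pa gQ[OF \<zeta>0(2)] by (simp add: C_def)
  obtain G where G: "continuous_on L G" "G \<in> L \<rightarrow> C" "G \<zeta>0 = a" "\<And>\<zeta>. \<zeta> \<in> L \<Longrightarrow> poly p (G \<zeta>) = g \<zeta>"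
    using covering_space_lift_strong[OF cov aC \<zeta>0(2) convex_imp_simply_connected[OF cvxL(1)]
      convex_imp_locally_path_connected[OF cvxL(1)] contg, OF _ pa[symmetric]] gQ by blast
  have Gk: "G \<zeta> = k (of_real \<rho> * exp \<zeta>)" if "\<zeta> \<in> D" for \<zeta>
  proof (rule covering_space_lift_unique[OF cov, of G \<zeta>0 "\<lambda>\<zeta>. k (of_real \<rho> * exp \<zeta>)" D g \<zeta>])
    show "continuous_on D (\<lambda>\<zeta>. k (of_real \<rho> * exp \<zeta>))"
      using De by (intro continuous_on_compose2[OF holomorphic_on_imp_continuous_on[OF k(2)]] continuous_intros) auto
    show "(\<lambda>\<zeta>. k (of_real \<rho> * exp \<zeta>)) \<in> D \<rightarrow> C" using kg gQ DL by (auto simp: C_def)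
    show "G \<zeta>0 = k (of_real \<rho> * exp \<zeta>0)" by (simp add: G(3) a_def)
    show "continuous_on D g" "continuous_on D G" using contg G(1) DL continuous_on_subset by blast+
    show "g \<in> D \<rightarrow> - Q" "G \<in> D \<rightarrow> C" using gQ G(2) DL by blast+
    show "g \<zeta> = poly p (G \<zeta>)" "g \<zeta> = poly p (k (of_real \<rho> * exp \<zeta>))" if "\<zeta> \<in> D" for \<zeta> using kg[OF that] G(4)[of \<zeta>] DL that by auto
  qed (use that \<zeta>0 cvxD convex_connected in auto)
  \<comment> \<open>By uniqueness of lifts: G and its translate by a period agree at \<zeta>0, since
    on D the lift is a function of exp \<zeta>.\<close>
  have per: "G \<zeta> = G \<zeta>'" if LL: "\<zeta> \<in> L" "\<zeta>' \<in> L" "exp \<zeta> = exp \<zeta>'" for \<zeta> \<zeta>'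
  proof -
    obtain n :: int where n: "\<zeta>' = \<zeta> + of_real (of_int (2 * n) * pi) * \<i>" using LL(3)[symmetric] unfolding exp_eq by blast
    define t where "t = complex_of_real (of_int (2 * n) * pi) * \<i>"
    have Ret: "Re t = 0" by (simp add: t_def)
    have et: "exp (c + t) = exp c" for c unfolding t_def exp_eq by (intro exI[of _ n]) simp
    have gt: "g (c + t) = g c" for c
    proof -
      have "exp (of_nat m * (c + t)) = exp (of_nat m * c)" by (simp add: exp_of_nat_mult et)
      then show ?thesis by (simp add: g_def)
    qed
    have Lt: "c + t \<in> L" if "c \<in> L" for c using that Ret by (simp add: L_def)
    have "G \<zeta> = G (\<zeta> + t)"
    proof (rule covering_space_lift_unique[OF cov, of G \<zeta>0 "\<lambda>c. G (c + t)" L g \<zeta>])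
      have "\<zeta>0 + t \<in> D" using \<zeta>0(1) Ret by (simp add: D_def)
      then show "G \<zeta>0 = G (\<zeta>0 + t)" using Gk \<zeta>0(1) et by simp
      show "continuous_on L (\<lambda>c. G (c + t))" using Lt by (intro continuous_on_compose2[OF G(1)] continuous_intros) auto
      show "g \<in> L \<rightarrow> - Q" "G \<in> L \<rightarrow> C" "(\<lambda>c. G (c + t)) \<in> L \<rightarrow> C" using gQ G(2) Lt by blast+
      show "g c = poly p (G c)" "g c = poly p (G (c + t))" if "c \<in> L" for c using G(4)[OF that] G(4)[OF Lt[OF that]] gt by auto
      show "connected L" using cvxL convex_connected by blast
    qed (use G(1) contg \<open>\<zeta> \<in> L\<close> \<zeta>0 in auto)
    then show ?thesis using n by (simp add: t_def)
  qed
  have holG: "G holomorphic_on L"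
  proof (rule holomorphic_lift[OF cvxL(2) G(1)])
    have "g holomorphic_on L" unfolding g_def by (intro holomorphic_intros)
    then show "(\<lambda>z. poly p (G z)) holomorphic_on L" by (rule holomorphic_transform) (simp add: G(4))
    show "poly (pderiv p) (G z) \<noteq> 0" if "z \<in> L" for z using Q(2)[of "G z"] G(4)[OF that] gQ[OF that] by auto
  qed
  define \<psi> where "\<psi> w = (if w = 0 then y else G (Ln w))" for w
  have LnL: "Ln w \<in> L" if "w \<in> ball 0 1" "w \<noteq> 0" for w using that by (simp add: L_def)
  have "\<psi> field_differentiable (at w0)" if w0: "w0 \<in> ball 0 1" for w0
  proof (cases "w0 = 0")
    case True
    define W where "W = ball (0::complex) (exp T)"
    have "\<psi> w = k (of_real \<rho> * w)" if "w \<in> W" for w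
    proof (cases "w = 0")
      case False
      then have "ln (norm w) < ln (exp T)" using that by (subst ln_less_cancel_iff) (auto simp: W_def)
      then have "Ln w \<in> D" using False by (simp add: D_def)
      then show ?thesis using False Gk by (simp add: \<psi>_def)
    qed (simp add: \<psi>_def k(3))
    moreover have "(\<lambda>w. k (of_real \<rho> * w)) holomorphic_on W"
    proof -
      have "of_real \<rho> * w \<in> ball 0 e" if "w \<in> W" for w :: complex
      proof -
        have "norm w < exp (ln (e/\<rho>))" using that by (simp add: W_def T_def min_def split: if_splits)
           (smt (verit) exp_le_cancel_iff exp_zero)
        then show ?thesis using \<rho>(1) k(1) by (simp add: norm_mult field_simps)
      qed
      then have "(k \<circ> (\<lambda>w. of_real \<rho> * w)) holomorphic_on W" by (intro holomorphic_on_compose_gen[OF _ k(2)] holomorphic_intros) auto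
      then show ?thesis by (simp add: o_def)
    qed
    ultimately have "\<psi> holomorphic_on W" by (simp cong: holomorphic_cong)
    then show ?thesis using True by (simp add: W_def holomorphic_on_imp_differentiable_at)
  next
    case False
    \<comment> \<open>A continuous branch of the logarithm around w0. \<open>Ln\<close> itself may
      jump there, but the two differ by a period of exp, to which G is insensitive.\<close>
    define b where "b w = Ln w0 + Ln (w / w0)" for w
    define W where "W = ball w0 (norm w0) \<inter> ball 0 1"
    have pos: "Re (w / w0) > 0" if "w \<in> W" for w
    proof -
      have "norm (w / w0 - 1) < 1"
      proof -
        have "w / w0 - 1 = (w - w0) / w0" using False by (simp add: field_simps)
        then show ?thesis using that False by (simp add: norm_divide W_def dist_norm norm_minus_commute)
      qed
      then show ?thesis using abs_Re_le_cmod[of "w / w0 - 1"] by auto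
    qed
    have nz: "w \<noteq> 0" if "w \<in> W" for w using pos[OF that] by auto
    have eb: "exp (b w) = w" if "w \<in> W" for w using nz[OF that] False by (simp add: b_def exp_add)
    have bL: "b w \<in> L" if "w \<in> W" for w
    proof -
      have "norm (exp (b w)) < 1" using eb[OF that] that by (simp add: W_def)
      then show ?thesis by (simp add: L_def)
    qed
    have "b holomorphic_on W" unfolding b_def using pos False by (intro holomorphic_intros) (force simp: complex_nonpos_Reals_iff)+
    then have "(G \<circ> b) holomorphic_on W" using bL by (intro holomorphic_on_compose_gen[OF _ holG]) auto
    then have "\<psi> holomorphic_on W"
    proof (rule holomorphic_transform)
      fix w assume w: "w \<in> W"
      then show "(G \<circ> b) w = \<psi> w" using nz[OF w] eb[OF w] per[OF bL[OF w] LnL] by (simp add: \<psi>_def W_def)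
    qed
    then show ?thesis using False w0 by (auto intro!: holomorphic_on_imp_differentiable_at[of _ W] simp: W_def open_Int)
  qed
  then have "\<psi> holomorphic_on ball 0 1" by (simp add: holomorphic_on_def field_differentiable_at_within)
  moreover have "poly p (\<psi> w) = x + of_real r * w ^ m" if "w \<in> ball 0 1" for w
  proof (cases "w = 0")
    case False
    then show ?thesis using G(4)[OF LnL[OF that False]] by (simp add: \<psi>_def g_def exp_of_nat_mult)
  qed (use py m0 in \<open>simp add: \<psi>_def\<close>)
  ultimately show ?thesis using that[of \<psi>] by (simp add: rlift_def m_def \<psi>_def)
qed

text \<open>The component D of the preimage of the ball that contains S is mapped onto the ball, as
  its image is open and closed there; y is a point of D over x. The image of a lift through y is
  open and closed in D, hence all of D. The point y is fixed before any lift is chosen.\<close>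

lemma rlift_cover:
  fixes p :: "complex poly"
  assumes deg: "degree p > 0" and r: "r > 0" and S: "connected S" "S \<noteq> {}" "poly p ` S \<subseteq> ball x r"
  obtains y where "poly p y = x" "\<And>\<psi> m. rlift p x r m \<psi> \<Longrightarrow> m > 0 \<Longrightarrow> \<psi> 0 = y \<Longrightarrow> S \<subseteq> \<psi> ` ball 0 1"
proof -
  define X where "X = poly p -` ball x r"
  have opX: "open X" unfolding X_def by (intro open_vimage continuous_intros) auto
  obtain s where s: "s \<in> S" using S(2) by auto
  define D where "D = connected_component_set X s"
  have SX: "S \<subseteq> X" using S(3) by (auto simp: X_def)
  have SD: "S \<subseteq> D" unfolding D_def using connected_component_maximal[OF s S(1) SX] .
  have opD: "open D" unfolding D_def by (rule open_connected_component[OF opX])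
  have conD: "connected D" by (simp add: D_def)
  have DX: "D \<subseteq> X" by (simp add: D_def connected_component_subset)
  have clD: "closedin (top_of_set X) D" unfolding D_def by (rule closedin_connected_component)
  have ncp: "\<not> poly p constant_on U" if "open U" "U \<noteq> {}" for U
  proof
    assume "poly p constant_on U"
    then obtain c where c: "\<And>z. z \<in> U \<Longrightarrow> poly p z = c" by (auto simp: constant_on_def)
    then have "U \<subseteq> {z. poly p z = c}" by auto
    then show False using finite_poly_fibre[OF deg, of c] that by (meson finite_subset finite_imp_not_open)
  qed
  have opim: "open (poly p ` D)"
    using opD conD ncp[OF opD] s SD by (intro open_mapping_thm[of "poly p" D D]) (auto intro!: holomorphic_intros)
  have "\<exists>C. closed C \<and> D = X \<inter> C" using clD by (auto simp: closedin_closed)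
  then obtain C where C: "closed C" "D = X \<inter> C" by auto
  have "poly p ` D = ball x r \<inter> poly p ` C" using C(2) by (auto simp: X_def)
  then have "closedin (top_of_set (ball x r)) (poly p ` D)" using poly_closed_image[OF deg C(1)] by (auto simp: closedin_closed)
  moreover have "openin (top_of_set (ball x r)) (poly p ` D)" using opim DX by (auto simp: X_def intro!: open_subset)
  ultimately have "poly p ` D = ball x r" using s SD connected_clopen[of "ball x r"] by fastforce
  then obtain y where y: "y \<in> D" "poly p y = x" using r by (metis centre_in_ball imageE)
  have "S \<subseteq> \<psi> ` ball 0 1" if R: "rlift p x r m \<psi>" "m > 0" "\<psi> 0 = y" for \<psi> m
  proof -
    let ?I = "\<psi> ` ball 0 1"
    have eq: "poly p (\<psi> w) = x + of_real r * w ^ m" if "w \<in> ball 0 1" for w using R(1) that by (simp add: rlift_def)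
    have hol: "\<psi> holomorphic_on ball 0 1" using R(1) by (simp add: rlift_def)
    have IX: "?I \<subseteq> X"
    proof -
      have "norm (of_real r * w ^ m) < r" if "w \<in> ball 0 1" for w :: complex
        using that r R(2) by (simp add: norm_mult norm_power power_less_one_iff)
      then show ?thesis using eq by (auto simp: X_def dist_norm)
    qed
    have conI: "connected ?I" by (intro connected_continuous_image holomorphic_on_imp_continuous_on hol) simp
    have yI: "y \<in> ?I" using R(3) by (auto simp: image_iff intro!: bexI[of _ 0])
    have "connected_component_set X s = connected_component_set X y" using y(1) unfolding D_def by (simp add: connected_component_eq)
    then have ID: "?I \<subseteq> D" using connected_component_maximal[OF yI conI IX] by (simp add: D_def)
    have "\<not> \<psi> constant_on ball 0 1"
    proof
      assume "\<psi> constant_on ball 0 1"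
      then have "poly p (\<psi> (1/2)) = poly p (\<psi> 0)" by (auto simp: constant_on_def norm_divide)
      moreover have "poly p (\<psi> (1/2)) = x + of_real r * (1/2) ^ m" "poly p (\<psi> 0) = x + of_real r * 0 ^ m"
        by (rule eq, simp add: norm_divide)+
      ultimately show False using R(2) r by (auto simp: zero_power)
    qed
    then have opI: "open ?I" using hol by (intro open_mapping_thm[of \<psi> "ball 0 1"]) auto
    have "closedin (top_of_set D) ?I"

    proof (intro closedin_seqI[OF ID])
      fix t l assume t: "\<forall>n. t n \<in> ?I" and l: "l \<in> D" "t \<longlonglongrightarrow> l"
      then have "\<forall>n. \<exists>w. w \<in> ball 0 1 \<and> t n = \<psi> w" by blast
      then obtain w where w: "\<And>n. w n \<in> ball 0 1" "\<And>n. t n = \<psi> (w n)" by metis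
      then obtain w' \<sigma> where w': "w' \<in> cball 0 1" "strict_mono \<sigma>" "(w \<circ> \<sigma>) \<longlonglongrightarrow> w'"
        using compact_cball[of "0::complex" 1] unfolding compact_def by (metis ball_subset_cball subset_eq)
      have tl: "(\<lambda>n. t (\<sigma> n)) \<longlonglongrightarrow> l" using LIMSEQ_subseq_LIMSEQ[OF l(2) w'(2)] by (simp add: o_def)
      have "(\<lambda>n. poly p (t (\<sigma> n))) \<longlonglongrightarrow> poly p l" by (intro tendsto_intros tl)
      moreover have "(\<lambda>n. poly p (t (\<sigma> n))) \<longlonglongrightarrow> x + of_real r * w' ^ m"
      proof -
        have "(\<lambda>n. x + of_real r * (w (\<sigma> n)) ^ m) \<longlonglongrightarrow> x + of_real r * w' ^ m" using w'(3) by (intro tendsto_intros) (simp add: o_def)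
        then show ?thesis using w eq by simp
      qed
      ultimately have "poly p l = x + of_real r * w' ^ m" using LIMSEQ_unique by blast
      moreover have "poly p l \<in> ball x r" using l(1) DX by (auto simp: X_def)
      \<comment> \<open>A limit l inside D lies over the open ball, so the limit parameter cannot be
        on the unit circle.\<close>
      ultimately have "r * norm w' ^ m < r" using r by (simp add: dist_norm norm_mult norm_power)
      then have "norm w' \<noteq> 1" by auto
      then have wb: "w' \<in> ball 0 1" using w'(1) by auto
      have "isCont \<psi> w'" using hol wb by (meson continuous_on_eq_continuous_at holomorphic_on_imp_continuous_on open_ball)
      then have "(\<lambda>n. \<psi> ((w \<circ> \<sigma>) n)) \<longlonglongrightarrow> \<psi> w'" using w'(3) isCont_tendsto_compose by blast
      then have "l = \<psi> w'" using tl w(2) LIMSEQ_unique by (simp add: o_def)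
      then show "l \<in> ?I" using wb by auto
    qed
    moreover have "openin (top_of_set D) ?I" using ID opI by (rule open_subset)
    ultimately have "?I = D" using conD yI connected_clopen[of D] by fastforce
    then show ?thesis using SD by simp
  qed
  then show ?thesis using that y(2) by blast
qed

section \<open>Iteration of a postcritically finite polynomial\<close>

locale pcf_poly =
  fixes f :: "complex poly"
  assumes deg2: "degree f \<ge> 2" and pcf: "postcritically_finite f"

text \<open>The iterate as a polynomial, so that degrees, root orders and \<open>pderiv\<close> are
  available for it.\<close>

fun ipoly :: "complex poly \<Rightarrow> nat \<Rightarrow> complex poly" where
  "ipoly f 0 = [:0, 1:]"
| "ipoly f (Suc n) = pcompose f (ipoly f n)"

lemma poly_ipoly: "poly (ipoly f n) = iter f n"
  by (induction n) (auto simp: poly_pcompose fun_eq_iff)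

lemma degree_ipoly: "degree (ipoly f n) = degree f ^ n"
  by (induction n) auto

lemma iter_add: "iter f (m + n) z = iter f m (iter f n z)"
  by (simp add: funpow_add)

lemma iter_Suc': "iter f (Suc n) z = iter f n (poly f z)"
  by (simp add: funpow_swap1)

lemma poly_minus_const_nonzero: "degree p > 0 \<Longrightarrow> p - [:c:] \<noteq> (0 :: complex poly)"
  by (metis degree_pCons_0 eq_iff_diff_eq_0 less_irrefl)

lemma pcompose_power: "pcompose (p ^ n) q = pcompose p q ^ n" for p q :: "complex poly"
  by (induction n) (auto simp: pcompose_mult pcompose_1)

text \<open>Multiplicativity of local degrees: substituting q into p - p(v) = (T - v)^a r, where v =
  q(y), gives (q - v)^a times a factor that does not vanish at y.\<close>

lemma order_pcompose:
  fixes p q :: "complex poly"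
  assumes "degree p > 0" "degree q > 0"
  shows "order y (pcompose p q - [:poly p (poly q y):]) =
    order (poly q y) (p - [:poly p (poly q y):]) * order y (q - [:poly q y:])"
proof -
  define v where "v = poly q y"
  define a where "a = order v (p - [:poly p v:])"
  have nz: "p - [:poly p v:] \<noteq> 0" "q - [:v:] \<noteq> 0" using assms poly_minus_const_nonzero by auto
  obtain r where r: "p - [:poly p v:] = [:-v, 1:] ^ a * r" "\<not> [:-v, 1:] dvd r" using order_decomp[OF nz(1), of v] a_def by auto
  have rv: "poly r v \<noteq> 0" using r(2) by (simp add: poly_eq_0_iff_dvd)
  have "pcompose p q - [:poly p v:] = pcompose (p - [:poly p v:]) q" by (simp add: pcompose_diff pcompose_const)
  also have "\<dots> = (q - [:v:]) ^ a * pcompose r q" unfolding r(1) pcompose_mult pcompose_power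
    by (simp add: poly_eq_poly_eq_iff[symmetric] fun_eq_iff poly_pcompose)
  finally have eq: "pcompose p q - [:poly p v:] = (q - [:v:]) ^ a * pcompose r q" .
  have r0: "poly (pcompose r q) y \<noteq> 0" using rv by (simp add: poly_pcompose v_def)
  then have "pcompose r q \<noteq> 0" by auto
  then have "order y (pcompose p q - [:poly p v:]) = order y ((q - [:v:]) ^ a) + order y (pcompose r q)"
    unfolding eq using nz(2) by (intro order_mult) auto
  also have "order y (pcompose r q) = 0" using r0 order_root by blast
  also have "order y ((q - [:v:]) ^ a) = a * order y (q - [:v:])" using nz(2) by (induction a) (auto simp: order_mult)
  finally show ?thesis by (simp add: v_def a_def)
qed

lemma order_noncritical:
  fixes p :: "complex poly"
  assumes "poly (pderiv p) z \<noteq> 0"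
  shows "order z (p - [:poly p z:]) = 1"
proof -
  let ?q = "p - [:poly p z:]"
  have nz: "?q \<noteq> 0"
  proof
    assume "?q = 0"
    then have "p = [:poly p z:]" by simp
    then have "pderiv p = 0" by (metis pderiv_pCons pderiv_0 add_0 pCons_0_0)
    then show False using assms by simp
  qed
  then have "order z ?q \<noteq> 0" using order_root[of ?q z] by simp
  moreover have "\<not> order z ?q \<ge> 2"
  proof
    assume "order z ?q \<ge> 2"
    then have "[:-z, 1:] ^ 2 dvd ?q" using order_divides by blast
    then obtain r where "?q = [:-z, 1:] ^ 2 * r" by auto
    then have "pderiv p = pderiv ([:-z, 1:] ^ 2 * r)" by (metis pderiv_diff pderiv_pCons pderiv_0 diff_zero add_0 pCons_0_0)
    then have "poly (pderiv p) z = 0" by (simp only: pderiv_mult power2_eq_square poly_add poly_mult) simp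
    then show False using assms by simp
  qed
  ultimately show ?thesis by linarith
qed

context pcf_poly
begin

abbreviation "P \<equiv> postcritical_set f"
abbreviation "K \<equiv> filled_Julia f"
abbreviation "J \<equiv> Julia f"

lemma degpos: "degree f > 0" using deg2 by simp

lemma deg_ipoly_pos: "degree (ipoly f n) > 0" using degpos by (simp add: degree_ipoly)

lemma iter_cont [continuous_intros]: "continuous_on S (iter f n)"
  unfolding poly_ipoly[symmetric] by (intro continuous_intros)

lemma iter_holo [holomorphic_intros]: "iter f n holomorphic_on S"
  unfolding poly_ipoly[symmetric] by (rule holomorphic_on_poly)

lemma crit_finite: "finite {c. poly (pderiv f) c = 0}"
proof -
  have "pderiv f \<noteq> 0" using deg2 by (simp add: pderiv_eq_0_iff)
  then show ?thesis by (rule poly_roots_finite)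
qed

lemma P_finite: "finite P"
proof -
  have "P = (\<Union>c\<in>{c. poly (pderiv f) c = 0}. range (\<lambda>n. iter f n c))" by (auto simp: postcritical_set_def)
  then show ?thesis using crit_finite pcf by (auto simp: postcritically_finite_def)
qed

lemma P_step: "z \<in> P \<Longrightarrow> poly f z \<in> P"
proof -
  assume "z \<in> P"
  then obtain n c where "z = iter f n c" "poly (pderiv f) c = 0" by (auto simp: postcritical_set_def)
  then show "poly f z \<in> P" by (auto simp: postcritical_set_def intro!: exI[of _ "Suc n"] exI[of _ c])
qed

lemma P_iter: "z \<in> P \<Longrightarrow> iter f n z \<in> P"
  by (induction n) (auto intro: P_step)

lemma crit_P: "poly (pderiv f) c = 0 \<Longrightarrow> c \<in> P"
  by (auto simp: postcritical_set_def intro!: exI[of _ 0] exI[of _ c])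

lemma crit_exists: obtains c where "poly (pderiv f) c = 0" "c \<in> P"
proof -
  have "degree (pderiv f) > 0" using deg2 by (simp add: degree_pderiv)
  then show ?thesis using poly_has_preimage[of "pderiv f" 0] crit_P that by metis
qed

lemma deriv_iter_eq_0:
  "poly (pderiv (ipoly f n)) z = 0 \<longleftrightarrow> (\<exists>i<n. poly (pderiv f) (iter f i z) = 0)"
  by (induction n) (auto simp: pderiv_pcompose poly_pcompose poly_ipoly less_Suc_eq pderiv_pCons)

lemma crit_iter: "poly (pderiv (ipoly f n)) z = 0 \<Longrightarrow> iter f n z \<in> P"
proof -
  assume "poly (pderiv (ipoly f n)) z = 0"
  then obtain i where i: "i < n" "poly (pderiv f) (iter f i z) = 0" using deriv_iter_eq_0 by auto
  then have "iter f ((n - i) + i) z \<in> P" unfolding iter_add by (intro P_iter crit_P)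
  then show ?thesis using i(1) by simp
qed

definition "R0 = (SOME R::real. R \<ge> 1 \<and> (\<forall>z. norm z \<ge> R \<longrightarrow> norm (poly f z) \<ge> 2 * norm z))"

lemma R0: "R0 \<ge> 1" "norm z \<ge> R0 \<Longrightarrow> norm (poly f z) \<ge> 2 * norm z"
proof -
  obtain a q where aq: "f = pCons a q" by (cases f)
  have dq: "degree q > 0" using deg2 aq by (auto split: if_splits)
  have "filterlim (poly q) at_infinity at_infinity" using dq by (intro filterlim_poly_at_infinity) auto
  then have "eventually (\<lambda>z. norm (poly q z) > 2 + norm a) at_infinity"
    using filterlim_at_infinity_imp_norm_at_top unfolding filterlim_at_top_dense by blast
  then obtain b where b: "\<And>z. norm z \<ge> b \<Longrightarrow> norm (poly q z) > 2 + norm a" by (auto simp: eventually_at_infinity)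
  have "norm (poly f z) \<ge> 2 * norm z" if z: "norm z \<ge> max b 1" for z
  proof -
    have "norm (z * poly q z) \<ge> norm z * (2 + norm a)" unfolding norm_mult using b[of z] z by (intro mult_left_mono) auto
    moreover have "norm z * norm a \<ge> 1 * norm a" using z by (intro mult_right_mono) auto
    moreover have "norm (a + z * poly q z) \<ge> norm (z * poly q z) - norm a" by (metis add.commute norm_diff_ineq)
    ultimately show ?thesis by (simp add: aq algebra_simps)
  qed
  then have "\<exists>R::real. R \<ge> 1 \<and> (\<forall>z. norm z \<ge> R \<longrightarrow> norm (poly f z) \<ge> 2 * norm z)" by (intro exI[of _ "max b 1"]) auto
  then have "R0 \<ge> 1 \<and> (\<forall>z. norm z \<ge> R0 \<longrightarrow> norm (poly f z) \<ge> 2 * norm z)" unfolding R0_def by (rule someI_ex)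
  then show "R0 \<ge> 1" "norm z \<ge> R0 \<Longrightarrow> norm (poly f z) \<ge> 2 * norm z" by auto
qed

text \<open>f maps the disc of radius \<open>R0\<close> into the disc of radius \<open>R1\<close>;
  the retractions of \<open>retraction_step\<close> rely on this.\<close>

definition "R1 = (SOME r. r \<ge> R0 \<and> (\<forall>z\<in>cball 0 R0. norm (poly f z) \<le> r))"

lemma R1: "R1 \<ge> R0" "z \<in> cball 0 R0 \<Longrightarrow> norm (poly f z) \<le> R1"
proof -
  have "compact (poly f ` cball 0 R0)" by (intro compact_continuous_image continuous_intros) auto
  then obtain B where "\<forall>z\<in>cball 0 R0. norm (poly f z) \<le> B" by (auto simp: bounded_iff dest!: compact_imp_bounded)
  then have "\<exists>r. r \<ge> R0 \<and> (\<forall>z\<in>cball 0 R0. norm (poly f z) \<le> r)" by (intro exI[of _ "max B R0"]) force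
  then have "R1 \<ge> R0 \<and> (\<forall>z\<in>cball 0 R0. norm (poly f z) \<le> R1)" unfolding R1_def by (rule someI_ex)
  then show "R1 \<ge> R0" "z \<in> cball 0 R0 \<Longrightarrow> norm (poly f z) \<le> R1" by auto
qed

text \<open>The slack puts the closed annulus between \<open>R0\<close> and \<open>R1\<close> into
  the open disc of radius \<open>R\<close>, where \<open>expand\<close> applies to it.\<close>

definition "R = R1 + 1"

lemma R: "R \<ge> 1" "norm z \<ge> R \<Longrightarrow> norm (poly f z) \<ge> 2 * norm z"
  using R0(1) R0(2)[of z] R1(1) by (auto simp: R_def)

lemma escape: "norm z \<ge> R \<Longrightarrow> norm (iter f n z) \<ge> 2 ^ n * norm z"
proof (induction n)
  case (Suc n)
  have "1 * norm z \<le> 2 ^ n * norm z" by (intro mult_right_mono) auto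
  then have "norm (iter f n z) \<ge> R" using Suc by linarith
  then have "norm (poly f (iter f n z)) \<ge> 2 * norm (iter f n z)" by (rule R(2))
  then show ?case using Suc by simp
qed simp

lemma escape_R: "norm z \<ge> R \<Longrightarrow> norm (iter f n z) \<ge> R"
proof -
  assume z: "norm z \<ge> R"
  have "1 * norm z \<le> 2 ^ n * norm z" by (intro mult_right_mono) auto
  then show ?thesis using escape[OF z, of n] z by linarith
qed

lemma escape_unbounded: "norm z \<ge> R \<Longrightarrow> z \<notin> K"
proof
  assume z: "norm z \<ge> R" "z \<in> K"
  then obtain B where B: "\<And>n. norm (iter f n z) \<le> B" by (auto simp: filled_Julia_def bounded_iff)
  obtain n where n: "B < 2 ^ n" using real_arch_pow[of 2 B] by auto
  have "2 ^ n * 1 \<le> 2 ^ n * norm z" using z(1) R(1) by (intro mult_left_mono) auto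
  then show False using escape[OF z(1), of n] B[of n] n by linarith
qed

lemma K_iter: "iter f n z \<in> K \<longleftrightarrow> z \<in> K"
proof -
  have "range (\<lambda>k. iter f k z) = (\<lambda>k. iter f k z) ` {..<n} \<union> range (\<lambda>k. iter f k (iter f n z))" (is "?L = ?R")
  proof
    show "?L \<subseteq> ?R"
    proof clarify
      fix k assume "iter f k z \<notin> range (\<lambda>k. iter f k (iter f n z))"
      then have "k < n" by (metis iter_add le_add_diff_inverse2 not_less rangeI)
      then show "iter f k z \<in> (\<lambda>k. iter f k z) ` {..<n}" by auto
    qed
    show "?R \<subseteq> ?L" by (auto simp flip: iter_add)
  qed
  moreover have "bounded ((\<lambda>k. iter f k z) ` {..<n})" by (intro finite_imp_bounded) auto
  ultimately show ?thesis by (simp add: filled_Julia_def)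
qed

lemma K_step: "poly f z \<in> K \<longleftrightarrow> z \<in> K" using K_iter[of 1] by simp

lemma K_iff: "z \<in> K \<longleftrightarrow> (\<forall>n. norm (iter f n z) < R)"
proof
  assume "z \<in> K"
  then show "\<forall>n. norm (iter f n z) < R" using escape_unbounded K_iter not_less by metis
next
  assume "\<forall>n. norm (iter f n z) < R"
  then show "z \<in> K" by (auto simp: filled_Julia_def bounded_iff intro!: exI[of _ R] less_imp_le)
qed

lemma K_iff': "z \<in> K \<longleftrightarrow> (\<forall>n. norm (iter f n z) \<le> R)"
  using K_iff[of z] by (auto simp: filled_Julia_def bounded_iff intro: less_imp_le)

lemma K_ball: "K \<subseteq> ball 0 R"
  using escape_unbounded by (force simp: not_less[symmetric])

lemma K_ball0: "K \<subseteq> ball 0 R0"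
proof
  fix z assume z: "z \<in> K"
  have grow: "norm (iter f n z) \<ge> 2 ^ n * norm z" if "norm z \<ge> R0" for n
  proof (induction n)
    case (Suc n)
    have "1 * norm z \<le> 2 ^ n * norm z" by (intro mult_right_mono) auto
    then have "norm (iter f n z) \<ge> R0" using Suc that by linarith
    then have "norm (poly f (iter f n z)) \<ge> 2 * norm (iter f n z)" by (rule R0(2))
    then show ?case using Suc by simp
  qed simp
  show "z \<in> ball 0 R0"
  proof (rule ccontr)
    assume "z \<notin> ball 0 R0"
    then have nz: "norm z \<ge> R0" by simp
    obtain n where n: "R < 2 ^ n" using real_arch_pow[of 2 R] by auto
    have "2 ^ n * 1 \<le> 2 ^ n * norm z" using nz R0(1) by (intro mult_left_mono) auto
    then have "norm (iter f n z) > R" using grow[OF nz, of n] n by linarith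
    then show False using z K_iff less_asym by blast
  qed
qed

lemma K_closed: "closed K"
proof -
  have "K = (\<Inter>n. iter f n -` cball 0 R)" using K_iff' by auto
  then show ?thesis by (auto intro!: closed_INT closed_vimage iter_cont)
qed

lemma K_compact: "compact K"
  using K_closed K_ball bounded_ball bounded_subset compact_eq_bounded_closed by blast

lemma P_K: "P \<subseteq> K"
proof
  fix z assume "z \<in> P"
  then obtain n c where z: "z = iter f n c" "poly (pderiv f) c = 0" by (auto simp: postcritical_set_def)
  then have "c \<in> K" using pcf by (auto simp: postcritically_finite_def filled_Julia_def finite_imp_bounded)
  then show "z \<in> K" using z K_iter by simp
qed

lemma ball_R_back: "iter f n z \<in> ball 0 R \<Longrightarrow> z \<in> ball 0 R"
  using escape_R[of z n] by (auto simp: not_less[symmetric])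

lemma escape_nbhd:
  assumes "z \<notin> K" obtains e N where "e > 0" "\<And>w n. w \<in> ball z e \<Longrightarrow> n \<ge> N \<Longrightarrow> norm (iter f n w) \<ge> R"
proof -
  obtain N where "\<not> norm (iter f N z) \<le> R" using assms K_iff' by auto
  then have "z \<in> iter f N -` (- cball 0 R)" by simp
  moreover have "open (iter f N -` (- cball 0 R))" by (intro open_vimage iter_cont) auto
  ultimately obtain e where e: "e > 0" "ball z e \<subseteq> iter f N -` (- cball 0 R)" using openE by blast
  have "norm (iter f n w) \<ge> R" if "w \<in> ball z e" "n \<ge> N" for w n
  proof -
    have "iter f n w = iter f (n - N) (iter f N w)" using that(2) by (simp flip: iter_add)
    moreover have "norm (iter f N w) \<ge> R" using e(2) that(1) by force
    ultimately show ?thesis using escape_R by simp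
  qed
  then show ?thesis using that e(1) by blast
qed

lemma K_int_step: "poly f z \<in> interior K \<longleftrightarrow> z \<in> interior K"
proof
  assume "poly f z \<in> interior K"
  moreover have "open (poly f -` interior K)" by (intro open_vimage continuous_intros) auto
  moreover have "poly f -` interior K \<subseteq> K" using interior_subset K_step by fastforce
  ultimately show "z \<in> interior K" by (meson interiorI vimageI)
next
  assume z: "z \<in> interior K"
  have "\<not> poly f constant_on UNIV" unfolding constant_on_def by (metis UNIV_I poly_has_preimage[OF degpos] zero_neq_one)
  then have "open (poly f ` interior K)" by (intro open_mapping_thm[of "poly f" UNIV]) (auto intro: holomorphic_intros)
  moreover have "poly f ` interior K \<subseteq> K" using interior_subset K_step by fastforce
  ultimately show "poly f z \<in> interior K" using z by (meson imageI interiorI)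
qed

lemma K_int_iter: "iter f n z \<in> interior K \<longleftrightarrow> z \<in> interior K"
  by (induction n) (auto simp: K_int_step)

lemma J_eq: "J = K - interior K" by (simp add: Julia_def frontier_def K_closed)

lemma Fatou_eq: "K - J = interior K" using interior_subset[of K] by (auto simp: J_eq)

lemma J_iter: "iter f n z \<in> J \<longleftrightarrow> z \<in> J"
  by (simp add: J_eq K_iter K_int_iter)

lemma J_K: "J \<subseteq> K" by (auto simp: J_eq)

lemma J_closed: "closed J" by (simp add: Julia_def)

lemma J_compact: "compact J" using K_compact by (simp add: Julia_def compact_frontier)

lemma P_ne: "P \<noteq> {}" using crit_exists by blast

lemma J_near: "x \<in> J \<Longrightarrow> open U \<Longrightarrow> x \<in> U \<Longrightarrow> \<exists>z\<in>U. z \<notin> K"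
  unfolding J_eq by (metis DiffE interiorI subsetI)

text \<open>The maximum principle for every iterate. It shows that the complement of K has no
  bounded component and that loops in K enclose only points of K.\<close>

lemma K_fill:
  assumes "bounded B" "open B" "frontier B \<subseteq> K" shows "B \<subseteq> K"
proof
  fix z assume z: "z \<in> B"
  have "norm (iter f n z) \<le> R" for n
  proof (rule maximum_modulus_frontier[where f = "iter f n" and S = B])
    show "norm (iter f n w) \<le> R" if "w \<in> frontier B" for w using that assms(3) K_iff' by blast
  qed (use assms z in \<open>auto intro: iter_holo iter_cont\<close>)
  then show "z \<in> K" using K_iff' by blast
qed

text \<open>The union of the superattracting cycles.\<close>

definition "Acyc = {iter f n c | n c k. poly (pderiv f) c = 0 \<and> k > 0 \<and> iter f k c = c}"

definition "Mx = degree f ^ card P"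

lemma Mx_pos: "Mx \<ge> 1" using degpos by (simp add: Mx_def Suc_leI)

lemma order_iter:
  "order y (ipoly f n - [:iter f n y:]) =
     (\<Prod>i<n. order (iter f i y) (f - [:iter f (Suc i) y:]))"
proof (induction n)
  case 0
  have "order y [:-y, 1:] = 1" using order_power_n_n[of y 1] by simp
  then show ?case by simp
next
  case (Suc n)
  then show ?case using order_pcompose[OF degpos deg_ipoly_pos, of y n] by (simp add: poly_ipoly)
qed

text \<open>A critical point met twice by the orbit of y before time n is periodic, which would put
  the endpoint into \<open>Acyc\<close>. So at most \<open>card P\<close> times contribute to the
  product of \<open>order_iter\<close>, each with a factor of at most
  \<open>degree f\<close>.\<close>

lemma order_iter_bound:
  assumes "iter f n y \<notin> Acyc"
  shows "order y (ipoly f n - [:iter f n y:]) \<le> Mx" "order y (ipoly f n - [:iter f n y:]) > 0"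
proof -
  let ?e = "\<lambda>i. order (iter f i y) (f - [:iter f (Suc i) y:])"
  define I where "I = {i. i < n \<and> poly (pderiv f) (iter f i y) = 0}"
  have finI: "finite I" by (simp add: I_def)
  have "inj_on (\<lambda>i. iter f i y) I"
  proof (rule linorder_inj_onI)
    fix i j assume ij: "i < j" "i \<in> I" "j \<in> I"
    show "iter f i y \<noteq> iter f j y"
    proof
      assume eq: "iter f i y = iter f j y"
      let ?c = "iter f i y"
      have "iter f (j - i) ?c = iter f (j - i + i) y" by (simp only: iter_add)
      then have "iter f (j - i) ?c = ?c" using ij(1) eq by simp
      moreover have "iter f n y = iter f (n - i) ?c" using ij by (simp add: I_def flip: iter_add)
      ultimately have "iter f n y \<in> Acyc" using ij unfolding Acyc_def I_def
        by (intro CollectI exI[of _ "n - i"] exI[of _ ?c] exI[of _ "j - i"]) auto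
      then show False using assms by simp
    qed
  qed auto
  moreover have "(\<lambda>i. iter f i y) ` I \<subseteq> P" using crit_P by (auto simp: I_def)
  ultimately have card: "card I \<le> card P" using P_finite by (metis card_image card_mono)
  have ed: "?e i \<le> degree f" for i
  proof -
    have "order (iter f i y) (f - [:iter f (Suc i) y:]) \<le> degree (f - [:iter f (Suc i) y:])"
      using degpos by (intro order_degree poly_minus_const_nonzero)
    also have "\<dots> \<le> degree f" by (rule degree_diff_le) auto
    finally show ?thesis .
  qed
  have e1: "?e i = 1" if "i < n" "i \<notin> I" for i using that order_noncritical[of f "iter f i y"] by (simp add: I_def)
  have "(\<Prod>i<n. ?e i) = (\<Prod>i\<in>I. ?e i)" by (rule prod.mono_neutral_right) (use e1 in \<open>auto simp: I_def\<close>)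
  also have "\<dots> \<le> (\<Prod>i\<in>I. degree f)" by (intro prod_mono) (use ed in auto)
  also have "\<dots> \<le> Mx" using card degpos unfolding Mx_def by (auto intro!: power_increasing)
  finally show "order y (ipoly f n - [:iter f n y:]) \<le> Mx" by (simp only: order_iter)
  have "ipoly f n - [:iter f n y:] \<noteq> 0" using deg_ipoly_pos[of n] by auto
  then show "order y (ipoly f n - [:iter f n y:]) > 0"
    using order_root[of "ipoly f n - [:iter f n y:]" y] by (auto simp: poly_ipoly intro: gr0I)
qed

lemma lift_exists:
  assumes "x \<notin> Acyc" "r > 0" "P \<inter> ball x r \<subseteq> {x}" "iter f n y = x"
  obtains m \<psi> where "1 \<le> m" "m \<le> Mx" "rlift (ipoly f n) x r m \<psi>" "\<psi> 0 = y"
proof -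
  obtain \<psi> where "rlift (ipoly f n) x r (order y (ipoly f n - [:x:])) \<psi>" "\<psi> 0 = y"
    using ramified_lift[OF deg_ipoly_pos P_finite, of n r x y] crit_iter assms by (auto simp: poly_ipoly)
  then show ?thesis using that order_iter_bound[of n y] assms(1,4) by (metis One_nat_def Suc_leI)
qed

text \<open>A connected set over the ball is covered by a single lift, with a bound on the exponent
  that is uniform in n. The estimates on pullbacks rest on this uniformity.\<close>

lemma lift_cover:
  assumes "x \<notin> Acyc" "r > 0" "P \<inter> ball x r \<subseteq> {x}" "connected S" "S \<noteq> {}" "iter f n ` S \<subseteq> ball x r"
  obtains m \<psi> where "1 \<le> m" "m \<le> Mx" "rlift (ipoly f n) x r m \<psi>" "S \<subseteq> \<psi> ` ball 0 1" "iter f n (\<psi> 0) = x"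
proof -
  obtain y where y: "iter f n y = x" "\<And>\<psi> m. rlift (ipoly f n) x r m \<psi> \<Longrightarrow> m > 0 \<Longrightarrow> \<psi> 0 = y \<Longrightarrow> S \<subseteq> \<psi> ` ball 0 1"
    using rlift_cover[OF deg_ipoly_pos assms(2,4,5), of n x] assms(6) by (auto simp: poly_ipoly)
  obtain m \<psi> where "1 \<le> m" "m \<le> Mx" "rlift (ipoly f n) x r m \<psi>" "\<psi> 0 = y" using lift_exists[OF assms(1-3) y(1)] .
  then show ?thesis using that y by (metis One_nat_def Suc_le_eq)
qed

lemma P_isolated: obtains r where "r > 0" "P \<inter> ball x r \<subseteq> {x}" "x \<in> ball 0 R \<Longrightarrow> ball x r \<subseteq> ball 0 R"
proof -
  obtain r1 where r1: "r1 > 0" "\<And>p. p \<in> P \<Longrightarrow> p \<noteq> x \<Longrightarrow> r1 \<le> dist x p" using finite_set_avoid[OF P_finite, of x] by metis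
  show ?thesis
  proof (cases "x \<in> ball 0 R")
    case True
    then obtain r2 where r2: "r2 > 0" "ball x r2 \<subseteq> ball 0 R" using open_ball openE by blast
    show ?thesis by (rule that[of "min r1 r2"]) (use r1 r2 in \<open>force+\<close>)
  next
    case False then show ?thesis using that[of r1] r1 by force
  qed
qed

end

section \<open>The superattracting basin fills the interior of the filled Julia set\<close>

context pcf_poly
begin

lemma superattracting:
  assumes c: "poly (pderiv f) (iter f j a) = 0" "j < k" "iter f k a = a" and "e > 0"
  obtains d where "d > 0" "d \<le> e" "\<And>z. z \<in> ball a d \<Longrightarrow> dist (iter f k z) a \<le> dist z a / 2"
proof -
  have "poly (pderiv (ipoly f k)) a = 0" using c deriv_iter_eq_0 by auto
  then have "(iter f k has_field_derivative 0) (at a)" using poly_DERIV[of "ipoly f k" a] by (simp add: poly_ipoly)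
  then have "((\<lambda>h. (iter f k (a + h) - iter f k a) / h) \<longlongrightarrow> 0) (at 0)" by (simp add: DERIV_def)
  then obtain d where d: "d > 0" "\<And>h. h \<noteq> 0 \<Longrightarrow> norm h < d \<Longrightarrow> norm ((iter f k (a + h) - a) / h) < 1/2"
    using c(3) LIM_D[of "\<lambda>h. (iter f k (a + h) - iter f k a) / h" 0 0 "1/2"] by auto
  have "dist (iter f k z) a \<le> dist z a / 2" if "z \<in> ball a (min d e)" for z
  proof (cases "z = a")
    case False
    then have "norm ((iter f k (a + (z - a)) - a) / (z - a)) < 1/2"
      using that by (intro d(2)) (auto simp: dist_norm norm_minus_commute)
    then show ?thesis using False by (simp add: norm_divide dist_norm field_simps)
  qed (use c in auto)
  then show ?thesis using that[of "min d e"] d(1) assms(4) by auto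
qed

lemma Acyc_periodic:
  assumes "a \<in> Acyc" obtains j k where "poly (pderiv f) (iter f j a) = 0" "j < k" "iter f k a = a"
proof -
  obtain n c k where c: "a = iter f n c" "poly (pderiv f) c = 0" "k > 0" "iter f k c = c" using assms by (auto simp: Acyc_def)
  have mult: "iter f (k * i) c = c" for i by (induction i) (auto simp: iter_add c(4) funpow_add)
  define l where "l = k * Suc n"
  have "n \<le> k * n" using c(3) by simp
  then have nl: "n < l" unfolding l_def mult_Suc_right using c(3) by linarith
  have "iter f (l - n) a = iter f (l - n + n) c" unfolding c(1) iter_add ..
  then have "iter f (l - n) a = c" using nl mult[of "Suc n"] by (simp add: l_def)
  moreover have "iter f l a = a" unfolding c(1) using mult[of "Suc n"] by (metis add.commute iter_add l_def)
  then have "iter f (l + l) a = a" by (simp only: iter_add)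
  \<comment> \<open>The period l is doubled so that the critical time stays strictly below it also
    for n = 0.\<close>
  moreover have "l - n < l + l" using nl by simp
  ultimately show ?thesis using that[of "l - n" "l + l"] c(2) by simp
qed

lemma Acyc_P: "Acyc \<subseteq> P" by (auto simp: Acyc_def postcritical_set_def)

lemma Acyc_finite: "finite Acyc" using Acyc_P P_finite finite_subset by blast

lemma Acyc_iter: "a \<in> Acyc \<Longrightarrow> iter f n a \<in> Acyc"
proof -
  assume "a \<in> Acyc"
  then obtain j c k where "a = iter f j c" "poly (pderiv f) c = 0" "k > 0" "iter f k c = c" by (auto simp: Acyc_def)
  then show ?thesis unfolding Acyc_def by (intro CollectI exI[of _ "n + j"] exI[of _ c] exI[of _ k]) (simp add: iter_add)
qed

text \<open>The return map at a halves distances, so a small ball comes back into itself after each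
  period; the finitely many times in between are handled by continuity.\<close>

lemma trap:
  assumes "a \<in> Acyc" "e > 0"
  obtains d where "d > 0" "\<And>z n. z \<in> ball a d \<Longrightarrow> dist (iter f n z) (iter f n a) < e"
proof -
  obtain j k where jk: "poly (pderiv f) (iter f j a) = 0" "j < k" "iter f k a = a" using Acyc_periodic[OF assms(1)] .
  have "\<exists>d>0. \<forall>z. dist z a < d \<longrightarrow> dist (iter f i z) (iter f i a) < e" for i
  proof -
    have "isCont (iter f i) a" using iter_cont[of UNIV i] by (simp add: continuous_on_eq_continuous_at)
    then show ?thesis using assms(2) unfolding continuous_at_eps_delta by blast
  qed
  then obtain d where d: "\<And>i. d i > 0" "\<And>i z. dist z a < d i \<Longrightarrow> dist (iter f i z) (iter f i a) < e" by metis
  define d0 where "d0 = Min (d ` {..<k})"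
  have d0: "d0 > 0" "\<And>i. i < k \<Longrightarrow> d0 \<le> d i" using jk(2) d(1) by (auto simp: d0_def intro!: Min_gr_iff[THEN iffD2])
  obtain d1 where d1: "d1 > 0" "d1 \<le> d0" "\<And>z. z \<in> ball a d1 \<Longrightarrow> dist (iter f k z) a \<le> dist z a / 2"
    using superattracting[OF jk d0(1)] by blast
  have st: "iter f (k * i) z \<in> ball a d1 \<and> iter f (k * i) a = a" if "z \<in> ball a d1" for z i
  proof (induction i)
    case (Suc i)
    have "iter f (k * Suc i) z = iter f k (iter f (k * i) z)" by (simp add: iter_add)
    moreover have "iter f (k * Suc i) a = iter f k (iter f (k * i) a)" by (simp add: iter_add)
    moreover have "dist (iter f k (iter f (k * i) z)) a \<le> dist (iter f (k * i) z) a / 2" using d1(3) Suc by blast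
    moreover have "dist (iter f (k * i) z) a < d1" using Suc by (simp add: dist_commute)
    moreover have "0 \<le> dist (iter f (k * i) z) a" by simp
    ultimately have "dist (iter f (k * Suc i) z) a < d1" unfolding \<open>iter f (k * Suc i) z = _\<close> by linarith
    moreover have "iter f (k * Suc i) a = a" using \<open>iter f (k * Suc i) a = _\<close> Suc jk(3) by (metis (no_types))
    ultimately show ?case by (simp only: mem_ball dist_commute simp_thms)
  qed (use that in simp)
  have "dist (iter f n z) (iter f n a) < e" if "z \<in> ball a d1" for z n
  proof -
    have n: "n = n mod k + k * (n div k)" by simp
    have "iter f n z = iter f (n mod k) (iter f (k * (n div k)) z)" "iter f n a = iter f (n mod k) a"
      using n st[OF that, of "n div k"] by (metis iter_add)+
    moreover have "n mod k < k" using jk(2) by simp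
    ultimately show ?thesis using st[OF that, of "n div k"] d(2)[of "iter f (k * (n div k)) z" "n mod k"] d1(2) d0(2)[of "n mod k"]
      by (simp add: dist_commute)
  qed
  then show ?thesis using that d1(1) by blast
qed

lemma Acyc_int: "Acyc \<subseteq> interior K"
proof
  fix a assume a: "a \<in> Acyc"
  have aK: "a \<in> K" using a Acyc_P P_K by blast
  obtain d where d: "d > 0" "\<And>z n. z \<in> ball a d \<Longrightarrow> dist (iter f n z) (iter f n a) < 1" using trap[OF a, of 1] by auto
  have "z \<in> K" if "z \<in> ball a d" for z
  proof -
    have "norm (iter f n z) \<le> R + 1" for n
    proof -
      have "norm (iter f n a) < R" using aK K_iff by blast
      then show ?thesis using d(2)[OF that, of n] norm_triangle_ineq2[of "iter f n z" "iter f n a"] by (simp add: dist_norm)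
    qed
    then show ?thesis by (auto simp: filled_Julia_def bounded_iff)
  qed
  then show "a \<in> interior K" using d(1) by (intro interiorI[of "ball a d"]) auto
qed

lemma J_Acyc: "x \<in> J \<Longrightarrow> x \<notin> Acyc" using Acyc_int J_eq by auto

lemma rlift_ball:
  assumes "rlift (ipoly f n) x r m \<psi>" "1 \<le> m" "r > 0" "w \<in> ball 0 1"
  shows "iter f n (\<psi> w) \<in> ball x r"
proof -
  have "iter f n (\<psi> w) = x + of_real r * w ^ m" using assms by (simp add: rlift_def poly_ipoly)
  moreover have "norm (w ^ m) < 1" using assms by (simp add: norm_power power_less_one_iff)
  ultimately show ?thesis using assms(3) by (simp add: dist_norm norm_mult)
qed

text \<open>The lifts are uniformly bounded, because points that have left the disc of radius
  \<open>R\<close> never return to it, so Montel applies. A nonconstant limit is an open map; with h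
  0 in J it would take a value outside K, near which all points escape, although high iterates send
  the lifts into that disc.\<close>

lemma lift_limit:
  assumes L: "\<And>k. rlift (ipoly f (n k)) x r (m k) (\<psi> k)" "\<And>k. 1 \<le> m k"
    and r: "r > 0" "ball x r \<subseteq> ball 0 R" and n: "filterlim n at_top sequentially"
  obtains h s where "strict_mono (s :: nat \<Rightarrow> nat)" "h holomorphic_on ball 0 1"
    "\<And>C. compact C \<Longrightarrow> C \<subseteq> ball 0 1 \<Longrightarrow> uniform_limit C (\<psi> \<circ> s) h sequentially"
    "h 0 \<in> J \<Longrightarrow> \<forall>w\<in>ball 0 1. h w = h 0"
proof -
  have inR: "iter f (n k) (\<psi> k w) \<in> ball 0 R" if "w \<in> ball 0 1" for k w using rlift_ball[OF L(1,2) r(1) that] r(2) by blast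
  have bd: "\<psi> k w \<in> ball 0 R" if "w \<in> ball 0 1" for k w using inR[OF that] by (rule ball_R_back)
  obtain h s where hs: "h holomorphic_on ball 0 1" "strict_mono s"
    "\<And>x. x \<in> ball 0 1 \<Longrightarrow> (\<lambda>n. \<psi> (s n) x) \<longlonglongrightarrow> h x"
    "\<And>C. compact C \<Longrightarrow> C \<subseteq> ball 0 1 \<Longrightarrow> uniform_limit C (\<psi> \<circ> s) h sequentially"
  proof (rule Montel[of "ball 0 1" "range \<psi>" \<psi>])
    show "\<exists>B. \<forall>h\<in>range \<psi>. \<forall>z\<in>C. norm (h z) \<le> B" if "compact C" "C \<subseteq> ball 0 1" for C
      using bd that(2) by (intro exI[of _ R]) (force intro: less_imp_le)
    show "h holomorphic_on ball 0 1" if "h \<in> range \<psi>" for h using that L(1) by (auto simp: rlift_def)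
  qed auto
  have "\<forall>w\<in>ball 0 1. h w = h 0" if h0: "h 0 \<in> J"
  proof (rule ccontr)
    assume "\<not> ?thesis"
    then have "\<not> h constant_on ball 0 1" unfolding constant_on_def by force
    then have "open (h ` ball 0 1)" using hs(1) by (intro open_mapping_thm[of h "ball 0 1"]) auto
    then obtain w where w: "w \<in> ball 0 1" "h w \<notin> K" using J_near[OF h0, of "h ` ball 0 1"] by force
    obtain e N where e: "e > 0" "\<And>z k. z \<in> ball (h w) e \<Longrightarrow> k \<ge> N \<Longrightarrow> norm (iter f k z) \<ge> R" using escape_nbhd[OF w(2)] by metis
    have "eventually (\<lambda>k. dist (\<psi> (s k) w) (h w) < e) sequentially" using hs(3)[OF w(1)] e(1) by (rule tendstoD)
    moreover have "filterlim (\<lambda>k. n (s k)) at_top sequentially" using n filterlim_subseq[OF hs(2)] by (rule filterlim_compose)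
    then have "eventually (\<lambda>k. n (s k) \<ge> N) sequentially" by (simp add: filterlim_at_top)
    ultimately have "eventually (\<lambda>k. False) sequentially"
    proof eventually_elim
      case (elim k)
      then have "norm (iter f (n (s k)) (\<psi> (s k) w)) \<ge> R" by (intro e(2)) (auto simp: dist_commute)
      then show False using inR[OF w(1), of "s k"] by simp
    qed
    then show False by simp
  qed
  then show ?thesis using that hs by metis
qed

text \<open>The radius uses the bound M in place of m, so that it can be fixed before the lift is
  known.\<close>

lemma rlift_small:
  assumes "rlift p x r m \<psi>" "m \<le> M" "S \<subseteq> \<psi> ` ball 0 1" "poly p ` S \<subseteq> ball x (r * t ^ M)" "0 < t" "t < 1" "r > 0"
  shows "S \<subseteq> \<psi> ` ball 0 t"
proof
  fix s assume s: "s \<in> S"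
  then obtain w where w: "w \<in> ball 0 1" "s = \<psi> w" using assms(3) by blast
  have "poly p s \<in> ball x (r * t ^ M)" using s assms(4) by blast
  then have "r * norm w ^ m < r * t ^ M" using w assms(1,7) by (simp add: rlift_def dist_norm norm_mult norm_power)
  then have "norm w ^ m < t ^ M" using assms(7) by simp
  also have "\<dots> \<le> t ^ m" using assms by (intro power_decreasing) auto
  finally have "norm w < t" by (rule power_less_imp_less_base) (use assms(5) in simp)
  then show "s \<in> \<psi> ` ball 0 t" using w by auto
qed

text \<open>If the orbit of an interior point a came back close to x in J at arbitrarily late times,
  lifts of a ball at x would have centres in J and reach a at parameters of modulus below t. By
  \<open>lift_limit\<close> their limit is constant with value in J, so a would lie in J.\<close>

lemma no_return_near_J:
  assumes x: "x \<in> J" and r: "r > 0" "P \<inter> ball x r \<subseteq> {x}" "ball x r \<subseteq> ball 0 R" and t: "0 < t" "t < 1"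
    and n: "filterlim n at_top sequentially" and a: "a \<in> interior K"
    and ev: "eventually (\<lambda>k. iter f (n k) a \<in> ball x (r * t ^ Mx)) sequentially"
  shows False
proof -
  obtain k0 where k0: "\<And>k. k \<ge> k0 \<Longrightarrow> iter f (n k) a \<in> ball x (r * t ^ Mx)" using ev by (auto simp: eventually_sequentially)
  define n' where "n' k = n (k + k0)" for k
  have n': "filterlim n' at_top sequentially" unfolding n'_def
    using n by (rule filterlim_compose) (simp add: filterlim_add_const_nat_at_top)
  have xA: "x \<notin> Acyc" by (rule J_Acyc[OF x])
  have sub: "ball x (r * t ^ Mx) \<subseteq> ball x r" using t r(1) by (intro subset_ball) (simp add: mult_le_cancel_left1 power_le_one)
  have "\<exists>m \<psi>. 1 \<le> m \<and> m \<le> Mx \<and> rlift (ipoly f (n' k)) x r m \<psi> \<and> a \<in> \<psi> ` ball 0 t \<and> \<psi> 0 \<in> J" for k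
  proof -
    have ak: "iter f (n' k) ` {a} \<subseteq> ball x (r * t ^ Mx)" using k0 by (simp add: n'_def)
    obtain m \<psi> where m: "1 \<le> m" "m \<le> Mx" "rlift (ipoly f (n' k)) x r m \<psi>" "{a} \<subseteq> \<psi> ` ball 0 1" "iter f (n' k) (\<psi> 0) = x"
      using lift_cover[OF xA r(1,2) connected_sing insert_not_empty subset_trans[OF ak sub]] by blast
    have "{a} \<subseteq> \<psi> ` ball 0 t" by (rule rlift_small[OF m(3,2,4) _ t r(1)]) (use ak in \<open>simp add: poly_ipoly\<close>)
    then show ?thesis using m x J_iter[of "n' k" "\<psi> 0"] by auto
  qed
  then obtain m \<psi> where m: "\<And>k. 1 \<le> m k" "\<And>k. rlift (ipoly f (n' k)) x r (m k) (\<psi> k)"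
    "\<And>k. a \<in> \<psi> k ` ball 0 t" "\<And>k. \<psi> k 0 \<in> J" by metis
  obtain h s where hs: "strict_mono s" "h holomorphic_on ball 0 1"
    "\<And>C. compact C \<Longrightarrow> C \<subseteq> ball 0 1 \<Longrightarrow> uniform_limit C (\<psi> \<circ> s) h sequentially"
    "h 0 \<in> J \<Longrightarrow> \<forall>w\<in>ball 0 1. h w = h 0" using lift_limit[OF m(2,1) r(1,3) n'] by metis
  have ul: "uniform_limit (cball 0 t) (\<psi> \<circ> s) h sequentially" using t by (intro hs(3)) auto
  have "(\<lambda>k. (\<psi> \<circ> s) k 0) \<longlonglongrightarrow> h 0" using tendsto_uniform_limitI[OF ul, of 0] t by simp
  then have h0: "h 0 \<in> J" using J_closed m(4) unfolding closed_sequential_limits by (metis comp_apply)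
  have "a = h 0"
  proof (rule ccontr)
    assume ne: "a \<noteq> h 0"
    then have "eventually (\<lambda>k. \<forall>w\<in>cball 0 t. dist ((\<psi> \<circ> s) k w) (h w) < dist a (h 0)) sequentially"
      using ul by (auto simp: uniform_limit_iff)
    then obtain k where k: "\<forall>w\<in>cball 0 t. dist ((\<psi> \<circ> s) k w) (h w) < dist a (h 0)"
      using eventually_happens'[OF sequentially_bot] by blast
    obtain w where w: "w \<in> ball 0 t" "a = \<psi> (s k) w" using m(3)[of "s k"] by (elim imageE)
    have "w \<in> ball 0 1" "w \<in> cball 0 t" using w(1) t by auto
    then have "h w = h 0" using hs(4)[OF h0] by blast
    then show False using k[rule_format, OF \<open>w \<in> cball 0 t\<close>] unfolding comp_apply w(2)[symmetric] by simp
  qed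
  then show False using h0 a J_eq by auto
qed

lemma montel_iter:
  assumes "open W" "W \<subseteq> K"
  obtains h s where "h holomorphic_on W" "strict_mono (s :: nat \<Rightarrow> nat)"
    "\<And>y. y \<in> W \<Longrightarrow> (\<lambda>k. iter f (p (s k)) y) \<longlonglongrightarrow> h y"
    "\<And>C. compact C \<Longrightarrow> C \<subseteq> W \<Longrightarrow> uniform_limit C (\<lambda>k. iter f (p (s k))) h sequentially"
proof (rule Montel[of W "range (iter f)" "\<lambda>k. iter f (p k)"])
  show "\<exists>B. \<forall>h\<in>range (iter f). \<forall>z\<in>C. norm (h z) \<le> B" if "compact C" "C \<subseteq> W" for C
    using that assms(2) K_iff' by (intro exI[of _ R]) auto
qed (use assms that in \<open>auto intro: iter_holo simp: o_def\<close>)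

lemma uniform_limit_moving:
  assumes "uniform_limit C F h sequentially" "continuous_on C h" "\<And>k. y k \<in> C" "y \<longlonglongrightarrow> l" "l \<in> C"
  shows "(\<lambda>k. F k (y k) :: complex) \<longlonglongrightarrow> h l"
proof -
  have "(\<lambda>k. h (y k)) \<longlonglongrightarrow> h l" using assms(3) by (intro continuous_on_tendsto_compose[OF assms(2,4,5)]) simp
  moreover have "(\<lambda>k. F k (y k) - h (y k)) \<longlonglongrightarrow> 0"
  proof (rule tendstoI)
    fix e :: real assume "e > 0"
    then have "eventually (\<lambda>k. \<forall>w\<in>C. dist (F k w) (h w) < e) sequentially" using assms(1) by (auto simp: uniform_limit_iff)
    then show "eventually (\<lambda>k. dist (F k (y k) - h (y k)) 0 < e) sequentially"
      by eventually_elim (use assms(3) in \<open>auto simp: dist_norm\<close>)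
  qed
  ultimately have "(\<lambda>k. (F k (y k) - h (y k)) + h (y k)) \<longlonglongrightarrow> 0 + h l" by (intro tendsto_intros)
  then show ?thesis by simp
qed

text \<open>Iterates that collapse a disc about x to x contradict the monomial form of the lifts:
  moving the parameter of x outwards by \<eta> keeps the point in the disc, by equicontinuity of the
  lifts, but puts its image at distance at least r \<eta>^m from x.\<close>

lemma no_constant_limit:
  assumes x: "x \<in> interior K" "x \<notin> Acyc" and q: "filterlim q at_top sequentially"
    and e: "e > 0" and ul: "uniform_limit (cball x e) (\<lambda>k. iter f (q k)) (\<lambda>_. x) sequentially"
  shows False
proof -
  have xR: "x \<in> ball 0 R" using x(1) interior_subset K_ball by blast
  obtain r where r: "r > 0" "P \<inter> ball x r \<subseteq> {x}" "ball x r \<subseteq> ball 0 R" using P_isolated[of x] xR by metis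
  define t where "t = (1/2 :: real)"
  have t: "0 < t" "t < 1" by (auto simp: t_def)
  have rt: "r * t ^ Mx > 0" using r(1) t by simp
  have "(\<lambda>k. iter f (q k) x) \<longlonglongrightarrow> x" using tendsto_uniform_limitI[OF ul, of x] e by simp
  then have "eventually (\<lambda>k. dist (iter f (q k) x) x < r * t ^ Mx) sequentially" using rt by (rule tendstoD)
  then obtain k0 where k0: "\<And>k. k \<ge> k0 \<Longrightarrow> iter f (q k) x \<in> ball x (r * t ^ Mx)" by (auto simp: eventually_sequentially dist_commute)
  define n' where "n' k = q (k + k0)" for k
  have n': "filterlim n' at_top sequentially" unfolding n'_def
    using q by (rule filterlim_compose) (simp add: filterlim_add_const_nat_at_top)
  have sub: "ball x (r * t ^ Mx) \<subseteq> ball x r" using t r(1) by (intro subset_ball) (simp add: mult_le_cancel_left1 power_le_one)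
  have "\<exists>m \<psi>. 1 \<le> m \<and> m \<le> Mx \<and> rlift (ipoly f (n' k)) x r m \<psi> \<and> x \<in> \<psi> ` ball 0 t" for k
  proof -
    have ak: "iter f (n' k) ` {x} \<subseteq> ball x (r * t ^ Mx)" using k0 by (simp add: n'_def)
    obtain m \<psi> where m: "1 \<le> m" "m \<le> Mx" "rlift (ipoly f (n' k)) x r m \<psi>" "{x} \<subseteq> \<psi> ` ball 0 1" "iter f (n' k) (\<psi> 0) = x"
      using lift_cover[OF x(2) r(1,2) connected_sing insert_not_empty subset_trans[OF ak sub]] by blast
    have "{x} \<subseteq> \<psi> ` ball 0 t" by (rule rlift_small[OF m(3,2,4) _ t r(1)]) (use ak in \<open>simp add: poly_ipoly\<close>)
    then show ?thesis using m by auto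
  qed
  then obtain m \<psi> where m: "\<And>k. 1 \<le> m k" "\<And>k. m k \<le> Mx" "\<And>k. rlift (ipoly f (n' k)) x r (m k) (\<psi> k)"
    "\<And>k. x \<in> \<psi> k ` ball 0 t" by metis
  obtain h s where hs: "strict_mono s" "h holomorphic_on ball 0 1"
    "\<And>C. compact C \<Longrightarrow> C \<subseteq> ball 0 1 \<Longrightarrow> uniform_limit C (\<psi> \<circ> s) h sequentially" using lift_limit[OF m(3,1) r(1,3) n'] by metis
  define D where "D = cball (0::complex) (3/4)"
  have D: "compact D" "D \<subseteq> ball 0 1" by (auto simp: D_def)
  have ulh: "uniform_limit D (\<psi> \<circ> s) h sequentially" by (rule hs(3)[OF D])
  have "uniformly_continuous_on D h"
    using D hs(2) by (meson compact_uniformly_continuous continuous_on_subset holomorphic_on_imp_continuous_on)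
  then obtain d where d: "d > 0" "\<And>u v. u \<in> D \<Longrightarrow> v \<in> D \<Longrightarrow> dist u v < d \<Longrightarrow> dist (h u) (h v) < e / 3"
    unfolding uniformly_continuous_on_def using e by (metis divide_pos_pos zero_less_numeral dist_commute)
  \<comment> \<open>The bound 1/4 keeps the moved parameter in the disc D of radius 3/4, since the
    old one has modulus below t = 1/2.\<close>
  define \<eta> where "\<eta> = min (d / 2) (1/4)"
  have \<eta>: "\<eta> > 0" "\<eta> < d" "\<eta> \<le> 1/4" using d(1) by (auto simp: \<eta>_def)
  have "eventually (\<lambda>k. \<forall>w\<in>D. dist ((\<psi> \<circ> s) k w) (h w) < e / 3) sequentially" using uniform_limitD[OF ulh, of "e/3"] e by simp
  moreover have "uniform_limit (cball x e) (\<lambda>k. iter f (n' (s k))) (\<lambda>_. x) sequentially"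
  proof -
    have "filterlim (\<lambda>k. s k + k0) sequentially sequentially"
      using filterlim_compose[OF filterlim_add_const_nat_at_top filterlim_subseq[OF hs(1)]] .
    then show ?thesis unfolding n'_def uniform_limit_iff by (intro allI impI eventually_compose_filterlim[OF uniform_limitD[OF ul]])
  qed
  then have "eventually (\<lambda>k. \<forall>z\<in>cball x e. dist (iter f (n' (s k)) z) x < r * \<eta> ^ Mx) sequentially"
    using r(1) \<eta>(1) by (auto simp: uniform_limit_iff)
  ultimately have "eventually (\<lambda>k. False) sequentially"
  proof eventually_elim
    case (elim k)
    obtain w0 where w0: "w0 \<in> ball 0 t" "x = \<psi> (s k) w0" using m(4)[of "s k"] by auto
    define u where "u = (if w0 = 0 then 1 else w0 / of_real (norm w0))"
    have u: "norm u = 1" "w0 = of_real (norm w0) * u" by (auto simp: u_def norm_divide)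
    define w where "w = w0 + of_real \<eta> * u"
    have "w = of_real (norm w0 + \<eta>) * u" unfolding w_def using u(2) by (metis distrib_right of_real_add)
    then have nw: "norm w = norm w0 + \<eta>" using u(1) \<eta>(1) by (simp add: norm_mult del: of_real_add)
    have wD: "w \<in> D" "w0 \<in> D" using nw w0(1) \<eta> by (auto simp: D_def t_def)
    have dw: "dist w w0 < d" using u(1) \<eta> by (simp add: w_def dist_norm norm_mult)
    have "dist (\<psi> (s k) w) x \<le> dist (\<psi> (s k) w) (h w) + dist (h w) (h w0) + dist (h w0) (\<psi> (s k) w0)"
      using dist_triangle[of "\<psi> (s k) w" x "h w"] dist_triangle[of "h w" x "h w0"] w0(2) by simp
    also have "\<dots> < e / 3 + e / 3 + e / 3" using elim(1) wD d(2)[OF wD dw] by (intro add_strict_mono) (auto simp: dist_commute)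
    finally have "\<psi> (s k) w \<in> cball x e" by (simp add: dist_commute)
    then have "dist (iter f (n' (s k)) (\<psi> (s k) w)) x < r * \<eta> ^ Mx" using elim(2) by blast
    moreover have "iter f (n' (s k)) (\<psi> (s k) w) = x + of_real r * w ^ m (s k)"
      using m(3)[of "s k"] wD D by (auto simp: rlift_def poly_ipoly)
    ultimately have "norm w ^ m (s k) < \<eta> ^ Mx" using r(1) by (simp add: dist_norm norm_mult norm_power)
    also have "\<dots> \<le> \<eta> ^ m (s k)" using m(2) \<eta> by (intro power_decreasing) auto
    also have "\<dots> \<le> norm w ^ m (s k)" using nw \<eta>(1) by (intro power_mono) auto
    finally show False by simp
  qed
  then show False by simp
qed

lemma strict_mono_diff: "strict_mono (n :: nat \<Rightarrow> nat) \<Longrightarrow> n k + j \<le> n (k + j)"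
  by (induction j) (auto simp: strict_mono_Suc_iff Suc_le_eq intro: le_less_trans)

lemma component_frontier_J:
  assumes "U \<in> components (interior K)" shows "frontier U \<subseteq> J" "frontier U \<noteq> {}" "open U" "U \<subseteq> K" "bounded U"
proof -
  have "frontier U \<subseteq> frontier (interior K)" using assms frontier_of_components_subset by blast
  then show "frontier U \<subseteq> J" using frontier_interior_subset by (force simp: Julia_def)
  show "open U" using assms open_components[OF open_interior] by blast
  show "U \<subseteq> K" using assms in_components_subset interior_subset by blast
  then show "bounded U" using K_compact bounded_subset compact_imp_bounded by blast
  then show "frontier U \<noteq> {}" using assms frontier_not_empty in_components_nonempty not_bounded_UNIV by metis
qed

text \<open>Otherwise the orbit of z accumulates at some x outside \<open>Acyc\<close>. By
  \<open>no_return_near_J\<close> this x lies in a component W, and iterates over the times between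
  two returns have a limit h on W that fixes x. \<open>no_constant_limit\<close> excludes a constant
  h. For any other h some limit of iterates is the identity on W, as on a rotation domain; then
  points of W near its frontier come back close to J, which \<open>no_return_near_J\<close>
  forbids.\<close>

theorem basin:
  assumes z: "z \<in> interior K" and d: "d > 0"
  shows "\<exists>n. \<exists>a\<in>Acyc. iter f n z \<in> ball a d"
proof (rule ccontr)
  assume neg: "\<not> ?thesis"
  have "iter f n z \<in> K" for n using z interior_subset K_iter by blast
  then obtain x n where n: "x \<in> K" "strict_mono n" "((\<lambda>n. iter f n z) \<circ> n) \<longlonglongrightarrow> x"
    using K_compact unfolding compact_def by (metis (no_types, lifting))
  have nx: "(\<lambda>k. iter f (n k) z) \<longlonglongrightarrow> x" using n(3) by (simp add: o_def)
  have xA: "x \<notin> Acyc"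
  proof
    assume "x \<in> Acyc"
    moreover have "eventually (\<lambda>k. dist (iter f (n k) z) x < d) sequentially" using nx d by (rule tendstoD)
    then obtain k where "dist (iter f (n k) z) x < d" using eventually_happens'[OF sequentially_bot] by blast
    ultimately show False using neg by (metis dist_commute mem_ball)
  qed
  have xint: "x \<in> interior K"
  proof (rule ccontr)
    assume "x \<notin> interior K"
    then have xJ: "x \<in> J" using n(1) J_eq by auto
    have "x \<in> ball 0 R" using n(1) K_ball by blast
    then obtain r where r: "r > 0" "P \<inter> ball x r \<subseteq> {x}" "ball x r \<subseteq> ball 0 R" using P_isolated[of x] by metis
    have "eventually (\<lambda>k. dist (iter f (n k) z) x < r * (1/2) ^ Mx) sequentially" using r(1) by (intro tendstoD[OF nx]) simp
    then show False using no_return_near_J[OF xJ r, of "1/2" n z] z filterlim_subseq[OF n(2)] by (simp add: dist_commute)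
  qed
  define W where "W = connected_component_set (interior K) x"
  have Wc: "W \<in> components (interior K)" unfolding W_def using xint by (rule componentsI)
  note Wf = component_frontier_J[OF Wc]
  have xW: "x \<in> W" using xint by (simp add: W_def)
  have conW: "connected W" by (simp add: W_def)
  obtain e where e: "e > 0" "cball x e \<subseteq> W" using Wf(3) xW open_contains_cball by blast
  have "eventually (\<lambda>k. dist (iter f (n k) z) x < e) sequentially" using nx e(1) by (rule tendstoD)
  then obtain k0 where "\<forall>k\<ge>k0. dist (iter f (n k) z) x < e" unfolding eventually_sequentially by blast
  then have k0: "\<And>k. k \<ge> k0 \<Longrightarrow> iter f (n k) z \<in> cball x e" by (simp add: dist_commute less_imp_le)
  \<comment> \<open>Doubling the index makes the time between the two returns tend to
    infinity.\<close>
  define p where "p k = n (2 * (k + k0)) - n (k + k0)" for k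
  have nadd: "n (k + k0) + (k + k0) \<le> n (2 * (k + k0))" for k using strict_mono_diff[OF n(2), of "k + k0" "k + k0"] unfolding mult_2 .
  have pn: "iter f (p k) (iter f (n (k + k0)) z) = iter f (n (2 * (k + k0))) z" for k
    using nadd[of k] by (simp add: p_def flip: iter_add)
  obtain h s where hs: "h holomorphic_on W" "strict_mono (s :: nat \<Rightarrow> nat)"
    "\<And>y. y \<in> W \<Longrightarrow> (\<lambda>k. iter f (p (s k)) y) \<longlonglongrightarrow> h y"
    "\<And>C. compact C \<Longrightarrow> C \<subseteq> W \<Longrightarrow> uniform_limit C (\<lambda>k. iter f (p (s k))) h sequentially" using montel_iter[OF Wf(3,4), of p] by metis
  define q where "q k = p (s k)" for k
  have q: "filterlim q at_top sequentially"
  proof -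
    have "k \<le> q k" for k using nadd[of "s k"] seq_suble[OF hs(2), of k] by (simp add: q_def p_def)
    then show ?thesis by (auto simp: filterlim_at_top eventually_sequentially intro: order_trans)
  qed
  have sq: "filterlim (\<lambda>k. s k + k0) sequentially sequentially"
    using filterlim_compose[OF filterlim_add_const_nat_at_top filterlim_subseq[OF hs(2)]] .
  have sq2: "filterlim (\<lambda>k. 2 * (s k + k0)) sequentially sequentially"
    by (rule filterlim_at_top_mono[OF sq]) (simp add: eventually_sequentially)
  have ulE: "uniform_limit (cball x e) (\<lambda>k. iter f (q k)) h sequentially" unfolding q_def using e(2) by (intro hs(4)) auto
  have hx: "h x = x"
  proof -
    have "(\<lambda>k. iter f (q k) (iter f (n (s k + k0)) z)) \<longlonglongrightarrow> h x"
    proof (rule uniform_limit_moving[OF ulE])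
      show "continuous_on (cball x e) h" using hs(1) e(2) holomorphic_on_imp_continuous_on continuous_on_subset by blast
      show "(\<lambda>k. iter f (n (s k + k0)) z) \<longlonglongrightarrow> x" using filterlim_compose[OF nx sq] .
    qed (use k0 e in auto)
    moreover have "(\<lambda>k. iter f (n (2 * (s k + k0))) z) \<longlonglongrightarrow> x" using filterlim_compose[OF nx sq2] .
    ultimately show ?thesis using LIMSEQ_unique by (simp add: q_def pn)
  qed
  have hK: "h y \<in> K" if "y \<in> W" for y using that Wf(4) K_iter by (intro closed_sequentially[OF K_closed _ hs(3)[OF that]]) blast
  show False
  proof (cases "h constant_on W")
    case True
    then have "h y = x" if "y \<in> W" for y using that xW hx unfolding constant_on_def by metis
    then have "uniform_limit (cball x e) (\<lambda>k. iter f (q k)) (\<lambda>_. x) sequentially"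
      using ulE e(2) by (auto simp: uniform_limit_iff subset_iff)
    then show False using no_constant_limit[OF xint xA q e(1)] by simp
  next
    case False
    have oh: "open (h ` W)" using hs(1) Wf(3) conW False by (intro open_mapping_thm[of h W]) auto
    have "h ` W \<subseteq> interior K" using oh hK by (intro interior_maximal) auto
    moreover have "connected (h ` W)" using conW hs(1) connected_continuous_image holomorphic_on_imp_continuous_on by blast
    moreover have "x \<in> h ` W" using hx xW by (metis imageI)
    ultimately have hW: "h ` W \<subseteq> W" using connected_component_maximal W_def by metis
    \<comment> \<open>The index j k leaves a gap of at least k. A limit g of the iterates over these
      gaps satisfies g (h y) = h y, so it is the identity on the open set h(W) and hence on
      W.\<close>
    have "\<exists>j. q j \<ge> q k + k" for k using q by (auto simp: filterlim_at_top eventually_sequentially)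
    then obtain j where j: "\<And>k. q (j k) \<ge> q k + k" by metis
    have jinf: "filterlim j at_top sequentially" unfolding filterlim_at_top eventually_sequentially
    proof (intro allI)
      fix N
      have "j k \<ge> N" if "k > Max (q ` {..N})" for k
      proof (rule ccontr)
        assume "\<not> N \<le> j k"
        then have "q (j k) \<le> Max (q ` {..N})" by (intro Max_ge) auto
        then show False using j[of k] that by simp
      qed
      then show "\<exists>M. \<forall>k\<ge>M. N \<le> j k" by (meson Suc_le_eq)
    qed
    define u where "u k = q (j k) - q k" for k
    have uq: "iter f (u k) (iter f (q k) y) = iter f (q (j k)) y" for k y using j[of k] by (simp add: u_def flip: iter_add)
    obtain g \<sigma> where g: "g holomorphic_on W" "strict_mono (\<sigma> :: nat \<Rightarrow> nat)"
      "\<And>y. y \<in> W \<Longrightarrow> (\<lambda>k. iter f (u (\<sigma> k)) y) \<longlonglongrightarrow> g y"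
      "\<And>C. compact C \<Longrightarrow> C \<subseteq> W \<Longrightarrow> uniform_limit C (\<lambda>k. iter f (u (\<sigma> k))) g sequentially" using montel_iter[OF Wf(3,4), of u] by metis
    have gh: "g (h y) = h y" if y: "y \<in> W" for y
    proof -
      have hyW: "h y \<in> W" using hW y by auto
      obtain e' where e': "e' > 0" "cball (h y) e' \<subseteq> W" using Wf(3) hyW open_contains_cball by blast
      have lim: "(\<lambda>k. iter f (q (\<sigma> k)) y) \<longlonglongrightarrow> h y" using filterlim_compose[OF hs(3)[OF y] filterlim_subseq[OF g(2)]] by (simp add: q_def)
      then have "eventually (\<lambda>k. dist (iter f (q (\<sigma> k)) y) (h y) < e') sequentially" using e'(1) by (rule tendstoD)
      then obtain N where "\<forall>k\<ge>N. dist (iter f (q (\<sigma> k)) y) (h y) < e'" unfolding eventually_sequentially by blast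
      then have N: "\<And>k. k \<ge> N \<Longrightarrow> iter f (q (\<sigma> k)) y \<in> cball (h y) e'" by (simp add: dist_commute less_imp_le)
      have "(\<lambda>k. iter f (u (\<sigma> (k + N))) (iter f (q (\<sigma> (k + N))) y)) \<longlonglongrightarrow> g (h y)"
      proof (rule uniform_limit_moving[of "\<lambda>k. iter f (u (\<sigma> (k + N)))" "cball (h y) e'" g "\<lambda>k. iter f (q (\<sigma> (k + N))) y" "h y"])
        show "uniform_limit (cball (h y) e') (\<lambda>k. iter f (u (\<sigma> (k + N)))) g sequentially"
          using g(4)[OF compact_cball e'(2)] unfolding uniform_limit_iff
          by (auto intro: eventually_compose_filterlim[OF _ filterlim_add_const_nat_at_top])
        show "continuous_on (cball (h y) e') g" using g(1) e'(2) holomorphic_on_imp_continuous_on continuous_on_subset by blast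
        show "(\<lambda>k. iter f (q (\<sigma> (k + N))) y) \<longlonglongrightarrow> h y" by (rule LIMSEQ_ignore_initial_segment[OF lim])
      qed (use N e' in auto)
      then have "(\<lambda>k. iter f (q (j (\<sigma> (k + N)))) y) \<longlonglongrightarrow> g (h y)" by (simp add: uq)
      moreover have "filterlim (\<lambda>k. j (\<sigma> (k + N))) sequentially sequentially"
        using filterlim_compose[OF jinf filterlim_compose[OF filterlim_subseq[OF g(2)] filterlim_add_const_nat_at_top]] .
      then have "(\<lambda>k. iter f (q (j (\<sigma> (k + N)))) y) \<longlonglongrightarrow> h y" unfolding q_def by (rule filterlim_compose[OF hs(3)[OF y]])
      ultimately show ?thesis using LIMSEQ_unique by blast
    qed
    have gid: "g y = y" if "y \<in> W" for y
    proof (rule analytic_continuation_open[of "h ` W" W g "\<lambda>y. y"])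
      show "h ` W \<noteq> {}" using xW by auto
    qed (use oh Wf(3) hW conW g(1) gh that in auto)
    \<comment> \<open>With g the identity, iterates over the gaps bring every point of W back to
      itself in the limit; a point next to the frontier thereby returns next to J.\<close>
    obtain x' where x': "x' \<in> frontier W" using Wf(2) by auto
    then have x'J: "x' \<in> J" using Wf(1) by auto
    have "x' \<in> ball 0 R" using x'J J_K K_ball by blast
    then obtain r where r: "r > 0" "P \<inter> ball x' r \<subseteq> {x'}" "ball x' r \<subseteq> ball 0 R" using P_isolated[of x'] by metis
    have "ball x' (r * (1/2) ^ Mx) \<inter> W \<noteq> {}" using x' r(1) unfolding frontier_def
      by (metis DiffD1 Int_commute centre_in_ball closure_iff_nhds_not_empty mult_pos_pos open_ball order_refl zero_less_divide_1_iff zero_less_numeral zero_less_power)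
    then obtain a where a: "a \<in> W" "a \<in> ball x' (r * (1/2) ^ Mx)" by auto
    have "(\<lambda>k. iter f (u (\<sigma> k)) a) \<longlonglongrightarrow> a" using g(3)[OF a(1)] gid[OF a(1)] by simp
    then have "eventually (\<lambda>k. iter f (u (\<sigma> k)) a \<in> ball x' (r * (1/2) ^ Mx)) sequentially"
      using a(2) by (intro topological_tendstoD) auto
    moreover have "filterlim (\<lambda>k. u (\<sigma> k)) at_top sequentially"
    proof -
      have "k \<le> u (\<sigma> k)" for k using j[of "\<sigma> k"] seq_suble[OF g(2), of k] by (simp add: u_def)
      then show ?thesis by (auto simp: filterlim_at_top eventually_sequentially intro: order_trans)
    qed
    moreover have "a \<in> interior K" using a(1) Wc in_components_subset by blast
    ultimately show False using no_return_near_J[OF x'J r, of "1/2" "\<lambda>k. u (\<sigma> k)" a] by simp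
  qed
qed

end

subsection \<open>Exponential shrinking of pullbacks\<close>

lemma seq_eventuallyE:
  assumes "eventually P sequentially" obtains k where "P k"
  using eventually_happens'[OF sequentially_bot assms] by blast

lemma connected_disjoint_balls:
  fixes S :: "'a::metric_space set"
  assumes "connected S" "S \<subseteq> (\<Union>a\<in>A. ball a d)" "a \<in> A" "s \<in> S" "s \<in> ball a d"
    "\<And>a a'. a \<in> A \<Longrightarrow> a' \<in> A \<Longrightarrow> a \<noteq> a' \<Longrightarrow> 2 * d \<le> dist a a'"
  shows "S \<subseteq> ball a d"
proof (rule ccontr)
  assume "\<not> S \<subseteq> ball a d"
  let ?B = "\<Union>b\<in>A - {a}. ball b d"
  have "ball a d \<inter> ?B = {}"
  proof -
    have False if "x \<in> ball a d" "x \<in> ball b d" "b \<in> A - {a}" for x b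
    proof -
      have "dist a b < 2 * d" using that(1,2) dist_triangle_less_add[of a x d b d] by (simp add: dist_commute)
      then show False using assms(3,6) that(3) by fastforce
    qed
    then show ?thesis by blast
  qed
  moreover have "S \<subseteq> ball a d \<union> ?B" using assms(2) by blast
  moreover have "?B \<inter> S \<noteq> {}" using \<open>\<not> S \<subseteq> ball a d\<close> assms(2) by blast
  moreover have "ball a d \<inter> S \<noteq> {}" using assms(4,5) by blast
  moreover have "open (ball a d)" "open ?B" by auto
  ultimately show False using connectedD[OF assms(1), of "ball a d" ?B] by blast
qed

lemma compact_cover_balls:
  fixes S :: "'a::metric_space set"
  assumes S: "compact S" and r: "\<And>x. x \<in> S \<Longrightarrow> r x > (0::real)"
  obtains X l where "X \<subseteq> S" "finite X" "l > 0" "\<And>y. y \<in> S \<Longrightarrow> \<exists>x\<in>X. ball y l \<subseteq> ball x (r x)"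
proof -
  have "S \<subseteq> (\<Union>x\<in>S. ball x (r x))" using r by force
  then obtain X where X: "X \<subseteq> S" "finite X" "S \<subseteq> (\<Union>x\<in>X. ball x (r x))" using compactE_image[OF S, of S "\<lambda>x. ball x (r x)"] by blast
  obtain l where l: "l > 0" "\<And>y. y \<in> S \<Longrightarrow> \<exists>G\<in>(\<lambda>x. ball x (r x)) ` X. ball y l \<subseteq> G"
    using Heine_Borel_lemma[OF S, of "(\<lambda>x. ball x (r x)) ` X"] X(3) by (metis (no_types, lifting) imageE open_ball)
  then show ?thesis using that X by (metis (no_types, lifting) imageE)
qed

context pcf_poly
begin

lemma Acyc_uniform:
  assumes "\<And>a. a \<in> Acyc \<Longrightarrow> r a > 0"
  obtains d where "d > 0" "\<And>a. a \<in> Acyc \<Longrightarrow> d \<le> r a"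
    "\<And>a b. a \<in> Acyc \<Longrightarrow> b \<in> Acyc \<Longrightarrow> a \<noteq> b \<Longrightarrow> 2 * d \<le> dist a b"
  using finite_separated[OF Acyc_finite, of r] assms by metis

lemma trap_point:
  assumes l: "l \<in> interior K" and e: "e > 0"
  obtains \<rho> N where "\<rho> > 0" "\<And>w n. w \<in> ball l \<rho> \<Longrightarrow> n \<ge> N \<Longrightarrow> \<exists>a\<in>Acyc. dist (iter f n w) a < e"
proof -
  have "\<exists>d>0. \<forall>z n. z \<in> ball a d \<longrightarrow> dist (iter f n z) (iter f n a) < e" if "a \<in> Acyc" for a using trap[OF that e] by metis
  then obtain D where D: "\<And>a. a \<in> Acyc \<Longrightarrow> D a > 0"
    "\<And>a z n. a \<in> Acyc \<Longrightarrow> z \<in> ball a (D a) \<Longrightarrow> dist (iter f n z) (iter f n a) < e" by metis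
  obtain d where d: "d > 0" "\<And>a. a \<in> Acyc \<Longrightarrow> d \<le> D a" using Acyc_uniform[of D] D(1) by metis
  obtain N a where a: "a \<in> Acyc" "iter f N l \<in> ball a d" using basin[OF l d(1)] by blast
  have "open (iter f N -` ball a d)" by (intro open_vimage iter_cont) auto
  then obtain \<rho> where \<rho>: "\<rho> > 0" "ball l \<rho> \<subseteq> iter f N -` ball a d" using a(2) openE by blast
  have "\<exists>a\<in>Acyc. dist (iter f n w) a < e" if "w \<in> ball l \<rho>" "n \<ge> N" for w n
  proof -
    have "iter f n w = iter f (n - N) (iter f N w)" using that(2) by (simp flip: iter_add)
    moreover have "iter f N w \<in> ball a (D a)" using \<rho>(2) that(1) d(2)[OF a(1)] by force
    ultimately have "dist (iter f n w) (iter f (n - N) a) < e" using D(2)[OF a(1)] by metis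
    then show ?thesis using Acyc_iter[OF a(1)] by blast
  qed
  then show ?thesis using that \<rho>(1) by blast
qed

lemma trap_compact:
  assumes C: "compact C" "C \<subseteq> interior K" and e: "e > 0"
  obtains N where "\<And>w n. w \<in> C \<Longrightarrow> n \<ge> N \<Longrightarrow> \<exists>a\<in>Acyc. dist (iter f n w) a < e"
proof -
  have "\<exists>\<rho> N. \<rho> > 0 \<and> (\<forall>w n. w \<in> ball l \<rho> \<longrightarrow> n \<ge> N \<longrightarrow> (\<exists>a\<in>Acyc. dist (iter f n w) a < e))" if "l \<in> C" for l
    using trap_point[of l e] that C(2) e by (metis subsetD)
  then obtain \<rho> N where N: "\<And>l. l \<in> C \<Longrightarrow> \<rho> l > 0"
    "\<And>l w n. l \<in> C \<Longrightarrow> w \<in> ball l (\<rho> l) \<Longrightarrow> n \<ge> N l \<Longrightarrow> \<exists>a\<in>Acyc. dist (iter f n w) a < e" by metis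
  obtain X d where X: "X \<subseteq> C" "finite X" "d > 0" "\<And>y. y \<in> C \<Longrightarrow> \<exists>l\<in>X. ball y d \<subseteq> ball l (\<rho> l)"
    using compact_cover_balls[OF C(1), of \<rho>] N(1) by metis
  have "\<exists>a\<in>Acyc. dist (iter f n w) a < e" if "w \<in> C" "n \<ge> (\<Sum>l\<in>X. N l)" for w n
  proof -
    obtain l where "l \<in> X" "ball w d \<subseteq> ball l (\<rho> l)" using X(4) \<open>w \<in> C\<close> by blast
    then have l: "l \<in> X" "w \<in> ball l (\<rho> l)" using X(3) centre_in_ball by blast+
    have "N l \<le> (\<Sum>l\<in>X. N l)" using l(1) X(2) by (intro member_le_sum) auto
    then show ?thesis using N(2)[OF _ l(2)] l(1) X(1) \<open>n \<ge> _\<close> by (meson order_trans subsetD)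
  qed
  then show ?thesis using that by blast
qed

text \<open>Points near one outside K escape and never reach x; points near an interior one end up
  close to \<open>Acyc\<close>, hence away from x.\<close>

lemma backward_accum:
  assumes x: "x \<notin> Acyc" "x \<in> ball 0 R" and n: "filterlim n at_top sequentially"
    and y: "\<And>k. iter f (n k) (y k) = x" "y \<longlonglongrightarrow> l"
  shows "l \<in> J"
proof -
  have evn: "eventually (\<lambda>k. n k \<ge> N) sequentially" for N using n by (simp add: filterlim_at_top)
  have evy: "eventually (\<lambda>k. y k \<in> ball l \<rho>) sequentially" if "\<rho> > 0" for \<rho> using tendstoD[OF y(2) that] by (simp add: dist_commute)
  have "l \<in> K"
  proof (rule ccontr)
    assume "l \<notin> K"
    then obtain e N where e: "e > 0" "\<And>w k. w \<in> ball l e \<Longrightarrow> k \<ge> N \<Longrightarrow> norm (iter f k w) \<ge> R" using escape_nbhd by metis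
    obtain k where "n k \<ge> N" "y k \<in> ball l e" using seq_eventuallyE[OF eventually_conj[OF evn[of N] evy[OF e(1)]]] by blast
    then have "norm x \<ge> R" using e(2) y(1) by metis
    then show False using x(2) by simp
  qed
  moreover have "l \<notin> interior K"
  proof
    assume l: "l \<in> interior K"
    obtain e where e: "e > 0" "\<And>a. a \<in> Acyc \<Longrightarrow> a \<noteq> x \<Longrightarrow> e \<le> dist x a" using finite_set_avoid[OF Acyc_finite, of x] by metis
    obtain \<rho> N where \<rho>: "\<rho> > 0" "\<And>w n. w \<in> ball l \<rho> \<Longrightarrow> n \<ge> N \<Longrightarrow> \<exists>a\<in>Acyc. dist (iter f n w) a < e" using trap_point[OF l e(1)] by metis
    obtain k where "n k \<ge> N" "y k \<in> ball l \<rho>" using seq_eventuallyE[OF eventually_conj[OF evn[of N] evy[OF \<rho>(1)]]] by blast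
    then obtain a where "a \<in> Acyc" "dist x a < e" using \<rho>(2) y(1) by metis
    then show False using e(2) x(1) by force
  qed
  ultimately show ?thesis by (simp add: J_eq)
qed

text \<open>Counterexamples at arbitrarily high iterates would have a limit; its centre lies in J by
  \<open>backward_accum\<close>, so it is constant by \<open>lift_limit\<close>.\<close>

lemma lifts_shrink:
  assumes x: "x \<notin> Acyc" "x \<in> ball 0 R" and r: "r > 0" "ball x r \<subseteq> ball 0 R"
    and t: "0 < t" "t < 1" and e: "e > 0"
  obtains N where "\<And>n m \<psi>. n \<ge> N \<Longrightarrow> rlift (ipoly f n) x r m \<psi> \<Longrightarrow> 1 \<le> m \<Longrightarrow>
      (\<forall>w\<in>cball 0 t. dist (\<psi> w) (\<psi> 0) < e) \<and> (\<exists>y\<in>J. dist (\<psi> 0) y < e)"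
proof (rule ccontr)
  assume neg: "\<not> thesis"
  have "\<exists>n m \<psi>. n \<ge> N \<and> rlift (ipoly f n) x r m \<psi> \<and> 1 \<le> m \<and>
      \<not> ((\<forall>w\<in>cball 0 t. dist (\<psi> w) (\<psi> 0) < e) \<and> (\<exists>y\<in>J. dist (\<psi> 0) y < e))" for N using neg that by blast
  then obtain n m \<psi> where L: "\<And>N. n N \<ge> N" "\<And>k. rlift (ipoly f (n k)) x r (m k) (\<psi> k)" "\<And>k. 1 \<le> m k"
    "\<And>k. \<not> ((\<forall>w\<in>cball 0 t. dist (\<psi> k w) (\<psi> k 0) < e) \<and> (\<exists>y\<in>J. dist (\<psi> k 0) y < e))" by metis
  have n: "filterlim n at_top sequentially" using L(1) by (auto simp: filterlim_at_top eventually_sequentially intro: order_trans)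
  obtain h s where hs: "strict_mono s" "h holomorphic_on ball 0 1"
    "\<And>C. compact C \<Longrightarrow> C \<subseteq> ball 0 1 \<Longrightarrow> uniform_limit C (\<psi> \<circ> s) h sequentially"
    "h 0 \<in> J \<Longrightarrow> \<forall>w\<in>ball 0 1. h w = h 0" using lift_limit[OF L(2,3) r n] by metis
  have ul: "uniform_limit (cball 0 t) (\<psi> \<circ> s) h sequentially" using t by (intro hs(3)) auto
  have lim0: "(\<lambda>k. (\<psi> \<circ> s) k 0) \<longlonglongrightarrow> h 0" using tendsto_uniform_limitI[OF ul, of 0] t by simp
  have "iter f (n (s k)) ((\<psi> \<circ> s) k 0) = x" for k
  proof -
    have "m (s k) \<noteq> 0" using L(3)[of "s k"] by simp
    then show ?thesis using L(2)[of "s k"] by (simp add: rlift_def poly_ipoly)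
  qed
  moreover have "filterlim (\<lambda>k. n (s k)) at_top sequentially" using n filterlim_subseq[OF hs(1)] by (rule filterlim_compose)
  ultimately have h0: "h 0 \<in> J" using backward_accum[OF x _ _ lim0] by blast
  have hc: "h w = h 0" if "w \<in> cball 0 t" for w
  proof -
    have "w \<in> ball 0 1" using that t by auto
    then show ?thesis using hs(4)[OF h0] by blast
  qed
  have "eventually (\<lambda>k. \<forall>w\<in>cball 0 t. dist ((\<psi> \<circ> s) k w) (h w) < e / 2) sequentially" using uniform_limitD[OF ul, of "e/2"] e by simp
  then obtain k where k: "\<forall>w\<in>cball 0 t. dist ((\<psi> \<circ> s) k w) (h w) < e / 2" by (rule seq_eventuallyE)
  have d: "dist (\<psi> (s k) w) (h 0) < e / 2" if "w \<in> cball 0 t" for w using k[rule_format, OF that] hc[OF that] by simp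
  have "dist (\<psi> (s k) w) (\<psi> (s k) 0) < e" if "w \<in> cball 0 t" for w using dist_triangle_half_l[OF d[OF that] d[of 0]] t by simp
  moreover have "dist (\<psi> (s k) 0) (h 0) < e" using d[of 0] t e by simp
  ultimately show False using L(4)[of "s k"] h0 by blast
qed

text \<open>A bound on the diameters of the components of the preimage of B, phrased for all
  connected subsets of that preimage.\<close>

definition small :: "nat \<Rightarrow> complex set \<Rightarrow> real \<Rightarrow> bool" where
  "small n B e \<longleftrightarrow> (\<forall>S. connected S \<longrightarrow> iter f n ` S \<subseteq> B \<longrightarrow> (\<forall>a\<in>S. \<forall>b\<in>S. dist a b \<le> e))"

text \<open>The quantifier over a restricts the claim to nonempty S.\<close>

definition nearJ :: "nat \<Rightarrow> complex set \<Rightarrow> real \<Rightarrow> bool" where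
  "nearJ n B e \<longleftrightarrow> (\<forall>S. connected S \<longrightarrow> iter f n ` S \<subseteq> B \<longrightarrow> (\<forall>a\<in>S. \<exists>y\<in>J. S \<subseteq> ball y e))"

text \<open>The Schwarz lemma for a lift: over the \<delta>-ball the lift stays within e of its
  centre, so over the much smaller \<tau>-ball it stays within a fixed fraction of e. The radii do
  not depend on n because all exponents are at most \<open>Mx\<close>.\<close>

lemma small_half:
  assumes x: "x \<notin> Acyc" "x \<in> ball 0 R"
  obtains \<delta> \<tau> where "0 < \<tau>" "\<tau> \<le> \<delta>" "ball x \<delta> \<subseteq> ball 0 R"
    "\<And>e. e > 0 \<Longrightarrow> \<exists>N. \<forall>n\<ge>N. nearJ n (ball x \<delta>) e"
    "\<And>n e. small n (ball x \<delta>) e \<Longrightarrow> small n (ball x \<tau>) (e / 2)"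
proof -
  obtain r where r: "r > 0" "P \<inter> ball x r \<subseteq> {x}" "ball x r \<subseteq> ball 0 R" using P_isolated[of x] x(2) by metis
  define \<delta> where "\<delta> = r * (1/2) ^ Mx"
  \<comment> \<open>1/16 is 1/2 times 1/8: the factor 1/2 is that of \<delta>, and 1/8 is the ratio
    of parameter radii to which the Schwarz lemma is applied, valid for every exponent up to
    \<open>Mx\<close>.\<close>
  define \<tau> where "\<tau> = r * (1/16) ^ Mx"
  have \<tau>: "0 < \<tau>" "\<tau> \<le> \<delta>" using r(1) by (auto simp: \<tau>_def \<delta>_def intro!: power_mono)
  have \<delta>r: "\<delta> \<le> r" using r(1) by (simp add: \<delta>_def mult_le_cancel_left1 power_le_one)
  then have sub: "ball x \<delta> \<subseteq> ball x r" by (intro subset_ball)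
  have "\<exists>N. \<forall>n\<ge>N. nearJ n (ball x \<delta>) e" if e: "e > 0" for e
  proof -
    obtain N where N: "\<And>n m \<psi>. n \<ge> N \<Longrightarrow> rlift (ipoly f n) x r m \<psi> \<Longrightarrow> 1 \<le> m \<Longrightarrow>
      (\<forall>w\<in>cball 0 (1/2). dist (\<psi> w) (\<psi> 0) < e/2) \<and> (\<exists>y\<in>J. dist (\<psi> 0) y < e/2)"
      using lifts_shrink[OF x r(1,3), of "1/2" "e/2"] e by auto
    have "nearJ n (ball x \<delta>) e" if n: "n \<ge> N" for n unfolding nearJ_def
    proof (intro allI impI ballI)
      fix S a assume S: "connected S" "iter f n ` S \<subseteq> ball x \<delta>" "a \<in> S"
      have "S \<noteq> {}" using S(3) by auto
      then obtain m \<psi> where m: "1 \<le> m" "m \<le> Mx" "rlift (ipoly f n) x r m \<psi>" "S \<subseteq> \<psi> ` ball 0 1"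
        using lift_cover[OF x(1) r(1,2) S(1) \<open>S \<noteq> {}\<close> subset_trans[OF S(2) sub]] by metis
      have S2: "S \<subseteq> \<psi> ` ball 0 (1/2)" by (rule rlift_small[OF m(3,2,4) _ _ _ r(1)]) (use S(2) in \<open>auto simp: \<delta>_def poly_ipoly\<close>)
      obtain y where y: "y \<in> J" "dist (\<psi> 0) y < e / 2" using N[OF n m(3,1)] by blast
      have "S \<subseteq> ball y e"
      proof
        fix s assume "s \<in> S"
        then obtain w where w: "w \<in> ball 0 (1/2)" "s = \<psi> w" using S2 by blast
        then have "dist s (\<psi> 0) < e / 2" using N[OF n m(3,1)] by auto
        then show "s \<in> ball y e" using dist_triangle_half_l[of s "\<psi> 0" e y] y(2) by (simp add: dist_commute)
      qed
      then show "\<exists>y\<in>J. S \<subseteq> ball y e" using y(1) by blast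
    qed
    then show ?thesis by blast
  qed
  moreover have "small n (ball x \<tau>) (e / 2)" if sm: "small n (ball x \<delta>) e" for n e unfolding small_def
  proof (intro allI impI ballI)
    fix S a b assume S: "connected S" "iter f n ` S \<subseteq> ball x \<tau>" and ab: "a \<in> S" "b \<in> S"
    have S\<delta>: "iter f n ` S \<subseteq> ball x \<delta>" using S(2) subset_ball[OF \<tau>(2), of x] by blast
    show "dist a b \<le> e / 2"
    proof (cases "e > 0")
      case False
      have "dist a b \<le> e" using sm S(1) S\<delta> ab by (auto simp: small_def)
      then show ?thesis using False by simp
    next
      case True
      have "S \<noteq> {}" using ab by auto
      then obtain m \<psi> where m: "1 \<le> m" "m \<le> Mx" "rlift (ipoly f n) x r m \<psi>" "S \<subseteq> \<psi> ` ball 0 1"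
        using lift_cover[OF x(1) r(1,2) S(1) \<open>S \<noteq> {}\<close> subset_trans[OF S\<delta> sub]] by metis
      have hol: "\<psi> holomorphic_on ball 0 1" and eq: "\<And>w. w \<in> ball 0 1 \<Longrightarrow> iter f n (\<psi> w) = x + of_real r * w ^ m"
        using m(3) by (auto simp: rlift_def poly_ipoly)
      \<comment> \<open>The disc of radius \<rho> is exactly the part of the parameter disc that
        lies over the \<delta>-ball.\<close>
      define \<rho> where "\<rho> = root m ((1/2) ^ Mx)"
      have \<rho>: "0 < \<rho>" "\<rho> ^ m = (1/2) ^ Mx" "\<rho> < 1"
      proof -
        show "0 < \<rho>" "\<rho> ^ m = (1/2) ^ Mx" using m(1) by (auto simp: \<rho>_def)
        have "(1/2::real) ^ Mx < 1" using Mx_pos by (simp add: power_less_one_iff)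
        then show "\<rho> < 1" unfolding \<rho>_def using m(1) by (subst real_root_lt_1_iff) auto
      qed
      have conT: "connected (\<psi> ` ball 0 \<rho>)"
        using hol \<rho>(3) by (intro connected_continuous_image) (auto intro!: holomorphic_on_imp_continuous_on holomorphic_on_subset[OF hol])
      have "iter f n ` (\<psi> ` ball 0 \<rho>) \<subseteq> ball x \<delta>"
      proof clarify
        fix w :: complex assume w: "w \<in> ball 0 \<rho>"
        then have "norm w ^ m < \<rho> ^ m" using m(1) by (intro power_strict_mono) auto
        then show "iter f n (\<psi> w) \<in> ball x \<delta>" using eq[of w] w \<rho>(2,3) r(1) by (simp add: dist_norm norm_mult norm_power \<delta>_def)
      qed
      then have bd: "dist (\<psi> w) (\<psi> 0) \<le> e" if "w \<in> ball 0 \<rho>" for w using sm conT that \<rho>(1) by (auto simp: small_def)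
      have sch: "dist (\<psi> w) (\<psi> 0) \<le> e / 4" if w: "norm w < \<rho> / 8" for w
      proof -
        \<comment> \<open>Division by 2 e instead of e makes the values strictly smaller than 1 in
          modulus, as the Schwarz lemma asks.\<close>
        define g where "g u = (\<psi> (of_real \<rho> * u) - \<psi> 0) / of_real (2 * e)" for u
        have inb: "of_real \<rho> * u \<in> ball 0 \<rho>" if "norm u < 1" for u :: complex using that \<rho>(1) by (simp add: norm_mult)
        have "(\<lambda>u. \<psi> (of_real \<rho> * u)) holomorphic_on ball 0 1"
          using holomorphic_on_compose_gen[of "\<lambda>u. of_real \<rho> * u" "ball 0 1" \<psi> "ball 0 1"] hol inb \<rho>(3)
          by (force simp: o_def intro!: holomorphic_intros)
        then have "g holomorphic_on ball 0 1" unfolding g_def using True by (intro holomorphic_intros) auto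
        moreover have "g 0 = 0" by (simp add: g_def)
        moreover have "norm (g u) < 1" if "norm u < 1" for u using bd[OF inb[OF that]] True by (simp add: g_def norm_divide dist_norm)
        ultimately have "norm (g u) \<le> norm u" if "norm u < 1" for u using Schwarz_Lemma(1)[of g u] that by blast
        moreover have "norm (w / of_real \<rho>) < 1/8" using w \<rho>(1) by (simp add: norm_divide field_simps)
        ultimately have "norm (g (w / of_real \<rho>)) \<le> 1/8" by (meson less_le_trans less_imp_le order_trans le_numeral_extra(4) one_le_numeral divide_le_eq_1_pos zero_less_numeral)
        then show ?thesis using \<rho>(1) True by (simp add: g_def norm_divide dist_norm field_simps)
      qed
      have Sw: "dist s (\<psi> 0) \<le> e / 4" if s: "s \<in> S" for s
      proof -
        obtain w where w: "w \<in> ball 0 1" "s = \<psi> w" using m(4) s by blast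
        have "iter f n s \<in> ball x \<tau>" using S(2) s by blast
        then have "r * norm w ^ m < r * (1/16) ^ Mx" using eq[OF w(1)] w(2) r(1) by (simp add: dist_norm norm_mult norm_power \<tau>_def)
        then have "norm w ^ m < (1/16) ^ Mx" using r(1) by simp
        also have "\<dots> = (1/2) ^ Mx * (1/8) ^ Mx" by (simp flip: power_mult_distrib)
        also have "\<dots> \<le> (1/2) ^ Mx * (1/8) ^ m" using m(2) by (intro mult_left_mono power_decreasing) auto
        also have "\<dots> = (\<rho> / 8) ^ m" using \<rho>(2) by (simp add: power_divide)
        finally have "norm w < \<rho> / 8" by (rule power_less_imp_less_base) (use \<rho>(1) in simp)
        then show ?thesis using sch w(2) by simp
      qed
      then show ?thesis using dist_triangle2[of a b "\<psi> 0"] Sw[OF ab(1)] Sw[OF ab(2)] by simp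
    qed
  qed
  moreover have "ball x \<delta> \<subseteq> ball 0 R" using sub r(3) by blast
  ultimately show ?thesis using that[of \<tau> \<delta>] \<tau> by blast
qed

lemma small_base: "B \<subseteq> ball 0 R \<Longrightarrow> small n B (2 * R)"
  unfolding small_def
proof (intro allI impI ballI)
  fix S a b assume "B \<subseteq> ball 0 R" "iter f n ` S \<subseteq> B" "a \<in> S" "b \<in> S"
  then have "a \<in> ball 0 R" "b \<in> ball 0 R" using ball_R_back[of n] by blast+
  then show "dist a b \<le> 2 * R" using dist_triangle2[of a b 0] by simp
qed

text \<open>The image of S under the n-th iterate is connected and sent into B by the N-th; so it
  lies in a small ball about a point of J, where the bound for n applies.\<close>

lemma small_step:
  assumes near: "nearJ N B l" and small: "\<And>y. y \<in> J \<Longrightarrow> small n (ball y l) e" and e: "0 \<le> e"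
  shows "small (N + n) B e"
  unfolding small_def
proof (intro allI impI ballI)
  fix S a b assume S: "connected S" "iter f (N + n) ` S \<subseteq> B" and ab: "a \<in> S" "b \<in> S"
  have "connected (iter f n ` S)" using S(1) by (intro connected_continuous_image iter_cont)
  moreover have "iter f N ` (iter f n ` S) \<subseteq> B" using S(2) by (auto simp: iter_add)
  ultimately obtain y where "y \<in> J" "iter f n ` S \<subseteq> ball y l" using near ab(1) unfolding nearJ_def by blast
  then show "dist a b \<le> e" using small S(1) ab unfolding small_def by blast
qed

text \<open>Pulling back by N iterates leads from the larger balls of a finite cover of J into the
  smaller ones, and the passage from the larger to the smaller radius halves the diameters each
  time.\<close>

lemma expand_J:
  obtains l q C where "0 < l" "0 < q" "q < 1" "0 < C" "\<And>y n. y \<in> J \<Longrightarrow> small n (ball y l) (C * q ^ n)"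
proof -
  define H where "H x \<delta> \<tau> \<longleftrightarrow> 0 < \<tau> \<and> \<tau> \<le> \<delta> \<and> ball x \<delta> \<subseteq> ball 0 R \<and> (\<forall>e>0. \<exists>N. \<forall>n\<ge>N. nearJ n (ball x \<delta>) e) \<and>
      (\<forall>n e. small n (ball x \<delta>) e \<longrightarrow> small n (ball x \<tau>) (e / 2))" for x \<delta> \<tau>
  have "\<exists>\<delta> \<tau>. H x \<delta> \<tau>" if xJ: "x \<in> J" for x
  proof -
    have "x \<notin> Acyc" "x \<in> ball 0 R" using xJ J_Acyc J_K K_ball by blast+
    then show ?thesis unfolding H_def by (rule small_half) blast
  qed
  then obtain \<delta> \<tau> where H: "\<And>x. x \<in> J \<Longrightarrow> H x (\<delta> x) (\<tau> x)" by metis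
  have D: "0 < \<tau> x" "\<tau> x \<le> \<delta> x" "ball x (\<delta> x) \<subseteq> ball 0 R"
    "e > 0 \<Longrightarrow> \<exists>N. \<forall>n\<ge>N. nearJ n (ball x (\<delta> x)) e"
    "small n (ball x (\<delta> x)) e \<Longrightarrow> small n (ball x (\<tau> x)) (e / 2)" if "x \<in> J" for x n e using H[OF that] unfolding H_def by blast+
  obtain X l where X: "X \<subseteq> J" "finite X" "l > 0" "\<And>y. y \<in> J \<Longrightarrow> \<exists>x\<in>X. ball y l \<subseteq> ball x (\<tau> x)"
    using compact_cover_balls[OF J_compact, of \<tau>] D(1) by metis
  note l = X(3) and lx = X(4)
  obtain N0 where N0: "\<And>x n. x \<in> X \<Longrightarrow> n \<ge> N0 x \<Longrightarrow> nearJ n (ball x (\<delta> x)) l" using D(4)[OF _ l] X(1) by (metis subsetD)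
  define N where "N = Suc (\<Sum>x\<in>X. N0 x)"
  have N: "nearJ N (ball x (\<delta> x)) l" if "x \<in> X" for x
  proof -
    have "N0 x \<le> (\<Sum>x\<in>X. N0 x)" using that X(2) by (intro member_le_sum) auto
    then show ?thesis using N0[OF that, of N] by (simp add: N_def)
  qed
  have main: "small (j * N + i) (ball x (\<delta> x)) (2 * R / 2 ^ j)" if "x \<in> X" for j i x using that
  proof (induction j arbitrary: x)
    case 0
    then show ?case using small_base D(3) X(1) by auto
  next
    case (Suc j)
    have "small (j * N + i) (ball y l) (2 * R / 2 ^ j / 2)" if "y \<in> J" for y
    proof -
      obtain x' where x': "x' \<in> X" "ball y l \<subseteq> ball x' (\<tau> x')" using lx[OF \<open>y \<in> J\<close>] by blast
      have "small (j * N + i) (ball x' (\<tau> x')) (2 * R / 2 ^ j / 2)" using D(5) Suc.IH[OF x'(1)] x'(1) X(1) by blast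
      then show ?thesis using x'(2) unfolding small_def by (meson order_trans)
    qed
    then have "small (N + (j * N + i)) (ball x (\<delta> x)) (2 * R / 2 ^ j / 2)" using R(1) by (intro small_step[OF N[OF Suc.prems]]) auto
    then show ?case by (simp add: ac_simps)
  qed
  define q where "q = root N (1/2)"
  have q: "0 < q" "q < 1" "q ^ N = 1/2" unfolding q_def using real_root_pow_pos2[of N "1/2"] by (auto simp: N_def simp del: power_Suc)
  \<comment> \<open>4 R instead of 2 R pays for the remaining n mod N iterates, over which the power
    of q loses at most the factor q^N = 1/2.\<close>
  have "small n (ball y l) (4 * R * q ^ n)" if "y \<in> J" for y n
  proof -
    obtain x where x: "x \<in> X" "ball y l \<subseteq> ball x (\<tau> x)" using lx[OF \<open>y \<in> J\<close>] by blast
    then have xJ: "x \<in> J" using X(1) by auto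
    have "ball y l \<subseteq> ball x (\<delta> x)" using x(2) D(2)[OF xJ] by (meson order_trans subset_ball)
    moreover have "small (n div N * N + n mod N) (ball x (\<delta> x)) (2 * R / 2 ^ (n div N))" by (rule main[OF x(1)])
    moreover have "2 * R / 2 ^ (n div N) \<le> 4 * R * q ^ n"
    proof -
      have "q ^ n = q ^ (N * (n div N) + n mod N)" by simp
      also have "\<dots> = (1/2) ^ (n div N) * q ^ (n mod N)" by (simp only: power_add power_mult q(3))
      finally have "q ^ n = (1/2) ^ (n div N) * q ^ (n mod N)" .
      moreover have "q ^ (n mod N) \<ge> q ^ N" using q by (intro power_decreasing) (auto simp: N_def less_imp_le)
      ultimately have "q ^ n \<ge> (1/2) ^ (n div N) * (1/2)" using q(3) by (simp only:) (intro mult_left_mono, auto)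
      then have "4 * R * q ^ n \<ge> 4 * R * ((1/2) ^ (n div N) * (1/2))" using R(1) by (intro mult_left_mono) auto
      then show ?thesis by (simp add: power_divide field_simps)
    qed
    ultimately show ?thesis unfolding small_def div_mult_mod_eq by (meson order_trans)
  qed
  then show ?thesis using that[of l q "4 * R"] l q R(1) by auto
qed

text \<open>Finitely many pullbacks bring discs centred in Q close to J, and from there
  \<open>expand_J\<close> takes over.\<close>

theorem expand:
  assumes Q: "compact Q" "Q \<subseteq> ball 0 R - Acyc"
  obtains d q C where "0 < d" "0 < q" "q < 1" "0 < C" "\<And>x n. x \<in> Q \<Longrightarrow> small n (ball x d) (C * q ^ n)"
proof -
  obtain l q C where lqC: "0 < l" "0 < q" "q < 1" "0 < C" "\<And>y n. y \<in> J \<Longrightarrow> small n (ball y l) (C * q ^ n)" using expand_J by metis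
  have "\<exists>\<delta> N. 0 < \<delta> \<and> ball x \<delta> \<subseteq> ball 0 R \<and> nearJ N (ball x \<delta>) l" if "x \<in> Q" for x
    using small_half[of x] that Q(2) lqC(1) by (metis Diff_iff less_le_trans order_refl subsetD)
  then obtain \<delta> N where D: "\<And>x. x \<in> Q \<Longrightarrow> 0 < \<delta> x" "\<And>x. x \<in> Q \<Longrightarrow> ball x (\<delta> x) \<subseteq> ball 0 R"
     "\<And>x. x \<in> Q \<Longrightarrow> nearJ (N x) (ball x (\<delta> x)) l" by metis
  obtain X d where X: "X \<subseteq> Q" "finite X" and d: "d > 0" "\<And>y. y \<in> Q \<Longrightarrow> \<exists>x\<in>X. ball y d \<subseteq> ball x (\<delta> x)"
    using compact_cover_balls[OF Q(1), of \<delta>] D(1) by metis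
  define M where "M = (\<Sum>x\<in>X. N x)"
  \<comment> \<open>2 R is the trivial bound for fewer than N x iterates; division by q^M makes up
    for the at most M iterates spent on reaching J.\<close>
  define C' where "C' = (C + 2 * R) / q ^ M"
  have C': "C' > 0" using lqC R(1) by (simp add: C'_def)
  have "small n (ball y d) (C' * q ^ n)" if "y \<in> Q" for y n
  proof -
    obtain x where x: "x \<in> X" "ball y d \<subseteq> ball x (\<delta> x)" using d(2) \<open>y \<in> Q\<close> by blast
    then have xQ: "x \<in> Q" using X(1) by auto
    have NM: "N x \<le> M" unfolding M_def using x(1) X(2) by (intro member_le_sum) auto
    have "small n (ball x (\<delta> x)) (C' * q ^ n)"
    proof (cases "n \<ge> N x")
      case True
      have "small (N x + (n - N x)) (ball x (\<delta> x)) (C * q ^ (n - N x))" using lqC by (intro small_step[OF D(3)[OF xQ]]) auto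
      moreover have "C * q ^ (n - N x) \<le> C' * q ^ n"
      proof -
        have "q ^ M * q ^ (n - N x) \<le> q ^ n" using lqC True NM by (simp flip: power_add)
        then have "q ^ (n - N x) \<le> q ^ n / q ^ M" using lqC by (simp add: field_simps)
        then have "C * q ^ (n - N x) \<le> (C + 2 * R) * (q ^ n / q ^ M)" using lqC R(1) by (intro mult_mono) auto
        then show ?thesis by (simp add: C'_def)
      qed
      ultimately show ?thesis using True unfolding small_def le_add_diff_inverse[OF True] by (meson order_trans)
    next
      case False
      then have "q ^ M \<le> q ^ n" using NM lqC by (intro power_decreasing) auto
      then have "2 * R * q ^ M \<le> (C + 2 * R) * q ^ n" using lqC R(1) by (intro mult_mono) auto
      then have "2 * R \<le> C' * q ^ n" using lqC by (simp add: C'_def field_simps)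
      then show ?thesis using small_base[OF D(2)[OF xQ], of n] unfolding small_def by (meson order_trans)
    qed
    then show ?thesis using x(2) unfolding small_def by (meson order_trans)
  qed
  then show ?thesis using that d(1) lqC(2,3) C' by blast
qed

end

subsection \<open>Bounded Fatou components\<close>

text \<open>In the coordinate of the lift that covers S, the fibre over x is given by r w^m =
  0.\<close>

lemma unique_preimage_conn:
  fixes p :: "complex poly"
  assumes deg: "degree p > 0" and Q: "finite Q" "\<And>z. poly (pderiv p) z = 0 \<Longrightarrow> poly p z \<in> Q"
    and r: "r > 0" "Q \<inter> ball x r \<subseteq> {x}" and S: "connected S" "poly p ` S \<subseteq> ball x r"
    and c: "c \<in> S" "c' \<in> S" "poly p c = x" "poly p c' = x"
  shows "c = c'"
proof -
  obtain y where y: "poly p y = x" "\<And>\<psi> m. rlift p x r m \<psi> \<Longrightarrow> m > 0 \<Longrightarrow> \<psi> 0 = y \<Longrightarrow> S \<subseteq> \<psi> ` ball 0 1"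
    using rlift_cover[OF deg r(1) S(1) _ S(2)] c(1) by blast
  obtain \<psi> where \<psi>: "rlift p x r (order y (p - [:x:])) \<psi>" "\<psi> 0 = y" using ramified_lift[OF deg Q r y(1)] by blast
  have m: "order y (p - [:x:]) > 0" using deg y(1) order_root[of "p - [:x:]" y] poly_minus_const_nonzero by (auto intro: gr0I)
  have "s = y" if s: "s \<in> S" "poly p s = x" for s
  proof -
    obtain w where w: "w \<in> ball 0 1" "s = \<psi> w" using y(2)[OF \<psi>(1) m \<psi>(2)] s(1) by blast
    then have "of_real r * w ^ order y (p - [:x:]) = 0" using \<psi>(1) s(2) by (auto simp: rlift_def)
    then have "w = 0" using r(1) by simp
    then show ?thesis using w(2) \<psi>(2) by simp
  qed
  then show ?thesis using c by metis
qed

context pcf_poly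
begin

abbreviation "comps \<equiv> components (interior K)"

lemma comps_open: "U \<in> comps \<Longrightarrow> open U" using component_frontier_J(3) .
lemma comps_sub: "U \<in> comps \<Longrightarrow> U \<subseteq> interior K" using in_components_subset .
lemma comps_conn: "U \<in> comps \<Longrightarrow> connected U" using in_components_connected .
lemma comps_ne: "U \<in> comps \<Longrightarrow> U \<noteq> {}" using in_components_nonempty .
lemma comps_eq: "U \<in> comps \<Longrightarrow> V \<in> comps \<Longrightarrow> z \<in> U \<Longrightarrow> z \<in> V \<Longrightarrow> U = V"
  by (metis components_nonoverlap disjoint_iff)

lemma comps_closure: "U \<in> comps \<Longrightarrow> closure U \<subseteq> K" "U \<in> comps \<Longrightarrow> closure U \<inter> interior K = U"
proof -
  assume U: "U \<in> comps"
  show "closure U \<subseteq> K" using component_frontier_J(4)[OF U] K_closed by (simp add: closure_minimal)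
  have "closure U = U \<union> frontier U" using closure_Un_frontier by blast
  then show "closure U \<inter> interior K = U" using component_frontier_J(1)[OF U] comps_sub[OF U] J_eq by auto
qed

lemma comps_frontier: "U \<in> comps \<Longrightarrow> closure U - U \<subseteq> J"
  using component_frontier_J(1,3) by (metis frontier_def interior_open)

lemma comps_disjoint_closure: "U \<in> comps \<Longrightarrow> V \<in> comps \<Longrightarrow> U \<noteq> V \<Longrightarrow> closure U \<inter> V = {}"
  using comps_closure(2)[of U] comps_sub[of V] components_nonoverlap[of U "interior K" V] by blast

lemma comp_of: "z \<in> interior K \<Longrightarrow> \<exists>U\<in>comps. z \<in> U"
  by (metis Union_components UnionE)

lemma iter_open_map:
  assumes "open S" shows "open (iter f n ` S)"
proof -
  have "\<not> iter f n constant_on UNIV"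
    unfolding constant_on_def poly_ipoly[symmetric] by (metis UNIV_I poly_has_preimage[OF deg_ipoly_pos] zero_neq_one)
  then show ?thesis using assms by (intro open_mapping_thm[of "iter f n" UNIV]) (auto intro: iter_holo)
qed

text \<open>The image is open, and closed in the component V around it: a limit in V of image points
  is the image of a point of the closure of U that is interior to K, hence in U.\<close>

lemma comps_image_iter:
  assumes U: "U \<in> comps" shows "iter f n ` U \<in> comps"
proof -
  obtain u where u: "u \<in> U" using comps_ne[OF U] by auto
  have FU: "iter f n ` U \<subseteq> interior K" using comps_sub[OF U] K_int_iter by auto
  obtain V where V: "V \<in> comps" "iter f n u \<in> V" using comp_of FU u by blast
  have con: "connected (iter f n ` U)" using comps_conn[OF U] by (intro connected_continuous_image iter_cont)
  then have sub: "iter f n ` U \<subseteq> V" using components_maximal[OF V(1) con FU] V(2) u by blast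
  have "closedin (top_of_set V) (iter f n ` U)"
  proof (rule closedin_seqI[OF sub])
    fix t l assume t: "\<forall>k. t k \<in> iter f n ` U" "l \<in> V" "t \<longlonglongrightarrow> l"
    then have "\<forall>k. \<exists>w. w \<in> U \<and> t k = iter f n w" by blast
    then obtain w where w: "\<And>k. w k \<in> U" "\<And>k. t k = iter f n (w k)" by metis
    have "w k \<in> K" for k using w(1) comps_sub[OF U] interior_subset by blast
    then obtain w' \<sigma> where w': "strict_mono \<sigma>" "(w \<circ> \<sigma>) \<longlonglongrightarrow> w'" using K_compact unfolding compact_def by metis
    have "isCont (iter f n) w'" using iter_cont[of UNIV n] by (simp add: continuous_on_eq_continuous_at)
    then have "(\<lambda>k. iter f n ((w \<circ> \<sigma>) k)) \<longlonglongrightarrow> iter f n w'" using w'(2) isCont_tendsto_compose by blast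
    moreover have "(\<lambda>k. iter f n ((w \<circ> \<sigma>) k)) \<longlonglongrightarrow> l" using LIMSEQ_subseq_LIMSEQ[OF t(3) w'(1)] w(2) by (simp add: o_def)
    ultimately have l: "l = iter f n w'" using LIMSEQ_unique by blast
    have "w' \<in> closure U" using w'(2) w(1) unfolding closure_sequential by (intro exI[of _ "w \<circ> \<sigma>"]) simp
    moreover have "w' \<in> interior K" using l t(2) comps_sub[OF V(1)] K_int_iter by blast
    ultimately have "w' \<in> U" using comps_closure(2)[OF U] by blast
    then show "l \<in> iter f n ` U" using l by blast
  qed
  moreover have "openin (top_of_set V) (iter f n ` U)" using sub iter_open_map[OF comps_open[OF U]] by (rule open_subset)
  ultimately have "iter f n ` U = V" using comps_conn[OF V(1)] u connected_clopen[of V] by fastforce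
  then show ?thesis using V(1) by simp
qed

lemma comps_image: "U \<in> comps \<Longrightarrow> poly f ` U \<in> comps"
  using comps_image_iter[of U 1] by simp

lemma finite_iter_fibre: "finite {z. iter f n z = w}"
  using finite_poly_fibre[OF deg_ipoly_pos, of n w] by (simp add: poly_ipoly)

lemma finite_comp_fibre: "finite {U \<in> comps. iter f n ` U = W}"
proof (cases "W = {}")
  case True
  then have "{U \<in> comps. iter f n ` U = W} = {}" using comps_ne by auto
  then show ?thesis by (metis finite.emptyI)
next
  case False
  then obtain w where w: "w \<in> W" by auto
  let ?A = "{U \<in> comps. iter f n ` U = W}"
  have "\<exists>u. u \<in> U \<and> iter f n u = w" if "U \<in> ?A" for U using that w by auto
  then obtain g where g: "\<And>U. U \<in> ?A \<Longrightarrow> g U \<in> U \<and> iter f n (g U) = w" by metis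
  have "inj_on g ?A" using g comps_eq by (intro inj_onI) (metis (no_types, lifting) mem_Collect_eq)
  moreover have "g ` ?A \<subseteq> {z. iter f n z = w}" using g by auto
  then have "finite (g ` ?A)" by (rule finite_subset[OF _ finite_iter_fibre])
  ultimately show ?thesis by (rule finite_imageD[rotated])
qed

text \<open>Openness of the iterate puts z into the closure of the preimage of W, and this preimage
  is covered by finitely many components.\<close>

lemma preimage_closure_comp:
  assumes W: "W \<in> comps" and z: "iter f n z \<in> closure W"
  obtains U where "U \<in> comps" "iter f n ` U = W" "z \<in> closure U"
proof -
  let ?A = "{U \<in> comps. iter f n ` U = W}"
  have pre: "iter f n -` W \<subseteq> \<Union>?A"
  proof
    fix u assume u: "u \<in> iter f n -` W"
    then have "u \<in> interior K" using comps_sub[OF W] K_int_iter by blast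
    then obtain U where U: "U \<in> comps" "u \<in> U" using comp_of by blast
    then have "iter f n ` U = W" using comps_eq[OF comps_image_iter[OF U(1)] W] u by blast
    then show "u \<in> \<Union>?A" using U by blast
  qed
  have "z \<in> closure (iter f n -` W)" unfolding closure_approachable
  proof (intro allI impI)
    fix e :: real assume "e > 0"
    then have "open (iter f n ` ball z e)" "iter f n z \<in> iter f n ` ball z e" by (auto intro: iter_open_map)
    then have "iter f n ` ball z e \<inter> W \<noteq> {}" using z closure_iff_nhds_not_empty by blast
    then show "\<exists>y\<in>iter f n -` W. dist y z < e" by (auto simp: dist_commute)
  qed
  then have "z \<in> closure (\<Union>?A)" using closure_mono[OF pre] by blast
  moreover have "closure (\<Union>?A) \<subseteq> (\<Union>U\<in>?A. closure U)"
    using closure_subset finite_comp_fibre[of n W] by (intro closure_minimal closed_UN) blast+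
  ultimately have "z \<in> (\<Union>U\<in>?A. closure U)" by blast
  then show ?thesis using that by blast
qed

lemma image_closure_comp: "U \<in> comps \<Longrightarrow> z \<in> closure U \<Longrightarrow> iter f n z \<in> closure (iter f n ` U)"
proof -
  have "iter f n ` closure U \<subseteq> closure (iter f n ` U)" by (intro image_closure_subset iter_cont closed_closure closure_subset)
  then show "z \<in> closure U \<Longrightarrow> iter f n z \<in> closure (iter f n ` U)" by blast
qed

lemma centre_exists:
  assumes U: "U \<in> comps" shows "\<exists>c\<in>U. \<exists>n. iter f n c \<in> Acyc"
proof -
  have "\<exists>r>0. ball a r \<subseteq> interior K" if "a \<in> Acyc" for a by (meson Acyc_int open_contains_ball open_interior subsetD that)
  then obtain r where r: "\<And>a. a \<in> Acyc \<Longrightarrow> r a > 0" "\<And>a. a \<in> Acyc \<Longrightarrow> ball a (r a) \<subseteq> interior K" by metis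
  obtain d where d: "d > 0" "\<And>a. a \<in> Acyc \<Longrightarrow> d \<le> r a" using Acyc_uniform[of r] r(1) by metis
  obtain z where z: "z \<in> U" using comps_ne[OF U] by auto
  then obtain n a where a: "a \<in> Acyc" "iter f n z \<in> ball a d" using basin[OF _ d(1), of z] comps_sub[OF U] by blast
  have bs: "ball a d \<subseteq> interior K" using r(2)[OF a(1)] d(2)[OF a(1)] by (meson order_trans subset_ball)
  have "ball a d \<subseteq> iter f n ` U" using components_maximal[OF comps_image_iter[OF U, of n] connected_ball bs] a(2) z by blast
  then have "a \<in> iter f n ` U" using d(1) by auto
  then show ?thesis using a(1) by blast
qed

text \<open>A path in U from c to c' is eventually carried into one ball about a point of
  \<open>Acyc\<close> that contains no other postcritical point; over such a ball a connected set
  meets the fibre of the centre only once.\<close>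

lemma centre_unique:
  assumes U: "U \<in> comps" and c: "c \<in> U" "iter f n c \<in> Acyc" and c': "c' \<in> U" "iter f n' c' \<in> Acyc"
  shows "c = c'"
proof -
  have "\<exists>r>0. P \<inter> ball a r \<subseteq> {a}" for a using P_isolated[of a] by metis
  then obtain r where r: "\<And>a. r a > 0" "\<And>a. P \<inter> ball a (r a) \<subseteq> {a}" by metis
  obtain d where d: "d > 0" "\<And>a. a \<in> Acyc \<Longrightarrow> d \<le> r a"
    "\<And>a b. a \<in> Acyc \<Longrightarrow> b \<in> Acyc \<Longrightarrow> a \<noteq> b \<Longrightarrow> 2 * d \<le> dist a b" using Acyc_uniform[of r] r(1) by metis
  have "path_connected U" using comps_conn[OF U] comps_open[OF U] connected_open_path_connected by blast
  then obtain g where g: "path g" "path_image g \<subseteq> U" "pathstart g = c" "pathfinish g = c'"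
    using c(1) c'(1) unfolding path_connected_def by metis
  let ?C = "path_image g"
  have C: "compact ?C" "?C \<subseteq> interior K" "connected ?C" "c \<in> ?C" "c' \<in> ?C"
    using g comps_sub[OF U] by (auto simp: compact_path_image connected_path_image)
  obtain N0 where N0: "\<And>w n. w \<in> ?C \<Longrightarrow> n \<ge> N0 \<Longrightarrow> \<exists>a\<in>Acyc. dist (iter f n w) a < d" using trap_compact[OF C(1,2) d(1)] by metis
  \<comment> \<open>Late enough for the whole path to be trapped and for both ends to have arrived
    in \<open>Acyc\<close>.\<close>
  define N where "N = N0 + n + n'"
  have cN: "iter f N c \<in> Acyc" "iter f N c' \<in> Acyc"
  proof -
    have "iter f N c = iter f (N0 + n') (iter f n c)" "iter f N c' = iter f (N0 + n) (iter f n' c')"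
      by (simp_all add: N_def ac_simps flip: iter_add)
    then show "iter f N c \<in> Acyc" "iter f N c' \<in> Acyc" using Acyc_iter c(2) c'(2) by metis+
  qed
  define a where "a = iter f N c"
  have sub: "iter f N ` ?C \<subseteq> ball a d"
  proof (rule connected_disjoint_balls[where A = Acyc and s = a])
    show "connected (iter f N ` ?C)" using C(3) by (intro connected_continuous_image iter_cont)
    have "\<exists>a\<in>Acyc. dist (iter f N w) a < d" if "w \<in> ?C" for w using N0[OF that, of N] by (simp add: N_def)
    then show "iter f N ` ?C \<subseteq> (\<Union>a\<in>Acyc. ball a d)" by (auto simp: dist_commute)
  qed (use cN C d a_def in auto)
  have "iter f N c' = a"
  proof (rule ccontr)
    assume "iter f N c' \<noteq> a"
    then have "2 * d \<le> dist a (iter f N c')" using d(3) cN a_def by metis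
    moreover have "dist a (iter f N c') < d" using sub C(5) by auto
    ultimately show False using d(1) by simp
  qed
  moreover have "P \<inter> ball a d \<subseteq> {a}" using r(2)[of a] d(2)[of a] cN a_def subset_ball[of d "r a" a] by blast
  ultimately show ?thesis using unique_preimage_conn[OF deg_ipoly_pos P_finite, of N d a ?C c c'] crit_iter d(1) sub C a_def
    by (simp add: poly_ipoly)
qed

definition "centre U = (THE c. c \<in> U \<and> (\<exists>n. iter f n c \<in> Acyc))"

lemma centre: assumes "U \<in> comps" shows "centre U \<in> U" "\<exists>n. iter f n (centre U) \<in> Acyc"
  "c \<in> U \<Longrightarrow> iter f n c \<in> Acyc \<Longrightarrow> c = centre U"
proof -
  have "\<exists>!c. c \<in> U \<and> (\<exists>n. iter f n c \<in> Acyc)" using centre_exists[OF assms] centre_unique[OF assms] by blast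
  then have "centre U \<in> U \<and> (\<exists>n. iter f n (centre U) \<in> Acyc)" unfolding centre_def by (rule theI')
  then show "centre U \<in> U" "\<exists>n. iter f n (centre U) \<in> Acyc"
    "c \<in> U \<Longrightarrow> iter f n c \<in> Acyc \<Longrightarrow> c = centre U" using centre_unique[OF assms] by blast+
qed

lemma centre_preimage:
  assumes U: "U \<in> comps" and c: "c \<in> U" shows "iter f n c = centre (iter f n ` U) \<longleftrightarrow> c = centre U"
proof
  assume "iter f n c = centre (iter f n ` U)"
  then obtain m where "iter f m (iter f n c) \<in> Acyc" using centre(2)[OF comps_image_iter[OF U]] by metis
  then show "c = centre U" using centre(3)[OF U c] by (metis iter_add)
next
  assume "c = centre U"
  then obtain m where m: "iter f m c \<in> Acyc" using centre(2)[OF U] by metis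
  have "iter f m (iter f n c) = iter f n (iter f m c)" by (metis add.commute iter_add)
  then have "iter f m (iter f n c) \<in> Acyc" using Acyc_iter[OF m] by simp
  then show "iter f n c = centre (iter f n ` U)" using centre(3)[OF comps_image_iter[OF U]] c by blast
qed

lemma compl_K_connected: "connected (- K)"
proof -
  have unb: "\<not> bounded C" if C: "C \<in> components (- K)" for C
  proof
    assume b: "bounded C"
    have "open C" using C K_closed open_components by (metis open_Compl)
    moreover have "frontier C \<subseteq> frontier (- K)" using C frontier_of_components_subset by blast
    then have "frontier C \<subseteq> K" using K_closed by (simp add: frontier_complement frontier_subset_closed order_trans)
    ultimately have "C \<subseteq> K" using K_fill b by blast
    then show False using C in_components_subset in_components_nonempty by blast
  qed
  have "C = D" if "C \<in> components (- K)" "D \<in> components (- K)" for C D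
    using cobounded_unique_unbounded_components[of "- K" C D] unb that K_compact by (simp add: compact_imp_bounded)
  then show ?thesis by (metis connected_iff_connected_component_eq components_iff)
qed

text \<open>It suffices to join each point outside U to infinity by a connected set that avoids U:
  the complement of K, with one point of J attached if necessary, and for a point of another
  component V also the closure of V.\<close>

lemma comps_simply_connected:
  assumes U: "U \<in> comps" shows "simply_connected U"
proof -
  have unbK: "\<not> bounded (- K)" using K_compact compact_imp_bounded cobounded_imp_unbounded by (metis double_complement)
  have conJ: "connected (insert w (- K))" if "w \<in> J" for w
  proof (rule connected_intermediate_closure[OF compl_K_connected])
    have "w \<in> closure (- K)" using that by (simp add: Julia_def frontier_closures)
    then show "insert w (- K) \<subseteq> closure (- K)" by (metis closure_subset insert_subset)
  qed auto
  have "\<exists>S. connected S \<and> \<not> bounded S \<and> z \<in> S \<and> S \<subseteq> - U" if z: "z \<notin> U" for z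
  proof -
    consider "z \<notin> K" | "z \<in> J" | "z \<in> interior K" using J_eq by blast
    then show ?thesis
    proof cases
      case 1
      then show ?thesis using compl_K_connected unbK component_frontier_J(4)[OF U] by (intro exI[of _ "- K"]) auto
    next
      case 2
      have "\<not> bounded (insert z (- K))" using unbK by simp
      then show ?thesis using conJ[OF 2] component_frontier_J(4)[OF U] z by (intro exI[of _ "insert z (- K)"]) auto
    next
      case 3
      then obtain V where V: "V \<in> comps" "z \<in> V" using comp_of by blast
      then have VU: "closure V \<inter> U = {}" using comps_disjoint_closure[OF V(1) U] z by blast
      obtain w where w: "w \<in> frontier V" using component_frontier_J(2)[OF V(1)] by auto
      have wJ: "w \<in> J" using component_frontier_J(1)[OF V(1)] w by auto
      have "w \<in> closure V" using w by (simp add: frontier_def)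
      then have "connected (closure V \<union> insert w (- K))"
        using conJ[OF wJ] comps_conn[OF V(1)] by (intro connected_Un) (auto simp: connected_imp_connected_closure)
      moreover have "\<not> bounded (closure V \<union> insert w (- K))" using unbK by simp
      moreover have "insert w (- K) \<subseteq> - U" using \<open>w \<in> closure V\<close> VU component_frontier_J(4)[OF U] by auto
      moreover have "z \<in> closure V" using V(2) closure_subset by blast
      ultimately show ?thesis using VU by (intro exI[of _ "closure V \<union> insert w (- K)"]) auto
    qed
  qed
  then have "\<not> bounded C" if C: "C \<in> components (- U)" for C
  proof -
    obtain z where z: "z \<in> C" "z \<notin> U" using C in_components_nonempty in_components_subset by blast
    then obtain S where S: "connected S" "\<not> bounded S" "z \<in> S" "S \<subseteq> - U"
      using \<open>\<And>z. z \<notin> U \<Longrightarrow> \<exists>S. connected S \<and> \<not> bounded S \<and> z \<in> S \<and> S \<subseteq> - U\<close> by blast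
    then have "S \<subseteq> C" using components_maximal[OF C] z(1) by blast
    then show ?thesis using S(2) bounded_subset by blast
  qed
  then show ?thesis using simply_connected_eq_unbounded_complement_components[OF comps_open[OF U]] comps_conn[OF U] by blast
qed

end

subsection \<open>Path-connectedness of the filled Julia set\<close>

lemma path_pieces:
  fixes p :: "real \<Rightarrow> 'a::metric_space"
  assumes "\<And>i. i < N \<Longrightarrow> dist (p (real i / real N)) (p (real (Suc i) / real N)) \<le> e" "N > 0"
  shows "dist (p 0) (p 1) \<le> real N * e"
proof -
  have "i \<le> N \<Longrightarrow> dist (p 0) (p (real i / real N)) \<le> real i * e" for i
  proof (induction i)
    case (Suc i)
    have "dist (p 0) (p (real (Suc i) / real N)) \<le> dist (p 0) (p (real i / real N)) + dist (p (real i / real N)) (p (real (Suc i) / real N))"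
      by (rule dist_triangle)
    also have "\<dots> \<le> real i * e + e" using Suc assms(1)[of i] by (intro add_mono) auto
    finally show ?case by (simp add: algebra_simps)
  qed simp
  from this[of N] show ?thesis using assms(2) by simp
qed

context pcf_poly
begin

text \<open>The path is cut into N pieces whose images under the iterate stay in balls of radius d
  about points of Q.\<close>

lemma path_tracking:
  assumes sm: "\<And>x. x \<in> Q \<Longrightarrow> small n (ball x d) e" and N: "N > 0"
    and p: "continuous_on {0..1} p" "\<And>t. t \<in> {0..1} \<Longrightarrow> iter f n (p t) \<in> Q"
    and u: "\<And>t t'. t \<in> {0..1} \<Longrightarrow> t' \<in> {0..1} \<Longrightarrow> \<bar>t - t'\<bar> \<le> 1 / real N \<Longrightarrow> dist (iter f n (p t)) (iter f n (p t')) < d"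
  shows "dist (p 0) (p 1) \<le> real N * e"
proof (rule path_pieces[OF _ N])
  fix i assume i: "i < N"
  define S where "S = p ` {real i / real N .. real (Suc i) / real N}"
  have sub: "{real i / real N .. real (Suc i) / real N} \<subseteq> {0..1}" using i by (auto simp: field_simps)
  have "connected S" unfolding S_def using continuous_on_subset[OF p(1) sub] by (intro connected_continuous_image) auto
  moreover have i01: "real i / real N \<in> {0..1}" using i by auto
  have "iter f n ` S \<subseteq> ball (iter f n (p (real i / real N))) d"
  proof clarsimp
    fix s assume "s \<in> S"
    then obtain t where t: "t \<in> {real i / real N .. real (Suc i) / real N}" "s = p t" by (auto simp: S_def)
    have "real (Suc i) / real N - real i / real N = 1 / real N" using N by (simp add: field_simps)
    then have "\<bar>real i / real N - t\<bar> \<le> 1 / real N" using t(1) by (auto simp: abs_le_iff)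
    then show "dist (iter f n (p (real i / real N))) (iter f n s) < d" using u[OF i01, of t] t sub by blast
  qed
  moreover have "p (real i / real N) \<in> S" "p (real (Suc i) / real N) \<in> S" by (auto simp: S_def divide_right_mono)
  ultimately show "dist (p (real i / real N)) (p (real (Suc i) / real N)) \<le> e" using sm[OF p(2)[OF i01]] unfolding small_def by blast
qed

definition ret :: "complex \<Rightarrow> complex" where "ret w = of_real (R0 / max R0 (norm w)) * w"

lemma ret_cont: "continuous_on S ret"
  unfolding ret_def using R0(1) by (intro continuous_intros) auto

lemma ret_norm: "norm (ret w) \<le> R0"
  using R0(1) by (cases "norm w \<le> R0") (auto simp: ret_def norm_mult norm_divide max_def)

lemma ret_id: "norm w \<le> R0 \<Longrightarrow> ret w = w"
  using R0(1) by (simp add: ret_def)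

text \<open>The straight-line homotopy from the identity to \<open>ret\<close>, the radial
  retraction onto the disc of radius \<open>R0\<close>.\<close>

definition hom :: "complex \<times> real \<Rightarrow> complex" where
  "hom z = of_real (1 - snd z) * fst z + of_real (snd z) * ret (fst z)"

lemma hom_cont: "continuous_on S hom"
  unfolding hom_def by (intro continuous_intros continuous_on_compose2[OF ret_cont[of UNIV]]) auto

lemma hom_annulus:
  assumes "R0 \<le> norm w" "norm w \<le> R1" "t \<in> {0..1}"
  shows "R0 \<le> norm (hom (w, t))" "norm (hom (w, t)) \<le> R1"
proof -
  have w: "norm w > 0" using assms(1) R0(1) by linarith
  have "hom (w, t) = of_real ((1 - t) + t * (R0 / norm w)) * w" using assms(1) by (simp add: hom_def ret_def max_def algebra_simps)
  then have "norm (hom (w, t)) = ((1 - t) + t * (R0 / norm w)) * norm w"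
    using assms(3) w R0(1) by (simp only: norm_mult norm_of_real) (simp add: abs_of_nonneg)
  also have "\<dots> = (1 - t) * norm w + t * R0" using w by (simp add: algebra_simps)
  finally have eq: "norm (hom (w, t)) = (1 - t) * norm w + t * R0" .
  have "(1 - t) * R0 \<le> (1 - t) * norm w" using assms by (intro mult_left_mono) auto
  then show "R0 \<le> norm (hom (w, t))" unfolding eq by (simp add: algebra_simps)
  have "t * R0 \<le> t * norm w" using assms by (intro mult_left_mono) auto
  then have "(1 - t) * norm w + t * R0 \<le> norm w" by (simp add: algebra_simps)
  then show "norm (hom (w, t)) \<le> R1" unfolding eq using assms(2) by linarith
qed

lemma hom_speed:
  assumes "norm w \<le> R1" shows "dist (hom (w, t)) (hom (w, t')) \<le> \<bar>t - t'\<bar> * (2 * R1)"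
proof -
  have "hom (w, t) - hom (w, t') = of_real (t - t') * (ret w - w)" by (simp add: hom_def algebra_simps)
  then have "dist (hom (w, t)) (hom (w, t')) = \<bar>t - t'\<bar> * norm (ret w - w)" by (simp only: dist_norm norm_mult norm_of_real)
  also have "norm (ret w - w) \<le> 2 * R1" using norm_triangle_ineq4[of "ret w" w] ret_norm[of w] R1(1) assms by linarith
  finally show ?thesis by (simp add: mult_left_mono)
qed

definition "Kn n = iter f n -` cball 0 R1"

lemma Kn_closed: "closed (Kn n)" unfolding Kn_def by (intro closed_vimage iter_cont) auto

lemma Kn_Suc: "Kn (Suc n) \<subseteq> Kn n"
proof
  fix z assume z: "z \<in> Kn (Suc n)"
  show "z \<in> Kn n"
  proof (rule ccontr)
    assume "z \<notin> Kn n"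
    then have "norm (iter f n z) > R1" by (simp add: Kn_def)
    then have "norm (poly f (iter f n z)) \<ge> 2 * norm (iter f n z)" using R1(1) by (intro R0(2)) simp
    then show False using z \<open>norm (iter f n z) > R1\<close> R1(1) R0(1) by (simp add: Kn_def)
  qed
qed

lemma Kn_mono: "m \<le> n \<Longrightarrow> Kn n \<subseteq> Kn m"
  using decseqD[of Kn m n] Kn_Suc by (simp add: decseq_Suc_iff)

lemma K_Kn: "K \<subseteq> Kn n"
proof
  fix z assume "z \<in> K"
  then have "iter f n z \<in> ball 0 R0" using K_iter K_ball0 by blast
  then show "z \<in> Kn n" using R1(1) by (simp add: Kn_def)
qed

lemma Kn_K: "(\<And>n. z \<in> Kn n) \<Longrightarrow> z \<in> K"
  by (auto simp: Kn_def filled_Julia_def bounded_iff)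

text \<open>The radial retraction of the annulus between \<open>R0\<close> and \<open>R1\<close> is
  lifted through the n-th iterate, a covering off P. At the end of the homotopy a point of
  \<open>Kn n\<close> lies over the disc of radius \<open>R0\<close>, hence in
  \<open>Kn (Suc n)\<close>, and its track is short because \<open>expand\<close> applies to the
  annulus.\<close>

lemma retraction_step:
  obtains C q where "0 < q" "q < 1"
    "\<And>n. \<exists>\<rho>. continuous_on (Kn n) \<rho> \<and> \<rho> ` Kn n \<subseteq> Kn (Suc n) \<and> (\<forall>z\<in>K. \<rho> z = z) \<and>
       (\<forall>z\<in>Kn n. dist z (\<rho> z) \<le> C * q ^ n)"
proof -
  define Q where "Q = cball (0::complex) R1 - ball 0 R0"
  have KQ: "Q \<inter> K = {}" using K_ball0 by (auto simp: Q_def)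
  have Q: "compact Q" "Q \<subseteq> ball 0 R - Acyc"
  proof -
    show "compact Q" unfolding Q_def by (intro compact_diff) auto
    show "Q \<subseteq> ball 0 R - Acyc" using KQ Acyc_P P_K by (auto simp: Q_def R_def)
  qed
  have QP: "Q \<subseteq> - P" using KQ P_K by blast
  obtain d q C where ex: "0 < d" "0 < q" "q < 1" "0 < C" "\<And>x n. x \<in> Q \<Longrightarrow> small n (ball x d) (C * q ^ n)" using expand[OF Q] by metis
  have R1pos: "R1 > 0" using R1(1) R0(1) by simp
  \<comment> \<open>In the annulus \<open>hom\<close> moves points at speed at most 2
    \<open>R1\<close>, so a piece of duration 1 / N stays in a ball of radius d.\<close>
  define N where "N = Suc (nat \<lceil>2 * R1 / d\<rceil>)"
  have N: "N > 0" "2 * R1 / real N < d"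
  proof -
    have "2 * R1 / d < real N" unfolding N_def by linarith
    then show "2 * R1 / real N < d" using ex(1) by (simp add: N_def field_simps)
  qed (simp add: N_def)
  have "\<exists>\<rho>. continuous_on (Kn n) \<rho> \<and> \<rho> ` Kn n \<subseteq> Kn (Suc n) \<and> (\<forall>z\<in>K. \<rho> z = z) \<and>
       (\<forall>z\<in>Kn n. dist z (\<rho> z) \<le> (real N * C) * q ^ n)" for n
  proof -
    define Y where "Y = iter f n -` Q"
    define C' where "C' = - (iter f n -` P)"
    have cov: "covering_space C' (iter f n) (- P)"
      using poly_covering_space[OF deg_ipoly_pos P_finite, of n] crit_iter unfolding poly_ipoly C'_def by blast
    have homQ: "hom (iter f n y, t) \<in> Q" if "y \<in> Y" "t \<in> {0..1}" for y t
      using hom_annulus[of "iter f n y" t] that by (auto simp: Y_def Q_def)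
    define H where "H z = hom (iter f n (fst z), snd z)" for z :: "complex \<times> real"
    have H: "continuous_on (Y \<times> {0..1}) H" unfolding H_def
      by (intro continuous_on_compose2[OF hom_cont[of UNIV]] continuous_intros continuous_on_compose2[OF iter_cont[of UNIV n]]) auto
    have H2: "H \<in> Y \<times> {0..1} \<rightarrow> - P"
    proof
      fix z assume "z \<in> Y \<times> {0..1::real}"
      then have "hom (iter f n (fst z), snd z) \<in> Q" by (intro homQ) auto
      then show "H z \<in> - P" using QP unfolding H_def by blast
    qed
    have H3: "H (y, 0) = iter f n (id y)" for y by (simp add: H_def hom_def)
    have idc: "continuous_on Y id" by (simp add: id_def)
    have YC: "id \<in> Y \<rightarrow> C'" using QP by (auto simp: Y_def C'_def)
    obtain k where k: "continuous_on (Y \<times> {0..1}) k" "k \<in> Y \<times> {0..1} \<rightarrow> C'"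
      "\<And>y. y \<in> Y \<Longrightarrow> k (y, 0) = id y" "\<And>z. z \<in> Y \<times> {0..1} \<Longrightarrow> H z = iter f n (k z)"
      using covering_space_lift_homotopy_alt[OF cov H H2 H3 idc YC] by blast
    have ky: "continuous_on {0..1} (\<lambda>t. k (y, t))" if "y \<in> Y" for y
      using that by (intro continuous_on_compose2[OF k(1)] continuous_intros) auto
    \<comment> \<open>Over the inner circle the homotopy is constant, so its lift does not move;
      this glues the lifted map continuously to the identity.\<close>
    have const: "k (y, 1) = y" if y: "y \<in> Y" "norm (iter f n y) = R0" for y
    proof -
      have Hc: "H (y, t) = iter f n y" for t using y(2) by (simp add: H_def hom_def ret_id algebra_simps)
      have "(\<lambda>t. k (y, t)) (1::real) = (\<lambda>t. y) (1::real)"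
      proof (rule covering_space_lift_unique[OF cov, of "\<lambda>t. k (y, t)" 0 "\<lambda>t. y" "{0..1::real}" "\<lambda>t. iter f n y" 1])
        show "(\<lambda>t. k (y, t)) \<in> {0..1} \<rightarrow> C'" using k(2) y(1) by auto
        show "iter f n y = iter f n (k (y, t))" if "t \<in> {0..1}" for t using k(4)[of "(y, t)"] Hc y(1) that by simp
      qed (use ky[OF y(1)] k(3)[OF y(1)] y YC QP in \<open>auto simp: Y_def\<close>)
      then show ?thesis by simp
    qed
    define \<rho> where "\<rho> z = (if z \<in> iter f n -` cball 0 R0 then z else k (z, 1))" for z
    define A where "A = iter f n -` cball 0 R0"
    have KA: "Kn n = A \<union> Y" using R1(1) by (auto simp: Kn_def A_def Y_def Q_def)
    have cl: "closed A" "closed Y" unfolding A_def Y_def by (intro closed_vimage iter_cont compact_imp_closed[OF Q(1)] closed_cball)+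
    have ov: "k (z, 1) = z" if "z \<in> A" "z \<in> Y" for z using that by (intro const) (auto simp: A_def Y_def Q_def)
    have "continuous_on (A \<union> Y) \<rho>" unfolding \<rho>_def
    proof (rule continuous_on_cases[OF cl])
      show "continuous_on Y (\<lambda>z. k (z, 1))" by (intro continuous_on_compose2[OF k(1)] continuous_intros) auto
    qed (use ov in \<open>auto simp: A_def\<close>)
    moreover have "\<rho> ` Kn n \<subseteq> Kn (Suc n)"
    proof clarify
      fix z assume z: "z \<in> Kn n"
      have "iter f n (\<rho> z) \<in> cball 0 R0"
      proof (cases "z \<in> A")
        case True then show ?thesis by (simp add: \<rho>_def A_def)
      next
        case False
        then have zY: "z \<in> Y" using z KA by blast
        have "iter f n (k (z, 1)) = hom (iter f n z, 1)" using k(4)[of "(z, 1)"] zY by (simp add: H_def)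
        then show ?thesis using False ret_norm by (simp add: \<rho>_def A_def hom_def)
      qed
      then show "\<rho> z \<in> Kn (Suc n)" using R1(2) by (simp add: Kn_def)
    qed
    moreover have "\<rho> z = z" if "z \<in> K" for z

    proof -
      have "iter f n z \<in> ball 0 R0" using that K_iter K_ball0 by blast
      then show ?thesis by (simp add: \<rho>_def)
    qed
    moreover have "dist z (\<rho> z) \<le> (real N * C) * q ^ n" if z: "z \<in> Kn n" for z
    proof (cases "z \<in> A")
      case True then show ?thesis using ex by (simp add: \<rho>_def A_def)
    next
      case False
      then have zY: "z \<in> Y" using z KA by blast
      have it: "iter f n (k (z, t)) = hom (iter f n z, t)" if "t \<in> {0..1}" for t using k(4)[of "(z, t)"] zY that by (simp add: H_def)
      have "dist (k (z, 0)) (k (z, 1)) \<le> real N * (C * q ^ n)"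
      proof (rule path_tracking[OF ex(5) N(1) ky[OF zY]])
        show "iter f n (k (z, t)) \<in> Q" if "t \<in> {0..1}" for t using it[OF that] homQ[OF zY that] by simp
        show "dist (iter f n (k (z, t))) (iter f n (k (z, t'))) < d"
          if "t \<in> {0..1}" "t' \<in> {0..1}" "\<bar>t - t'\<bar> \<le> 1 / real N" for t t'
        proof -
          have "dist (hom (iter f n z, t)) (hom (iter f n z, t')) \<le> \<bar>t - t'\<bar> * (2 * R1)"
            using zY by (intro hom_speed) (auto simp: Y_def Q_def)
          also have "\<dots> \<le> 1 / real N * (2 * R1)" using that(3) R1pos by (intro mult_right_mono) auto
          finally show ?thesis using N(2) it that(1,2) by simp
        qed
      qed auto
      then show ?thesis using False k(3)[OF zY] by (simp add: \<rho>_def A_def mult.assoc)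
    qed
    ultimately show ?thesis using KA by metis
  qed
  then show ?thesis using that ex(2,3) by metis
qed

text \<open>The displacements of the retractions are summable, so their compositions converge
  uniformly, to a continuous map of the disc \<open>Kn 0\<close> onto K that fixes K.\<close>

theorem K_path_connected: "path_connected K"
proof -
  obtain C q where q: "0 < q" "q < 1" and "\<forall>n. \<exists>\<rho>. continuous_on (Kn n) \<rho> \<and> \<rho> ` Kn n \<subseteq> Kn (Suc n) \<and> (\<forall>z\<in>K. \<rho> z = z) \<and>
       (\<forall>z\<in>Kn n. dist z (\<rho> z) \<le> C * q ^ n)" using retraction_step by metis
  then obtain \<rho> where \<rho>: "\<And>n. continuous_on (Kn n) (\<rho> n)" "\<And>n. \<rho> n ` Kn n \<subseteq> Kn (Suc n)"
    "\<And>n z. z \<in> K \<Longrightarrow> \<rho> n z = z" "\<And>n z. z \<in> Kn n \<Longrightarrow> dist z (\<rho> n z) \<le> C * q ^ n" by metis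
  define r where "r = rec_nat id (\<lambda>n g. \<rho> n \<circ> g)"
  have r0: "r 0 = id" and rS: "r (Suc n) = \<rho> n \<circ> r n" for n by (auto simp: r_def)
  have rK: "r n ` Kn 0 \<subseteq> Kn n" for n by (induction n) (use \<rho>(2) in \<open>auto simp: r0 rS image_comp[symmetric]\<close>)
  have rc: "continuous_on (Kn 0) (r n)" for n
  proof (induction n)
    case (Suc n)
    show ?case unfolding rS using rK by (intro continuous_on_compose Suc continuous_on_subset[OF \<rho>(1)])
  qed (simp add: r0 continuous_on_id)
  have rid: "r n z = z" if "z \<in> K" for n z by (induction n) (use \<rho>(3) that in \<open>auto simp: r0 rS\<close>)
  have "uniformly_convergent_on (Kn 0) (\<lambda>n z. z + (\<Sum>i<n. r (Suc i) z - r i z))"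
  proof (rule uniformly_convergent_add[OF uniformly_convergent_on_const])
    show "uniformly_convergent_on (Kn 0) (\<lambda>n z. \<Sum>i<n. r (Suc i) z - r i z)"
    proof (rule Weierstrass_m_test'[of "Kn 0" "\<lambda>n z. r (Suc n) z - r n z" "\<lambda>n. C * q ^ n"])
      show "norm (r (Suc n) z - r n z) \<le> C * q ^ n" if "z \<in> Kn 0" for n z
        using \<rho>(4)[of "r n z" n] rK[of n] that by (auto simp: rS dist_norm norm_minus_commute)
      show "summable (\<lambda>n. C * q ^ n)" using q by (intro summable_mult summable_geometric) auto
    qed
  qed
  moreover have "z + (\<Sum>i<n. r (Suc i) z - r i z) = r n z" for n z using sum_lessThan_telescope[of "\<lambda>n. r n z" n] by (simp add: r0)
  ultimately obtain g where g: "uniform_limit (Kn 0) r g sequentially" by (auto simp: uniformly_convergent_on_def)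
  have gc: "continuous_on (Kn 0) g" by (rule uniform_limit_theorem[OF _ g]) (use rc in auto)
  have lim: "(\<lambda>n. r n z) \<longlonglongrightarrow> g z" if "z \<in> Kn 0" for z using tendsto_uniform_limitI[OF g that] .
  have "g z \<in> K" if z: "z \<in> Kn 0" for z
  proof (rule Kn_K)
    fix m
    have a: "(\<lambda>n. r (n + m) z) \<longlonglongrightarrow> g z" using lim[OF z] by (rule LIMSEQ_ignore_initial_segment)
    have b: "r (n + m) z \<in> Kn m" for n using rK[of "n + m"] Kn_mono[of m "n + m"] z by auto
    show "g z \<in> Kn m" by (rule closed_sequentially[OF Kn_closed b a])
  qed
  moreover have "g z = z" if "z \<in> K" for z using lim[of z] that K_Kn rid LIMSEQ_unique[of "\<lambda>n. r n z" "g z" z] by auto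
  ultimately have "K = g ` Kn 0" using K_Kn[of 0] by force
  moreover have "Kn 0 = cball 0 R1" by (simp add: Kn_def)
  ultimately show ?thesis using gc path_connected_continuous_image convex_imp_path_connected[OF convex_cball] by metis
qed

end

subsection \<open>Hulls of finite sets in uniquely arcwise connected spaces\<close>

lemma compact_last:
  fixes g :: "real \<Rightarrow> 'a::t2_space"
  assumes "continuous_on {0..1} g" "closed C" "0 \<le> t" "t \<le> 1" "g 0 \<in> C"
  obtains a where "0 \<le> a" "a \<le> t" "g a \<in> C" "\<And>s. a < s \<Longrightarrow> s \<le> t \<Longrightarrow> g s \<notin> C"
proof -
  have "continuous_on {0..t} g" using assms by (intro continuous_on_subset[OF assms(1)]) auto
  then have "closed ({0..t} \<inter> g -` C)" using assms(2) by (intro continuous_closed_preimage) auto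
  then have "compact ({0..t} \<inter> ({0..t} \<inter> g -` C))" by (intro compact_Int_closed) auto
  moreover have "{0..t} \<inter> g -` C \<noteq> {}" using assms by force
  ultimately obtain a where a: "a \<in> {0..t} \<inter> g -` C" "\<And>s. s \<in> {0..t} \<inter> g -` C \<Longrightarrow> s \<le> a"
    using compact_attains_sup[of "{0..t} \<inter> g -` C"] by (metis Int_left_absorb)
  have "g s \<notin> C" if "a < s" "s \<le> t" for s using a(2)[of s] a(1) that by force
  then show ?thesis using that[of a] a(1) by auto
qed

lemma compact_first:
  fixes g :: "real \<Rightarrow> 'a::t2_space"
  assumes "continuous_on {0..1} g" "closed C" "0 \<le> t" "t \<le> 1" "g 1 \<in> C"
  obtains a where "t \<le> a" "a \<le> 1" "g a \<in> C" "\<And>s. t \<le> s \<Longrightarrow> s < a \<Longrightarrow> g s \<notin> C"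
proof -
  have "continuous_on {t..1} g" using assms by (intro continuous_on_subset[OF assms(1)]) auto
  then have "closed ({t..1} \<inter> g -` C)" using assms(2) by (intro continuous_closed_preimage) auto
  then have "compact ({t..1} \<inter> ({t..1} \<inter> g -` C))" by (intro compact_Int_closed) auto
  moreover have "{t..1} \<inter> g -` C \<noteq> {}" using assms by force
  ultimately obtain a where a: "a \<in> {t..1} \<inter> g -` C" "\<And>s. s \<in> {t..1} \<inter> g -` C \<Longrightarrow> a \<le> s"
    using compact_attains_inf[of "{t..1} \<inter> g -` C"] by (metis Int_left_absorb)
  have "g s \<notin> C" if "t \<le> s" "s < a" for s using a(2)[of s] a(1) that by force
  then show ?thesis using that[of a] a(1) by auto
qed

text \<open>The maximal interval around t on which g is off h has its ends on h; the part of h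
  between these two points closes it to a simple loop.\<close>

lemma arc_loop_of_deviation:
  fixes g h :: "real \<Rightarrow> 'a::real_normed_vector"
  assumes g: "arc g" and h: "arc h" and ends: "pathstart g \<in> path_image h" "pathfinish g \<in> path_image h"
    and t: "t \<in> {0..1}" "g t \<notin> path_image h"
  obtains k l where "arc k" "arc l" "pathfinish k = pathstart l" "pathfinish l = pathstart k"
    "path_image k \<subseteq> path_image g" "path_image l \<subseteq> path_image h" "g t \<in> path_image k"
    "path_image k \<inter> path_image l = {pathstart k, pathfinish k}"
    "simple_path (k +++ l)" "pathfinish (k +++ l) = pathstart (k +++ l)"
proof -
  have cg: "continuous_on {0..1} g" using g arc_imp_path path_def by blast
  have cl: "closed (path_image h)" using h arc_imp_path closed_path_image by blast
  obtain a where a: "0 \<le> a" "a \<le> t" "g a \<in> path_image h" "\<And>s. a < s \<Longrightarrow> s \<le> t \<Longrightarrow> g s \<notin> path_image h"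
    using compact_last[OF cg cl, of t] t ends by (auto simp: pathstart_def)
  obtain b where b: "t \<le> b" "b \<le> 1" "g b \<in> path_image h" "\<And>s. t \<le> s \<Longrightarrow> s < b \<Longrightarrow> g s \<notin> path_image h"
    using compact_first[OF cg cl, of t] t ends by (auto simp: pathfinish_def)
  have ab: "a < t" "t < b" using a b t by (metis less_le)+
  obtain c d where c: "c \<in> {0..1}" "h c = g a" and d: "d \<in> {0..1}" "h d = g b"
    using a(3) b(3) unfolding path_image_def by (metis imageE)
  have inj: "inj_on g {0..1}" using g by (simp add: arc_def)
  have "a \<in> {0..1}" "b \<in> {0..1}" "a \<noteq> b" using ab a(1) b(2) t(1) by auto
  then have gab: "g a \<noteq> g b" using inj_onD[OF inj] by blast
  define k where "k = subpath a b g"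
  define l where "l = subpath d c h"
  have k: "arc k" unfolding k_def using g ab a b t by (intro arc_subpath_arc) auto
  have l: "arc l" unfolding l_def using h c d gab by (intro arc_subpath_arc) auto
  have kim: "path_image k = g ` {a..b}" unfolding k_def using ab by (simp add: path_image_subpath)
  have lim: "path_image l \<subseteq> path_image h" unfolding l_def using c d by (intro path_image_subpath_subset) auto
  have "g s \<in> path_image h \<Longrightarrow> s = a \<or> s = b" if "s \<in> {a..b}" for s using a(4)[of s] b(4)[of s] that by force
  then have "path_image k \<inter> path_image h \<subseteq> {g a, g b}" unfolding kim by blast
  moreover have "{g a, g b} \<subseteq> path_image l" using pathstart_in_path_image[of l] pathfinish_in_path_image[of l] c d by (simp add: l_def)
  moreover have "{g a, g b} \<subseteq> path_image k" using ab by (auto simp: kim)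
  ultimately have kl: "path_image k \<inter> path_image l = {pathstart k, pathfinish k}" using lim by (auto simp: k_def)
  have st: "pathfinish k = pathstart l" "pathfinish l = pathstart k" by (auto simp: k_def l_def c d)
  have "simple_path (k +++ l)" by (rule simple_path_join_loop[OF k l]) (use st kl in auto)
  moreover have "path_image k \<subseteq> path_image g" unfolding kim unfolding path_image_def using a b by (intro image_mono) auto
  moreover have "g t \<in> path_image k" using ab by (auto simp: kim)
  ultimately show ?thesis using that[OF k l st] lim kl st by simp
qed

text \<open>The source of unique arcs: any two points are joined by a good arc, and good sets
  contain no simple closed curve. Closure under finite unions is what makes two different good arcs
  with the same ends produce a good loop.\<close>

locale arc_space =
  fixes X :: "complex set" and good :: "complex set \<Rightarrow> bool"
  assumes good_sub: "good S \<Longrightarrow> T \<subseteq> S \<Longrightarrow> good T"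
    and good_Un: "good S \<Longrightarrow> good T \<Longrightarrow> good (S \<union> T)"
    and good_sing: "x \<in> X \<Longrightarrow> good {x}"
    and good_X: "good S \<Longrightarrow> S \<subseteq> X"
    and noloop: "good (path_image g) \<Longrightarrow> simple_path g \<Longrightarrow> pathfinish g \<noteq> pathstart g"
    and arc_ex: "x \<in> X \<Longrightarrow> y \<in> X \<Longrightarrow> x \<noteq> y \<Longrightarrow>
      \<exists>g. arc g \<and> pathstart g = x \<and> pathfinish g = y \<and> good (path_image g)"
begin

lemma arc_sub:
  assumes "arc g" "arc h" "good (path_image g)" "good (path_image h)"
    "pathstart g \<in> path_image h" "pathfinish g \<in> path_image h"
  shows "path_image g \<subseteq> path_image h"
proof (rule ccontr)
  assume "\<not> path_image g \<subseteq> path_image h"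
  then obtain t where t: "t \<in> {0..1}" "g t \<notin> path_image h" unfolding path_image_def[of g] by blast
  obtain k l where kl: "path_image k \<subseteq> path_image g" "path_image l \<subseteq> path_image h"
    "simple_path (k +++ l)" "pathfinish (k +++ l) = pathstart (k +++ l)" using arc_loop_of_deviation[OF assms(1,2,5,6) t] by metis
  have "path_image (k +++ l) \<subseteq> path_image g \<union> path_image h" using kl(1,2) path_image_join_subset[of k l] by blast
  then have "good (path_image (k +++ l))" using good_sub[OF good_Un[OF assms(3,4)]] by blast
  then show False using noloop kl(3,4) by blast
qed

definition "sarc x y = (SOME g. arc g \<and> pathstart g = x \<and> pathfinish g = y \<and> good (path_image g))"
definition "seg x y = (if x = y then {x} else path_image (sarc x y))"

lemma sarc:
  assumes "x \<in> X" "y \<in> X" "x \<noteq> y"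
  shows "arc (sarc x y)" "pathstart (sarc x y) = x" "pathfinish (sarc x y) = y" "good (path_image (sarc x y))"
    "path_image (sarc x y) = seg x y"
  using someI_ex[OF arc_ex[OF assms]] assms(3) unfolding sarc_def[symmetric] by (auto simp: seg_def)

lemma seg_refl [simp]: "seg x x = {x}" by (simp add: seg_def)

lemma seg_arc:
  assumes "arc g" "good (path_image g)" "pathstart g = x" "pathfinish g = y"
  shows "path_image g = seg x y" "x \<noteq> y" "x \<in> X" "y \<in> X"
proof -
  show xy: "x \<in> X" "y \<in> X" using good_X[OF assms(2)] assms(3,4) pathstart_in_path_image pathfinish_in_path_image by blast+
  show ne: "x \<noteq> y" using assms arc_distinct_ends by blast
  note s = sarc[OF xy ne]
  show "path_image g = seg x y" unfolding s(5)[symmetric]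
    using arc_sub[OF assms(1) s(1) assms(2) s(4)] arc_sub[OF s(1) assms(1) s(4) assms(2)] s assms
      pathstart_in_path_image pathfinish_in_path_image by (metis subset_antisym)
qed

lemma seg_good: "x \<in> X \<Longrightarrow> y \<in> X \<Longrightarrow> good (seg x y)"
  using sarc(4,5)[of x y] good_sing[of x] by (cases "x = y") auto

lemma seg_X: "x \<in> X \<Longrightarrow> y \<in> X \<Longrightarrow> seg x y \<subseteq> X" using seg_good good_X by blast

lemma seg_ends: "x \<in> X \<Longrightarrow> y \<in> X \<Longrightarrow> x \<in> seg x y \<and> y \<in> seg x y"
  using sarc(2,3,5)[of x y] pathstart_in_path_image[of "sarc x y"] pathfinish_in_path_image[of "sarc x y"]
  by (cases "x = y") auto

lemma seg_compact: "x \<in> X \<Longrightarrow> y \<in> X \<Longrightarrow> compact (seg x y)"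
  using sarc(1,5)[of x y] by (cases "x = y") (auto dest: arc_imp_path simp flip: sarc(5) intro: compact_path_image)

lemma seg_connected: "x \<in> X \<Longrightarrow> y \<in> X \<Longrightarrow> connected (seg x y)"
  using sarc(1,5)[of x y] by (cases "x = y") (auto dest: arc_imp_path simp flip: sarc(5) intro: connected_path_image)

lemma seg_sym: "x \<in> X \<Longrightarrow> y \<in> X \<Longrightarrow> seg x y = seg y x"
proof (cases "x = y")
  case False
  assume X: "x \<in> X" "y \<in> X"
  note s = sarc[OF X False]
  show ?thesis using seg_arc(1)[of "reversepath (sarc x y)" y x] s by (simp add: arc_reversepath)
qed auto

lemma seg_split:
  assumes X: "x \<in> X" "y \<in> X" and z: "z \<in> seg x y"
  shows "seg x y = seg x z \<union> seg z y" "seg x z \<inter> seg z y = {z}" "seg x z \<subseteq> seg x y" "seg z y \<subseteq> seg x y"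
proof -
  have "seg x y = seg x z \<union> seg z y \<and> seg x z \<inter> seg z y = {z}"
  proof (cases "x = y \<or> z = x \<or> z = y")
    case True
    then show ?thesis using z seg_ends[OF X] by auto
  next
    case False
    note s = sarc[OF X]
    let ?g = "sarc x y"
    have g: "arc ?g" "pathstart ?g = x" "pathfinish ?g = y" "good (path_image ?g)" "path_image ?g = seg x y" using s False by auto
    obtain t where t: "t \<in> {0..1}" "?g t = z" using z g(5) by (force simp: path_image_def)
    have inj: "inj_on ?g {0..1}" using g(1) by (simp add: arc_def)
    have g01: "?g 0 = x" "?g 1 = y" using g(2,3) by (auto simp: pathstart_def pathfinish_def)
    have t01: "0 < t" "t < 1" using t g01 False by (auto simp: less_le)
    have a1: "arc (subpath 0 t ?g)" "arc (subpath t 1 ?g)" using g(1) g01 t False by (auto intro!: arc_subpath_arc)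
    have im: "path_image (subpath 0 t ?g) = ?g ` {0..t}" "path_image (subpath t 1 ?g) = ?g ` {t..1}"
      using t01 by (auto simp: path_image_subpath)
    have sub: "?g ` {0..t} \<subseteq> path_image ?g" "?g ` {t..1} \<subseteq> path_image ?g" using t01 by (auto simp: path_image_def)
    have e1: "?g ` {0..t} = seg x z" using seg_arc(1)[OF a1(1), of x z] good_sub[OF g(4)] sub(1) im(1) g01 t(2) by simp
    have e2: "?g ` {t..1} = seg z y" using seg_arc(1)[OF a1(2), of z y] good_sub[OF g(4)] sub(2) im(2) g01 t(2) by simp
    have "{0..1} = {0..t} \<union> {t..1}" using t01 by auto
    then have "seg x y = seg x z \<union> seg z y" unfolding e1[symmetric] e2[symmetric] g(5)[symmetric] path_image_def by auto
    moreover have "seg x z \<inter> seg z y \<subseteq> {z}"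
      unfolding e1[symmetric] e2[symmetric] using inj t t01 by (auto simp: inj_on_def) (metis atLeastAtMost_iff order_antisym order_trans less_imp_le)
    moreover have "z \<in> seg x z" "z \<in> seg z y" unfolding e1[symmetric] e2[symmetric] using t t01 by force+
    ultimately show ?thesis by auto
  qed
  then show "seg x y = seg x z \<union> seg z y" "seg x z \<inter> seg z y = {z}" "seg x z \<subseteq> seg x y" "seg z y \<subseteq> seg x y" by blast+
qed

lemma seg_cut:
  assumes "x \<in> X" "y \<in> X" "z \<in> seg x y" "w \<in> seg x z" "w \<in> seg z y" shows "w = z"
proof -
  have "w \<in> seg x z \<inter> seg z y" using assms(4,5) by simp
  then show ?thesis unfolding seg_split(2)[OF assms(1-3)] by simp
qed

lemma seg_path_sub:
  assumes "path g" "good (path_image g)" "pathstart g = x" "pathfinish g = y"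
  shows "seg x y \<subseteq> path_image g"
proof (cases "x = y")
  case True then show ?thesis using assms pathstart_in_path_image by auto
next
  case False
  then obtain q where q: "arc q" "path_image q \<subseteq> path_image g" "pathstart q = x" "pathfinish q = y"
    using path_contains_arc[OF assms(1,3,4)] by metis
  then show ?thesis using seg_arc(1)[OF q(1) good_sub[OF assms(2) q(2)] q(3,4)] by simp
qed

lemma seg_tri:
  assumes "x \<in> X" "y \<in> X" "z \<in> X" shows "seg x y \<subseteq> seg x z \<union> seg z y"
proof (cases "x = z \<or> z = y")
  case False
  then have xz: "x \<noteq> z" and zy: "z \<noteq> y" by auto
  note a = sarc[OF assms(1,3) xz] and b = sarc[OF assms(3,2) zy]
  have im: "path_image (sarc x z +++ sarc z y) = seg x z \<union> seg z y" using a b by (simp add: path_image_join)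
  have "seg x y \<subseteq> path_image (sarc x z +++ sarc z y)"
    using a b by (intro seg_path_sub) (auto simp: path_image_join arc_imp_path intro: good_Un)
  then show ?thesis using im by simp
qed (use seg_ends assms in auto)

lemma seg_join:
  assumes "x \<in> X" "y \<in> X" "z \<in> X" "seg x z \<inter> seg z y \<subseteq> {z}"
  shows "seg x y = seg x z \<union> seg z y" "z \<in> seg x y"
proof -
  have "seg x y = seg x z \<union> seg z y"
  proof (cases "x = z \<or> z = y")
    case False
    then have xz: "x \<noteq> z" and zy: "z \<noteq> y" by auto
    note a = sarc[OF assms(1,3) xz] and b = sarc[OF assms(3,2) zy]
    have im: "path_image (sarc x z +++ sarc z y) = seg x z \<union> seg z y" using a b by (simp add: path_image_join)
    have "arc (sarc x z +++ sarc z y)" using a b assms(4) by (intro arc_join) auto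
    then show ?thesis using seg_arc(1)[of "sarc x z +++ sarc z y" x y] a b im good_Un[OF a(4) b(4)] by simp
  qed (use seg_ends assms in auto)
  then show "seg x y = seg x z \<union> seg z y" "z \<in> seg x y" using seg_ends assms by auto
qed

text \<open>w is the last point of the arc from x to y on the arc from x to z; there the arcs to y
  and z part.\<close>

lemma seg_meet:
  assumes X: "x \<in> X" "y \<in> X" "z \<in> X"
  obtains w where "w \<in> X" "seg x y \<inter> seg x z = seg x w" "w \<in> seg x y" "w \<in> seg x z"
    "w \<in> seg y z" "seg w y \<inter> seg w z = {w}"
proof -
  have "\<exists>w. w \<in> seg x y \<and> w \<in> seg x z \<and> (seg w y \<inter> seg w z = {w})"
  proof (cases "x = y")
    case True then show ?thesis using seg_ends X by (intro exI[of _ x]) auto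
  next
    case False
    note s = sarc[OF X(1,2) False]
    let ?g = "sarc x y"
    have cont: "continuous_on {0..1} ?g" using s(1) arc_imp_path path_def by blast
    have cl: "closed (seg x z)" using seg_compact X compact_imp_closed by blast
    obtain a where a: "0 \<le> a" "a \<le> 1" "?g a \<in> seg x z" "\<And>s. a < s \<Longrightarrow> s \<le> 1 \<Longrightarrow> ?g s \<notin> seg x z"
      using compact_last[OF cont cl, of 1] s(2) seg_ends X by (auto simp: pathstart_def)
    let ?w = "?g a"
    have wy: "?w \<in> seg x y" using a(1,2) s(5) by (force simp: path_image_def)
    have wX: "?w \<in> X" using wy seg_X X by blast
    have "path_image (subpath a 1 ?g) = seg ?w y" if "a < 1"
    proof -
      have "arc (subpath a 1 ?g)" using s(1) a(1) that by (intro arc_subpath_arc) (auto simp: arc_def inj_on_def)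
      moreover have "path_image (subpath a 1 ?g) \<subseteq> path_image ?g" using a by (intro path_image_subpath_subset) auto
      moreover have "pathfinish (subpath a 1 ?g) = y" using s(3) by (simp add: pathfinish_def[of ?g])
      ultimately show ?thesis by (intro seg_arc good_sub[OF s(4)]) auto
    qed
    moreover have "seg ?w y = {?w}" if "\<not> a < 1" using that a(2) s(3) by (simp add: pathfinish_def)
    ultimately have im: "seg ?w y = ?g ` {a..1}" using a(2) by (cases "a < 1") (auto simp: path_image_subpath)
    have "seg ?w z \<subseteq> seg x z" using seg_split(4)[OF X(1,3) a(3)] .
    then have "seg ?w y \<inter> seg ?w z \<subseteq> {?w}" unfolding im using a(4) by force
    then show ?thesis using wy a(3) seg_ends[OF wX X(2)] seg_ends[OF wX X(3)] by (intro exI[of _ ?w]) auto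
  qed
  then obtain w where w: "w \<in> seg x y" "w \<in> seg x z" "seg w y \<inter> seg w z = {w}" by auto
  have wX: "w \<in> X" using w(1) seg_X X by blast
  have "seg x y \<inter> seg x z = seg x w" using seg_split(1)[OF X(1,2) w(1)] seg_split(1)[OF X(1,3) w(2)] w(3)
      seg_split(2)[OF X(1,2) w(1)] seg_split(2)[OF X(1,3) w(2)] by auto
  moreover have "w \<in> seg y z" using seg_join(2)[OF X(2,3) wX] w(3) seg_sym[OF X(2) wX] by simp
  ultimately show ?thesis using that w wX by blast
qed

lemma seg_open_connected:
  assumes X: "x \<in> X" "y \<in> X"
  shows "connected (seg x y - {x, y})" "x \<noteq> y \<Longrightarrow> seg x y - {x, y} \<noteq> {}" "x \<noteq> y \<Longrightarrow> closure (seg x y - {x, y}) = seg x y"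
    "connected (seg x y - {x})"
proof -
  have "connected (seg x y - {x, y}) \<and> connected (seg x y - {x}) \<and> (x \<noteq> y \<longrightarrow> seg x y - {x, y} \<noteq> {} \<and> closure (seg x y - {x, y}) = seg x y)"
  proof (cases "x = y")
    case False
    note s = sarc[OF X False]
    let ?g = "sarc x y"
    have cont: "continuous_on {0..1} ?g" using s(1) arc_imp_path path_def by blast
    have inj: "inj_on ?g {0..1}" using s(1) by (simp add: arc_def)
    have g01: "?g 0 = x" "?g 1 = y" using s by (auto simp: pathstart_def pathfinish_def)
    have "{0<..<1} = {0..1} - {0, 1::real}" "{0<..1} = {0..1} - {0::real}" by auto
    then have im: "seg x y - {x, y} = ?g ` {0<..<1}" "seg x y - {x} = ?g ` {0<..1}"
      using inj g01 unfolding s(5)[symmetric] path_image_def by (auto simp: inj_on_def image_iff)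
    have c: "connected (?g ` {0<..<1})" "connected (?g ` {0<..1})"
      by (rule connected_continuous_image, auto intro!: continuous_on_subset[OF cont])+
    have "?g ` closure {0<..<1} \<subseteq> closure (?g ` {0<..<1})"
      by (intro image_closure_subset closed_closure closure_subset) (use cont in simp)
    then have "seg x y \<subseteq> closure (seg x y - {x, y})" unfolding im using s(5) by (simp add: path_image_def)
    moreover have "closure (seg x y - {x, y}) \<subseteq> seg x y"
      using seg_compact[OF X] by (intro closure_minimal) (auto intro: compact_imp_closed)
    moreover have "?g ` {0<..<1} \<noteq> {}" by (simp add: greaterThanLessThan_empty_iff)
    ultimately have "closure (seg x y - {x, y}) = seg x y" "seg x y - {x, y} \<noteq> {}" using im by blast+
    then show ?thesis using c im by metis
  qed auto
  then show "connected (seg x y - {x, y})" "x \<noteq> y \<Longrightarrow> seg x y - {x, y} \<noteq> {}" "x \<noteq> y \<Longrightarrow> closure (seg x y - {x, y}) = seg x y"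
    "connected (seg x y - {x})" by auto
qed

definition "hull_of Q = (\<Union>p\<in>Q. \<Union>q\<in>Q. seg p q)"

definition "convx C \<longleftrightarrow> C \<subseteq> X \<and> (\<forall>x\<in>C. \<forall>y\<in>C. seg x y \<subseteq> C)"

text \<open>Edges in terms of segments alone; \<open>edges_components\<close> and
  \<open>preimage_edges_eq\<close> identify them with the edges of the Hubbard tree and of its
  preimages.\<close>

definition "Ed V = {seg u v | u v. u \<in> V \<and> v \<in> V \<and> u \<noteq> v \<and> seg u v \<inter> V = {u, v}}"

lemma good_finite_UN: "finite I \<Longrightarrow> I \<noteq> {} \<Longrightarrow> (\<And>i. i \<in> I \<Longrightarrow> good (A i)) \<Longrightarrow> good (\<Union>i\<in>I. A i)"
  by (induction I rule: finite_ne_induct) (auto intro: good_Un)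

lemma seg_sub_hull: "p \<in> Q \<Longrightarrow> q \<in> Q \<Longrightarrow> seg p q \<subseteq> hull_of Q" by (auto simp: hull_of_def)

lemma sub_hull: "Q \<subseteq> X \<Longrightarrow> Q \<subseteq> hull_of Q" unfolding hull_of_def using seg_ends by blast

text \<open>Covers a hull by one arc per point of Q from a common base point, instead of one arc per
  pair.\<close>

lemma hull_star1:
  assumes "Q \<subseteq> X" "z \<in> X" "x \<in> hull_of Q" shows "\<exists>q\<in>Q. x \<in> seg z q"
proof -
  obtain p q where pq: "p \<in> Q" "q \<in> Q" "x \<in> seg p q" using assms(3) by (auto simp: hull_of_def)
  then have "x \<in> seg p z \<union> seg z q" using seg_tri[of p q z] assms by blast
  then show ?thesis using pq seg_sym[of p z] assms by blast
qed

lemma hull_convx: assumes "Q \<subseteq> X" shows "convx (hull_of Q)"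
  unfolding convx_def
proof (intro conjI ballI)
  show "hull_of Q \<subseteq> X" using seg_X assms unfolding hull_of_def by blast
  fix x y assume xy: "x \<in> hull_of Q" "y \<in> hull_of Q"
  then have X: "x \<in> X" "y \<in> X" using \<open>hull_of Q \<subseteq> X\<close> by auto
  obtain p q where pq: "p \<in> Q" "q \<in> Q" "x \<in> seg p q" using xy(1) by (auto simp: hull_of_def)
  have pX: "p \<in> X" "q \<in> X" using pq assms by auto
  obtain r where r: "r \<in> Q" "y \<in> seg p r" using hull_star1[OF assms pX(1) xy(2)] by blast
  have "seg x p \<subseteq> seg p q" using seg_split(3)[OF pX pq(3)] seg_sym[OF X(1) pX(1)] by simp
  moreover have "seg p y \<subseteq> seg p r" using seg_split(3)[OF pX(1) _ r(2)] r(1) assms by blast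
  moreover have "seg x y \<subseteq> seg x p \<union> seg p y" by (rule seg_tri[OF X pX(1)])
  ultimately show "seg x y \<subseteq> hull_of Q" using seg_sub_hull pq r by blast
qed

lemma hull_compact: "finite Q \<Longrightarrow> Q \<subseteq> X \<Longrightarrow> compact (hull_of Q)"
  unfolding hull_of_def by (intro compact_UN seg_compact) auto

lemma hull_good: assumes "finite Q" "Q \<subseteq> X" "Q \<noteq> {}" shows "good (hull_of Q)"
  unfolding hull_of_def using assms by (intro good_finite_UN seg_good) auto

lemma convx_connected: "convx C \<Longrightarrow> connected C"
proof -
  assume C: "convx C"
  have "connected_component C x y" if "x \<in> C" "y \<in> C" for x y unfolding connected_component_def
    using C that seg_connected[of x y] seg_ends[of x y] by (intro exI[of _ "seg x y"]) (auto simp: convx_def)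
  then show ?thesis by (simp add: connected_iff_connected_component)
qed

lemma Ed_finite: "finite V \<Longrightarrow> finite (Ed V)"
  by (rule finite_subset[of _ "(\<lambda>(u,v). seg u v) ` (V \<times> V)"]) (auto simp: Ed_def)

lemma EdE:
  assumes "e \<in> Ed V"
  obtains u v where "u \<in> V" "v \<in> V" "u \<noteq> v" "seg u v \<inter> V = {u, v}" "e = seg u v"
  using assms by (auto simp: Ed_def)

lemma nearest:
  assumes V: "finite V" "V \<subseteq> X" and x: "x \<in> X" and p: "p \<in> V"
  obtains u where "u \<in> V" "u \<in> seg x p" "seg x u \<inter> V = {u}" "seg x u \<subseteq> seg x p"
proof -
  \<comment> \<open>With the fewest vertices between it and x, u can have none but itself
    there.\<close>
  define u where "u = (ARG_MIN (\<lambda>u. card (V \<inter> seg x u)) u. u \<in> V \<and> u \<in> seg x p)"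
  have "p \<in> V \<and> p \<in> seg x p" using p V(2) x seg_ends by blast
  then have u: "u \<in> V" "u \<in> seg x p" and mn: "\<And>u'. u' \<in> V \<Longrightarrow> u' \<in> seg x p \<Longrightarrow> card (V \<inter> seg x u) \<le> card (V \<inter> seg x u')"
    unfolding u_def using arg_min_nat_lemma[of "\<lambda>u. u \<in> V \<and> u \<in> seg x p" p "\<lambda>u. card (V \<inter> seg x u)"] by blast+
  have uX: "u \<in> X" "p \<in> X" using u(1) p V(2) by auto
  have sub: "seg x u \<subseteq> seg x p" by (rule seg_split(3)[OF x uX(2) u(2)])
  have "seg x u \<inter> V \<subseteq> {u}"
  proof (rule ccontr)
    assume "\<not> ?thesis"
    then obtain u' where u': "u' \<in> seg x u" "u' \<in> V" "u' \<noteq> u" by auto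
    have "seg x u' \<subseteq> seg x u" by (rule seg_split(3)[OF x uX(1) u'(1)])
    moreover have "u \<notin> seg x u'" using seg_cut[OF x uX(1) u'(1), of u] u'(2,3) seg_ends[of u' u] uX V(2) by blast
    ultimately have "V \<inter> seg x u' \<subset> V \<inter> seg x u" using u(1) seg_ends[OF x uX(1)] by blast
    then have "card (V \<inter> seg x u') < card (V \<inter> seg x u)" using V(1) by (intro psubset_card_mono) auto
    then show False using mn[OF u'(2)] u'(1) sub by fastforce
  qed
  then show ?thesis using that u sub seg_ends[OF x uX(1)] by blast
qed

lemma edge_through:
  assumes V: "finite V" "V \<subseteq> X" and p: "p \<in> V" "q \<in> V" and x: "x \<in> seg p q" "x \<notin> V"
  obtains e where "e \<in> Ed V" "x \<in> e" "e \<subseteq> seg p q"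
proof -
  have pX: "p \<in> X" "q \<in> X" using p V by auto
  have xX: "x \<in> X" using seg_X[OF pX] x(1) by blast
  note sp = seg_split[OF pX x(1)]
  obtain u where u: "u \<in> V" "u \<in> seg x p" "seg x u \<inter> V = {u}" "seg x u \<subseteq> seg x p" using nearest[OF V xX p(1)] .
  obtain v where v: "v \<in> V" "v \<in> seg x q" "seg x v \<inter> V = {v}" "seg x v \<subseteq> seg x q" using nearest[OF V xX p(2)] .
  have X: "u \<in> X" "v \<in> X" using u v V by auto
  have sy: "seg u x = seg x u" "seg p x = seg x p" using seg_sym X xX pX by auto
  have int: "seg u x \<inter> seg x v \<subseteq> {x}" using sp(2) u(4) v(4) sy by blast
  note j = seg_join[OF X xX int]
  have "u \<noteq> v" using int seg_ends[OF xX X(1)] seg_ends[OF xX X(2)] sy u(1) x(2) by blast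
  moreover have "seg u v \<inter> V = {u, v}" using j(1) u(3) v(3) sy by blast
  moreover have "seg u v \<subseteq> seg p q" using j(1) u(4) v(4) sp(1) sy by blast
  ultimately show ?thesis using that[of "seg u v"] j(2) u(1) v(1) unfolding Ed_def by blast
qed

text \<open>If z' lies between z and q, then unless the points agree, z would lie between z' and r
  and z' between z and r.\<close>

lemma median_unique:
  assumes X: "p \<in> X" "q \<in> X" "r \<in> X"
    and z: "z \<in> seg p q" "z \<in> seg q r" "z \<in> seg p r" and z': "z' \<in> seg p q" "z' \<in> seg q r" "z' \<in> seg p r"
  shows "z = z'"
proof -
  have main: "z = z'"
    if "z \<in> seg p q" "z \<in> seg q r" "z \<in> seg p r" "z' \<in> seg p q" "z' \<in> seg q r" "z' \<in> seg p r" "z' \<in> seg z q" for z z'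
  proof -
    have zX: "z \<in> X" "z' \<in> X" using that seg_X X by blast+
    have "z \<in> seg q z' \<union> seg z' r" using seg_split(1)[OF X(2,3) that(5)] that(2) by blast
    moreover have "z \<in> seg q z' \<Longrightarrow> z = z'" using seg_cut[OF zX(1) X(2) that(7), of z] seg_ends[OF zX] seg_sym[OF X(2) zX(2)] by simp
    moreover have "z' \<in> seg p z \<union> seg z r" using seg_split(1)[OF X(1,3) that(3)] that(6) by blast
    moreover have "z' \<in> seg p z \<Longrightarrow> z = z'" using seg_cut[OF X(1,2) that(1) _ that(7)] by simp
    moreover have "z = z'" if "z \<in> seg z' r" "z' \<in> seg z r" using seg_cut[OF zX(2) X(3) that(1) _ that(2)] seg_ends[OF zX(2,1)] by simp
    ultimately show ?thesis by blast
  qed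
  have zX: "z \<in> X" "z' \<in> X" using z z' seg_X X by blast+
  have "z' \<in> seg p z \<union> seg z q" using seg_split(1)[OF X(1,2) z(1)] z'(1) by blast
  moreover have "z \<in> seg z' q" if "z' \<in> seg p z"
  proof -
    have "z \<in> seg p z' \<union> seg z' q" using seg_split(1)[OF X(1,2) z'(1)] z(1) by blast
    moreover have "z \<in> seg p z' \<Longrightarrow> z = z'" using seg_cut[OF X(1) zX(1) that, of z] seg_ends[OF zX(2,1)] by simp
    ultimately show ?thesis using seg_ends[OF zX(2) X(2)] by blast
  qed
  ultimately show ?thesis using main[OF z z'] main[OF z' z] by blast
qed

lemma median_ex:
  assumes X: "x \<in> X" "y \<in> X" "z \<in> X"
  obtains w where "w \<in> seg x y" "w \<in> seg x z" "w \<in> seg y z" "w \<in> X"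
  using seg_meet[OF X] by metis

text \<open>Contains the branch points of arcs between its points. In this form the condition passes
  to preimages under iterates (\<open>Vs_median\<close>), and it makes different edges of
  \<open>Ed V\<close> meet only in V.\<close>

definition "median_closed V \<longleftrightarrow> (\<forall>a\<in>V. \<forall>b\<in>V. \<forall>c\<in>V. seg a b \<inter> seg b c \<inter> seg a c \<subseteq> V)"

lemma median_closedD:
  "median_closed V \<Longrightarrow> a \<in> V \<Longrightarrow> b \<in> V \<Longrightarrow> c \<in> V \<Longrightarrow> w \<in> seg a b \<Longrightarrow> w \<in> seg b c \<Longrightarrow> w \<in> seg a c \<Longrightarrow> w \<in> V"
  unfolding median_closed_def by blast

text \<open>The medians of u, v with a and of u, v with b lie in V and on the edge, so each is u or
  v. If both are the same end, the arc from a to b misses the rest of the edge and with it x. If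
  they are the two ends, that arc contains u and v, which must then be a and b.\<close>

lemma Ed_unique:
  assumes V: "V \<subseteq> X" and br: "median_closed V"
    and e: "e \<in> Ed V" "e' \<in> Ed V" "x \<in> e" "x \<in> e'" "x \<notin> V"
  shows "e = e'"
proof -
  obtain u v where uv: "u \<in> V" "v \<in> V" "u \<noteq> v" "seg u v \<inter> V = {u, v}" "e = seg u v" using EdE[OF e(1)] .
  obtain a b where ab: "a \<in> V" "b \<in> V" "a \<noteq> b" "seg a b \<inter> V = {a, b}" "e' = seg a b" using EdE[OF e(2)] .
  have X: "u \<in> X" "v \<in> X" "a \<in> X" "b \<in> X" using uv ab V by auto
  have xX: "x \<in> X" using e(3) uv(5) seg_X X by blast
  have xe: "x \<in> seg u v" "x \<in> seg a b" using e uv ab by auto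
  have main: "seg u v = seg a b" if uv: "u \<in> V" "v \<in> V" "u \<noteq> v" "seg u v \<inter> V = {u, v}" "x \<in> seg u v"
    and m: "u \<in> seg v a" "v \<in> seg u b" for u v
  proof -
    have X': "u \<in> X" "v \<in> X" using uv V by auto
    have "u \<in> seg a b" if uv: "u \<in> V" "v \<in> V" "x \<in> seg u v" and m: "u \<in> seg v a" and ab: "a \<in> X" "b \<in> X" "x \<in> seg a b" for u v a b
    proof -
      have X': "u \<in> X" "v \<in> X" using uv V by auto
      have "x \<in> seg v u" using uv(3) seg_sym X' by simp
      then have xva: "x \<in> seg v a" using seg_split(3)[OF X'(2) ab(1) m] by blast
      have "u \<notin> seg v x" using seg_cut[OF X'(2,1) \<open>x \<in> seg v u\<close>, of u] seg_ends[OF xX X'(1)] e(5) uv(1) by blast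
      then have "u \<in> seg x a" using seg_split(1)[OF X'(2) ab(1) xva] m by blast
      then show ?thesis using seg_split(3)[OF ab] seg_sym[OF ab(1) xX] by blast
    qed
    from this[OF uv(1,2,5) m(1) X(3,4) xe(2)] this[OF uv(2,1) _ m(2) X(4,3)]
    have "u \<in> seg a b" "v \<in> seg b a" using uv(5) xe(2) seg_sym X X' by auto
    then have "u \<in> {a, b}" "v \<in> {a, b}" using uv(1,2) ab(4) seg_sym[OF X(3,4)] by auto
    then show ?thesis using uv(3) seg_sym[OF X(3,4)] by auto
  qed
  obtain m where m: "m \<in> seg u v" "m \<in> seg u a" "m \<in> seg v a" using median_ex[OF X(1,2,3)] by metis
  obtain m' where m': "m' \<in> seg u v" "m' \<in> seg u b" "m' \<in> seg v b" using median_ex[OF X(1,2,4)] by metis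
  have "m \<in> V" using median_closedD[OF br uv(1,2) ab(1)] m by blast
  then have mm: "m \<in> {u, v}" using m(1) uv(4) by blast
  have "m' \<in> V" using median_closedD[OF br uv(1,2) ab(2)] m' by blast
  then have mm': "m' \<in> {u, v}" using m'(1) uv(4) by blast
  have no: False if "u \<in> V" "v \<in> V" "x \<in> seg u v" "u \<in> seg v a" "u \<in> seg v b" for u v
  proof -
    have X': "u \<in> X" "v \<in> X" using that V by auto
    have "x \<in> seg v u" using that(3) seg_sym X' by simp
    then have "x \<in> seg u a \<Longrightarrow> x = u" "x \<in> seg u b \<Longrightarrow> x = u" using seg_cut[OF X'(2) X(3) that(4)] seg_cut[OF X'(2) X(4) that(5)] by blast+
    moreover have "x \<in> seg a u \<union> seg u b" using seg_tri[OF X(3,4) X'(1)] xe(2) by blast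
    ultimately have "x = u" using seg_sym[OF X(3) X'(1)] by blast
    then show False using that(1) e(5) by simp
  qed
  have sv: "seg v u \<inter> V = {v, u}" "x \<in> seg v u" "seg v u = seg u v" using uv(4) xe(1) seg_sym[OF X(1,2)] by auto
  consider "m = u" "m' = u" | "m = v" "m' = v" | "m = u" "m' = v" | "m = v" "m' = u" using mm mm' by blast
  then have "seg u v = seg a b"
  proof cases
    case 1 then show ?thesis using no[OF uv(1,2) xe(1)] m m' by blast
  next
    case 2 then show ?thesis using no[OF uv(2,1) sv(2)] m m' by blast
  next
    case 3 then show ?thesis using main[OF uv(1-4) xe(1)] m m' by blast
  next
    case 4 then show ?thesis using main[OF uv(2,1) uv(3)[symmetric] sv(1,2)] m m' sv(3) by auto
  qed
  then show ?thesis using uv ab by simp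
qed

text \<open>The component of x in \<open>H - {z}\<close>, as \<open>ccs_eq\<close> shows, expressed
  by segments.\<close>

definition "Cls H z x = {y \<in> H. y \<noteq> z \<and> z \<notin> seg y x}"

context
  fixes Q assumes Q: "finite Q" "Q \<subseteq> X" "Q \<noteq> {}"
begin

abbreviation "H \<equiv> hull_of Q"

lemma H_X: "H \<subseteq> X" using hull_convx[OF Q(2)] by (simp add: convx_def)

lemma H_seg: "x \<in> H \<Longrightarrow> y \<in> H \<Longrightarrow> seg x y \<subseteq> H" using hull_convx[OF Q(2)] by (simp add: convx_def)

lemma rel_trans: "x \<in> H \<Longrightarrow> y \<in> H \<Longrightarrow> w \<in> H \<Longrightarrow> z \<notin> seg x y \<Longrightarrow> z \<notin> seg y w \<Longrightarrow> z \<notin> seg x w"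
  using seg_tri[of x w y] H_X by blast

lemma rel_sym: "x \<in> H \<Longrightarrow> y \<in> H \<Longrightarrow> z \<notin> seg x y \<longleftrightarrow> z \<notin> seg y x"
  using seg_sym[of x y] H_X by auto

lemma rel_end: "z \<in> H \<Longrightarrow> q \<in> H \<Longrightarrow> x \<in> seg z q \<Longrightarrow> x \<noteq> z \<Longrightarrow> z \<notin> seg x q"
  using seg_cut[of z q x z] seg_ends[of z x] H_X seg_X[of z q] by blast

text \<open>Arcs from z to the points of Q cover the hull. Those to points on the side of x and the
  remaining ones form two sets, closed because Q is finite, which meet at most in z.\<close>

lemma ccs_eq:
  assumes z: "z \<in> H" and x: "x \<in> H" "x \<noteq> z"
  shows "connected_component_set (H - {z}) x = Cls H z x"
proof
  show "Cls H z x \<subseteq> connected_component_set (H - {z}) x"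
  proof
    fix y assume y: "y \<in> Cls H z x"
    then have "y \<in> H" "z \<notin> seg y x" by (auto simp: Cls_def)
    then have "seg y x \<subseteq> H - {z}" "connected (seg y x)" "y \<in> seg y x" "x \<in> seg y x"
      using H_seg[of y x] x seg_connected[of y x] seg_ends[of y x] H_X by blast+
    then show "y \<in> connected_component_set (H - {z}) x" by (auto simp: connected_component_def)
  qed
  define A where "A = (\<Union>q\<in>{q\<in>Q. q \<noteq> z \<and> z \<notin> seg q x}. seg z q)"
  define B where "B = (\<Union>q\<in>{q\<in>Q. q \<noteq> z \<and> z \<in> seg q x}. seg z q)"
  have QH: "Q \<subseteq> H" by (rule sub_hull[OF Q(2)])
  have cl: "closed A" "closed B" unfolding A_def B_def using Q z H_X by (intro closed_UN ballI compact_imp_closed seg_compact; auto)+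
  have cov: "H - {z} \<subseteq> A \<union> B"
  proof
    fix y assume y: "y \<in> H - {z}"
    then obtain q where "q \<in> Q" "y \<in> seg z q" using hull_star1[OF Q(2), of z y] z H_X by blast
    moreover then have "q \<noteq> z" using y by auto
    ultimately show "y \<in> A \<union> B" by (auto simp: A_def B_def)
  qed
  have An: "z \<notin> seg y x" if y: "y \<in> A" "y \<noteq> z" for y
  proof -
    obtain q where q: "q \<in> Q" "z \<notin> seg q x" "y \<in> seg z q" using y(1) by (auto simp: A_def)
    have qH: "q \<in> H" using q(1) QH by auto
    have yH: "y \<in> H" using H_seg[OF z qH] q(3) by blast
    show ?thesis using rel_trans[OF yH qH x(1) rel_end[OF z qH q(3) y(2)] q(2)] .
  qed
  have Bn: "z \<in> seg y x" if y: "y \<in> B" "y \<noteq> z" for y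
  proof (rule ccontr)
    assume n: "z \<notin> seg y x"
    obtain q where q: "q \<in> Q" "z \<in> seg q x" "y \<in> seg z q" using y(1) by (auto simp: B_def)
    have qH: "q \<in> H" using q(1) QH by auto
    have yH: "y \<in> H" using H_seg[OF z qH] q(3) by blast
    have "z \<notin> seg q y" using rel_end[OF z qH q(3) y(2)] rel_sym[OF yH qH] by blast
    then show False using rel_trans[OF qH yH x(1) _ n] q(2) by blast
  qed
  let ?C = "connected_component_set (H - {z}) x"
  have Csub: "?C \<subseteq> H - {z}" by (rule connected_component_subset)
  have xC: "x \<in> ?C" using x by simp
  have xA: "x \<in> A" using cov x Bn[of x] by auto
  have "A \<inter> B \<inter> ?C = {}" using An Bn Csub by blast
  moreover have "?C \<subseteq> A \<union> B" using cov Csub by blast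
  ultimately have "B \<inter> ?C = {}" using connected_closedD[OF connected_connected_component, of A B "H - {z}" x] cl xA xC by blast
  then have "?C \<subseteq> A" using \<open>?C \<subseteq> A \<union> B\<close> by blast
  then show "?C \<subseteq> Cls H z x" using An Csub by (auto simp: Cls_def)
qed

lemma Cls_eq_iff:
  assumes "x \<in> H" "y \<in> H" "x \<noteq> z" shows "Cls H z x = Cls H z y \<longleftrightarrow> z \<notin> seg x y"
proof
  assume "Cls H z x = Cls H z y"
  moreover have "x \<in> Cls H z x" using assms by (simp add: Cls_def)
  ultimately show "z \<notin> seg x y" by (simp add: Cls_def)
next
  assume n: "z \<notin> seg x y"
  then show "Cls H z x = Cls H z y" using rel_trans assms rel_sym unfolding Cls_def by blast
qed

lemma components_minus:
  assumes z: "z \<in> H" shows "components (H - {z}) = Cls H z ` (Q - {z})"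
proof -
  have QH: "Q \<subseteq> H" by (rule sub_hull[OF Q(2)])
  have "components (H - {z}) = Cls H z ` (H - {z})" unfolding components_def using ccs_eq[OF z] by auto
  also have "\<dots> = Cls H z ` (Q - {z})"
  proof
    show "Cls H z ` (H - {z}) \<subseteq> Cls H z ` (Q - {z})"
    proof (rule image_subsetI)
      fix x assume "x \<in> H - {z}"
      then have x: "x \<in> H" "x \<noteq> z" by auto
      obtain q where q: "q \<in> Q" "x \<in> seg z q" using hull_star1[OF Q(2) _ x(1), of z] z H_X by blast
      have "q \<noteq> z" using q(2) x(2) by auto
      moreover have qH: "q \<in> H" using q(1) QH by auto
      then have "Cls H z x = Cls H z q" using Cls_eq_iff[OF x(1) qH x(2)] rel_end[OF z qH q(2) x(2)] by blast
      ultimately show "Cls H z x \<in> Cls H z ` (Q - {z})" using q(1) by blast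
    qed
  qed (use QH in auto)
  finally show ?thesis .
qed

lemma branchI:
  assumes z: "z \<in> H" and abc: "a \<in> H" "b \<in> H" "c \<in> H" "z \<noteq> a" "z \<noteq> b" "z \<noteq> c" "z \<in> seg a b" "z \<in> seg b c" "z \<in> seg a c"
  shows "card (components (H - {z})) > 2"
proof -
  have fin: "finite (components (H - {z}))" unfolding components_minus[OF z] using Q(1) by simp
  have "Cls H z x \<in> components (H - {z})" if "x \<in> H" "z \<noteq> x" for x
    using ccs_eq[OF z that(1)] that unfolding components_def by (metis DiffI imageI singletonD)
  then have "{Cls H z a, Cls H z b, Cls H z c} \<subseteq> components (H - {z})" using abc by simp
  moreover have ne: "Cls H z a \<noteq> Cls H z b" "Cls H z b \<noteq> Cls H z c" "Cls H z a \<noteq> Cls H z c" using Cls_eq_iff abc by metis+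
  ultimately have "card {Cls H z a, Cls H z b, Cls H z c} \<le> card (components (H - {z}))" using fin by (intro card_mono) auto
  then show ?thesis using ne by simp
qed

text \<open>Each component contains a point of Q, and z lies on the arc between points of different
  components.\<close>

lemma branchD:
  assumes z: "z \<in> H" and br: "infinite (components (H - {z})) \<or> card (components (H - {z})) > 2"
  shows "\<exists>a\<in>Q. \<exists>b\<in>Q. \<exists>c\<in>Q. z \<in> seg a b \<and> z \<in> seg b c \<and> z \<in> seg a c"
proof -
  have QH: "Q \<subseteq> H" by (rule sub_hull[OF Q(2)])
  have fin: "finite (components (H - {z}))" unfolding components_minus[OF z] using Q(1) by simp
  then have "3 \<le> card (components (H - {z}))" using br by simp
  then obtain T where "T \<subseteq> components (H - {z})" "card T = 3" using obtain_subset_with_card_n by metis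
  then obtain A B C where ABC: "{A, B, C} \<subseteq> Cls H z ` (Q - {z})" "A \<noteq> B" "B \<noteq> C" "A \<noteq> C"
    unfolding card_3_iff components_minus[OF z] by metis
  then obtain a b c where abc: "a \<in> Q - {z}" "b \<in> Q - {z}" "c \<in> Q - {z}" "A = Cls H z a" "B = Cls H z b" "C = Cls H z c" by auto
  have "z \<in> seg x y" if "x \<in> Q - {z}" "y \<in> Q - {z}" "Cls H z x \<noteq> Cls H z y" for x y using that QH Cls_eq_iff[of x y z] by blast
  then show ?thesis using abc ABC(2-4) by blast
qed

lemma branch_finite: "finite {z. \<exists>a\<in>Q. \<exists>b\<in>Q. \<exists>c\<in>Q. z \<in> seg a b \<and> z \<in> seg b c \<and> z \<in> seg a c}"
proof -
  define M where "M = (\<lambda>(a, b, c). {z. z \<in> seg a b \<and> z \<in> seg b c \<and> z \<in> seg a c})"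
  have "finite (M t)" if "t \<in> Q \<times> Q \<times> Q" for t
  proof -
    obtain a b c where t: "t = (a, b, c)" "a \<in> X" "b \<in> X" "c \<in> X" using \<open>t \<in> _\<close> Q(2) by auto
    have "\<exists>w. M t \<subseteq> {w}" unfolding t(1) M_def using median_unique[OF t(2-4)] by (auto, blast)
    then show ?thesis by (meson finite.simps finite_subset)
  qed
  then have "finite (\<Union>t\<in>Q \<times> Q \<times> Q. M t)" using Q(1) by (intro finite_UN_I) auto
  then show ?thesis by (rule finite_subset[rotated]) (auto simp: M_def)
qed

text \<open>The edges other than e form a closed set, which by \<open>Ed_unique\<close> meets e only
  in V; so \<open>e - V\<close> is a whole component of the complement of V.\<close>

lemma edges_components:
  assumes V: "V = Q \<union> {z \<in> H. infinite (components (H - {z})) \<or> card (components (H - {z})) > 2}"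
  shows "finite V" "V \<subseteq> H" "closure ` components (H - V) = Ed V"
    "median_closed V" "\<And>x. x \<in> H - V \<Longrightarrow> \<exists>e\<in>Ed V. x \<in> e" "\<And>e. e \<in> Ed V \<Longrightarrow> e \<subseteq> H"
proof -
  have QH: "Q \<subseteq> H" by (rule sub_hull[OF Q(2)])
  show VH: "V \<subseteq> H" using V QH by auto
  have "V \<subseteq> Q \<union> {z. \<exists>a\<in>Q. \<exists>b\<in>Q. \<exists>c\<in>Q. z \<in> seg a b \<and> z \<in> seg b c \<and> z \<in> seg a c}" unfolding V using branchD by blast
  then show finV: "finite V" using finite_subset branch_finite Q(1) by (meson finite_UnI)
  have VX: "V \<subseteq> X" using VH H_X by blast
  have "w \<in> V" if w: "a \<in> V" "b \<in> V" "c \<in> V" "w \<in> seg a b" "w \<in> seg b c" "w \<in> seg a c" for a b c w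
  proof (cases "w = a \<or> w = b \<or> w = c")
    case False
    have "w \<in> H" using H_seg[of a b] w VH by blast
    then show ?thesis using branchI[of w a b c] w VH False unfolding V by blast
  qed (use w in auto)
  then show br: "median_closed V" unfolding median_closed_def by blast
  show ex: "\<exists>e\<in>Ed V. x \<in> e" if x: "x \<in> H - V" for x
  proof -
    obtain p q where "p \<in> Q" "q \<in> Q" "x \<in> seg p q" using x by (auto simp: hull_of_def)
    then have pq: "p \<in> V" "q \<in> V" "x \<in> seg p q" "x \<notin> V" using x V by auto
    show ?thesis using edge_through[OF finV VX pq] by metis
  qed
  show eH: "e \<subseteq> H" if "e \<in> Ed V" for e using that H_seg VH by (auto simp: Ed_def)
  have eX: "\<exists>u v. e = seg u v \<and> u \<in> X \<and> v \<in> X \<and> u \<noteq> v \<and> e - V = seg u v - {u, v}" if e: "e \<in> Ed V" for e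
  proof -
    obtain u v where uv: "u \<in> V" "v \<in> V" "u \<noteq> v" "seg u v \<inter> V = {u, v}" "e = seg u v" using EdE[OF e] .
    have "e - V = seg u v - {u, v}" using uv(4,5) by blast
    then show ?thesis using uv VX by blast
  qed
  have edcl: "closed e" "connected (e - V)" "closure (e - V) = e" "e - V \<noteq> {}" if e: "e \<in> Ed V" for e
    using eX[OF e] seg_open_connected seg_compact compact_imp_closed by metis+
  have ccs: "connected_component_set (H - V) x = e - V" if e: "e \<in> Ed V" "x \<in> e" "x \<notin> V" for e x
  proof
    show "e - V \<subseteq> connected_component_set (H - V) x" using edcl(2)[OF e(1)] e eH by (intro connected_component_maximal) auto
    let ?C = "connected_component_set (H - V) x"
    have Csub: "?C \<subseteq> H - V" by (rule connected_component_subset)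
    define B where "B = \<Union>(Ed V - {e})"
    have clB: "closed B" unfolding B_def using Ed_finite[OF finV] edcl(1) by (intro closed_Union) auto
    have "e \<inter> B \<inter> ?C = {}"
    proof (rule ccontr)
      assume "e \<inter> B \<inter> ?C \<noteq> {}"
      then obtain y e' where y: "y \<in> e" "y \<in> e'" "e' \<in> Ed V" "e' \<noteq> e" "y \<in> ?C" by (auto simp: B_def)
      then have "y \<notin> V" using Csub by blast
      then have "e = e'" by (rule Ed_unique[OF VX br e(1) y(3,1,2)])
      then show False using y(4) by blast
    qed
    moreover have "?C \<subseteq> e \<union> B" using ex Csub unfolding B_def by blast
    moreover have "x \<in> ?C" using e eH by auto
    ultimately have "B \<inter> ?C = {}"
      using connected_closedD[OF connected_connected_component, of e B "H - V" x] edcl(1)[OF e(1)] clB e(2) by blast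
    then show "?C \<subseteq> e - V" using \<open>?C \<subseteq> e \<union> B\<close> Csub by blast
  qed
  show "closure ` components (H - V) = Ed V"
  proof
    show "closure ` components (H - V) \<subseteq> Ed V"
    proof clarify
      fix C assume "C \<in> components (H - V)"
      then obtain x where x: "x \<in> H - V" "C = connected_component_set (H - V) x" by (auto simp: components_def)
      obtain e where e: "e \<in> Ed V" "x \<in> e" using ex[OF x(1)] by blast
      then show "closure C \<in> Ed V" using ccs[OF e] x edcl(3)[OF e(1)] by simp
    qed
    show "Ed V \<subseteq> closure ` components (H - V)"
    proof
      fix e assume e: "e \<in> Ed V"
      then obtain x where x: "x \<in> e" "x \<notin> V" using edcl(4) by blast
      have "e - V \<in> components (H - V)" unfolding components_def using ccs[OF e x, symmetric] eH[OF e] x by blast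
      then show "e \<in> closure ` components (H - V)" using edcl(3)[OF e] by (metis imageI)
    qed
  qed
qed

end

end

subsection \<open>Fatou coordinates\<close>

lemma constant_norm_imp_constant:
  assumes "q holomorphic_on ball 0 1" "\<And>w. norm w < 1 \<Longrightarrow> norm (q w) = 1"
  obtains c where "norm c = 1" "\<And>w. norm w < 1 \<Longrightarrow> q w = (c :: complex)"
proof -
  have "q constant_on ball 0 1"
  proof (rule ccontr)
    assume "\<not> ?thesis"
    then have op: "open (q ` ball 0 1)" using assms(1) by (intro open_mapping_thm[of q "ball 0 1"]) auto
    moreover have "q 0 \<in> q ` ball 0 1" by simp
    ultimately obtain e where e: "e > 0" "ball (q 0) e \<subseteq> q ` ball 0 1" using openE by blast
    define z where "z = q 0 * of_real (1 + e / 2)"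
    have "z - q 0 = q 0 * of_real (e / 2)" by (simp add: z_def algebra_simps)
    then have "norm (z - q 0) = e / 2" using assms(2)[of 0] e(1) by (simp only: norm_mult norm_of_real) simp
    then have "z \<in> ball (q 0) e" using e(1) by (simp add: dist_norm norm_minus_commute)
    then have "norm z = 1" using e(2) assms(2) by auto
    moreover have "norm z = 1 + e / 2" using assms(2)[of 0] e(1) unfolding z_def norm_mult norm_of_real by simp
    ultimately show False using e(1) by simp
  qed
  then obtain c where "\<And>w. w \<in> ball 0 1 \<Longrightarrow> q w = c" by (auto simp: constant_on_def)
  then show ?thesis using that[of c] assms(2)[of 0] by auto
qed

lemma max_modulus_ball:
  assumes "q holomorphic_on ball 0 1" "norm w \<le> t" "t < 1" "\<And>z. norm z = t \<Longrightarrow> norm (q z) \<le> B"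
  shows "norm (q w) \<le> (B :: real)"
proof (rule maximum_modulus_frontier[of q "cball 0 t"])
  have "cball 0 t \<subseteq> ball (0::complex) 1" "ball 0 t \<subseteq> ball (0::complex) 1" using assms(3) by auto
  then show "q holomorphic_on interior (cball 0 t)" "continuous_on (closure (cball 0 t)) q"
    using assms(1) by (auto intro: holomorphic_on_subset holomorphic_on_imp_continuous_on)
  show "norm (q z) \<le> B" if "z \<in> frontier (cball 0 t)" for z using that assms(4) by (cases "t \<ge> 0") (auto simp: frontier_cball)
qed (use assms(2) in auto)

text \<open>The only zero of h is at 0. After division by w^n the quotient q has no zeros, and
  properness makes its modulus tend to 1 at the circle; the maximum principle for q and 1 / q gives
  modulus 1 throughout.\<close>

lemma proper_disc_map:
  assumes hol: "h holomorphic_on ball 0 1" and im: "\<And>w. norm w < 1 \<Longrightarrow> norm (h w) < 1"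
    and zero: "\<And>w. norm w < 1 \<Longrightarrow> h w = 0 \<longleftrightarrow> w = 0"
    and proper: "\<And>\<rho>. \<rho> < 1 \<Longrightarrow> \<exists>s<1. \<forall>w. norm w < 1 \<longrightarrow> norm (h w) \<le> \<rho> \<longrightarrow> norm w \<le> s"
  obtains c m where "norm c = 1" "m \<ge> 1" "\<And>w. norm w < 1 \<Longrightarrow> h w = c * w ^ m"
proof -
  have nc: "\<not> h constant_on ball 0 1"
  proof
    assume "h constant_on ball 0 1"
    then obtain c where "\<And>w. w \<in> ball 0 1 \<Longrightarrow> h w = c" by (auto simp: constant_on_def)
    then have "h (1/2) = h 0" by (simp add: norm_divide)
    then show False using zero[of "1/2"] zero[of 0] by (simp add: norm_divide)
  qed
  obtain g r n where g: "0 < n" "0 < r" "ball (0::complex) r \<subseteq> ball 0 1" "g holomorphic_on ball 0 r"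
    "\<And>w. w \<in> ball 0 r \<Longrightarrow> h w = (w - 0) ^ n * g w" "\<And>w. w \<in> ball 0 r \<Longrightarrow> g w \<noteq> 0"
  proof -
    have z: "(0::complex) \<in> ball 0 1" "h 0 = 0" using zero[of 0] by auto
    show ?thesis by (rule holomorphic_factor_zero_nonconstant[OF hol open_ball connected_ball z nc]) (rule that)
  qed
  define q where "q w = (if w = 0 then g 0 else h w / w ^ n)" for w
  have qg: "q w = g w" if "w \<in> ball 0 r" for w using g(5)[OF that] by (auto simp: q_def)
  have holq: "q holomorphic_on ball 0 1"
  proof -
    have "q holomorphic_on ball 0 r" using g(4) holomorphic_cong[OF refl, of "ball 0 r" q g] qg by blast
    moreover have "(\<lambda>w. h w / w ^ n) holomorphic_on (ball 0 1 - {0})" by (intro holomorphic_intros holomorphic_on_subset[OF hol]) auto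
    then have "q holomorphic_on (ball 0 1 - {0})" by (rule holomorphic_transform) (auto simp: q_def)
    ultimately have "q holomorphic_on (ball 0 r \<union> (ball 0 1 - {0}))" by (intro holomorphic_on_Un) auto
    moreover have "ball 0 1 \<subseteq> ball 0 r \<union> (ball 0 1 - {0::complex})" using g(2) by auto
    ultimately show ?thesis by (rule holomorphic_on_subset)
  qed
  have q0: "q w \<noteq> 0" if "norm w < 1" for w using zero[OF that] g(2,6) by (auto simp: q_def)
  have q1: "norm (q w) \<le> 1" if w: "norm w < 1" for w
  proof -
    have "norm (q w) \<le> 1 / t ^ n" if t: "max (norm w) 0 < t" "t < 1" for t
    proof (rule max_modulus_ball[OF holq _ t(2)])
      fix z :: complex assume z: "norm z = t"
      then have "norm (q z) = norm (h z) / t ^ n" using t by (auto simp: q_def norm_divide norm_power)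
      also have "\<dots> \<le> 1 / t ^ n" using im[of z] z t by (intro divide_right_mono) auto
      finally show "norm (q z) \<le> 1 / t ^ n" .
    qed (use t in auto)
    then have ev: "eventually (\<lambda>t. norm (q w) \<le> 1 / t ^ n) (at_left (1::real))"
      using w by (intro eventually_at_leftI[of "norm w" 1]) auto
    have "((\<lambda>t::real. 1 / t ^ n) \<longlongrightarrow> 1 / 1 ^ n) (at_left 1)" by (intro tendsto_divide tendsto_const tendsto_power tendsto_ident_at) auto
    from tendsto_lowerbound[OF this ev] show ?thesis by simp
  qed
  have q2: "norm (q w) \<ge> 1" if w: "norm w < 1" for w
  proof -
    have "norm (inverse (q w)) \<le> 1 / \<rho>" if \<rho>: "0 < \<rho>" "\<rho> < 1" for \<rho>
    proof -
      obtain s where s: "s < 1" "\<And>w. norm w < 1 \<Longrightarrow> norm (h w) \<le> \<rho> \<Longrightarrow> norm w \<le> s" using proper[OF \<rho>(2)] by blast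
      \<comment> \<open>Above s, so that h exceeds \<rho> in modulus on the circle of radius t, and
        large enough for this circle to enclose w.\<close>
      define t where "t = (max (max s (norm w)) 0 + 1) / 2"
      have t: "s < t" "norm w < t" "0 < t" "t < 1" using s(1) w by (auto simp: t_def max_def)
      show ?thesis
      proof (rule max_modulus_ball[of "\<lambda>w. inverse (q w)"])
        show "(\<lambda>w. inverse (q w)) holomorphic_on ball 0 1" using holq q0 by (intro holomorphic_intros) auto
        fix z :: complex assume z: "norm z = t"
        have "\<rho> < norm (h z)" using s(2)[of z] z t by force
        also have "\<dots> \<le> norm (h z) / t ^ n" using t mult_right_mono[of "t ^ n" 1 "norm (h z)"] by (simp add: field_simps power_le_one)
        also have "\<dots> = norm (q z)" using z t by (auto simp: q_def norm_divide norm_power)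
        finally have "\<rho> < norm (q z)" .
        then show "norm (inverse (q z)) \<le> 1 / \<rho>" using \<rho> by (simp add: norm_inverse norm_divide inverse_eq_divide frac_le)
      qed (use t in auto)
    qed
    then have ev: "eventually (\<lambda>\<rho>. norm (inverse (q w)) \<le> 1 / \<rho>) (at_left (1::real))" by (intro eventually_at_leftI[of 0 1]) auto
    have "((\<lambda>\<rho>::real. 1 / \<rho>) \<longlongrightarrow> 1 / 1) (at_left 1)" by (intro tendsto_divide tendsto_const tendsto_power tendsto_ident_at) auto
    from tendsto_lowerbound[OF this ev] have "inverse (norm (q w)) \<le> 1" by (simp add: norm_inverse)
    then show ?thesis using q0[OF w] by (simp add: inverse_le_1_iff)
  qed
  obtain c where c: "norm c = 1" "\<And>w. norm w < 1 \<Longrightarrow> q w = c" using constant_norm_imp_constant[OF holq] q1 q2 by (metis order_antisym)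
  have "h w = c * w ^ n" if "norm w < 1" for w using c(2)[OF that] zero[of 0] g(1) by (cases "w = 0") (auto simp: q_def field_simps)
  then show ?thesis using that[of c n] c(1) g(1) by auto
qed

text \<open>A factor of at least 2 recurs with period k, so the products grow at least like a
  constant times 2^(n / k).\<close>

lemma summable_prod_gap:
  fixes m :: "nat \<Rightarrow> nat"
  assumes m: "\<And>i. 1 \<le> m i" and k: "k > 0" and gap: "\<And>t. 2 \<le> m (j + k * t)"
  shows "summable (\<lambda>n. 1 / real (\<Prod>i\<le>n. m i))"
proof -
  have lower: "2 ^ ((n - j) div k) \<le> (\<Prod>i<n. m i)" for n
  proof -
    define t where "t = (n - j) div k"
    define I where "I = (\<lambda>s. j + k * s) ` {..<t}"
    have In: "I \<subseteq> {..<n}"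
    proof
      fix i assume "i \<in> I"
      then obtain s where s: "s < t" "i = j + k * s" by (auto simp: I_def)
      have "k * s < k * t" using s(1) k by simp
      moreover have "k * t \<le> n - j" unfolding t_def by simp
      ultimately have "k * s < n - j" by linarith
      then show "i \<in> {..<n}" using s(2) by simp
    qed
    have cI: "card I = t" unfolding I_def using k by (subst card_image) (auto simp: inj_on_def)
    have "2 ^ card I = (\<Prod>i\<in>I. (2::nat))" by simp
    also have "\<dots> \<le> (\<Prod>i\<in>I. m i)" using gap by (intro prod_mono) (auto simp: I_def)
    also have "\<dots> \<le> (\<Prod>i<n. m i)" using In m by (intro dvd_imp_le prod_dvd_prod_subset prod_pos) (auto simp: Suc_le_eq)
    finally show ?thesis by (simp add: cI t_def)
  qed
  define q where "q = root k (1/2)"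
  have q: "0 < q" "q < 1" "q ^ k = 1/2" using k by (auto simp: q_def)
  show ?thesis
  proof (rule summable_comparison_test)
    show "summable (\<lambda>n. q ^ n * (1 / q ^ (j + k)))" using q by (intro summable_mult2 summable_geometric) auto
    have "1 / real (\<Prod>i\<le>n. m i) \<le> q ^ n * (1 / q ^ (j + k))" for n
    proof -
      let ?D = "(Suc n - j) div k"
      have "(Suc n - j) mod k < k" using k by simp
      then have "n \<le> k * ?D + (j + k)" using mult_div_mod_eq[of k "Suc n - j"] by linarith
      then have "q ^ (k * ?D + (j + k)) \<le> q ^ n" using q by (intro power_decreasing) auto
      then have "(1/2) ^ ?D * q ^ (j + k) \<le> q ^ n" by (simp only: power_add power_mult q(3))
      then have le: "(1/2) ^ ?D \<le> q ^ n * (1 / q ^ (j + k))" using q by (simp add: pos_le_divide_eq)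
      moreover have "2 ^ ?D \<le> real (\<Prod>i\<le>n. m i)"
        using lower[of "Suc n"] by (simp only: lessThan_Suc_atMost) (metis of_nat_le_iff of_nat_numeral of_nat_power)
      moreover from this have "0 < real (\<Prod>i\<le>n. m i)" by (rule less_le_trans[rotated]) simp
      ultimately have "1 / real (\<Prod>i\<le>n. m i) \<le> 1 / 2 ^ ?D" by (intro divide_left_mono mult_pos_pos) auto
      then show ?thesis using le by (simp add: power_divide)
    qed
    then show "\<exists>N. \<forall>n\<ge>N. norm (1 / real (\<Prod>i\<le>n. m i)) \<le> q ^ n * (1 / q ^ (j + k))" by (auto simp: abs_prod)
  qed
qed

definition biholo :: "complex set \<Rightarrow> (complex \<Rightarrow> complex) \<Rightarrow> (complex \<Rightarrow> complex) \<Rightarrow> bool" where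
  "biholo U \<phi> \<psi> \<longleftrightarrow> \<phi> holomorphic_on U \<and> \<psi> holomorphic_on ball 0 1 \<and>
     (\<forall>z\<in>U. \<phi> z \<in> ball 0 1 \<and> \<psi> (\<phi> z) = z) \<and> (\<forall>w\<in>ball 0 1. \<psi> w \<in> U \<and> \<phi> (\<psi> w) = w)"

lemma biholoD:
  assumes "biholo U \<phi> \<psi>"
  shows "\<phi> holomorphic_on U" "\<psi> holomorphic_on ball 0 1" "z \<in> U \<Longrightarrow> norm (\<phi> z) < 1" "z \<in> U \<Longrightarrow> \<psi> (\<phi> z) = z"
    "norm w < 1 \<Longrightarrow> \<psi> w \<in> U" "norm w < 1 \<Longrightarrow> \<phi> (\<psi> w) = w"
  using assms by (auto simp: biholo_def)

lemma riemann_centre: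
  assumes "open U" "simply_connected U" "U \<noteq> UNIV" "c \<in> U"
  obtains \<phi> \<psi> where "biholo U \<phi> \<psi>" "\<phi> c = 0"
proof -
  obtain F G where FG: "F holomorphic_on U" "G holomorphic_on ball 0 1"
    "\<And>z. z \<in> U \<Longrightarrow> F z \<in> ball 0 1 \<and> G (F z) = z" "\<And>z. z \<in> ball 0 1 \<Longrightarrow> G z \<in> U \<and> F (G z) = z"
    using Riemann_mapping_theorem[of U] assms by blast
  obtain a b where ab: "a (F c) = 0" "a holomorphic_on ball 0 1" "b holomorphic_on ball 0 1"
    "\<And>z. z \<in> ball 0 1 \<Longrightarrow> a z \<in> ball 0 1 \<and> b (a z) = z" "\<And>z. z \<in> ball 0 1 \<Longrightarrow> b z \<in> ball 0 1 \<and> a (b z) = z"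
  proof -
    obtain a b where ab: "a (F c) = 0" "a holomorphic_on ball 0 1" "a ` ball 0 1 \<subseteq> ball 0 1" "b holomorphic_on ball 0 1"
       "b ` ball 0 1 \<subseteq> ball 0 1" "\<And>z. z \<in> ball 0 1 \<Longrightarrow> a (b z) = z" "\<And>z. z \<in> ball 0 1 \<Longrightarrow> b (a z) = z"
      using ball_biholomorphism_exists[of "F c"] FG(3)[OF assms(4)] by blast
    show ?thesis by (rule that[OF ab(1,2,4)]) (use ab in blast)+
  qed
  have "(a \<circ> F) holomorphic_on U" "(G \<circ> b) holomorphic_on ball 0 1"
    using FG ab by (auto intro!: holomorphic_on_compose_gen[where t = "ball 0 1"])
  then have "biholo U (a \<circ> F) (G \<circ> b)" unfolding biholo_def using FG(3,4) ab(4,5) by simp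
  then show ?thesis using that ab(1) by simp
qed

context pcf_poly
begin

text \<open>In Riemann maps that send centres to 0, f becomes a proper map of the disc; by
  \<open>centre_preimage\<close> its only zero is 0.\<close>

lemma comp_power_map:
  assumes U: "U \<in> comps" and b: "biholo U \<phi> \<psi>" "\<phi> (centre U) = 0"
    and b': "biholo (poly f ` U) \<phi>' \<psi>'" "\<phi>' (centre (poly f ` U)) = 0"
  obtains c m where "norm c = 1" "m \<ge> 1" "\<And>w. norm w < 1 \<Longrightarrow> \<phi>' (poly f (\<psi> w)) = c * w ^ m"
proof -
  let ?V = "poly f ` U"
  have V: "?V \<in> comps" by (rule comps_image[OF U])
  have \<psi>: "\<psi> w \<in> U" "\<phi> (\<psi> w) = w" if "norm w < 1" for w using b(1) that by (auto simp: biholo_def)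
  have \<phi>: "norm (\<phi> z) < 1" "\<psi> (\<phi> z) = z" if "z \<in> U" for z using b(1) that by (auto simp: biholo_def)
  have \<psi>': "\<psi>' w \<in> ?V" "\<phi>' (\<psi>' w) = w" if "norm w < 1" for w using b'(1) that by (auto simp: biholo_def)
  have \<phi>': "norm (\<phi>' z) < 1" "\<psi>' (\<phi>' z) = z" if "z \<in> ?V" for z using b'(1) that by (auto simp: biholo_def)
  define h where "h w = \<phi>' (poly f (\<psi> w))" for w
  have "(\<phi>' \<circ> (poly f \<circ> \<psi>)) holomorphic_on ball 0 1"
    using b b' \<psi>(1) by (intro holomorphic_on_compose_gen[where t = ?V] holomorphic_on_compose holomorphic_on_poly)
      (auto simp: biholo_def)
  moreover have "h = \<phi>' \<circ> (poly f \<circ> \<psi>)" by (simp add: h_def fun_eq_iff)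
  ultimately have hol: "h holomorphic_on ball 0 1" by simp
  show ?thesis
  proof (rule proper_disc_map[OF hol])
    show "norm (h w) < 1" if "norm w < 1" for w using \<phi>'(1) \<psi>(1)[OF that] by (simp add: h_def)
    show "h w = 0 \<longleftrightarrow> w = 0" if w: "norm w < 1" for w
    proof -
      have "h w = 0 \<longleftrightarrow> poly f (\<psi> w) = centre ?V"
        using \<phi>'(2)[of "poly f (\<psi> w)"] \<phi>'(2)[OF centre(1)[OF V]] b'(2) \<psi>(1)[OF w] by (auto simp: h_def)
      also have "\<dots> \<longleftrightarrow> \<psi> w = centre U" using centre_preimage[OF U \<psi>(1)[OF w], of 1] by simp
      also have "\<dots> \<longleftrightarrow> w = 0" using \<psi>(2)[OF w] \<phi>(2)[OF centre(1)[OF U]] b(2) by auto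
      finally show ?thesis .
    qed
    show "\<exists>s<1. \<forall>w. norm w < 1 \<longrightarrow> norm (h w) \<le> \<rho> \<longrightarrow> norm w \<le> s" if \<rho>: "\<rho> < 1" for \<rho>
    proof -
      define D where "D = \<psi>' ` cball 0 \<rho>"
      have "cball 0 \<rho> \<subseteq> ball (0::complex) 1" using \<rho> by auto
      then have "compact D" unfolding D_def using b'(1)
        by (intro compact_continuous_image) (auto simp: biholo_def intro: holomorphic_on_imp_continuous_on continuous_on_subset)
      moreover have DV: "D \<subseteq> ?V" unfolding D_def using \<psi>'(1) \<rho> by auto
      define C where "C = closure U \<inter> poly f -` D"
      have "closed C" unfolding C_def
        by (intro closed_Int closed_closure closed_vimage continuous_intros compact_imp_closed[OF \<open>compact D\<close>])
      moreover have "C \<subseteq> K" using comps_closure(1)[OF U] by (auto simp: C_def)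
      ultimately have "compact C" using K_compact by (metis compact_Int_closed inf.absorb2)
      have CU: "C \<subseteq> U"
      proof
        fix z assume z: "z \<in> C"
        then have "poly f z \<in> interior K" using DV comps_sub[OF V] by (auto simp: C_def)
        then have "z \<in> interior K" by (simp add: K_int_step)
        then show "z \<in> U" using z comps_closure(2)[OF U] by (auto simp: C_def)
      qed
      have "compact (\<phi> ` C)" using \<open>compact C\<close> b(1) CU
        by (intro compact_continuous_image) (auto simp: biholo_def intro: holomorphic_on_imp_continuous_on continuous_on_subset)
      moreover have "\<phi> ` C \<subseteq> ball 0 1" using \<phi>(1) CU by auto
      ultimately have "\<exists>s<1. \<phi> ` C \<subseteq> cball 0 s"
      proof (cases "C = {}")
        case False
        then obtain x where "x \<in> \<phi> ` C" "\<And>y. y \<in> \<phi> ` C \<Longrightarrow> norm y \<le> norm x"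
          using continuous_attains_sup[OF \<open>compact (\<phi> ` C)\<close>, of norm] by (auto intro: continuous_intros)
        then show ?thesis using \<open>\<phi> ` C \<subseteq> ball 0 1\<close> by (intro exI[of _ "norm x"]) auto
      qed (auto intro: exI[of _ 0])
      then obtain s where s: "s < 1" "\<phi> ` C \<subseteq> cball 0 s" by auto
      have "norm w \<le> s" if w: "norm w < 1" "norm (h w) \<le> \<rho>" for w
      proof -
        have "poly f (\<psi> w) = \<psi>' (h w)" using \<phi>'(2)[of "poly f (\<psi> w)"] \<psi>(1)[OF w(1)] by (simp add: h_def)
        then have "\<psi> w \<in> C" unfolding C_def D_def using w \<psi>(1)[OF w(1)] closure_subset by auto
        then show ?thesis using s(2) \<psi>(2)[OF w(1)] by force
      qed
      then show ?thesis using s(1) by blast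
    qed
  qed (use that h_def in auto)
qed

lemma comp_riemann: "U \<in> comps \<Longrightarrow> \<exists>\<phi> \<psi>. biholo U \<phi> \<psi> \<and> \<phi> (centre U) = 0"
proof -
  assume U: "U \<in> comps"
  have "U \<noteq> UNIV" using component_frontier_J(5)[OF U] not_bounded_UNIV by blast
  then show ?thesis using riemann_centre[OF comps_open[OF U] comps_simply_connected[OF U] _ centre(1)[OF U]] by metis
qed

lemma biholo_deriv:
  assumes "biholo U \<phi> \<psi>" "open U" "z \<in> U"
  shows "deriv \<phi> z \<noteq> 0" "deriv \<psi> (\<phi> z) \<noteq> 0"
proof -
  have inj: "inj_on \<phi> U" by (rule inj_on_inverseI[where g = \<psi>]) (rule biholoD(4)[OF assms(1)])
  show "deriv \<phi> z \<noteq> 0" using holomorphic_injective_imp_regular[of \<phi> U z] assms inj by (auto simp: biholo_def)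
  have inj: "inj_on \<psi> (ball 0 1)" by (rule inj_on_inverseI[where g = \<phi>]) (simp add: biholoD(6)[OF assms(1)])
  show "deriv \<psi> (\<phi> z) \<noteq> 0" using holomorphic_injective_imp_regular[of \<psi> "ball 0 1" "\<phi> z"] assms inj by (auto simp: biholo_def)
qed

text \<open>The first claim compares derivatives at the centre; the second exhibits m points with
  the same image.\<close>

lemma comp_degree:
  assumes U: "U \<in> comps" and b: "biholo U \<phi> \<psi>" "\<phi> (centre U) = 0"
    and b': "biholo (poly f ` U) \<phi>' \<psi>'"
    and m: "norm c = 1" "m \<ge> 1" "\<And>w. norm w < 1 \<Longrightarrow> \<phi>' (poly f (\<psi> w)) = c * w ^ m"
  shows "m \<ge> 2 \<longleftrightarrow> poly (pderiv f) (centre U) = 0" "m \<le> degree f"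
proof -
  let ?V = "poly f ` U" and ?z = "centre U"
  have V: "?V \<in> comps" by (rule comps_image[OF U])
  have z: "?z \<in> U" "\<psi> 0 = ?z" using centre(1)[OF U] b by (auto simp: biholo_def)
  have "(\<psi> has_field_derivative deriv \<psi> 0) (at 0)" using b(1) by (intro holomorphic_derivI[of \<psi> "ball 0 1"]) (auto simp: biholo_def)
  moreover have "(poly f has_field_derivative poly (pderiv f) ?z) (at (\<psi> 0))" using z(2) poly_DERIV by simp
  moreover have "(\<phi>' has_field_derivative deriv \<phi>' (poly f ?z)) (at (poly f (\<psi> 0)))"
    unfolding z(2) using b' z(1) comps_open[OF V] by (intro holomorphic_derivI[of \<phi>' ?V]) (auto simp: biholo_def)
  ultimately have D1: "((\<lambda>w. \<phi>' (poly f (\<psi> w))) has_field_derivative deriv \<phi>' (poly f ?z) * (poly (pderiv f) ?z * deriv \<psi> 0)) (at 0)"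
    by (intro DERIV_chain2[of \<phi>'] DERIV_chain2[of "poly f"])
  have "((\<lambda>w. c * w ^ m) has_field_derivative deriv \<phi>' (poly f ?z) * (poly (pderiv f) ?z * deriv \<psi> 0)) (at 0)"
    by (rule has_field_derivative_transform_within_open[OF D1 open_ball, of 0 1]) (use m(3) in auto)
  moreover have "((\<lambda>w. c * w ^ m) has_field_derivative c * (of_nat m * 0 ^ (m - 1))) (at 0)" by (auto intro!: derivative_eq_intros)
  ultimately have eq: "deriv \<phi>' (poly f ?z) * (poly (pderiv f) ?z * deriv \<psi> 0) = c * (of_nat m * 0 ^ (m - 1))" by (rule DERIV_unique)
  have "deriv \<phi>' (poly f ?z) \<noteq> 0" using biholo_deriv(1)[OF b' comps_open[OF V]] z(1) by auto
  moreover have "deriv \<psi> 0 \<noteq> 0" using biholo_deriv(2)[OF b(1) comps_open[OF U] z(1)] b(2) by simp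
  moreover have "c \<noteq> 0" using m(1) by auto
  ultimately have "poly (pderiv f) ?z = 0 \<longleftrightarrow> of_nat m * (0::complex) ^ (m - 1) = 0" using eq by (metis mult_eq_0_iff)
  also have "\<dots> \<longleftrightarrow> m \<ge> 2" using m(2) by (cases "m = 1") (auto simp: zero_power)
  finally show "m \<ge> 2 \<longleftrightarrow> poly (pderiv f) ?z = 0" by simp
  show "m \<le> degree f"
  proof -
    \<comment> \<open>The m points of modulus 1/2 whose m-th power is (1/2)^m; f sends the
      corresponding points of U to one point y.\<close>
    define A where "A = (\<lambda>w. w / 2) ` {w::complex. w ^ m = 1}"
    have "card {w::complex. w ^ m = 1} = m" using m(2) card_roots_unity_eq by simp
    then have cA: "card A = m" unfolding A_def by (subst card_image) (auto simp: inj_on_def)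
    have nA: "norm w < 1" "w ^ m = (1/2) ^ m" if wA: "w \<in> A" for w
    proof -
      obtain v where v: "v ^ m = 1" "w = v / 2" using wA unfolding A_def by blast
      then have "norm v ^ m = 1" by (metis norm_one norm_power)
      then have "norm v = 1" using m(2) power_eq_1_iff[of "norm v" m] by auto
      then show "norm w < 1" "w ^ m = (1/2) ^ m" unfolding v(2) using v(1) by (simp_all add: norm_divide power_divide)
    qed
    define y where "y = \<psi>' (c * (1/2) ^ m)"
    have "inj_on \<psi> A" using nA(1) b(1) unfolding biholo_def by (intro inj_onI) (metis dist_0_norm mem_ball)
    moreover have "\<psi> ` A \<subseteq> {z. poly f z = y}"
    proof clarify
      fix w assume w: "w \<in> A"
      have "\<psi> w \<in> U" using nA(1)[OF w] b(1) by (auto simp: biholo_def)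
      then have "poly f (\<psi> w) = \<psi>' (\<phi>' (poly f (\<psi> w)))" using b' by (auto simp: biholo_def)
      then show "poly f (\<psi> w) = y" using m(3)[OF nA(1)[OF w]] nA(2)[OF w] by (simp add: y_def)
    qed
    ultimately have "m \<le> card {z. poly f z = y}" using finite_poly_fibre[OF degpos, of y] cA by (metis card_image card_mono)
    also have "\<dots> = card {z. poly (f - [:y:]) z = 0}" by (rule arg_cong[where f = card]) auto
    also have "\<dots> \<le> degree (f - [:y:])" using poly_minus_const_nonzero[OF degpos] by (intro card_poly_roots_bound)
    also have "\<dots> \<le> degree f" by (rule degree_diff_le) auto
    finally show ?thesis .
  qed
qed

text \<open>The centre lands on a superattracting cycle, on which a critical point recurs with
  period k.\<close>

lemma crit_recurrent:
  assumes U: "U \<in> comps"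
  obtains j k where "k > 0" "\<And>t. poly (pderiv f) (centre (iter f (j + k * t) ` U)) = 0"
proof -
  obtain n where n: "iter f n (centre U) \<in> Acyc" using centre(2)[OF U] by blast
  obtain i k where ik: "poly (pderiv f) (iter f i (iter f n (centre U))) = 0" "i < k" "iter f k (iter f n (centre U)) = iter f n (centre U)"
    using Acyc_periodic[OF n] .
  have per: "iter f (k * t) (iter f n (centre U)) = iter f n (centre U)" for t by (induction t) (use ik(3) in \<open>auto simp: iter_add\<close>)
  have "centre (iter f ((i + n) + k * t) ` U) = iter f i (iter f n (centre U))" for t
  proof -
    have "centre (iter f ((i + n) + k * t) ` U) = iter f ((i + n) + k * t) (centre U)"
      using centre_preimage[OF U centre(1)[OF U]] by metis
    also have "\<dots> = iter f (i + (k * t + n)) (centre U)" by (simp add: ac_simps)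
    also have "\<dots> = iter f i (iter f (k * t) (iter f n (centre U)))" unfolding iter_add ..
    finally show ?thesis using per by simp
  qed
  then show ?thesis using that[of k "i + n"] ik by simp
qed

definition "normal_system \<phi> \<psi> d \<longleftrightarrow> (\<forall>U\<in>comps. biholo U (\<phi> U) (\<psi> U) \<and> \<phi> U (centre U) = 0 \<and> (1::nat) \<le> d U \<and>
   (\<forall>z\<in>U. \<phi> (poly f ` U) (poly f z) = \<phi> U z ^ d U))"

text \<open>Each Riemann map is rotated by a unit \<open>lam U\<close>. The constant c(U) disappears
  when lam(U)^m = c(U) lam(f(U)), that is, when the angles satisfy m \<alpha>(U) = \<theta>(U) +
  \<alpha>(f(U)). Iterating this forward along the orbit of U gives a series for \<alpha>(U), for
  periodic and for strictly preperiodic components alike.\<close>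

lemma normal_system_exists: "\<exists>\<phi> \<psi> d. normal_system \<phi> \<psi> d"
proof -
  obtain \<phi>0 \<psi>0 where b: "\<And>U. U \<in> comps \<Longrightarrow> biholo U (\<phi>0 U) (\<psi>0 U)" "\<And>U. U \<in> comps \<Longrightarrow> \<phi>0 U (centre U) = 0" using comp_riemann by metis
  have "\<exists>c m. norm c = 1 \<and> m \<ge> (1::nat) \<and> (\<forall>w. norm w < 1 \<longrightarrow> \<phi>0 (poly f ` U) (poly f (\<psi>0 U w)) = c * w ^ m)" if "U \<in> comps" for U
    using comp_power_map[OF that b(1,2)[OF that] b(1,2)[OF comps_image[OF that]]] by metis
  then obtain c m where cm: "\<And>U. U \<in> comps \<Longrightarrow> norm (c U) = 1" "\<And>U. U \<in> comps \<Longrightarrow> m U \<ge> (1::nat)"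
    "\<And>U w. U \<in> comps \<Longrightarrow> norm w < 1 \<Longrightarrow> \<phi>0 (poly f ` U) (poly f (\<psi>0 U w)) = c U * w ^ m U" by metis
  define \<theta> where "\<theta> U = Arg (c U)" for U
  have c\<theta>: "c U = cis (\<theta> U)" if "U \<in> comps" for U
    using cm(1)[OF that] by (simp add: \<theta>_def cis_Arg sgn_eq) (metis cis_Arg div_by_1 norm_eq_zero of_real_1 sgn_eq zero_neq_one)
  have \<theta>b: "\<bar>\<theta> U\<bar> \<le> pi" for U using Arg_bounded[of "c U"] by (auto simp: \<theta>_def abs_le_iff)
  define S where "S n U = iter f n ` U" for n U
  have S: "S n U \<in> comps" if "U \<in> comps" for n U using comps_image_iter[OF that] by (simp add: S_def)
  have SS: "S n (poly f ` U) = S (Suc n) U" for n U by (simp add: S_def image_image iter_Suc' del: funpow.simps)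
  have S0: "S 0 U = U" for U by (simp add: S_def)
  \<comment> \<open>The terms of the forward iteration. They are summable because critical centres,
    and with them exponents of at least 2, recur along the orbit of U.\<close>
  define a where "a U n = \<theta> (S n U) / real (\<Prod>i\<le>n. m (S i U))" for U n
  have m0: "m (S i U) > 0" if "U \<in> comps" for i U using cm(2)[OF S[OF that]] by (simp add: Suc_le_eq)
  have sum: "summable (a U)" if U: "U \<in> comps" for U
  proof (rule summable_comparison_test)
    obtain j k where jk: "k > 0" "\<And>t. poly (pderiv f) (centre (iter f (j + k * t) ` U)) = 0" using crit_recurrent[OF U] by metis
    have "m (S (j + k * t) U) \<ge> 2" for t
    proof -
      let ?V = "S (j + k * t) U"
      have V: "?V \<in> comps" by (rule S[OF U])
      show ?thesis using comp_degree(1)[OF V b(1,2)[OF V] b(1)[OF comps_image[OF V]] cm(1,2,3)[OF V]] jk(2)[of t] by (simp add: S_def)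
    qed
    then have "summable (\<lambda>n. 1 / real (\<Prod>i\<le>n. m (S i U)))"
      using m0[OF U] jk(1) by (intro summable_prod_gap[of _ k j]) (auto simp: Suc_le_eq)
    then show "summable (\<lambda>n. pi * (1 / real (\<Prod>i\<le>n. m (S i U))))" by (rule summable_mult)
    show "\<exists>N. \<forall>n\<ge>N. norm (a U n) \<le> pi * (1 / real (\<Prod>i\<le>n. m (S i U)))"
      using \<theta>b by (intro exI[of _ 0]) (auto simp: a_def abs_divide abs_prod intro!: divide_right_mono prod_nonneg)
  qed
  define \<alpha> where "\<alpha> U = suminf (a U)" for U
  have \<alpha>: "real (m U) * \<alpha> U = \<theta> U + \<alpha> (poly f ` U)" if U: "U \<in> comps" for U
  proof -
    have mU: "m U > 0" using m0[OF U, of 0] by (simp add: S0)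
    have "a U (Suc n) = a (poly f ` U) n / real (m U)" for n
    proof -
      have "(\<Prod>i\<le>Suc n. m (S i U)) = m U * (\<Prod>i\<le>n. m (S i (poly f ` U)))" by (simp only: prod.atMost_Suc_shift SS S0)
      then show ?thesis by (simp add: a_def SS)
    qed
    then have "suminf (\<lambda>n. a U (Suc n)) = \<alpha> (poly f ` U) / real (m U)"
      unfolding \<alpha>_def using sum[OF comps_image[OF U]] by (simp add: suminf_divide)
    moreover have "suminf (\<lambda>n. a U (Suc n)) = \<alpha> U - a U 0" unfolding \<alpha>_def by (rule suminf_split_head[OF sum[OF U]])
    moreover have "a U 0 = \<theta> U / real (m U)" by (simp add: a_def S0)
    ultimately show ?thesis using mU by (simp add: field_simps)
  qed
  define lam where "lam U = cis (\<alpha> U)" for U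
  have lam1: "norm (lam U) = 1" "lam U * inverse (lam U) = 1" for U by (auto simp: lam_def cis_mult)
  have lamm: "lam U ^ m U = c U * lam (poly f ` U)" if U: "U \<in> comps" for U
    unfolding lam_def Complex.DeMoivre c\<theta>[OF U] cis_mult using \<alpha>[OF U] by simp
  define \<phi> where "\<phi> U z = lam U * \<phi>0 U z" for U z
  define \<psi> where "\<psi> U w = \<psi>0 U (inverse (lam U) * w)" for U w
  have nl: "norm (inverse (lam U) * w) = norm w" for U w using lam1(1)[of U] by (simp add: norm_mult norm_inverse)
  have "biholo U (\<phi> U) (\<psi> U)" if U: "U \<in> comps" for U unfolding biholo_def
  proof (intro conjI ballI)
    note B = biholoD[OF b(1)[OF U]]
    show "\<phi> U holomorphic_on U" unfolding \<phi>_def by (intro holomorphic_intros B)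
    have "(\<psi>0 U \<circ> (\<lambda>w. inverse (lam U) * w)) holomorphic_on ball 0 1"
      by (intro holomorphic_on_compose_gen[OF _ B(2)] holomorphic_intros) (auto simp: nl)
    then show "\<psi> U holomorphic_on ball 0 1" by (simp add: \<psi>_def[abs_def] o_def)
    show "\<phi> U z \<in> ball 0 1" if "z \<in> U" for z using B(3)[OF that] lam1 by (simp add: \<phi>_def norm_mult)
    show "\<psi> U (\<phi> U z) = z" if "z \<in> U" for z
      using B(4)[OF that] lam1(2)[of U] by (simp add: \<phi>_def \<psi>_def mult.assoc[symmetric] mult.commute[of "inverse (lam U)"])
    show "\<psi> U w \<in> U" "\<phi> U (\<psi> U w) = w" if "w \<in> ball 0 1" for w
      using B(5,6)[of "inverse (lam U) * w"] nl that lam1(2)[of U] by (simp_all add: \<phi>_def \<psi>_def mult.assoc[symmetric])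
  qed
  moreover have "\<phi> (poly f ` U) (poly f z) = \<phi> U z ^ m U" if U: "U \<in> comps" and z: "z \<in> U" for U z
    using cm(3)[OF U, of "\<phi>0 U z"] biholoD(3,4)[OF b(1)[OF U] z] lamm[OF U] by (simp add: \<phi>_def power_mult_distrib)
  ultimately have "normal_system \<phi> \<psi> m" unfolding normal_system_def using b(2) cm(2) by (auto simp: \<phi>_def)
  then show ?thesis by blast
qed

end

section \<open>Estimates for the Riemann maps near the unit circle\<close>

lemma max_modulus_cball:
  assumes "continuous_on (cball 0 1) g" "g holomorphic_on ball 0 1" "norm w \<le> 1" "\<And>z. norm z = 1 \<Longrightarrow> norm (g z) \<le> B"
  shows "norm (g w :: complex) \<le> B"
proof (rule maximum_modulus_frontier[of g "cball 0 1"])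
  show "norm (g z) \<le> B" if "z \<in> frontier (cball 0 1)" for z using that assms(4) by (auto simp: frontier_cball)
qed (use assms in auto)

lemma exp_neg_lipschitz: "0 \<le> x \<Longrightarrow> 0 \<le> y \<Longrightarrow> \<bar>exp (-x) - exp (-y)\<bar> \<le> \<bar>x - y :: real\<bar>"
proof -
  have main: "\<bar>exp (-x) - exp (-y)\<bar> \<le> \<bar>x - y\<bar>" if "0 \<le> x" "x \<le> y" for x y :: real
  proof -
    have "exp (-x) - exp (-y) = exp (-x) * (1 - exp (x - y))" by (simp add: algebra_simps flip: exp_add)
    also have "\<dots> \<le> 1 * (1 - exp (x - y))" using that by (intro mult_right_mono) auto
    also have "\<dots> \<le> y - x" using exp_ge_add_one_self[of "x - y"] by (simp only: mult_1)
    finally show ?thesis using that by (simp add: abs_le_iff)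
  qed
  show "0 \<le> x \<Longrightarrow> 0 \<le> y \<Longrightarrow> ?thesis" using main[of x y] main[of y x] by (cases "x \<le> y") (auto simp: abs_minus_commute)
qed

lemma norm_cis_diff_le: "norm (cis a - cis b) \<le> \<bar>a - b\<bar>"
proof -
  have "cis a - cis b = cis ((a + b) / 2) * Complex 0 (2 * sin ((a - b) / 2))"
  proof (rule complex_eqI)
    have "sin ((b - a) / 2) = - sin ((a - b) / 2)" by (metis minus_diff_eq minus_divide_left sin_minus)
    then show "Re (cis a - cis b) = Re (cis ((a + b) / 2) * Complex 0 (2 * sin ((a - b) / 2)))" using cos_diff_cos[of a b] by simp
    show "Im (cis a - cis b) = Im (cis ((a + b) / 2) * Complex 0 (2 * sin ((a - b) / 2)))" using sin_diff_sin[of a b] by simp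
  qed
  then have "norm (cis a - cis b) = 2 * \<bar>sin ((a - b) / 2)\<bar>" by (simp add: norm_mult cmod_eq_Im)
  also have "\<dots> \<le> 2 * \<bar>(a - b) / 2\<bar>" using abs_sin_x_le_abs_x[of "(a - b) / 2"] by simp
  finally show ?thesis by simp
qed

context pcf_poly
begin

definition "nsys = (SOME t. normal_system (fst t) (fst (snd t)) (snd (snd t)))"
definition "nphi = fst nsys"
definition "npsi = fst (snd nsys)"
definition "ndeg = snd (snd nsys)"

lemma nsys: "normal_system nphi npsi ndeg"
proof -
  have "\<exists>t. normal_system (fst t) (fst (snd t)) (snd (snd t))" using normal_system_exists by auto
  then have "normal_system (fst nsys) (fst (snd nsys)) (snd (snd nsys))" unfolding nsys_def by (rule someI_ex)
  then show ?thesis by (simp add: nphi_def npsi_def ndeg_def)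
qed

lemma nbiholo: "U \<in> comps \<Longrightarrow> biholo U (nphi U) (npsi U)" using nsys by (simp add: normal_system_def)
lemma nphi_centre: "U \<in> comps \<Longrightarrow> nphi U (centre U) = 0" using nsys by (simp add: normal_system_def)
lemma ndeg_pos: "U \<in> comps \<Longrightarrow> 1 \<le> ndeg U" using nsys by (simp add: normal_system_def)
lemma nphi_step: "U \<in> comps \<Longrightarrow> z \<in> U \<Longrightarrow> nphi (poly f ` U) (poly f z) = nphi U z ^ ndeg U"
  using nsys by (simp add: normal_system_def)

lemmas nB = biholoD[OF nbiholo]

lemma npsi_step:
  assumes U: "U \<in> comps" and w: "norm w < 1"
  shows "poly f (npsi U w) = npsi (poly f ` U) (w ^ ndeg U)"
proof -
  have "poly f (npsi U w) \<in> poly f ` U" using nB(5)[OF U w] by simp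
  then have "npsi (poly f ` U) (nphi (poly f ` U) (poly f (npsi U w))) = poly f (npsi U w)" by (rule nB(4)[OF comps_image[OF U]])
  then show ?thesis using nphi_step[OF U nB(5)[OF U w]] nB(6)[OF U w] by simp
qed

lemma ndeg_bounds:
  assumes U: "U \<in> comps"
  shows "ndeg U \<ge> 2 \<longleftrightarrow> poly (pderiv f) (centre U) = 0" "ndeg U \<le> degree f"
proof -
  have "nphi (poly f ` U) (poly f (npsi U w)) = 1 * w ^ ndeg U" if "norm w < 1" for w
    using nphi_step[OF U nB(5)[OF U that]] nB(6)[OF U that] by simp
  from comp_degree[OF U nbiholo[OF U] nphi_centre[OF U] nbiholo[OF comps_image[OF U]] _ ndeg_pos[OF U] this]
  show "ndeg U \<ge> 2 \<longleftrightarrow> poly (pderiv f) (centre U) = 0" "ndeg U \<le> degree f" by simp_all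
qed

text \<open>The degree of the n-th iterate on U: in coordinates it is the power map with this
  exponent (\<open>npsi_iter\<close>).\<close>

definition "Mp n U = (\<Prod>i<n. ndeg (iter f i ` U))"

lemma Mp_Suc: "Mp (Suc n) U = Mp n U * ndeg (iter f n ` U)" by (simp add: Mp_def)

lemma Mp_pos: "U \<in> comps \<Longrightarrow> 1 \<le> Mp n U"
  unfolding Mp_def using ndeg_pos[OF comps_image_iter] by (intro prod_ge_1) auto

lemma npsi_iter:
  assumes U: "U \<in> comps" and w: "norm w < 1"
  shows "iter f n (npsi U w) = npsi (iter f n ` U) (w ^ Mp n U)"
proof (induction n)
  case (Suc n)
  have nw: "norm (w ^ Mp n U) < 1" using w Mp_pos[OF U, of n] by (simp add: norm_power power_less_one_iff)
  have "iter f (Suc n) (npsi U w) = poly f (npsi (iter f n ` U) (w ^ Mp n U))" using Suc by simp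
  also have "\<dots> = npsi (poly f ` (iter f n ` U)) ((w ^ Mp n U) ^ ndeg (iter f n ` U))" by (rule npsi_step[OF comps_image_iter[OF U] nw])
  also have "poly f ` (iter f n ` U) = iter f (Suc n) ` U" by (simp add: image_image)
  finally show ?case by (simp add: Mp_Suc power_mult)
qed (simp add: Mp_def)

text \<open>The periodic components, characterised by their centres.\<close>

definition "percomps = {U \<in> comps. centre U \<in> Acyc}"

lemma percomps_comps: "U \<in> percomps \<Longrightarrow> U \<in> comps" by (simp add: percomps_def)

lemma centre_iter: "U \<in> comps \<Longrightarrow> centre (iter f n ` U) = iter f n (centre U)"
  using centre_preimage[OF _ centre(1)] by metis

lemma percomps_iter: "U \<in> percomps \<Longrightarrow> iter f n ` U \<in> percomps"
  using comps_image_iter centre_iter Acyc_iter by (simp add: percomps_def)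

lemma percomps_finite: "finite percomps"
proof (rule finite_imageD)
  show "finite (centre ` percomps)" by (rule finite_subset[OF _ Acyc_finite]) (auto simp: percomps_def)
  show "inj_on centre percomps"
    unfolding percomps_def using centre(1) comps_eq by (intro inj_onI) (metis (no_types, lifting) mem_Collect_eq)
qed

lemma percomps_eventually: "U \<in> comps \<Longrightarrow> \<exists>n. iter f n ` U \<in> percomps"
  using centre(2)[of U] centre_iter[of U] comps_image_iter[of U] by (auto simp: percomps_def)

definition "entry U = (LEAST n. iter f n ` U \<in> percomps)"

lemma entry: "U \<in> comps \<Longrightarrow> iter f (entry U) ` U \<in> percomps"
  unfolding entry_def using percomps_eventually LeastI_ex by (metis (mono_tags, lifting))

lemma entry_less: "n < entry U \<Longrightarrow> iter f n ` U \<notin> percomps"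
  unfolding entry_def using not_less_Least by blast

lemma percomps_later: "iter f n ` U \<in> percomps \<Longrightarrow> n \<le> k \<Longrightarrow> iter f k ` U \<in> percomps"
proof -
  assume a: "iter f n ` U \<in> percomps" "n \<le> k"
  have "iter f k ` U = iter f (k - n) ` (iter f n ` U)" using a(2) by (simp add: image_image flip: iter_add)
  then show ?thesis using percomps_iter[OF a(1)] by simp
qed

text \<open>A critical centre met twice before the entry time would lie on a superattracting cycle
  and make its component periodic already. So each critical point contributes at most one factor, as
  in \<open>order_iter_bound\<close>.\<close>

lemma Mp_entry: assumes U: "U \<in> comps" shows "Mp (entry U) U \<le> Mx"
proof -
  let ?n = "entry U"
  define I where "I = {i. i < ?n \<and> 2 \<le> ndeg (iter f i ` U)}"
  have finI: "finite I" by (simp add: I_def)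
  have cr: "poly (pderiv f) (iter f i (centre U)) = 0" if "i \<in> I" for i
    using that ndeg_bounds(1)[OF comps_image_iter[OF U]] centre_iter[OF U] by (simp add: I_def)
  have "inj_on (\<lambda>i. iter f i (centre U)) I"
  proof (rule linorder_inj_onI)
    fix i j assume ij: "i < j" "i \<in> I" "j \<in> I"
    show "iter f i (centre U) \<noteq> iter f j (centre U)"
    proof
      let ?c = "iter f i (centre U)"
      assume eq: "?c = iter f j (centre U)"
      have "iter f (j - i) ?c = iter f (j - i + i) (centre U)" by (simp only: iter_add)
      then have "iter f (j - i) ?c = ?c" using ij(1) eq by simp
      then have "?c \<in> Acyc" unfolding Acyc_def using cr[OF ij(2)] ij(1)
        by (intro CollectI exI[of _ 0] exI[of _ ?c] exI[of _ "j - i"]) auto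
      then have "iter f i ` U \<in> percomps" using comps_image_iter[OF U] centre_iter[OF U] by (simp add: percomps_def)
      then show False using entry_less[of i U] ij(2) by (simp add: I_def)
    qed
  qed auto
  moreover have "(\<lambda>i. iter f i (centre U)) ` I \<subseteq> P" using crit_P cr by auto
  ultimately have card: "card I \<le> card P" using P_finite by (metis card_image card_mono)
  have "Mp ?n U = (\<Prod>i\<in>I. ndeg (iter f i ` U))" unfolding Mp_def
  proof (rule prod.mono_neutral_right)
    show "\<forall>i\<in>{..<?n} - I. ndeg (iter f i ` U) = 1"
    proof
      fix i assume "i \<in> {..<?n} - I"
      then show "ndeg (iter f i ` U) = 1" using ndeg_pos[OF comps_image_iter[OF U], of i] by (auto simp: I_def)
    qed
  qed (auto simp: I_def)
  also have "\<dots> \<le> (\<Prod>i\<in>I. degree f)" using ndeg_bounds(2)[OF comps_image_iter[OF U]] by (intro prod_mono) auto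
  also have "\<dots> \<le> Mx" using card degpos unfolding Mx_def by (auto intro!: power_increasing)
  finally show ?thesis .
qed

lemma Mp_lim: assumes U: "U \<in> comps" shows "(\<lambda>n. 1 / real (Mp n U)) \<longlonglongrightarrow> 0"
proof -
  obtain j k where jk: "k > 0" "\<And>t. poly (pderiv f) (centre (iter f (j + k * t) ` U)) = 0" using crit_recurrent[OF U] by metis
  have "2 \<le> ndeg (iter f (j + k * t) ` U)" for t using ndeg_bounds(1)[OF comps_image_iter[OF U]] jk(2)[of t] by simp
  then have "summable (\<lambda>n. 1 / real (\<Prod>i\<le>n. ndeg (iter f i ` U)))"
    using jk(1) ndeg_pos[OF comps_image_iter[OF U]] by (intro summable_prod_gap[of _ k j]) auto
  then have "(\<lambda>n. 1 / real (\<Prod>i\<le>n. ndeg (iter f i ` U))) \<longlonglongrightarrow> 0" by (rule summable_LIMSEQ_zero)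
  then have "(\<lambda>n. 1 / real (Mp (Suc n) U)) \<longlonglongrightarrow> 0" by (simp only: Mp_def lessThan_Suc_atMost)
  then show ?thesis by (rule LIMSEQ_imp_Suc)
qed

text \<open>In terms of -ln |w| this is the interval from 1 to \<open>degree f\<close>. It contains
  the interval from 1 to \<open>ndeg U\<close> for every component U, so every scale near the circle
  is sent into it by some iterate.\<close>

definition "annul = {w::complex. exp (- real (degree f)) \<le> norm w \<and> norm w \<le> exp (- 1)}"

lemma annul: "compact annul" "annul \<subseteq> ball 0 1" "0 \<notin> annul"
proof -
  have "annul = norm -` {exp (- real (degree f)) .. exp (- 1)}" by (auto simp: annul_def)
  moreover have "closed (norm -` {exp (- real (degree f)) .. exp (- 1)} :: complex set)" by (intro closed_vimage continuous_intros)
  moreover have "bounded annul" by (auto simp: bounded_iff annul_def)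
  ultimately show "compact annul" by (simp add: compact_eq_bounded_closed)
  have "norm w < 1" if "w \<in> annul" for w by (rule le_less_trans[of "norm w" "exp (- 1)" 1]) (use that in \<open>auto simp: annul_def\<close>)
  then show "annul \<subseteq> ball 0 1" by auto
  show "0 \<notin> annul" by (simp add: annul_def not_le)
qed

definition "annuli = (\<Union>W\<in>percomps. npsi W ` annul)"

lemma annuli: "compact annuli" "annuli \<subseteq> ball 0 R - Acyc"
proof -
  show "compact annuli" unfolding annuli_def
  proof (intro compact_UN percomps_finite compact_continuous_image annul(1))
    show "continuous_on annul (npsi W)" if "W \<in> percomps" for W
      using nB(2)[OF percomps_comps[OF that]] annul(2) holomorphic_on_imp_continuous_on continuous_on_subset by blast
  qed
  show "annuli \<subseteq> ball 0 R - Acyc"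
  proof
    fix z assume "z \<in> annuli"
    then obtain W w where W: "W \<in> percomps" "w \<in> annul" "z = npsi W w" by (auto simp: annuli_def)
    have Wc: "W \<in> comps" using W(1) by (rule percomps_comps)
    have w1: "norm w < 1" using W(2) annul(2) by auto
    have zW: "z \<in> W" using nB(5)[OF Wc w1] W(3) by simp
    then have "z \<in> ball 0 R" using comps_sub[OF Wc] interior_subset K_ball by blast
    moreover have "z \<notin> Acyc"
    proof
      assume "z \<in> Acyc"
      then have "z = centre W" using centre(3)[OF Wc zW, of 0] by simp
      then have "w = 0" using nphi_centre[OF Wc] nB(6)[OF Wc w1] W(3) by simp
      then show False using W(2) annul(3) by simp
    qed
    ultimately show "z \<in> ball 0 R - Acyc" by simp
  qed
qed

lemma base_uniform:
  assumes "e > 0"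
  obtains \<eta> where "\<eta> > 0" "\<And>W x y. W \<in> percomps \<Longrightarrow> x \<in> annul \<Longrightarrow> y \<in> annul \<Longrightarrow> dist x y < \<eta> \<Longrightarrow> dist (npsi W x) (npsi W y) < e"
proof -
  have "\<exists>\<eta>>0. \<forall>x\<in>annul. \<forall>y\<in>annul. dist x y < \<eta> \<longrightarrow> dist (npsi W x) (npsi W y) < e" if "W \<in> percomps" for W
  proof -
    have "continuous_on annul (npsi W)"
      using nB(2)[OF percomps_comps[OF that]] annul(2) holomorphic_on_imp_continuous_on continuous_on_subset by blast
    then have "uniformly_continuous_on annul (npsi W)" using annul(1) compact_uniformly_continuous by blast
    then show ?thesis unfolding uniformly_continuous_on_def using assms by (metis dist_commute)
  qed
  then obtain \<eta> where \<eta>: "\<And>W. W \<in> percomps \<Longrightarrow> \<eta> W > 0"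
    "\<And>W x y. W \<in> percomps \<Longrightarrow> x \<in> annul \<Longrightarrow> y \<in> annul \<Longrightarrow> dist x y < \<eta> W \<Longrightarrow> dist (npsi W x) (npsi W y) < e" by metis
  define \<eta>0 where "\<eta>0 = Min (insert 1 (\<eta> ` percomps))"
  have "\<eta>0 > 0" unfolding \<eta>0_def using percomps_finite \<eta>(1) by (subst Min_gr_iff) auto
  moreover have "\<eta>0 \<le> \<eta> W" if "W \<in> percomps" for W unfolding \<eta>0_def using percomps_finite that by auto
  ultimately show ?thesis using that \<eta>(2) by (meson less_le_trans)
qed

text \<open>The images of \<open>annul\<close> in the finitely many periodic components form a
  compact set off \<open>Acyc\<close>, so by \<open>expand\<close> pullbacks of paths in it are
  exponentially short.\<close>

lemma annul_track:
  obtains C q \<eta> where "0 < q" "q < 1" "0 < C" "0 < \<eta>"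
   "\<And>U n v N. U \<in> comps \<Longrightarrow> iter f n ` U \<in> percomps \<Longrightarrow> continuous_on {0..1} v \<Longrightarrow>
     (\<And>t. t \<in> {0..1} \<Longrightarrow> norm (v t) < 1 \<and> v t ^ Mp n U \<in> annul) \<Longrightarrow> N > 0 \<Longrightarrow>
     (\<And>t t'. t \<in> {0..1} \<Longrightarrow> t' \<in> {0..1} \<Longrightarrow> \<bar>t - t'\<bar> \<le> 1 / real N \<Longrightarrow> dist (v t ^ Mp n U) (v t' ^ Mp n U) < \<eta>) \<Longrightarrow>
     dist (npsi U (v 0)) (npsi U (v (1::real))) \<le> real N * (C * q ^ n)"
proof -
  obtain d q C where ex: "0 < d" "0 < q" "q < 1" "0 < C" "\<And>x n. x \<in> annuli \<Longrightarrow> small n (ball x d) (C * q ^ n)"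
    using expand[OF annuli] by metis
  obtain \<eta> where \<eta>: "\<eta> > 0" "\<And>W x y. W \<in> percomps \<Longrightarrow> x \<in> annul \<Longrightarrow> y \<in> annul \<Longrightarrow> dist x y < \<eta> \<Longrightarrow> dist (npsi W x) (npsi W y) < d"
    using base_uniform[OF ex(1)] by metis
  have "dist (npsi U (v 0)) (npsi U (v (1::real))) \<le> real N * (C * q ^ n)"
    if U: "U \<in> comps" and W: "iter f n ` U \<in> percomps" and v: "continuous_on {0..1} v"
      "\<And>t. t \<in> {0..1} \<Longrightarrow> norm (v t) < 1 \<and> v t ^ Mp n U \<in> annul" and N: "N > 0"
      "\<And>t t'. t \<in> {0..1} \<Longrightarrow> t' \<in> {0..1} \<Longrightarrow> \<bar>t - t'\<bar> \<le> 1 / real N \<Longrightarrow> dist (v t ^ Mp n U) (v t' ^ Mp n U) < \<eta>" for U n v N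
  proof (rule path_tracking[OF ex(5) N(1)])
    have it: "iter f n (npsi U (v t)) = npsi (iter f n ` U) (v t ^ Mp n U)" if "t \<in> {0..1}" for t
      using npsi_iter[OF U] v(2)[OF that] by blast
    show "continuous_on {0..1} (\<lambda>t. npsi U (v t))"
      using v by (intro continuous_on_compose2[OF holomorphic_on_imp_continuous_on[OF nB(2)[OF U]] v(1)]) auto
    show "iter f n (npsi U (v t)) \<in> annuli" if "t \<in> {0..1}" for t unfolding it[OF that] annuli_def using W v(2)[OF that] by blast
    show "dist (iter f n (npsi U (v t))) (iter f n (npsi U (v t'))) < d"
      if t: "t \<in> {0..1}" "t' \<in> {0..1}" "\<bar>t - t'\<bar> \<le> 1 / real N" for t t'
      unfolding it[OF t(1)] it[OF t(2)] using \<eta>(2)[OF W] v(2) N(2) t by blast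
  qed
  then show ?thesis using that[of q C \<eta>] ex(2-4) \<eta>(1) by blast
qed

text \<open>A radius is cut at the moduli exp(-1 / \<open>Mp n U\<close>). The later of the two
  iterates sends the piece between consecutive cuts into \<open>annul\<close>, so its ends are
  exponentially close, and the pieces sum geometrically. In the second bound the circle is sent into
  \<open>annul\<close> at the entry time; its winding there is bounded by
  \<open>Mp_entry\<close>.\<close>

lemma radial_tail:
  obtains C q where "0 < q" "q < 1" "0 < C"
    "\<And>U n \<zeta> x. U \<in> comps \<Longrightarrow> iter f n ` U \<in> percomps \<Longrightarrow> norm \<zeta> = 1 \<Longrightarrow> 0 < x \<Longrightarrow> x \<le> 1 / real (Mp n U) \<Longrightarrow>
       dist (npsi U (of_real (exp (- x)) * \<zeta>)) (npsi U (of_real (exp (- (1 / real (Mp n U)))) * \<zeta>)) \<le> C * q ^ n"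
    "\<And>U \<zeta>. U \<in> comps \<Longrightarrow> norm \<zeta> = 1 \<Longrightarrow>
       dist (npsi U (of_real (exp (- (1 / real (Mp (entry U) U))))))
            (npsi U (of_real (exp (- (1 / real (Mp (entry U) U)))) * \<zeta>)) \<le> C * q ^ entry U"
proof -
  obtain C q \<eta> where at: "0 < q" "q < 1" "0 < C" "0 < \<eta>"
   "\<And>U n v N. U \<in> comps \<Longrightarrow> iter f n ` U \<in> percomps \<Longrightarrow> continuous_on {0..1} v \<Longrightarrow>
     (\<And>t. t \<in> {0..1} \<Longrightarrow> norm (v t) < 1 \<and> v t ^ Mp n U \<in> annul) \<Longrightarrow> N > 0 \<Longrightarrow>
     (\<And>t t'. t \<in> {0..1} \<Longrightarrow> t' \<in> {0..1} \<Longrightarrow> \<bar>t - t'\<bar> \<le> 1 / real N \<Longrightarrow> dist (v t ^ Mp n U) (v t' ^ Mp n U) < \<eta>) \<Longrightarrow>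
     dist (npsi U (v 0)) (npsi U (v (1::real))) \<le> real N * (C * q ^ n)" using annul_track by metis
  define D where "D = real (degree f)"
  have D1: "D \<ge> 1" using degpos by (simp add: D_def)
  \<comment> \<open>Enough pieces for both uses: radially the image moves at speed at most D, and
    along the circle its angle changes by at most 2 pi \<open>Mx\<close>.\<close>
  define N where "N = Suc (nat \<lceil>max D (2 * pi * real Mx) / \<eta>\<rceil>)"
  have "max D (2 * pi * real Mx) / \<eta> < real N" unfolding N_def by linarith
  then have "max D (2 * pi * real Mx) / real N < \<eta>" using at(4) by (simp add: N_def field_simps)
  moreover have "D / real N \<le> max D (2 * pi * real Mx) / real N" "2 * pi * real Mx / real N \<le> max D (2 * pi * real Mx) / real N"
    by (intro divide_right_mono; simp)+
  ultimately have N: "N > 0" "D / real N < \<eta>" "2 * pi * real Mx / real N < \<eta>" by (auto simp: N_def)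
  have rad: "dist (npsi U (of_real (exp (- (a / real (Mp n U)))) * \<zeta>)) (npsi U (of_real (exp (- (b / real (Mp n U)))) * \<zeta>)) \<le> real N * C * q ^ n"
    if U: "U \<in> comps" and W: "iter f n ` U \<in> percomps" and \<zeta>: "norm \<zeta> = 1" and ab: "1 \<le> a" "a \<le> D" "1 \<le> b" "b \<le> D" for U n \<zeta> a b
  proof -
    define M where "M = Mp n U"
    have M: "M > 0" using Mp_pos[OF U, of n] by (simp add: M_def)
    define s where "s t = a + t * (b - a)" for t
    define v where "v t = complex_of_real (exp (- (s t / real M))) * \<zeta>" for t
    have s: "1 \<le> s t" "s t \<le> D" if "t \<in> {0..1}" for t
    proof -
      have eq: "s t = (1 - t) * a + t * b" by (simp add: s_def algebra_simps)
      have *: "(1 - t) * 1 \<le> (1 - t) * a" "t * 1 \<le> t * b" using that ab by (intro mult_left_mono; simp)+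
      show "1 \<le> s t" unfolding eq using add_mono[OF *] by simp
      show "s t \<le> D" unfolding eq using that ab by (intro convex_bound_le) auto
    qed
    have vM: "v t ^ M = of_real (exp (- s t)) * \<zeta> ^ M" for t
      using M by (simp add: v_def power_mult_distrib flip: exp_of_nat_mult of_real_power)
    have "dist (npsi U (v 0)) (npsi U (v 1)) \<le> real N * (C * q ^ n)"
    proof (rule at(5)[OF U W _ _ N(1)])
      show "continuous_on {0..1} v" unfolding v_def s_def by (intro continuous_intros) (use M in auto)
      show "norm (v t) < 1 \<and> v t ^ Mp n U \<in> annul" if t: "t \<in> {0..1}" for t
      proof
        have "s t / real M > 0" using s[OF t] M by simp
        then show "norm (v t) < 1" using \<zeta> by (simp add: v_def norm_mult)
        show "v t ^ Mp n U \<in> annul" using vM[of t] s[OF t] \<zeta> by (simp add: annul_def M_def norm_mult norm_power D_def)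
      qed
      show "dist (v t ^ Mp n U) (v t' ^ Mp n U) < \<eta>" if t: "t \<in> {0..1}" "t' \<in> {0..1}" "\<bar>t - t'\<bar> \<le> 1 / real N" for t t'
      proof -
        have "v t ^ M - v t' ^ M = of_real (exp (- s t) - exp (- s t')) * \<zeta> ^ M" by (simp add: vM algebra_simps)
        then have "dist (v t ^ M) (v t' ^ M) = \<bar>exp (- s t) - exp (- s t')\<bar>"
          using \<zeta> by (simp only: dist_norm norm_mult norm_of_real norm_power) simp
        also have "\<dots> \<le> \<bar>s t - s t'\<bar>" using s t by (intro exp_neg_lipschitz) (auto intro: order_trans[of 0 1])
        also have "s t - s t' = (t - t') * (b - a)" by (simp add: s_def algebra_simps)
        also have "\<bar>(t - t') * (b - a)\<bar> \<le> (1 / real N) * D" unfolding abs_mult using t(3) ab by (intro mult_mono) auto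
        finally show ?thesis using N(2) by (simp add: M_def)
      qed
    qed
    then show ?thesis by (simp add: v_def s_def M_def mult.assoc)
  qed
  define C1 where "C1 = real N * C / (1 - q)"
  have tl: "dist (npsi U (of_real (exp (- x)) * \<zeta>)) (npsi U (of_real (exp (- (1 / real (Mp n U)))) * \<zeta>)) \<le> C1 * q ^ n"
    if U: "U \<in> comps" and W: "iter f n ` U \<in> percomps" and \<zeta>: "norm \<zeta> = 1" and x: "0 < x" "x \<le> 1 / real (Mp n U)" for U n \<zeta> x
  proof -
    define y where "y k = 1 / real (Mp k U)" for k
    define G where "G x = npsi U (of_real (exp (- x)) * \<zeta>)" for x
    have step: "dist (G x) (G (y k)) \<le> real N * C * q ^ Suc k" if k: "n \<le> k" "y (Suc k) \<le> x" "x \<le> y k" for k x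
    proof -
      have Wk: "iter f (Suc k) ` U \<in> percomps" using percomps_later[OF W] k(1) by (meson le_SucI)
      let ?M = "real (Mp (Suc k) U)" and ?m = "real (ndeg (iter f k ` U))"
      have M: "?M > 0" "real (Mp k U) > 0" "?m > 0"
        using Mp_pos[OF U, of "Suc k"] Mp_pos[OF U, of k] ndeg_pos[OF comps_image_iter[OF U], of k] by auto
      have yk: "y k = ?m / ?M" using M by (simp add: y_def Mp_Suc)
      have mD: "1 \<le> ?m" "?m \<le> D" using ndeg_pos[OF comps_image_iter[OF U], of k] ndeg_bounds(2)[OF comps_image_iter[OF U], of k]
        by (auto simp: D_def)
      have xM: "x = (x * ?M) / ?M" using M by simp
      have "1 \<le> x * ?M" using k(2) M by (simp add: y_def field_simps)
      moreover have "x * ?M \<le> ?m" using k(3) M unfolding yk by (simp add: field_simps)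
      ultimately have "dist (npsi U (of_real (exp (- ((x * ?M) / ?M))) * \<zeta>)) (npsi U (of_real (exp (- (?m / ?M))) * \<zeta>)) \<le> real N * C * q ^ Suc k"
        using mD by (intro rad[OF U Wk \<zeta>]) auto
      then show ?thesis using xM yk by (simp add: G_def)
    qed
    have ydec: "y (Suc k) \<le> y k" for k
      using Mp_pos[OF U, of k] ndeg_pos[OF comps_image_iter[OF U], of k] unfolding y_def Mp_Suc of_nat_mult
      by (intro divide_left_mono mult_pos_pos) auto
    have chain: "dist (G x) (G (y n)) \<le> real N * C * (\<Sum>i<k. q ^ (n + i + 1))" if "y (n + k) \<le> x" "x \<le> y n" for k x using that
    proof (induction k arbitrary: x)
      case (Suc k)
      show ?case
      proof (cases "y (n + k) \<le> x")
        case True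
        have "(\<Sum>i<k. q ^ (n + i + 1)) \<le> (\<Sum>i<Suc k. q ^ (n + i + 1))" using at(1) by simp
        then have "real N * C * (\<Sum>i<k. q ^ (n + i + 1)) \<le> real N * C * (\<Sum>i<Suc k. q ^ (n + i + 1))"
          using at(3) by (intro mult_left_mono) auto
        then show ?thesis using Suc.IH[OF True Suc.prems(2)] by linarith
      next
        case False
        have "y (n + k) \<le> y n" using lift_Suc_antimono_le[of y n "n + k"] ydec by simp
        then have "dist (G (y (n + k))) (G (y n)) \<le> real N * C * (\<Sum>i<k. q ^ (n + i + 1))" by (intro Suc.IH) auto
        moreover have "dist (G x) (G (y (n + k))) \<le> real N * C * q ^ Suc (n + k)" using False Suc.prems by (intro step) auto
        ultimately have "dist (G x) (G (y n)) \<le> real N * C * q ^ Suc (n + k) + real N * C * (\<Sum>i<k. q ^ (n + i + 1))"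
          using dist_triangle[of "G x" "G (y n)" "G (y (n + k))"] by linarith
        then show ?thesis by (simp add: algebra_simps)
      qed
    qed simp
    have "eventually (\<lambda>k. y k < x) sequentially" using order_tendstoD(2)[OF Mp_lim[OF U] x(1)] by (simp add: y_def)
    then obtain k0 where k0: "\<And>k. k \<ge> k0 \<Longrightarrow> y k < x" by (auto simp: eventually_sequentially)
    have "dist (G x) (G (y n)) \<le> real N * C * (\<Sum>i<k0. q ^ (n + i + 1))" using k0[of "n + k0"] x(2) by (intro chain) (auto simp: y_def)
    also have "(\<Sum>i<k0. q ^ (n + i + 1)) \<le> q ^ n / (1 - q)"
    proof -
      have "(\<Sum>i<k0. q ^ (n + i + 1)) = q ^ n * (q * (\<Sum>i<k0. q ^ i))" by (simp add: sum_distrib_left power_add algebra_simps)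
      also have "(\<Sum>i<k0. q ^ i) \<le> 1 / (1 - q)" using at(1,2) sum_le_suminf[of "\<lambda>i. q ^ i" "{..<k0}"] by (simp add: suminf_geometric)
      also have "q ^ n * (q * (1 / (1 - q))) \<le> q ^ n * (1 * (1 / (1 - q)))"
        using at(1,2) by (intro mult_left_mono mult_right_mono) auto
      finally show ?thesis using at(1) by (simp add: mult_left_mono)
    qed
    finally show ?thesis using at(3) by (simp add: C1_def G_def y_def mult_left_mono)
  qed
  have circ: "dist (npsi U (of_real (exp (- (1 / real (Mp (entry U) U))))))
            (npsi U (of_real (exp (- (1 / real (Mp (entry U) U)))) * \<zeta>)) \<le> C1 * q ^ entry U"
    if U: "U \<in> comps" and \<zeta>: "norm \<zeta> = 1" for U \<zeta>
  proof -
    let ?n = "entry U"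
    define M where "M = Mp ?n U"
    have M: "M > 0" "M \<le> Mx" using Mp_pos[OF U, of ?n] Mp_entry[OF U] by (auto simp: M_def)
    define \<theta> where "\<theta> = Arg \<zeta>"
    have \<theta>: "\<zeta> = cis \<theta>" "\<bar>\<theta>\<bar> \<le> pi"
      using \<zeta> Arg_bounded[of \<zeta>] by (auto simp: \<theta>_def abs_le_iff cis_Arg_unique) (metis cis_Arg div_by_1 norm_eq_zero of_real_1 sgn_eq zero_neq_one)
    define v where "v t = complex_of_real (exp (- (1 / real M))) * cis (t * \<theta>)" for t
    have vM: "v t ^ M = of_real (exp (- 1)) * cis (real M * (t * \<theta>))" for t
      using M by (simp add: v_def power_mult_distrib Complex.DeMoivre flip: exp_of_nat_mult of_real_power)
    have "dist (npsi U (v 0)) (npsi U (v 1)) \<le> real N * (C * q ^ ?n)"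
    proof (rule at(5)[OF U entry[OF U] _ _ N(1)])
      show "continuous_on {0..1} v" unfolding v_def by (intro continuous_intros)
      show "norm (v t) < 1 \<and> v t ^ Mp ?n U \<in> annul" for t using vM[of t] M D1 by (auto simp: v_def norm_mult annul_def M_def D_def)
      show "dist (v t ^ Mp ?n U) (v t' ^ Mp ?n U) < \<eta>" if t: "t \<in> {0..1}" "t' \<in> {0..1}" "\<bar>t - t'\<bar> \<le> 1 / real N" for t t'
      proof -
        have "dist (v t ^ M) (v t' ^ M) = exp (-1) * norm (cis (real M * (t * \<theta>)) - cis (real M * (t' * \<theta>)))"
          unfolding vM dist_norm right_diff_distrib[symmetric] norm_mult by simp
        also have "\<dots> \<le> 1 * norm (cis (real M * (t * \<theta>)) - cis (real M * (t' * \<theta>)))" by (intro mult_right_mono) auto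
        also have "\<dots> \<le> 1 * \<bar>real M * (t * \<theta>) - real M * (t' * \<theta>)\<bar>" using norm_cis_diff_le by (intro mult_left_mono) auto
        also have "\<dots> = real M * (\<bar>t - t'\<bar> * \<bar>\<theta>\<bar>)" by (simp add: abs_mult flip: right_diff_distrib left_diff_distrib)
        also have "\<dots> \<le> real Mx * (1 / real N * pi)" using M t(3) \<theta>(2) by (intro mult_mono) auto
        also have "\<dots> \<le> 2 * pi * real Mx / real N" using pi_gt_zero by (simp add: mult.commute mult.left_commute divide_right_mono)
        finally show ?thesis using N(3) by (simp add: M_def)
      qed
    qed
    moreover have "real N * C * 1 \<le> real N * C * (1 / (1 - q))" using at by (intro mult_left_mono) auto
    then have "real N * C * q ^ ?n \<le> C1 * q ^ ?n" unfolding C1_def using at(1) by (intro mult_right_mono) auto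
    ultimately show ?thesis using \<theta>(1) by (simp add: v_def M_def mult.assoc)
  qed
  have "C1 > 0" using at N(1) by (simp add: C1_def)
  then show ?thesis using that[of q C1] at(1,2) tl circ by blast
qed

end

section \<open>Extension of the Riemann maps to homeomorphisms of the closures\<close>

lemma arc_compose_inj:
  assumes "arc c" "continuous_on (path_image c) h" "inj_on h (path_image c)"
  shows "arc (h \<circ> c)"
  using assms unfolding arc_def path_image_def by (simp add: path_continuous_image path_image_def comp_inj_on)

text \<open>N rotations of the arc cover the circle, so the product of the rotated copies of \<Psi>
  - p vanishes on the whole circle and, by the maximum principle, at 0, where it is (\<Psi> 0 -
  p)^N.\<close>

lemma const_arc_centre:
  fixes \<Psi> :: "complex \<Rightarrow> complex"
  assumes cont: "continuous_on (cball 0 1) \<Psi>" and hol: "\<Psi> holomorphic_on ball 0 1"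
    and ab: "a < b" and arc: "\<And>t. a < t \<Longrightarrow> t < b \<Longrightarrow> \<Psi> (cis t) = p"
  shows "\<Psi> 0 = p"
proof -
  define N where "N = Suc (nat \<lceil>2 * pi / (b - a)\<rceil>)"
  have "2 * pi / (b - a) < real N" unfolding N_def by linarith
  moreover have N0: "N > 0" by (simp add: N_def)
  ultimately have N: "N > 0" "2 * pi / real N < b - a" using ab by (auto simp: field_simps simp del: of_nat_Suc)
  define G where "G w = (\<Prod>j<N. \<Psi> (cis (2 * pi * real j / real N) * w) - p)" for w
  have "norm (G 0) \<le> 0"
  proof (rule max_modulus_cball[of G 0 0])
    have "continuous_on (cball 0 1) (\<lambda>w. \<Psi> (cis (2 * pi * real j / real N) * w))" for j
      by (intro continuous_on_compose2[OF cont] continuous_intros) (auto simp: norm_mult)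
    then show "continuous_on (cball 0 1) G" unfolding G_def by (intro continuous_intros)
    have "(\<Psi> \<circ> (\<lambda>w. cis (2 * pi * real j / real N) * w)) holomorphic_on ball 0 1" for j
      by (intro holomorphic_on_compose_gen[OF _ hol] holomorphic_intros) (auto simp: norm_mult)
    then show "G holomorphic_on ball 0 1" unfolding G_def by (intro holomorphic_intros) (simp add: o_def)
    show "norm (G w) \<le> 0" if w: "norm w = 1" for w
    proof -
      define \<theta> where "\<theta> = Arg w"
      have wc: "w = cis \<theta>" using w rcis_cmod_Arg[of w] by (simp add: \<theta>_def rcis_def)
      \<comment> \<open>Rotation by k steps of 2 pi / N is the first to bring the angle of w beyond
        a; a step is shorter than b - a, so the angle lands in the arc.\<close>
      define k where "k = \<lfloor>(a - \<theta>) * real N / (2 * pi)\<rfloor> + 1"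
      have k1: "(a - \<theta>) * real N / (2 * pi) < of_int k" and k2: "of_int k \<le> (a - \<theta>) * real N / (2 * pi) + 1"
        unfolding k_def by linarith+
      define t where "t = \<theta> + 2 * pi * of_int k / real N"
      have "a < t" using k1 N(1) pi_gt_zero by (simp add: t_def field_simps)
      moreover have "t \<le> a + 2 * pi / real N"
      proof -
        have "2 * pi * of_int k \<le> (a - \<theta>) * real N + 2 * pi" using k2 pi_gt_zero by (simp add: field_simps)
        then have "2 * pi * of_int k / real N \<le> ((a - \<theta>) * real N + 2 * pi) / real N" by (intro divide_right_mono) auto
        also have "\<dots> = a - \<theta> + 2 * pi / real N" using N(1) by (simp add: add_divide_distrib)
        finally show ?thesis by (simp add: t_def)
      qed
      then have "t < b" using N(2) by linarith
      ultimately have pt: "\<Psi> (cis t) = p" by (rule arc)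
      define j where "j = nat (k mod int N)"
      have j: "j < N" "int j = k mod int N" using N(1) by (auto simp: j_def nat_less_iff)
      have "k = int N * (k div int N) + int j" using j(2) by simp
      then have "real_of_int k = real N * of_int (k div int N) + real j" by (metis of_int_add of_int_mult of_int_of_nat_eq)
      then have "t = (2 * pi * real j / real N + \<theta>) + 2 * pi * of_int (k div int N)" using N(1) by (simp add: t_def field_simps)
      then have "cis t = cis (2 * pi * real j / real N) * w" unfolding wc by (simp add: cis_mult[symmetric] cis_multiple_2pi)
      then have "\<Psi> (cis (2 * pi * real j / real N) * w) - p = 0" using pt by simp
      then have "G w = 0" unfolding G_def using j(1) by (intro prod_zero) auto
      then show ?thesis by simp
    qed
  qed auto
  then have "(\<Psi> 0 - p) ^ N = 0" by (simp add: G_def)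
  then show ?thesis by simp
qed

lemma Arg2pi_cis: "w = of_real (norm w) * cis (Arg2pi w)"
  using Arg2pi[of w] unfolding is_Arg_def cis_conv_exp by simp

definition sector :: "real \<Rightarrow> real \<Rightarrow> complex set" where
  "sector a b = (\<lambda>(r, t). of_real r * cis t) ` ({0<..<1} \<times> {a<..<b})"

lemma sector_connected: "connected (sector a b)"
proof -
  have "connected ({0<..<1::real} \<times> {a<..<b})" by (intro connected_Times) auto
  moreover have "continuous_on UNIV (\<lambda>(r, t). of_real r * cis t)" unfolding case_prod_unfold by (intro continuous_intros)
  ultimately show ?thesis unfolding sector_def by (meson connected_continuous_image continuous_on_subset subset_UNIV)
qed

lemma sector_cover:
  assumes "a \<le> b" "norm w < 1"
  shows "w \<in> closed_segment (cis a) 0 \<union> closed_segment 0 (cis b) \<union> sector a b \<union> sector b (a + 2 * pi)"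
proof -
  define t where "t = a + Arg2pi (w * cis (- a))"
  have "w * cis (- a) = of_real (norm w) * cis (Arg2pi (w * cis (- a)))" using Arg2pi_cis[of "w * cis (- a)"] by (simp add: norm_mult)
  then have "w * cis (- a) * cis a = of_real (norm w) * cis (Arg2pi (w * cis (- a))) * cis a" by (rule arg_cong)
  moreover have "w * cis (- a) * cis a = w" by (simp add: mult.assoc cis_mult)
  ultimately have w: "w = of_real (norm w) * cis t" by (simp only: mult.assoc cis_mult t_def add.commute)
  have t: "a \<le> t" "t < a + 2 * pi" using Arg2pi[of "w * cis (- a)"] by (auto simp: t_def)
  have seg: "of_real r * \<zeta> \<in> closed_segment \<zeta> 0 \<and> of_real r * \<zeta> \<in> closed_segment 0 \<zeta>" if "0 \<le> r" "r \<le> 1" for r and \<zeta> :: complex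
  proof -
    have eq: "of_real r * \<zeta> = (1 - (1 - r)) *\<^sub>R \<zeta> + (1 - r) *\<^sub>R 0" "of_real r * \<zeta> = (1 - r) *\<^sub>R 0 + r *\<^sub>R \<zeta>"
      by (simp_all add: scaleR_conv_of_real)
    have "of_real r * \<zeta> \<in> closed_segment \<zeta> 0" unfolding closed_segment_def
      by (intro CollectI exI[of _ "1 - r"] conjI eq(1)) (use that in auto)
    moreover have "of_real r * \<zeta> \<in> closed_segment 0 \<zeta>" unfolding closed_segment_def
      by (intro CollectI exI[of _ r] conjI eq(2)) (use that in auto)
    ultimately show ?thesis by simp
  qed
  consider "w = 0" | "w \<noteq> 0" "t = a" | "w \<noteq> 0" "t = b" | "w \<noteq> 0" "a < t" "t < b" | "w \<noteq> 0" "b < t" using t by linarith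
  then show ?thesis
  proof cases
    case 1 then show ?thesis by simp
  next
    case 2 then show ?thesis using seg[of "norm w" "cis a"] w assms(2) by (metis UnI1 norm_ge_zero less_imp_le)
  next
    case 3 then show ?thesis using seg[of "norm w" "cis b"] w assms(2) by (metis UnI1 UnI2 norm_ge_zero less_imp_le)
  next
    case 4
    then have "w \<in> sector a b" unfolding sector_def using w assms(2) by (intro image_eqI[of _ _ "(norm w, t)"]) auto
    then show ?thesis by simp
  next
    case 5
    then have "w \<in> sector b (a + 2 * pi)" unfolding sector_def using w assms(2) t by (intro image_eqI[of _ _ "(norm w, t)"]) auto
    then show ?thesis by simp
  qed
qed

lemma radial_limit:
  fixes \<Psi> :: "complex \<Rightarrow> 'a::topological_space"
  assumes "continuous_on (cball 0 1) \<Psi>" "norm \<zeta> = 1"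
  shows "(\<lambda>n. \<Psi> (of_real (1 - 1 / real (n + 2)) * \<zeta>)) \<longlonglongrightarrow> \<Psi> \<zeta>"
proof (rule continuous_on_tendsto_compose[OF assms(1)])
  have "(\<lambda>n. 1 / real (n + 2)) \<longlonglongrightarrow> 0" using LIMSEQ_ignore_initial_segment[OF lim_1_over_n, of 2] by simp
  then have "(\<lambda>n. complex_of_real (1 - 1 / real (n + 2)) * \<zeta>) \<longlonglongrightarrow> of_real (1 - 0) * \<zeta>" by (intro tendsto_intros)
  then show "(\<lambda>n. complex_of_real (1 - 1 / real (n + 2)) * \<zeta>) \<longlonglongrightarrow> \<zeta>" by simp
  show "\<forall>\<^sub>F n in sequentially. complex_of_real (1 - 1 / real (n + 2)) * \<zeta> \<in> cball 0 1"
    by (intro always_eventually) (auto simp: norm_mult assms(2) simp del: of_real_diff)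
qed (simp add: assms(2))

lemma sector_closure:
  assumes "continuous_on (cball 0 1) \<Psi>" "\<Psi> ` sector a b \<subseteq> S" "a < t" "t < b"
  shows "\<Psi> (cis t) \<in> closure S"
proof -
  have lim: "(\<lambda>n. \<Psi> (of_real (1 - 1 / real (n + 2)) * cis t)) \<longlonglongrightarrow> \<Psi> (cis t)" using radial_limit[OF assms(1)] by simp
  have mem: "\<Psi> (of_real (1 - 1 / real (n + 2)) * cis t) \<in> S" for n
  proof -
    have "of_real (1 - 1 / real (n + 2)) * cis t \<in> sector a b" unfolding sector_def
      using assms(3,4) by (intro image_eqI[of _ _ "(1 - 1 / real (n + 2), t)"]) auto
    then show ?thesis using assms(2) by blast
  qed
  show ?thesis by (rule closed_sequentially[OF closed_closure _ lim]) (rule subsetD[OF closure_subset mem])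
qed

context pcf_poly
begin

lemma inside_loop:
  assumes "simple_path c" "pathfinish c = pathstart c" "path_image c \<subseteq> K"
  shows "inside (path_image c) \<subseteq> interior K"
proof -
  note J = Jordan_inside_outside[OF assms(1,2)]
  have I: "open (inside (path_image c))" "bounded (inside (path_image c))" "frontier (inside (path_image c)) = path_image c"
    using J by simp_all
  have "inside (path_image c) \<subseteq> K" by (rule K_fill) (simp_all add: I assms(3))
  then show ?thesis using I(1) by (rule interior_maximal)
qed

text \<open>The dilations g n of the Riemann map are uniformly Cauchy on the circle by
  \<open>radial_tail\<close>, hence on the closed disc by the maximum principle; their limit is the
  extension. Comparison with the circle at the entry time bounds the diameter of U.\<close>

lemma disc_estimates:
  obtains C q where "0 < q" "q < 1" "0 < C"
    "\<And>U. U \<in> comps \<Longrightarrow> \<exists>\<Psi>. continuous_on (cball 0 1) \<Psi> \<and> (\<forall>w. norm w < 1 \<longrightarrow> \<Psi> w = npsi U w)"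
    "\<And>U x y. U \<in> comps \<Longrightarrow> x \<in> U \<Longrightarrow> y \<in> U \<Longrightarrow> dist x y \<le> C * q ^ entry U"
proof -
  obtain C q where tl: "0 < q" "q < 1" "0 < C"
    "\<And>U n \<zeta> x. U \<in> comps \<Longrightarrow> iter f n ` U \<in> percomps \<Longrightarrow> norm \<zeta> = 1 \<Longrightarrow> 0 < x \<Longrightarrow> x \<le> 1 / real (Mp n U) \<Longrightarrow>
       dist (npsi U (of_real (exp (- x)) * \<zeta>)) (npsi U (of_real (exp (- (1 / real (Mp n U)))) * \<zeta>)) \<le> C * q ^ n"
    "\<And>U \<zeta>. U \<in> comps \<Longrightarrow> norm \<zeta> = 1 \<Longrightarrow>
       dist (npsi U (of_real (exp (- (1 / real (Mp (entry U) U))))))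
            (npsi U (of_real (exp (- (1 / real (Mp (entry U) U)))) * \<zeta>)) \<le> C * q ^ entry U" using radial_tail by metis
  have est: "(\<exists>\<Psi>. continuous_on (cball 0 1) \<Psi> \<and> (\<forall>w. norm w < 1 \<longrightarrow> \<Psi> w = npsi U w)) \<and>
      (\<forall>x\<in>U. \<forall>y\<in>U. dist x y \<le> 6 * C * q ^ entry U)" if U: "U \<in> comps" for U
  proof -
    define s where "s n = exp (- (1 / real (Mp n U)))" for n
    define g where "g n w = npsi U (of_real (s n) * w)" for n w
    have M: "real (Mp n U) > 0" for n using Mp_pos[OF U, of n] by simp
    have s: "0 < s n" "s n < 1" for n using M[of n] by (auto simp: s_def)
    have sw: "norm (of_real (s n) * w) < 1" if "norm w \<le> 1" for n and w :: complex
    proof -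
      have "s n * norm w \<le> s n * 1" using s[of n] that by (intro mult_left_mono) auto
      then have "s n * norm w < 1" using s[of n] by linarith
      then show ?thesis using s[of n] by (simp add: norm_mult)
    qed
    have gc: "continuous_on (cball 0 1) (g n)" for n unfolding g_def using sw
      by (intro continuous_on_compose2[OF holomorphic_on_imp_continuous_on[OF nB(2)[OF U]]] continuous_intros) auto
    have gh: "g n holomorphic_on ball 0 1" for n
    proof -
      have "(npsi U \<circ> (\<lambda>w. of_real (s n) * w)) holomorphic_on ball 0 1"
        using sw by (intro holomorphic_on_compose_gen[OF _ nB(2)[OF U]] holomorphic_intros) auto
      then show ?thesis by (simp add: g_def[abs_def] o_def)
    qed
    have Mmono: "1 / real (Mp n U) \<le> 1 / real (Mp n0 U)" if "n0 \<le> n" for n n0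
    proof -
      have "Mp k U \<le> Mp (Suc k) U" for k using ndeg_pos[OF comps_image_iter[OF U], of k] by (simp add: Mp_Suc)
      then have "Mp n0 U \<le> Mp n U" using lift_Suc_mono_le[of "\<lambda>n. Mp n U"] that by blast
      then show ?thesis using M by (intro divide_left_mono) auto
    qed
    have cau: "dist (g n w) (g m w) \<le> 2 * C * q ^ n0"
      if n0: "iter f n0 ` U \<in> percomps" "n0 \<le> n" "n0 \<le> m" and w: "norm w \<le> 1" for n m n0 w
    proof -
      have "norm (g n w - g m w) \<le> 2 * C * q ^ n0"
      proof (rule max_modulus_cball[of "\<lambda>w. g n w - g m w"])
        show "norm (g n z - g m z) \<le> 2 * C * q ^ n0" if z: "norm z = 1" for z
        proof -
          have "dist (g k z) (g n0 z) \<le> C * q ^ n0" if "n0 \<le> k" for k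
            unfolding g_def s_def using tl(4)[OF U n0(1) z _ Mmono[OF that]] M by simp
          from this[OF n0(2)] this[OF n0(3)] show ?thesis using dist_triangle2[of "g n z" "g m z" "g n0 z"] by (simp add: dist_norm)
        qed
      qed (use gc gh w in \<open>auto intro!: continuous_intros holomorphic_intros\<close>)
      then show ?thesis by (simp add: dist_norm)
    qed
    have "uniformly_Cauchy_on (cball 0 1) g" unfolding uniformly_Cauchy_on_def
    proof (intro allI impI)
      fix e :: real assume e: "e > 0"
      have "(\<lambda>n. 2 * C * q ^ n) \<longlonglongrightarrow> 2 * C * 0" using tl(1,2) by (intro tendsto_intros LIMSEQ_power_zero) auto
      then have "eventually (\<lambda>n. 2 * C * q ^ n < e) sequentially" using order_tendstoD(2) e by simp
      then obtain n1 where n1: "\<And>n. n \<ge> n1 \<Longrightarrow> 2 * C * q ^ n < e" by (auto simp: eventually_sequentially)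
      define n0 where "n0 = max n1 (entry U)"
      have n0: "iter f n0 ` U \<in> percomps" "2 * C * q ^ n0 < e"
        using percomps_later[OF entry[OF U], of n0] n1[of n0] by (auto simp: n0_def)
      show "\<exists>M. \<forall>x\<in>cball 0 1. \<forall>m\<ge>M. \<forall>n\<ge>M. dist (g m x) (g n x) < e"
        by (intro exI[of _ n0] ballI allI impI) (rule le_less_trans[OF cau[OF n0(1)] n0(2)]; simp)
    qed
    then obtain \<Psi> where \<Psi>: "uniform_limit (cball 0 1) g \<Psi> sequentially"
      using Cauchy_uniformly_convergent uniformly_convergent_on_def by blast
    have slim: "s \<longlonglongrightarrow> 1" unfolding s_def using tendsto_exp[OF tendsto_minus[OF Mp_lim[OF U]]] by simp
    have lim: "(\<lambda>n. g n w) \<longlonglongrightarrow> npsi U w" if w: "norm w < 1" for w unfolding g_def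
    proof (rule continuous_on_tendsto_compose[OF holomorphic_on_imp_continuous_on[OF nB(2)[OF U]]])
      show "(\<lambda>n. of_real (s n) * w) \<longlonglongrightarrow> w" using tendsto_mult[OF tendsto_of_real[OF slim] tendsto_const[of w]] by simp
      show "\<forall>\<^sub>F n in sequentially. of_real (s n) * w \<in> ball 0 1" using sw[of w] w by (intro always_eventually) auto
    qed (use w in auto)
    have "continuous_on (cball 0 1) \<Psi>" by (rule uniform_limit_theorem[OF _ \<Psi>]) (use gc in auto)
    moreover have "\<Psi> w = npsi U w" if "norm w < 1" for w using LIMSEQ_unique[OF tendsto_uniform_limitI[OF \<Psi>] lim[OF that]] that by auto
    moreover have "dist x y \<le> 6 * C * q ^ entry U" if xy: "x \<in> U" "y \<in> U" for x y
    proof -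
      let ?n = "entry U"
      have near: "dist x (npsi U (of_real (s ?n))) \<le> 3 * C * q ^ ?n" if x: "x \<in> U" for x
      proof -
        define w where "w = nphi U x"
        have w: "norm w < 1" "npsi U w = x" using nB(3,4)[OF U x] by (auto simp: w_def)
        have "dist (g ?n w) (npsi U w) \<le> 2 * C * q ^ ?n"
        proof (rule tendsto_upperbound[of "\<lambda>m. dist (g ?n w) (g m w)"])
          show "(\<lambda>m. dist (g ?n w) (g m w)) \<longlonglongrightarrow> dist (g ?n w) (npsi U w)" by (intro tendsto_intros lim w)
          show "\<forall>\<^sub>F m in sequentially. dist (g ?n w) (g m w) \<le> 2 * C * q ^ ?n"
            unfolding eventually_sequentially using cau[OF entry[OF U] order_refl] w by (intro exI[of _ ?n]) auto
        qed simp
        moreover have "norm (g ?n w - npsi U (of_real (s ?n))) \<le> C * q ^ ?n"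
        proof (rule max_modulus_cball[of "\<lambda>w. g ?n w - npsi U (of_real (s ?n))"])
          show "norm (g ?n z - npsi U (of_real (s ?n))) \<le> C * q ^ ?n" if "norm z = 1" for z
            using tl(5)[OF U that] by (simp add: g_def s_def dist_norm norm_minus_commute)
        qed (use gc gh w in \<open>auto intro!: continuous_intros holomorphic_intros\<close>)
        ultimately show ?thesis using w(2) dist_triangle[of x "npsi U (of_real (s ?n))" "g ?n w"]
          by (simp add: dist_norm norm_minus_commute)
      qed
      show ?thesis using near[OF xy(1)] near[OF xy(2)] dist_triangle2[of x y "npsi U (of_real (s ?n))"] by simp
    qed
    ultimately show ?thesis by blast
  qed
  show ?thesis by (rule that[of q "6 * C"]) (use tl est in auto)
qed

text \<open>A large diameter forces an early entry, and only finitely many components reach the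
  finitely many periodic ones at a given time.\<close>

lemma comps_small:
  assumes e: "e > 0"
  shows "finite {U \<in> comps. \<exists>x\<in>closure U. \<exists>y\<in>closure U. dist x y > e}"
proof -
  obtain C q where d: "0 < q" "q < 1" "0 < C"
    "\<And>U x y. U \<in> comps \<Longrightarrow> x \<in> U \<Longrightarrow> y \<in> U \<Longrightarrow> dist x y \<le> C * q ^ entry U" using disc_estimates by metis
  have cl: "dist x y \<le> C * q ^ entry U" if U: "U \<in> comps" and xy: "x \<in> closure U" "y \<in> closure U" for U x y
  proof -
    obtain u v where uv: "\<And>n::nat. u n \<in> U" "u \<longlonglongrightarrow> x" "\<And>n::nat. v n \<in> U" "v \<longlonglongrightarrow> y" using xy unfolding closure_sequential by metis
    have "(\<lambda>n. dist (u n) (v n)) \<longlonglongrightarrow> dist x y" using uv by (intro tendsto_intros)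
    then show ?thesis using d(4)[OF U uv(1,3)] by (intro tendsto_upperbound[of "\<lambda>n. dist (u n) (v n)"]) auto
  qed
  have "(\<lambda>n. C * q ^ n) \<longlonglongrightarrow> C * 0" using d by (intro tendsto_intros LIMSEQ_power_zero) auto
  then have "eventually (\<lambda>n. C * q ^ n < e) sequentially" using order_tendstoD(2) e by simp
  then obtain n0 where n0: "\<And>n. n \<ge> n0 \<Longrightarrow> C * q ^ n < e" by (auto simp: eventually_sequentially)
  have "{U \<in> comps. \<exists>x\<in>closure U. \<exists>y\<in>closure U. dist x y > e} \<subseteq> (\<Union>n\<in>{..<n0}. \<Union>W\<in>percomps. {U \<in> comps. iter f n ` U = W})"
  proof clarify
    fix U x y assume U: "U \<in> comps" "x \<in> closure U" "y \<in> closure U" "dist x y > e"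
    then have "entry U < n0" using cl[OF U(1-3)] n0[of "entry U"] by force
    then show "U \<in> (\<Union>n\<in>{..<n0}. \<Union>W\<in>percomps. {U \<in> comps. iter f n ` U = W})" using entry[OF U(1)] U(1) by blast
  qed
  moreover have "finite (\<Union>n\<in>{..<n0}. \<Union>W\<in>percomps. {U \<in> comps. iter f n ` U = W})"
    using percomps_finite finite_comp_fibre by (intro finite_UN_I) auto
  ultimately show ?thesis by (rule finite_subset)
qed

text \<open>The main point is injectivity on the circle. If a and b had the same image p, the images
  of their radii would form a Jordan curve with inside in the interior of K. One of the two sectors
  is mapped to the inside, and its boundary arc into J, hence onto the curve, where p is the only
  point of J. So \<Psi> is constant on an arc, and \<open>const_arc_centre\<close> gives \<Psi> 0 =
  p, although \<Psi> 0 lies in U and p does not.\<close>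

lemma disc_extension:
  assumes U: "U \<in> comps"
  obtains \<Psi> \<Phi> where "homeomorphism (cball 0 1) (closure U) \<Psi> \<Phi>" "\<And>w. norm w < 1 \<Longrightarrow> \<Psi> w = npsi U w"
    "\<And>z. z \<in> U \<Longrightarrow> \<Phi> z = nphi U z"
proof -
  obtain \<Psi> where \<Psi>: "continuous_on (cball 0 1) \<Psi>" "\<And>w. norm w < 1 \<Longrightarrow> \<Psi> w = npsi U w" using disc_estimates U by metis
  have hol: "\<Psi> holomorphic_on ball 0 1" using nB(2)[OF U] holomorphic_cong[OF refl, of "ball 0 1" \<Psi> "npsi U"] \<Psi>(2) by simp
  have \<Psi>U: "\<Psi> w \<in> U" if "norm w < 1" for w using \<Psi>(2)[OF that] nB(5)[OF U that] by simp
  have inj: "w = w'" if "norm w < 1" "norm w' < 1" "\<Psi> w = \<Psi> w'" for w w' using \<Psi>(2) nB(6)[OF U] that by metis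
  have "\<Psi> ` ball 0 1 = U"
  proof
    show "U \<subseteq> \<Psi> ` ball 0 1"
    proof
      fix z assume "z \<in> U"
      then show "z \<in> \<Psi> ` ball 0 1" using nB(3,4)[OF U] \<Psi>(2) by (intro image_eqI[of _ _ "nphi U z"]) auto
    qed
  qed (use \<Psi>U in auto)
  have im: "\<Psi> ` cball 0 1 = closure U"
  proof
    have "\<Psi> ` closure (ball 0 1) \<subseteq> closure U"
    proof (rule image_closure_subset)
      show "\<Psi> ` ball 0 1 \<subseteq> closure U" using \<Psi>U closure_subset[of U] by auto
    qed (use \<Psi>(1) in auto)
    then show "\<Psi> ` cball 0 1 \<subseteq> closure U" by simp
    have "compact (\<Psi> ` cball 0 1)" using \<Psi>(1) by (intro compact_continuous_image) auto
    moreover have "U \<subseteq> \<Psi> ` cball 0 1" using \<open>\<Psi> ` ball 0 1 = U\<close> ball_subset_cball by blast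
    ultimately show "closure U \<subseteq> \<Psi> ` cball 0 1" by (intro closure_minimal compact_imp_closed)
  qed
  have bd: "\<Psi> \<zeta> \<notin> U" if \<zeta>: "norm \<zeta> = 1" for \<zeta>
  proof
    assume inU: "\<Psi> \<zeta> \<in> U"
    note l = radial_limit[OF \<Psi>(1) \<zeta>]
    have small: "norm (of_real (1 - 1 / real (n + 2)) * \<zeta>) < 1" for n using \<zeta> by (simp add: norm_mult del: of_real_diff)
    have l1: "(\<lambda>n. nphi U (\<Psi> (of_real (1 - 1 / real (n + 2)) * \<zeta>))) \<longlonglongrightarrow> nphi U (\<Psi> \<zeta>)"
      by (rule continuous_on_tendsto_compose[OF holomorphic_on_imp_continuous_on[OF nB(1)[OF U]] l inU])
        (use \<Psi>U[OF small] in auto)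
    have eq: "nphi U (\<Psi> (of_real (1 - 1 / real (n + 2)) * \<zeta>)) = of_real (1 - 1 / real (n + 2)) * \<zeta>" for n
      using \<Psi>(2)[OF small] nB(6)[OF U small] by metis
    have l2: "(\<lambda>n. of_real (1 - 1 / real (n + 2)) * \<zeta>) \<longlonglongrightarrow> \<zeta>" by (rule radial_limit[of "\<lambda>w. w"]) (simp_all add: \<zeta>)
    from LIMSEQ_unique[OF l1[unfolded eq] l2] have "nphi U (\<Psi> \<zeta>) = \<zeta>" .
    then show False using nB(3)[OF U inU] \<zeta> by simp
  qed
  have bdJ: "\<Psi> \<zeta> \<in> J" if "norm \<zeta> = 1" for \<zeta>
  proof -
    have "\<Psi> \<zeta> \<in> closure U" unfolding im[symmetric] using that by (intro imageI) simp
    then show ?thesis using bd[OF that] comps_frontier[OF U] by blast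
  qed
  have injb: "a = b" if ab: "norm a = 1" "norm b = 1" "\<Psi> a = \<Psi> b" for a b
  proof (rule ccontr)
    assume ne: "a \<noteq> b"
    define \<alpha> where "\<alpha> = Arg a"
    define \<beta> where "\<beta> = \<alpha> + Arg2pi (b * cis (- \<alpha>))"
    have a: "a = cis \<alpha>" using ab(1) rcis_cmod_Arg[of a] by (simp add: \<alpha>_def rcis_def)
    have "b * cis (- \<alpha>) = cis (Arg2pi (b * cis (- \<alpha>)))" using Arg2pi_cis[of "b * cis (- \<alpha>)"] ab(2) by (simp add: norm_mult)
    then have "b * cis (- \<alpha>) * cis \<alpha> = cis (Arg2pi (b * cis (- \<alpha>))) * cis \<alpha>" by (rule arg_cong)
    moreover have "b * cis (- \<alpha>) * cis \<alpha> = b" by (simp add: mult.assoc cis_mult)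
    ultimately have b: "b = cis \<beta>" by (simp only: cis_mult \<beta>_def add.commute)
    have r: "\<alpha> \<le> \<beta>" "\<beta> < \<alpha> + 2 * pi" using Arg2pi[of "b * cis (- \<alpha>)"] by (auto simp: \<beta>_def)
    then have r1: "\<alpha> < \<beta>" using a b ne by (metis less_le)
    define p where "p = \<Psi> a"
    define g where "g = \<Psi> \<circ> linepath a 0"
    define h where "h = \<Psi> \<circ> linepath 0 b"
    have segb: "x = \<zeta> \<or> norm x < 1" if xs: "x \<in> closed_segment \<zeta> 0" and n1: "norm \<zeta> = 1" for x \<zeta> :: complex
    proof -
      obtain u where u: "0 \<le> u" "u \<le> 1" "x = (1 - u) *\<^sub>R \<zeta> + u *\<^sub>R 0" using xs unfolding closed_segment_def by blast
      then have "norm x = 1 - u" "u = 0 \<Longrightarrow> x = \<zeta>" using n1 by simp_all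
      then show ?thesis using u(1) by (cases "u = 0") simp_all
    qed
    have seg1: "closed_segment \<zeta> 0 \<subseteq> cball 0 1" if "norm \<zeta> = 1" for \<zeta> :: complex
    proof
      fix x assume "x \<in> closed_segment \<zeta> 0"
      then show "x \<in> cball 0 1" using segb[of x \<zeta>] that by auto
    qed
    have injs: "inj_on \<Psi> (closed_segment \<zeta> 0)" if \<zeta>: "norm \<zeta> = 1" for \<zeta>
    proof (rule inj_onI)
      fix x y assume xy: "x \<in> closed_segment \<zeta> 0" "y \<in> closed_segment \<zeta> 0" "\<Psi> x = \<Psi> y"
      consider "x = \<zeta>" "y = \<zeta>" | "x = \<zeta>" "norm y < 1" | "norm x < 1" "y = \<zeta>" | "norm x < 1" "norm y < 1"
        using segb[OF xy(1) \<zeta>] segb[OF xy(2) \<zeta>] by blast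
      then show "x = y"
      proof cases
        case 2 then show ?thesis using \<Psi>U[of y] bd[OF \<zeta>] xy(3) by simp
      next
        case 3 then show ?thesis using \<Psi>U[of x] bd[OF \<zeta>] xy(3) by simp
      next
        case 4 then show ?thesis using inj xy(3) by simp
      qed simp
    qed
    have arcg: "arc g" unfolding g_def
      using seg1[OF ab(1)] injs[OF ab(1)] ab(1) by (intro arc_compose_inj arc_linepath) (auto intro: continuous_on_subset[OF \<Psi>(1)])
    have arch: "arc h" unfolding h_def
      using seg1[OF ab(2)] injs[OF ab(2)] ab(2) by (intro arc_compose_inj arc_linepath) (auto simp: closed_segment_commute[of 0] intro: continuous_on_subset[OF \<Psi>(1)])
    have ends: "pathstart g = p" "pathfinish g = \<Psi> 0" "pathstart h = \<Psi> 0" "pathfinish h = p"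
      using ab(3) by (auto simp: g_def h_def pathstart_compose pathfinish_compose p_def)
    have img: "path_image g = \<Psi> ` closed_segment a 0" "path_image h = \<Psi> ` closed_segment 0 b"
      by (auto simp: g_def h_def path_image_compose)
    have sint: "x = 0" if x: "x \<in> closed_segment a 0" "x \<in> closed_segment 0 b" for x
    proof (rule ccontr)
      assume x0: "x \<noteq> 0"
      obtain u where u: "0 \<le> u" "u \<le> 1" "x = (1 - u) *\<^sub>R a + u *\<^sub>R 0" using x(1) unfolding closed_segment_def by blast
      obtain v where v: "0 \<le> v" "v \<le> 1" "x = (1 - v) *\<^sub>R 0 + v *\<^sub>R b" using x(2) unfolding closed_segment_def by blast
      have "norm x = 1 - u" using u ab(1) by simp
      moreover have "norm x = v" using v ab(2) by simp
      ultimately have "v *\<^sub>R a = v *\<^sub>R b" "v \<noteq> 0" using u v x0 by auto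
      then show False using ne by simp
    qed
    have "path_image g \<inter> path_image h \<subseteq> {p, \<Psi> 0}"
    proof
      fix y assume "y \<in> path_image g \<inter> path_image h"
      then obtain x x' where x: "x \<in> closed_segment a 0" "x' \<in> closed_segment b 0" "y = \<Psi> x" "y = \<Psi> x'"
        unfolding img by (auto simp: closed_segment_commute)
      show "y \<in> {p, \<Psi> 0}"
      proof (cases "x = a \<or> x' = b")
        case True then show ?thesis using x ab(3) by (auto simp: p_def)
      next
        case False
        then have "x = x'" using segb[OF x(1) ab(1)] segb[OF x(2) ab(2)] inj x(3,4) by metis
        then have "x = 0" using sint x by (simp add: closed_segment_commute)
        then show ?thesis using x by simp
      qed
    qed
    then have sp: "simple_path (g +++ h)" using arcg arch ends by (intro simple_path_join_loop) auto
    have lp: "pathfinish (g +++ h) = pathstart (g +++ h)" using ends by simp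
    define \<Gamma> where "\<Gamma> = path_image (g +++ h)"
    have \<Gamma>: "\<Gamma> = \<Psi> ` closed_segment a 0 \<union> \<Psi> ` closed_segment 0 b" using ends img by (simp add: \<Gamma>_def path_image_join)
    have \<Gamma>K: "\<Gamma> \<subseteq> K" using im seg1[OF ab(1)] seg1[OF ab(2)] comps_closure(1)[OF U] unfolding \<Gamma> by (auto simp: closed_segment_commute)
    note Jd = Jordan_inside_outside[OF sp lp, folded \<Gamma>_def]
    have insK: "inside \<Gamma> \<subseteq> interior K" using inside_loop[OF sp lp] \<Gamma>K by (simp add: \<Gamma>_def)
    \<comment> \<open>The curve is the frontier of its inside and passes through \<Psi> 0 in the
      open set U, so U meets the inside.\<close>
    have "\<Psi> 0 \<in> frontier (inside \<Gamma>)" using Jd by (auto simp: \<Gamma>)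
    moreover have "\<Psi> 0 \<in> U" by (rule \<Psi>U) simp
    ultimately have "U \<inter> inside \<Gamma> \<noteq> {}"
      using open_Int_closure_eq_empty[OF comps_open[OF U], of "inside \<Gamma>"] unfolding frontier_def by blast
    then obtain z where z: "z \<in> U" "z \<in> inside \<Gamma>" by auto
    obtain w where w: "norm w < 1" "z = \<Psi> w" using z(1) \<open>\<Psi> ` ball 0 1 = U\<close> by auto
    have "z \<notin> \<Gamma>" using z(2) inside_no_overlap[of \<Gamma>] by blast
    then have "w \<in> sector \<alpha> \<beta> \<union> sector \<beta> (\<alpha> + 2 * pi)"
      using sector_cover[OF r(1) w(1)] w(2) unfolding \<Gamma> a[symmetric] b[symmetric] by blast
    then obtain s t where st: "w \<in> sector s t" "s < t" "(s = \<alpha> \<and> t = \<beta>) \<or> (s = \<beta> \<and> t = \<alpha> + 2 * pi)" using r1 r(2) by blast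
    have secb: "norm x < 1" if "x \<in> sector s t" for x using that by (auto simp: sector_def norm_mult)
    have secn: "\<Psi> x \<notin> \<Gamma>" if x: "x \<in> sector s t" for x
    proof
      obtain \<rho> \<tau> where \<rho>: "0 < \<rho>" "\<rho> < 1" "s < \<tau>" "\<tau> < t" "x = of_real \<rho> * cis \<tau>" using x by (auto simp: sector_def)
      assume "\<Psi> x \<in> \<Gamma>"
      then obtain y \<zeta> where y: "y \<in> closed_segment \<zeta> 0" "\<zeta> = a \<or> \<zeta> = b" "\<Psi> y = \<Psi> x" unfolding \<Gamma> by (auto simp: closed_segment_commute)
      have n\<zeta>: "norm \<zeta> = 1" using y(2) ab by auto
      have "y = x" using segb[OF y(1) n\<zeta>] inj[OF _ secb[OF x] y(3)] bd[OF n\<zeta>] \<Psi>U[OF secb[OF x]] y(3) by auto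
      then obtain u where u: "0 \<le> u" "u \<le> 1" "x = (1 - u) *\<^sub>R \<zeta>" using y(1) unfolding closed_segment_def by auto
      have "norm x = \<rho>" using \<rho>(1,2) unfolding \<rho>(5) by (simp add: norm_mult)
      moreover have "norm x = 1 - u" using u(1,2) n\<zeta> unfolding u(3) by simp
      ultimately have "1 - u = \<rho>" by simp
      then have "of_real \<rho> * \<zeta> = of_real \<rho> * cis \<tau>" using \<rho>(5) u(3) by (simp add: scaleR_conv_of_real)
      then have "cis \<tau> = \<zeta>" using \<rho>(1) by simp
      then have "cis \<tau> = cis \<alpha> \<or> cis \<tau> = cis \<beta>" using y(2) a b by auto
      moreover have "\<alpha> < \<tau>" "\<tau> < \<alpha> + 2 * pi" using \<rho> st(3) r r1 by auto
      moreover have "\<tau> < \<beta> \<or> \<beta> < \<tau>" using \<rho> st(3) by auto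
      moreover have "cis \<tau> \<noteq> cis x" if "\<tau> \<noteq> x" "\<bar>\<tau> - x\<bar> < 2 * pi" for x
      proof
        assume "cis \<tau> = cis x"
        then have "cis (\<tau> - x) = 1" by (metis cis_divide divide_self_if cis_neq_zero)
        then obtain k :: int where "\<tau> - x = of_int k * 2 * pi"
          using complex_eq_iff cos_one_2pi_int[of "\<tau> - x"] by (auto simp: mult.assoc)
        then have "\<bar>of_int k\<bar> * (2 * pi) < 1 * (2 * pi)" "of_int k \<noteq> (0::real)" using that by (auto simp: abs_mult)
        then have "\<bar>of_int k\<bar> < (1::real)" by (meson mult_less_cancel_right_pos pi_gt_zero mult_pos_pos zero_less_numeral)
        then have "k = 0" by linarith
        then show False using \<open>of_int k \<noteq> (0::real)\<close> by simp
      qed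
      ultimately show False using r r1 by (smt (verit))
    qed
    \<comment> \<open>The image of the sector is connected, meets the inside and is disjoint from
      the curve.\<close>
    have "\<Psi> ` sector s t \<subseteq> inside \<Gamma>"
    proof (rule ccontr)
      assume "\<not> ?thesis"
      moreover have "connected (\<Psi> ` sector s t)"
        by (intro connected_continuous_image sector_connected continuous_on_subset[OF \<Psi>(1)] subsetI) (simp add: less_imp_le[OF secb])
      moreover have "\<Psi> ` sector s t \<inter> inside \<Gamma> \<noteq> {}" using st(1) w(2) z(2) by blast
      ultimately have "\<Psi> ` sector s t \<inter> frontier (inside \<Gamma>) \<noteq> {}" using connected_Int_frontier by blast
      then show False using Jd secn by blast
    qed
    then have cl: "\<Psi> (cis \<tau>) \<in> closure (inside \<Gamma>)" if "s < \<tau>" "\<tau> < t" for \<tau> using sector_closure[OF \<Psi>(1)] that by blast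
    have "\<Psi> (cis \<tau>) = p" if \<tau>: "s < \<tau>" "\<tau> < t" for \<tau>
    proof -
      have "\<Psi> (cis \<tau>) \<in> J" by (rule bdJ) simp
      then have "\<Psi> (cis \<tau>) \<notin> inside \<Gamma>" using insK J_eq by blast
      moreover have "closure (inside \<Gamma>) = inside \<Gamma> \<union> \<Gamma>" using Jd closure_Un_frontier by metis
      ultimately have "\<Psi> (cis \<tau>) \<in> \<Gamma>" using cl[OF \<tau>] by blast
      then obtain y \<zeta> where y: "y \<in> closed_segment \<zeta> 0" "\<zeta> = a \<or> \<zeta> = b" "\<Psi> y = \<Psi> (cis \<tau>)" unfolding \<Gamma> by (auto simp: closed_segment_commute)
      have n\<zeta>: "norm \<zeta> = 1" using y(2) ab by auto
      have "y = \<zeta>" using segb[OF y(1) n\<zeta>] \<Psi>U[of y] bd[of "cis \<tau>"] y(3) by auto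
      then show ?thesis using y ab(3) by (auto simp: p_def)
    qed
    then have "\<Psi> 0 = p" using const_arc_centre[OF \<Psi>(1) hol st(2)] by blast
    then show False using bd[OF ab(1)] \<open>\<Psi> 0 \<in> U\<close> by (simp add: p_def)
  qed
  have "inj_on \<Psi> (cball 0 1)"
  proof (rule inj_onI)
    fix x y assume xy: "x \<in> cball 0 1" "y \<in> cball 0 1" "\<Psi> x = \<Psi> y"
    then consider "norm x < 1" "norm y < 1" | "norm x = 1" "norm y = 1" | "norm x < 1" "norm y = 1" | "norm x = 1" "norm y < 1"
      by (auto simp: le_less)
    then show "x = y"
    proof cases
      case 1 then show ?thesis using inj xy(3) by simp
    next
      case 2 then show ?thesis using injb xy(3) by simp
    next
      case 3 then show ?thesis using \<Psi>U[of x] bd[of y] xy(3) by simp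
    next
      case 4 then show ?thesis using \<Psi>U[of y] bd[of x] xy(3) by simp
    qed
  qed
  then obtain \<Phi> where \<Phi>: "homeomorphism (cball 0 1) (closure U) \<Psi> \<Phi>" using homeomorphism_compact[OF compact_cball \<Psi>(1) im] by blast
  have "\<Phi> z = nphi U z" if "z \<in> U" for z
  proof -
    have "\<Psi> (nphi U z) = z" using \<Psi>(2) nB(3,4)[OF U that] by metis
    then show ?thesis using \<Phi> nB(3)[OF U that] unfolding homeomorphism_def by (metis dist_0_norm less_imp_le mem_cball)
  qed
  then show ?thesis using that[OF \<Phi> \<Psi>(2)] by blast
qed

lemma bounded_Fatou_eq: "bounded_Fatou_components f = comps"
  by (simp add: bounded_Fatou_components_def Fatou_eq)

text \<open>Existence of one system makes the choice in \<open>Fatou_coord\<close> meaningful. From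
  here on only the chosen system is used; its coordinates may differ from those constructed
  above.\<close>

theorem Fatou_coordinates_Fatou_coord: "Fatou_coordinates f (Fatou_coord f)"
proof -
  have "\<exists>\<Phi> \<Psi>. homeomorphism (cball 0 1) (closure U) \<Psi> \<Phi> \<and> (\<forall>w. norm w < 1 \<longrightarrow> \<Psi> w = npsi U w) \<and>
     (\<forall>z\<in>U. \<Phi> z = nphi U z)" if "U \<in> comps" for U using disc_extension[OF that] by metis
  then obtain \<Phi> \<Psi> where E: "\<And>U. U \<in> comps \<Longrightarrow> homeomorphism (cball 0 1) (closure U) (\<Psi> U) (\<Phi> U)"
    "\<And>U w. U \<in> comps \<Longrightarrow> norm w < 1 \<Longrightarrow> \<Psi> U w = npsi U w" "\<And>U z. U \<in> comps \<Longrightarrow> z \<in> U \<Longrightarrow> \<Phi> U z = nphi U z" by metis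
  have "Fatou_coordinates f \<Phi>" unfolding Fatou_coordinates_def bounded_Fatou_eq
  proof (intro ballI conjI)
    fix U assume U: "U \<in> comps"
    show "\<Phi> U holomorphic_on U" using nB(1)[OF U] holomorphic_cong[OF refl, of U "\<Phi> U" "nphi U"] E(3)[OF U] by simp
    show "\<Phi> U ` U = ball 0 1"
    proof
      show "ball 0 1 \<subseteq> \<Phi> U ` U"
      proof
        fix w :: complex assume "w \<in> ball 0 1"
        then have w: "norm w < 1" by simp
        then show "w \<in> \<Phi> U ` U" using nB(5,6)[OF U w] E(3)[OF U] by (intro image_eqI[of _ _ "npsi U w"]) auto
      qed
    qed (use nB(3)[OF U] E(3)[OF U] in auto)
    have "\<Psi> U holomorphic_on ball 0 1" using nB(2)[OF U] holomorphic_cong[OF refl, of "ball 0 1" "\<Psi> U" "npsi U"] E(2)[OF U] by simp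
    then show "\<exists>\<psi>. homeomorphism (closure U) (cball 0 1) (\<Phi> U) \<psi> \<and> \<psi> holomorphic_on ball 0 1"
      using E(1)[OF U] homeomorphism_symD by blast
    show "\<exists>d\<ge>1. \<forall>z\<in>U. \<Phi> (poly f ` U) (poly f z) = \<Phi> U z ^ d"
      using ndeg_pos[OF U] nphi_step[OF U] E(3)[OF U] E(3)[OF comps_image[OF U]] by (intro exI[of _ "ndeg U"]) auto
  qed
  then show ?thesis unfolding Fatou_coord_def by (rule someI[of "Fatou_coordinates f" \<Phi>])
qed

end

subsection \<open>Allowable arcs\<close>

definition rayfin :: "complex set \<Rightarrow> bool" where
  "rayfin Z \<longleftrightarrow> (\<exists>F. finite F \<and> F \<subseteq> sphere 0 1 \<and> Z \<subseteq> (\<Union>\<zeta>\<in>F. disk_ray \<zeta>))"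

lemma rayfin_mono: "rayfin Z \<Longrightarrow> Z' \<subseteq> Z \<Longrightarrow> rayfin Z'"
  unfolding rayfin_def by (meson order_trans)

lemma rayfin_Un: assumes "rayfin Z" "rayfin Z'" shows "rayfin (Z \<union> Z')"
proof -
  obtain F F' where "finite F" "F \<subseteq> sphere 0 1" "Z \<subseteq> (\<Union>\<zeta>\<in>F. disk_ray \<zeta>)"
    "finite F'" "F' \<subseteq> sphere 0 1" "Z' \<subseteq> (\<Union>\<zeta>\<in>F'. disk_ray \<zeta>)" using assms unfolding rayfin_def by metis
  then show ?thesis unfolding rayfin_def by (intro exI[of _ "F \<union> F'"]) auto
qed

lemma rayfin_empty: "rayfin {}" unfolding rayfin_def by (intro exI[of _ "{}"]) auto

lemma rayfin_UN: "finite I \<Longrightarrow> (\<And>i. i \<in> I \<Longrightarrow> rayfin (Z i)) \<Longrightarrow> rayfin (\<Union>i\<in>I. Z i)"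
  by (induction I rule: finite_induct) (auto simp: rayfin_empty intro: rayfin_Un)

lemma disk_ray_scale: "0 \<le> r \<Longrightarrow> r \<le> 1 \<Longrightarrow> of_real r * \<zeta> \<in> disk_ray \<zeta>"
  by (auto simp: disk_ray_def)

lemma ray_through:
  fixes w :: complex assumes "norm w \<le> 1" obtains \<zeta> where "norm \<zeta> = 1" "w = of_real (norm w) * \<zeta>"
proof (cases "w = 0")
  case True then show ?thesis using that[of 1] by simp
next
  case False then show ?thesis using that[of "w / of_real (norm w)"] by (simp add: norm_divide)
qed

lemma rayfin_ray: "norm \<zeta> = 1 \<Longrightarrow> rayfin (disk_ray \<zeta>)"
  unfolding rayfin_def by (intro exI[of _ "{\<zeta>}"]) auto

lemma rayfin_sing: assumes "norm w \<le> 1" shows "rayfin {w}"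
proof -
  obtain \<zeta> where \<zeta>: "norm \<zeta> = 1" "w = of_real (norm w) * \<zeta>" using ray_through[OF assms] .
  have "w \<in> disk_ray \<zeta>" by (subst \<zeta>(2)) (use assms in \<open>auto intro!: disk_ray_scale\<close>)
  then show ?thesis using rayfin_mono[OF rayfin_ray[OF \<zeta>(1)]] by blast
qed

lemma disk_ray_power: "w \<in> disk_ray \<zeta> \<Longrightarrow> w ^ d \<in> disk_ray (\<zeta> ^ d)"
proof -
  assume "w \<in> disk_ray \<zeta>"
  then obtain t where t: "0 \<le> t" "t \<le> 1" "w = of_real t * \<zeta>" by (auto simp: disk_ray_def)
  then have "w ^ d = of_real (t ^ d) * \<zeta> ^ d" by (simp add: power_mult_distrib)
  then show ?thesis using disk_ray_scale[of "t ^ d" "\<zeta> ^ d"] t by (simp add: power_le_one)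
qed

lemma rayfin_power: assumes "rayfin Z" shows "rayfin ((\<lambda>w. w ^ d) ` Z)"
proof -
  obtain F where F: "finite F" "F \<subseteq> sphere 0 1" "Z \<subseteq> (\<Union>\<zeta>\<in>F. disk_ray \<zeta>)" using assms unfolding rayfin_def by metis
  show ?thesis unfolding rayfin_def
  proof (intro exI[of _ "(\<lambda>w. w ^ d) ` F"] conjI)
    show "(\<lambda>w. w ^ d) ` Z \<subseteq> (\<Union>\<zeta>\<in>(\<lambda>w. w ^ d) ` F. disk_ray \<zeta>)"
    proof
      fix v assume "v \<in> (\<lambda>w. w ^ d) ` Z"
      then obtain w where w: "w \<in> Z" "v = w ^ d" by auto
      then obtain \<zeta> where "\<zeta> \<in> F" "w \<in> disk_ray \<zeta>" using F(3) by blast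
      then show "v \<in> (\<Union>\<zeta>\<in>(\<lambda>w. w ^ d) ` F. disk_ray \<zeta>)" using disk_ray_power[of w \<zeta> d] w(2) by auto
    qed
  qed (use F in \<open>auto simp: norm_power\<close>)
qed

lemma rayfin_root:
  assumes "rayfin Z" "d \<ge> 1" shows "rayfin {w. norm w \<le> 1 \<and> w ^ d \<in> Z}"
proof -
  obtain F where F: "finite F" "F \<subseteq> sphere 0 1" "Z \<subseteq> (\<Union>\<zeta>\<in>F. disk_ray \<zeta>)" using assms(1) unfolding rayfin_def by metis
  \<comment> \<open>The ray through 1 is added for w = 0, to which no particular d-th root
    belongs.\<close>
  define G where "G = insert 1 (\<Union>\<zeta>\<in>F. {\<xi>. \<xi> ^ d = \<zeta>})"
  show ?thesis unfolding rayfin_def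
  proof (intro exI[of _ G] conjI)
    show "finite G" unfolding G_def using F(1) assms(2) by (intro finite.insertI finite_UN_I finite_nth_roots) auto
    show "G \<subseteq> sphere 0 1"
    proof
      fix \<xi> assume "\<xi> \<in> G"
      then consider "\<xi> = 1" | "norm \<xi> ^ d = 1" using F(2) by (auto simp: G_def simp flip: norm_power)
      then show "\<xi> \<in> sphere 0 1"
      proof cases
        case 2
        then have "norm (norm \<xi>) = 1" using power_eq_1_iff[of "norm \<xi>" d] assms(2) by auto
        then show ?thesis by simp
      qed simp
    qed
    show "{w. norm w \<le> 1 \<and> w ^ d \<in> Z} \<subseteq> (\<Union>\<zeta>\<in>G. disk_ray \<zeta>)"
    proof
      fix w assume "w \<in> {w. norm w \<le> 1 \<and> w ^ d \<in> Z}"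
      then have w: "norm w \<le> 1" "w ^ d \<in> Z" by auto
      show "w \<in> (\<Union>\<zeta>\<in>G. disk_ray \<zeta>)"
      proof (cases "w = 0")
        case True
        then have "w \<in> disk_ray 1" using disk_ray_scale[of 0 1] by simp
        then show ?thesis by (auto simp: G_def)
      next
        case False
        obtain \<zeta> where \<zeta>: "\<zeta> \<in> F" "w ^ d \<in> disk_ray \<zeta>" using F(3) w(2) by blast
        then obtain t where t: "0 \<le> t" "t \<le> 1" "w ^ d = of_real t * \<zeta>" by (auto simp: disk_ray_def)
        have "norm \<zeta> = 1" using F(2) \<zeta>(1) by auto
        then have "t = norm w ^ d" using arg_cong[OF t(3), of norm] t(1) by (simp add: norm_mult norm_power)
        then have "(w / of_real (norm w)) ^ d = \<zeta>" using t(3) False by (simp add: power_divide field_simps)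
        then have "w / of_real (norm w) \<in> G" using \<zeta>(1) by (auto simp: G_def)
        moreover have "of_real (norm w) * (w / of_real (norm w)) \<in> disk_ray (w / of_real (norm w))"
          using w(1) by (intro disk_ray_scale) auto
        ultimately show ?thesis using False by (auto intro!: bexI[of _ "w / of_real (norm w)"])
      qed
    qed
  qed
qed

lemma disk_ray_segment: "disk_ray \<zeta> = closed_segment 0 \<zeta>"
  by (auto simp: disk_ray_def closed_segment_def scaleR_conv_of_real)

lemma rays_no_open:
  assumes "open O'" "O' \<noteq> {}" "finite F" shows "\<not> O' \<subseteq> (\<Union>\<zeta>\<in>F. disk_ray \<zeta>)"
proof
  assume "O' \<subseteq> (\<Union>\<zeta>\<in>F. disk_ray \<zeta>)"
  moreover have "negligible (disk_ray \<zeta>)" for \<zeta>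
    unfolding disk_ray_segment by (simp add: negligible_convex_interior interior_closed_segment_ge2)
  then have "negligible (\<Union>\<zeta>\<in>F. disk_ray \<zeta>)" using assms(3) by (intro negligible_Union) auto
  ultimately have "negligible O'" using negligible_subset by blast
  then show False using open_not_negligible assms by blast
qed

text \<open>A union of radii is star-shaped about 0, so the outward half-line from a point u off it
  never meets it. Such a half-line starting inside the loop stays inside, although the inside is
  bounded; u exists because finitely many radii contain no nonempty open set.\<close>

lemma rays_no_loop:
  assumes c: "simple_path c" "pathfinish c = pathstart c" shows "\<not> rayfin (path_image c)"
proof
  assume "rayfin (path_image c)"
  then obtain F where F: "finite F" "F \<subseteq> sphere 0 1" "path_image c \<subseteq> (\<Union>\<zeta>\<in>F. disk_ray \<zeta>)" unfolding rayfin_def by metis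
  note Jd = Jordan_inside_outside[OF c]
  have I: "open (inside (path_image c))" "inside (path_image c) \<noteq> {}" "bounded (inside (path_image c))"
    "frontier (inside (path_image c)) = path_image c" using Jd by simp_all
  have Fne: "F \<noteq> {}" using F(3) path_image_nonempty[of c] by auto
  obtain u where u: "u \<in> inside (path_image c)" "u \<notin> (\<Union>\<zeta>\<in>F. disk_ray \<zeta>)" using rays_no_open[OF I(1,2) F(1)] by blast
  have u0: "u \<noteq> 0" using u(2) Fne by (auto simp: disk_ray_segment)
  define L where "L = (\<lambda>s::real. of_real s * u) ` {1..}"
  have "connected L" unfolding L_def by (intro connected_continuous_image continuous_intros) auto
  moreover have "L \<inter> path_image c = {}"
  proof (rule ccontr)
    assume "L \<inter> path_image c \<noteq> {}"
    then obtain s where s: "s \<ge> 1" "of_real s * u \<in> path_image c" by (auto simp: L_def)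
    then obtain \<zeta> t where t: "\<zeta> \<in> F" "0 \<le> t" "t \<le> 1" "of_real s * u = of_real t * \<zeta>" using F(3) by (fastforce simp: disk_ray_def)
    have "u = of_real (t / s) * \<zeta>" using t(4) s(1) by (simp add: field_simps)
    moreover have "0 \<le> t / s" "t / s \<le> 1" using t s(1) by (auto simp: field_simps)
    ultimately have "u \<in> disk_ray \<zeta>" using disk_ray_scale by metis
    then show False using u(2) t(1) by blast
  qed
  moreover have "u \<in> L" unfolding L_def by (intro image_eqI[of _ _ 1]) auto
  ultimately have "L \<subseteq> inside (path_image c)" using connected_Int_frontier[of L "inside (path_image c)"] u(1) I(4) by blast
  then have "bounded L" using I(3) bounded_subset by blast
  then obtain B where B: "\<And>z. z \<in> L \<Longrightarrow> norm z \<le> B" unfolding bounded_iff by blast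
  define s where "s = max 1 ((B + 1) / norm u)"
  have "of_real s * u \<in> L" unfolding L_def by (rule imageI) (simp add: s_def)
  then have "norm (of_real s * u) \<le> B" by (rule B)
  moreover have "(B + 1) / norm u \<le> s" "s \<ge> 1" by (auto simp: s_def)
  then have "B + 1 \<le> s * norm u" using u0 by (simp add: field_simps)
  ultimately show False using \<open>s \<ge> 1\<close> by (simp add: norm_mult)
qed

context pcf_poly
begin

abbreviation "fphi \<equiv> Fatou_coord f"
definition "fpsi U = (SOME \<psi>. homeomorphism (closure U) (cball 0 1) (fphi U) \<psi>)"

text \<open>The functional equation extends from U to its closure by continuity.\<close>

lemma fphi:
  assumes U: "U \<in> comps"
  shows "homeomorphism (closure U) (cball 0 1) (fphi U) (fpsi U)" "fphi U ` U = ball 0 1"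
    "\<exists>d\<ge>1. \<forall>z\<in>closure U. fphi (poly f ` U) (poly f z) = fphi U z ^ d"
proof -
  have *: "\<exists>\<psi>. homeomorphism (closure U) (cball 0 1) (fphi U) \<psi>" "fphi U ` U = ball 0 1"
    "\<exists>d\<ge>1. \<forall>z\<in>U. fphi (poly f ` U) (poly f z) = fphi U z ^ d" if "U \<in> comps" for U
    using Fatou_coordinates_Fatou_coord that unfolding Fatou_coordinates_def bounded_Fatou_eq by blast+
  have h: "homeomorphism (closure U) (cball 0 1) (fphi U) (fpsi U)" if "U \<in> comps" for U
    unfolding fpsi_def using *(1)[OF that] by (rule someI_ex)
  show "homeomorphism (closure U) (cball 0 1) (fphi U) (fpsi U)" using h[OF U] .
  show "fphi U ` U = ball 0 1" using *(2)[OF U] .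
  obtain d where d: "d \<ge> 1" "\<And>z. z \<in> U \<Longrightarrow> fphi (poly f ` U) (poly f z) = fphi U z ^ d" using *(3)[OF U] by blast
  have cU: "continuous_on (closure U) (fphi U)" using h[OF U] by (simp add: homeomorphism_def)
  have cV: "continuous_on (closure (poly f ` U)) (fphi (poly f ` U))" using h[OF comps_image[OF U]] by (simp add: homeomorphism_def)
  have "fphi (poly f ` U) (poly f z) = fphi U z ^ d" if "z \<in> closure U" for z
  proof -
    have "poly f ` closure U \<subseteq> closure (poly f ` U)" using image_closure_comp[OF U, of _ 1] by auto
    then have "continuous_on (closure U) (\<lambda>z. fphi (poly f ` U) (poly f z))" by (intro continuous_on_compose2[OF cV] continuous_intros)
    then have "continuous_on (closure U) (\<lambda>z. fphi (poly f ` U) (poly f z) - fphi U z ^ d)" by (intro continuous_intros cU)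
    then have "fphi (poly f ` U) (poly f z) - fphi U z ^ d = 0" by (rule continuous_constant_on_closure[OF _ _ that]) (simp add: d(2))
    then show ?thesis by simp
  qed
  then show "\<exists>d\<ge>1. \<forall>z\<in>closure U. fphi (poly f ` U) (poly f z) = fphi U z ^ d" using d(1) by blast
qed

lemma fphiD:
  assumes U: "U \<in> comps"
  shows "continuous_on (closure U) (fphi U)" "continuous_on (cball 0 1) (fpsi U)"
    "z \<in> closure U \<Longrightarrow> norm (fphi U z) \<le> 1" "z \<in> closure U \<Longrightarrow> fpsi U (fphi U z) = z"
    "norm w \<le> 1 \<Longrightarrow> fpsi U w \<in> closure U" "norm w \<le> 1 \<Longrightarrow> fphi U (fpsi U w) = w" "norm w < 1 \<Longrightarrow> fpsi U w \<in> U"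
proof -
  note h = fphi(1)[OF U, unfolded homeomorphism_def]
  show "continuous_on (closure U) (fphi U)" "continuous_on (cball 0 1) (fpsi U)" using h by auto
  show "z \<in> closure U \<Longrightarrow> norm (fphi U z) \<le> 1" "z \<in> closure U \<Longrightarrow> fpsi U (fphi U z) = z"
    "norm w \<le> 1 \<Longrightarrow> fpsi U w \<in> closure U" "norm w \<le> 1 \<Longrightarrow> fphi U (fpsi U w) = w" for w using h by auto
  show "fpsi U w \<in> U" if "norm w < 1"
  proof -
    have "w \<in> fphi U ` U" using that unfolding fphi(2)[OF U] by simp
    then obtain z where z: "z \<in> U" "w = fphi U z" by auto
    then have "fpsi U w = z" using h closure_subset by auto
    then show ?thesis using z by simp
  qed
qed

text \<open>Unlike allowable sets, good sets are closed under finite unions, images and preimages.\<close>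

definition good :: "complex set \<Rightarrow> bool" where
  "good S \<longleftrightarrow> S \<subseteq> K \<and> (\<forall>U\<in>comps. rayfin (fphi U ` (S \<inter> closure U)))"

text \<open>The inside of the loop is connected and lies in the interior of K, hence in one
  component; the loop is the frontier of its inside.\<close>

lemma loop_one_comp:
  assumes c: "simple_path c" "pathfinish c = pathstart c" "path_image c \<subseteq> K"
  obtains U where "U \<in> comps" "path_image c \<subseteq> closure U"
proof -
  note Jd = Jordan_inside_outside[OF c(1,2)]
  have I: "connected (inside (path_image c))" "inside (path_image c) \<noteq> {}" "frontier (inside (path_image c)) = path_image c" using Jd by simp_all
  have ins: "inside (path_image c) \<subseteq> interior K" using inside_loop[OF c] .
  then obtain U where U: "U \<in> comps" "U \<inter> inside (path_image c) \<noteq> {}" using I(2) comp_of by blast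
  then have "inside (path_image c) \<subseteq> U" using components_maximal[OF U(1) I(1) ins] U(2) by (simp add: Int_commute)
  then have "closure (inside (path_image c)) \<subseteq> closure U" by (rule closure_mono)
  then show ?thesis using that[OF U(1)] I(3) by (auto simp: frontier_def)
qed

lemma no_good_loop:
  assumes "good (path_image g)" "simple_path g" shows "pathfinish g \<noteq> pathstart g"
proof
  assume lp: "pathfinish g = pathstart g"
  have gK: "path_image g \<subseteq> K" using assms(1) by (simp add: good_def)
  obtain U where U: "U \<in> comps" "path_image g \<subseteq> closure U" using loop_one_comp[OF assms(2) lp gK] .
  have inj: "inj_on (fphi U) (path_image g)" by (rule inj_on_inverseI[of _ "fpsi U"]) (use fphiD(4)[OF U(1)] U(2) in blast)
  have "simple_path (fphi U \<circ> g)" using simple_path_continuous_image[OF assms(2) continuous_on_subset[OF fphiD(1)[OF U(1)] U(2)] inj] .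
  moreover have "pathfinish (fphi U \<circ> g) = pathstart (fphi U \<circ> g)" using lp by (simp add: pathstart_compose pathfinish_compose)
  ultimately have "\<not> rayfin (path_image (fphi U \<circ> g))" by (rule rays_no_loop)
  moreover have "path_image g \<inter> closure U = path_image g" using U(2) by blast
  ultimately show False using assms(1) U(1) by (auto simp: good_def path_image_compose)
qed

text \<open>The image of a Euclidean chord of the disc; strict convexity of the disc keeps all but
  its ends in U.\<close>

lemma chord:
  assumes U: "U \<in> comps" and pq: "p \<in> closure U" "q \<in> closure U" "p \<noteq> q"
  obtains h where "arc h" "pathstart h = p" "pathfinish h = q" "path_image h \<subseteq> closure U" "path_image h - {p, q} \<subseteq> U" "h (1/2) \<in> U"
proof -
  define A B where "A = fphi U p" and "B = fphi U q"
  have AB: "norm A \<le> 1" "norm B \<le> 1" "A \<noteq> B" "fpsi U A = p" "fpsi U B = q" using fphiD(3,4)[OF U] pq unfolding A_def B_def by (auto, metis)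
  define h where "h = fpsi U \<circ> linepath A B"
  have seg: "closed_segment A B \<subseteq> cball 0 1" using AB by (intro closed_segment_subset) auto
  have inj: "inj_on (fpsi U) (cball 0 1)" using fphiD(6)[OF U] by (metis inj_onI mem_cball_0)
  have op: "norm w < 1" if "w \<in> open_segment A B" for w
  proof -
    have "dist w 0 < dist A 0 \<or> dist w 0 < dist B 0" using dist_decreases_open_segment that by (metis dist_commute)
    then show ?thesis using AB by auto
  qed
  have "arc h" unfolding h_def using AB(3) seg
    by (intro arc_compose_inj arc_linepath) (auto intro: continuous_on_subset[OF fphiD(2)[OF U]] inj_on_subset[OF inj])
  moreover have "pathstart h = p" "pathfinish h = q" using AB by (auto simp: h_def pathstart_compose pathfinish_compose)
  moreover have "path_image h \<subseteq> closure U" using seg fphiD(5)[OF U] by (force simp: h_def path_image_compose)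
  moreover have "path_image h - {p, q} \<subseteq> U"
  proof
    fix z assume "z \<in> path_image h - {p, q}"
    then obtain w where w: "w \<in> closed_segment A B" "z = fpsi U w" "z \<noteq> p" "z \<noteq> q" by (auto simp: h_def path_image_compose)
    then have "w \<in> open_segment A B" using AB by (auto simp: open_segment_def)
    then show "z \<in> U" using op fphiD(7)[OF U] w(2) by blast
  qed
  moreover have "h (1/2) \<in> U"
  proof -
    have "linepath A B (1/2) \<in> open_segment A B" using AB(3) by (auto simp: in_segment linepath_def intro!: exI[of _ "1/2"])
    then show ?thesis using op fphiD(7)[OF U] by (auto simp: h_def)
  qed
  ultimately show ?thesis by (rule that)
qed

text \<open>An excursion of g from the closure of U would form a loop with part of a chord. This
  loop lies in the closure of one component, which is U because the chord runs through U; so there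
  is no excursion.\<close>

lemma arc_in_closure:
  assumes U: "U \<in> comps" and g: "arc g" "path_image g \<subseteq> K" and e: "pathstart g \<in> closure U" "pathfinish g \<in> closure U"
  shows "path_image g \<subseteq> closure U"
proof (rule ccontr)
  assume "\<not> ?thesis"
  then obtain t where t: "t \<in> {0..1}" "g t \<notin> closure U" unfolding path_image_def by blast
  obtain h where h: "arc h" "pathstart h = pathstart g" "pathfinish h = pathfinish g" "path_image h \<subseteq> closure U"
    "path_image h - {pathstart g, pathfinish g} \<subseteq> U" using chord[OF U e] arc_distinct_ends[OF g(1)] by metis
  have ends: "pathstart g \<in> path_image h" "pathfinish g \<in> path_image h" using pathstart_in_path_image[of h] pathfinish_in_path_image[of h] h by auto
  have th: "g t \<notin> path_image h" using t(2) h(4) by blast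
  obtain k l where kl: "arc k" "arc l" "pathfinish k = pathstart l" "pathfinish l = pathstart k"
    "path_image k \<subseteq> path_image g" "path_image l \<subseteq> path_image h" "g t \<in> path_image k"
    "path_image k \<inter> path_image l = {pathstart k, pathfinish k}"
    "simple_path (k +++ l)" "pathfinish (k +++ l) = pathstart (k +++ l)" by (rule arc_loop_of_deviation[OF g(1) h(1) ends t(1) th])
  have im: "path_image (k +++ l) = path_image k \<union> path_image l" using kl(3) by (simp add: path_image_join)
  have "path_image (k +++ l) \<subseteq> K" unfolding im using kl(5,6) g(2) h(4) comps_closure(1)[OF U] by blast
  then obtain W where W: "W \<in> comps" "path_image (k +++ l) \<subseteq> closure W" using loop_one_comp[OF kl(9,10)] by blast
  have "infinite (path_image l)"
    using connected_finite_iff_sing[of "path_image l"] arc_distinct_ends[OF kl(2)] connected_arc_image[OF kl(2)]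
      pathstart_in_path_image[of l] pathfinish_in_path_image[of l] by (metis empty_iff singletonD)
  then have "\<not> path_image l \<subseteq> {pathstart g, pathfinish g}" using finite_subset by blast
  then obtain z where "z \<in> path_image l" "z \<in> U" using kl(6) h(5) by blast
  then have "W = U" using comps_disjoint_closure[OF W(1) U] W(2) im by blast
  then show False using W(2) im kl(7) t(2) by blast
qed

text \<open>A chord of V between two common points lies in the closure of U by
  \<open>arc_in_closure\<close>, yet it passes through V.\<close>

lemma closures_meet:
  assumes U: "U \<in> comps" and V: "V \<in> comps" and p: "p \<in> closure U" "p \<in> closure V" and q: "q \<in> closure U" "q \<in> closure V" and ne: "p \<noteq> q"
  shows "U = V"
proof -
  obtain h where h: "arc h" "pathstart h = p" "pathfinish h = q" "path_image h \<subseteq> closure V" "h (1/2) \<in> V" using chord[OF V p(2) q(2) ne] by metis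
  have hK: "path_image h \<subseteq> K" using h(4) comps_closure(1)[OF V] by blast
  have "path_image h \<subseteq> closure U" using arc_in_closure[OF U h(1) hK] h(2,3) p q by simp
  moreover have "h (1/2) \<in> path_image h" by (simp add: path_image_def)
  ultimately show ?thesis using comps_disjoint_closure[OF U V] h(5) by blast
qed

text \<open>\<open>g + D\<close> replaces the part of the arc \<open>g\<close> in \<open>closure U\<close> by two radii of \<open>U\<close>.\<close>

definition "radmod g U (D :: real \<Rightarrow> complex) \<longleftrightarrow> (let T = {t \<in> {0..1}. g t \<in> closure U} in
    continuous_on {0..1} D \<and>
    (\<forall>t\<in>{0..1}. D t \<noteq> 0 \<longrightarrow> (\<exists>a b. a < t \<and> t < b \<and> {a..b} \<subseteq> T)) \<and>
    (\<exists>\<zeta> \<xi>. norm \<zeta> = 1 \<and> norm \<xi> = 1 \<and>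
      (\<forall>t\<in>T. g t + D t \<in> closure U \<and> fphi U (g t + D t) \<in> disk_ray \<zeta> \<union> disk_ray \<xi>)) \<and>
    (\<forall>t\<in>T. g t + D t \<in> U \<or> (\<exists>t'\<in>T. g t + D t = g t')))"

text \<open>By \<open>arc_in_closure\<close> the times spent in the closure of U form an interval
  from a to b. There g is replaced by the path along the radius of g a to the point with coordinate
  0 and out along the radius of g b. The new path may fail to be injective, for instance if both
  ends lie on one radius; \<open>allowable_arc_exists\<close> extracts an arc later.\<close>

lemma radial_modification:
  assumes U: "U \<in> comps" and g: "arc g" "path_image g \<subseteq> K"
  defines "T \<equiv> {t \<in> {0..1}. g t \<in> closure U}"
  shows "\<exists>D. radmod g U D"
proof (cases "\<exists>a b. a \<in> T \<and> b \<in> T \<and> a < b")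
  case False
  have "\<exists>\<zeta>. norm \<zeta> = 1 \<and> (\<forall>t\<in>T. fphi U (g t) \<in> disk_ray \<zeta>)"
  proof (cases "T = {}")
    case True then show ?thesis using norm_one by blast
  next
    case ne: False
    then obtain t where t: "t \<in> T" by blast
    have Tt: "s = t" if "s \<in> T" for s using False that t by (meson linorder_neqE)
    have n1: "norm (fphi U (g t)) \<le> 1" using fphiD(3)[OF U] t by (simp add: T_def)
    obtain \<zeta> where \<zeta>: "norm \<zeta> = 1" "fphi U (g t) = of_real (norm (fphi U (g t))) * \<zeta>" using ray_through[OF n1] .
    have "fphi U (g t) \<in> disk_ray \<zeta>" by (subst \<zeta>(2)) (use n1 in \<open>auto intro!: disk_ray_scale\<close>)
    then show ?thesis using \<zeta>(1) Tt by metis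
  qed
  then obtain \<zeta> where \<zeta>: "norm \<zeta> = 1" "\<And>t. t \<in> T \<Longrightarrow> fphi U (g t) \<in> disk_ray \<zeta>" by blast
  show ?thesis unfolding radmod_def Let_def T_def[symmetric]
  proof (intro exI[of _ "\<lambda>_. 0"] conjI)
    show "\<exists>\<zeta> \<xi>. norm \<zeta> = 1 \<and> norm \<xi> = 1 \<and>
      (\<forall>t\<in>T. g t + 0 \<in> closure U \<and> fphi U (g t + 0) \<in> disk_ray \<zeta> \<union> disk_ray \<xi>)" by (intro exI[of _ \<zeta>]) (use \<zeta> in \<open>auto simp: T_def\<close>)
  qed auto
next
  case True
  have gc: "continuous_on {0..1} g" using g(1) by (simp add: arc_def path_def)
  have Tcl: "closed T" unfolding T_def by (rule continuous_closed_preimage[OF gc, of "closure U", unfolded vimage_def Int_def mem_Collect_eq]) auto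
  have T01: "T \<subseteq> {0..1}" by (auto simp: T_def)
  have Tne: "T \<noteq> {}" and Tbd: "bdd_above T" "bdd_below T" using True T01 by (auto intro: bdd_above_mono[of "{0..1}"] bdd_below_mono[of "{0..1}"])
  define a b where "a = Inf T" and "b = Sup T"
  have aT: "a \<in> T" and bT: "b \<in> T" unfolding a_def b_def using closed_contains_Inf[OF Tne Tbd(2) Tcl] closed_contains_Sup[OF Tne Tbd(1) Tcl] .
  have Tb: "a \<le> t" "t \<le> b" if "t \<in> T" for t unfolding a_def b_def using that Tbd cInf_lower cSup_upper by blast+
  have ab: "a < b" using True Tb by fastforce
  have a01: "0 \<le> a" "b \<le> 1" "a \<in> {0..1}" "b \<in> {0..1}" using aT bT T01 by auto
  have "path_image (subpath a b g) \<subseteq> closure U"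
  proof (rule arc_in_closure[OF U])
    show "arc (subpath a b g)" using arc_subpath_arc[OF g(1)] a01 ab by simp
    show "path_image (subpath a b g) \<subseteq> K" using path_image_subpath_subset[of a b g] a01 g(2) by auto
  qed (use aT bT in \<open>auto simp: T_def\<close>)
  then have Tab: "T = {a..b}" using Tb ab a01 path_image_subpath[of a b g] by (fastforce simp: T_def)
  define A B where "A = fphi U (g a)" and "B = fphi U (g b)"
  have AB: "norm A \<le> 1" "norm B \<le> 1" "fpsi U A = g a" "fpsi U B = g b" using aT bT fphiD(3,4)[OF U] by (auto simp: A_def B_def T_def)
  \<comment> \<open>Runs from -1 at a to 1 at b; its negative part scales A and its positive part
    scales B, so w passes through 0 in the middle.\<close>
  define lam where "lam t = 2 * (t - a) / (b - a) - 1" for t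
  have lam: "-1 \<le> lam t" "lam t \<le> 1" if "t \<in> {a..b}" for t using that ab by (auto simp: lam_def field_simps)
  have "b - a \<noteq> 0" using ab by simp
  then have lamab: "lam a = -1" "lam b = 1" by (simp_all only: lam_def times_divide_eq_right[symmetric] divide_self) simp_all
  define w where "w t = of_real (max 0 (- lam t)) * A + of_real (max 0 (lam t)) * B" for t
  have wcont: "continuous_on S w" for S unfolding w_def lam_def by (intro continuous_intros) (use ab in auto)
  have wab: "w a = A" "w b = B" by (auto simp: w_def lamab)
  have wcase: "\<exists>r Z. 0 \<le> r \<and> r \<le> 1 \<and> w t = of_real r * Z \<and> (Z = A \<or> Z = B)" if "t \<in> {a..b}" for t
  proof (cases "lam t \<le> 0")
    case True then show ?thesis using lam[OF that] by (intro exI[of _ "- lam t"] exI[of _ A]) (auto simp: w_def)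
  next
    case False then show ?thesis using lam[OF that] by (intro exI[of _ "lam t"] exI[of _ B]) (auto simp: w_def)
  qed
  have w1: "norm (w t) \<le> 1" if t: "t \<in> {a..b}" for t
  proof -
    obtain r Z where r: "0 \<le> r" "r \<le> 1" "w t = of_real r * Z" "Z = A \<or> Z = B" using wcase[OF t] by blast
    have "r * norm Z \<le> 1 * 1" using r AB by (intro mult_mono) auto
    then show ?thesis using r by (simp add: norm_mult)
  qed
  \<comment> \<open>Clamping to the interval makes D continuous on all of [0, 1] and zero outside
    (a, b), as w starts and ends at the coordinates of g a and g b.\<close>
  define c where "c t = max a (min b t)" for t
  have cab: "c t \<in> {a..b}" for t using ab by (auto simp: c_def)
  have cT: "c t = t" if "t \<in> T" for t using that by (auto simp: c_def Tab)
  define D where "D t = fpsi U (w (c t)) - g (c t)" for t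
  have DT: "g t + D t = fpsi U (w t)" if "t \<in> T" for t using cT[OF that] by (simp add: D_def)
  obtain \<zeta> where \<zeta>: "norm \<zeta> = 1" "A = of_real (norm A) * \<zeta>" using ray_through[OF AB(1)] .
  obtain \<xi> where \<xi>: "norm \<xi> = 1" "B = of_real (norm B) * \<xi>" using ray_through[OF AB(2)] .
  show ?thesis unfolding radmod_def Let_def T_def[symmetric]
  proof (intro exI[of _ D] conjI ballI impI)
    have cc: "continuous_on {0..1} c" unfolding c_def by (intro continuous_intros)
    have wc: "continuous_on {0..1} (\<lambda>t. w (c t))" by (rule continuous_on_compose2[OF wcont cc]) auto
    show "continuous_on {0..1} D" unfolding D_def
    proof (intro continuous_on_diff continuous_on_compose2[OF fphiD(2)[OF U] wc] continuous_on_compose2[OF gc cc])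
      show "(\<lambda>t. w (c t)) ` {0..1} \<subseteq> cball 0 1" using w1[OF cab] by auto
      show "c ` {0..1} \<subseteq> {0..1}"
      proof
        fix s assume "s \<in> c ` {0..1}"
        then obtain t where "s = c t" by blast
        then show "s \<in> {0..1}" using cab[of t] a01 by simp
      qed
    qed
    show "\<exists>a b. a < t \<and> t < b \<and> {a..b} \<subseteq> T" if "D t \<noteq> 0" for t
    proof (rule exI[of _ a], rule exI[of _ b], intro conjI)
      have "c t \<noteq> a" "c t \<noteq> b" using that wab AB(3,4) unfolding D_def by auto
      then show "a < t" "t < b" using ab unfolding c_def by (auto simp: max_def min_def split: if_splits)
    qed (simp add: Tab)
    show "\<exists>\<zeta> \<xi>. norm \<zeta> = 1 \<and> norm \<xi> = 1 \<and>
      (\<forall>t\<in>T. g t + D t \<in> closure U \<and> fphi U (g t + D t) \<in> disk_ray \<zeta> \<union> disk_ray \<xi>)"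
    proof (rule exI[of _ \<zeta>], rule exI[of _ \<xi>], intro conjI ballI \<zeta>(1) \<xi>(1))
      fix t assume t: "t \<in> T"
      then have tab: "t \<in> {a..b}" by (simp add: Tab)
      show "g t + D t \<in> closure U" unfolding DT[OF t] using fphiD(5)[OF U w1[OF tab]] .
    obtain r Z where r: "0 \<le> r" "r \<le> 1" "w t = of_real r * Z" "Z = A \<or> Z = B" using wcase[OF tab] by blast
    have "w t = of_real (r * norm A) * \<zeta> \<or> w t = of_real (r * norm B) * \<xi>" using r(3,4) \<zeta>(2) \<xi>(2) by (metis mult.assoc of_real_mult)
    moreover have "0 \<le> r * norm A" "r * norm A \<le> 1" "0 \<le> r * norm B" "r * norm B \<le> 1" using r AB by (auto intro: mult_le_one)
    ultimately have "w t \<in> disk_ray \<zeta> \<union> disk_ray \<xi>" using disk_ray_scale by (metis UnI1 UnI2)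
    then show "fphi U (g t + D t) \<in> disk_ray \<zeta> \<union> disk_ray \<xi>" unfolding DT[OF t] using fphiD(6)[OF U w1[OF tab]] by simp
    qed
    fix t assume t: "t \<in> T"
    then have tab: "t \<in> {a..b}" by (simp add: Tab)
    obtain r Z where r: "0 \<le> r" "r \<le> 1" "w t = of_real r * Z" "Z = A \<or> Z = B" using wcase[OF tab] by blast
    show "g t + D t \<in> U \<or> (\<exists>t'\<in>T. g t + D t = g t')"
    proof (cases "norm (w t) < 1")
      case True then show ?thesis unfolding DT[OF t] using fphiD(7)[OF U] by blast
    next
      case False
      then have "1 \<le> r * norm Z" using r by (simp add: norm_mult)
      moreover have "r * norm Z \<le> r * 1" using r AB by (intro mult_left_mono) auto
      ultimately have "w t = Z" using r by simp
      then have "g t + D t = g a \<or> g t + D t = g b" unfolding DT[OF t] using r(4) AB by auto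
      then show ?thesis using aT bT by blast
    qed
  qed
qed

text \<open>All components are modified at once. Modifications for different components are nonzero
  at disjoint sets of times because their closures share at most one point. The sums over the
  components of diameter above 1 / \<open>Suc n\<close> are finite by \<open>comps_small\<close> and
  converge uniformly, so the modified path is continuous.\<close>

lemma allowable_arc_exists:
  assumes x: "x \<in> K" and y: "y \<in> K" and ne: "x \<noteq> y"
  shows "\<exists>g. arc g \<and> pathstart g = x \<and> pathfinish g = y \<and> allowable f (path_image g)"
proof -
  obtain g where g: "arc g" "path_image g \<subseteq> K" "pathstart g = x" "pathfinish g = y"
    using K_path_connected x y ne unfolding path_connected_arcwise by metis
  have gc: "continuous_on {0..1} g" using g(1) by (simp add: arc_def path_def)
  have ginj: "s = t" if "s \<in> {0..1}" "t \<in> {0..1}" "g s = g t" for s t using g(1) that by (auto simp: arc_def inj_on_def)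
  define T where "T U = {t \<in> {0..1}. g t \<in> closure U}" for U
  obtain D where rD: "\<And>U. U \<in> comps \<Longrightarrow> radmod g U (D U)" using radial_modification[OF _ g(1,2)] by metis
  have D: "continuous_on {0..1} (D U)"
    "t \<in> {0..1} \<Longrightarrow> D U t \<noteq> 0 \<Longrightarrow> \<exists>a b. a < t \<and> t < b \<and> {a..b} \<subseteq> T U"
    "\<exists>\<zeta> \<xi>. norm \<zeta> = 1 \<and> norm \<xi> = 1 \<and>
      (\<forall>t\<in>T U. g t + D U t \<in> closure U \<and> fphi U (g t + D U t) \<in> disk_ray \<zeta> \<union> disk_ray \<xi>)"
    "t \<in> T U \<Longrightarrow> g t + D U t \<in> U \<or> (\<exists>t'\<in>T U. g t + D U t = g t')" if "U \<in> comps" for U t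
    using rD[OF that] unfolding radmod_def Let_def T_def[symmetric] by simp_all
  \<comment> \<open>A time moved for V inside an interval of times spent in the closure of U yields
    two common points of the closures.\<close>
  have ov: "U = V" if U: "U \<in> comps" and V: "V \<in> comps" and t: "t \<in> {0..1}" "D V t \<noteq> 0" and c: "c < d" "c \<le> s" "s \<le> d" "{c..d} \<subseteq> T U" "s = t" for U V t s c d
  proof -
    obtain a b where ab: "a < t" "t < b" "{a..b} \<subseteq> T V" using D(2)[OF V t] by blast
    have "\<exists>t'. t' \<noteq> t \<and> t' \<in> {a..b} \<and> t' \<in> {c..d}"
    proof (cases "t < d")
      case True then show ?thesis using ab c by (intro exI[of _ "min b d"]) auto
    next
      case False then show ?thesis using ab c by (intro exI[of _ "max a c"]) auto
    qed
    then obtain t' where t': "t' \<noteq> t" "t' \<in> T V" "t' \<in> T U" using ab(3) c(4) by blast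
    have tt: "t \<in> T V" "t \<in> T U" using ab c by auto
    have "g t \<noteq> g t'" using ginj[of t t'] t' tt by (auto simp: T_def)
    then show ?thesis using closures_meet[OF U V, of "g t" "g t'"] t' tt by (auto simp: T_def)
  qed
  have uniq: "U = V" if UV: "U \<in> comps" "V \<in> comps" and t: "t \<in> {0..1}" "D U t \<noteq> 0" "D V t \<noteq> 0" for U V t
  proof -
    obtain a b where "a < t" "t < b" "{a..b} \<subseteq> T U" using D(2)[OF UV(1) t(1,2)] by blast
    then show ?thesis using ov[OF UV t(1,3), of a b t] by auto
  qed
  have DT: "t \<in> T U" if "U \<in> comps" "t \<in> {0..1}" "D U t \<noteq> 0" for U t using D(2)[OF that] by fastforce
  \<comment> \<open>By \<open>uniq\<close> the component chosen here is the only one that moves the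
    point at time t.\<close>
  define h where "h t = g t + (if \<exists>U\<in>comps. D U t \<noteq> 0 then D (SOME U. U \<in> comps \<and> D U t \<noteq> 0) t else 0)" for t
  have h1: "h t = g t + D U t" if U: "U \<in> comps" "D U t \<noteq> 0" and t: "t \<in> {0..1}" for U t
  proof -
    have "(SOME V. V \<in> comps \<and> D V t \<noteq> 0) = U"
    proof (rule some_equality)
      show "V = U" if "V \<in> comps \<and> D V t \<noteq> 0" for V using uniq[of V U t] that U t by simp
    qed (use U in simp)
    then show ?thesis using U unfolding h_def by auto
  qed
  have h0: "h t = g t" if "\<And>U. U \<in> comps \<Longrightarrow> D U t = 0" for t using that by (auto simp: h_def)
  define big where "big n = {U \<in> comps. \<exists>x\<in>closure U. \<exists>y\<in>closure U. dist x y > 1 / real (Suc n)}" for n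
  have bf: "finite (big n)" for n using comps_small[of "1 / real (Suc n)"] unfolding big_def by simp
  define S where "S n t = g t + (\<Sum>U\<in>big n. D U t)" for n t
  have Sd: "dist (S n t) (h t) \<le> 1 / real (Suc n)" if t: "t \<in> {0..1}" for n t
  proof (cases "\<exists>U\<in>comps. D U t \<noteq> 0")
    case False
    then have "(\<Sum>U\<in>big n. D U t) = 0" by (intro sum.neutral) (auto simp: big_def)
    then show ?thesis using h0[of t] False by (auto simp: S_def)
  next
    case True
    then obtain U where U: "U \<in> comps" "D U t \<noteq> 0" by blast
    have z: "D V t = 0" if "V \<in> comps" "V \<noteq> U" for V using uniq[OF that(1) U(1) t _ U(2)] that(2) by blast
    show ?thesis
    proof (cases "U \<in> big n")
      case True
      have "(\<Sum>V\<in>big n. D V t) = (\<Sum>V\<in>{U}. D V t)" using bf z True by (intro sum.mono_neutral_right) (auto simp: big_def)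
      then show ?thesis using h1[OF U t] by (simp add: S_def)
    next
      case nb: False
      have "(\<Sum>V\<in>big n. D V t) = 0" using nb z by (intro sum.neutral) (auto simp: big_def)
      then have "S n t = g t" by (simp add: S_def)
      moreover have "g t \<in> closure U" "h t \<in> closure U" using DT[OF U(1) t U(2)] D(3)[OF U(1)] h1[OF U t] by (auto simp: T_def)
      moreover have "\<not> dist (g t) (h t) > 1 / real (Suc n)" if "g t \<in> closure U" "h t \<in> closure U"
        using nb U(1) that unfolding big_def by blast
      ultimately show ?thesis by simp
    qed
  qed
  have hc: "continuous_on {0..1} h"
  proof (rule uniform_limit_theorem[of _ S sequentially])
    have "continuous_on {0..1} (S n)" for n unfolding S_def by (intro continuous_intros gc D(1)) (auto simp: big_def)
    then show "\<forall>\<^sub>F n in sequentially. continuous_on {0..1} (S n)" by simp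
    show "uniform_limit {0..1} S h sequentially"
    proof (rule uniform_limitI)
      fix e :: real assume "e > 0"
      have "eventually (\<lambda>n. 1 / real (Suc n) < e) sequentially"
        using order_tendstoD(2)[OF lim_1_over_n[THEN LIMSEQ_Suc] \<open>e > 0\<close>] by simp
      then show "\<forall>\<^sub>F n in sequentially. \<forall>x\<in>{0..1}. dist (S n x) (h x) < e"
      proof eventually_elim
        case (elim n)
        show ?case
        proof
          fix x :: real assume "x \<in> {0..1}"
          from Sd[OF this] elim show "dist (S n x) (h x) < e" by (rule le_less_trans)
        qed
      qed
    qed
  qed auto
  have hx: "h 0 = x" and hy: "h 1 = y"
  proof -
    have "D U 0 = 0" "D U 1 = 0" if U: "U \<in> comps" for U
    proof -
      show "D U 0 = 0"
      proof (rule ccontr)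
        assume "D U 0 \<noteq> 0"
        then obtain a b :: real where "a < 0" "0 < b" "{a..b} \<subseteq> T U" using D(2)[OF U, of 0] by auto
        then show False by (force simp: T_def)
      qed
      show "D U 1 = 0"
      proof (rule ccontr)
        assume "D U 1 \<noteq> 0"
        then obtain a b :: real where "a < 1" "1 < b" "{a..b} \<subseteq> T U" using D(2)[OF U, of 1] by auto
        then have "b \<in> T U" by auto
        then show False using \<open>1 < b\<close> by (simp add: T_def)
      qed
    qed
    then show "h 0 = x" "h 1 = y" using h0 g(3,4) by (auto simp: pathstart_def pathfinish_def)
  qed
  have hK: "h t \<in> K" if t: "t \<in> {0..1}" for t
  proof (cases "\<exists>U\<in>comps. D U t \<noteq> 0")
    case True
    then obtain U where U: "U \<in> comps" "D U t \<noteq> 0" by blast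
    then have "h t \<in> closure U" using DT[OF U(1) t U(2)] D(3)[OF U(1)] h1[OF U t] by auto
    then show ?thesis using comps_closure(1)[OF U(1)] by blast
  next
    case False then show ?thesis using h0[of t] g(2) t by (auto simp: path_image_def)
  qed
  have rays: "\<exists>\<zeta> \<xi>. norm \<zeta> = 1 \<and> norm \<xi> = 1 \<and> (\<forall>t\<in>{0..1}. h t \<in> closure V \<longrightarrow> fphi V (h t) \<in> disk_ray \<zeta> \<union> disk_ray \<xi>)" if V: "V \<in> comps" for V
  proof -
    obtain \<zeta> \<xi> where z: "norm \<zeta> = 1" "norm \<xi> = 1" "\<And>t. t \<in> T V \<Longrightarrow> fphi V (g t + D V t) \<in> disk_ray \<zeta> \<union> disk_ray \<xi>" using D(3)[OF V] by blast
    have "fphi V (h t) \<in> disk_ray \<zeta> \<union> disk_ray \<xi>" if t: "t \<in> {0..1}" and hV: "h t \<in> closure V" for t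
    proof (cases "\<exists>U\<in>comps. D U t \<noteq> 0")
      case False
      then have "h t = g t" "D V t = 0" using h0 V by blast+
      moreover from this have "t \<in> T V" using t hV by (simp add: T_def)
      ultimately show ?thesis using z(3)[of t] by simp
    next
      case True
      then obtain U where U: "U \<in> comps" "D U t \<noteq> 0" by blast
      have tU: "t \<in> T U" using DT[OF U(1) t U(2)] .
      show ?thesis
      proof (cases "U = V")
        case True then show ?thesis using z(3)[of t] tU h1[OF U t] by simp
      next
        case ne: False
        have "h t \<notin> U" using comps_disjoint_closure[OF V U(1)] ne hV by blast
        then obtain t' where t': "t' \<in> T U" "h t = g t'" using D(4)[OF U(1) tU] h1[OF U t] by auto
        have tV: "t' \<in> T V" using t' hV by (simp add: T_def)
        \<comment> \<open>The point of the closure of V reached while U is modified is g t', a point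
          of the old arc, and V does not move it: otherwise an interval of times in the closure of U
          containing t' would contradict \<open>ov\<close>.\<close>
        have "D V t' = 0"
        proof (rule ccontr)
          assume nz: "D V t' \<noteq> 0"
          obtain a b where ab: "a < t" "t < b" "{a..b} \<subseteq> T U" using D(2)[OF U(1) t U(2)] by blast
          have int: "{min t t'..max t t'} \<subseteq> T U"
          proof (cases "t = t'")
            case True then show ?thesis using tU by simp
          next
            case False
            have t01: "t \<in> {0..1}" "t' \<in> {0..1}" using t t' by (auto simp: T_def)
            have "path_image (subpath t t' g) \<subseteq> closure U"
            proof (rule arc_in_closure[OF U(1)])
              show "arc (subpath t t' g)" using arc_subpath_arc[OF g(1) t01 False] .
              show "path_image (subpath t t' g) \<subseteq> K" using path_image_subpath_subset[OF t01, of g] g(2) by auto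
            qed (use tU t' in \<open>auto simp: T_def\<close>)
            then show ?thesis using t01 path_image_subpath_gen[of t t' g] by (fastforce simp: T_def closed_segment_eq_real_ivl min_def max_def split: if_splits)
          qed
          have t'01: "t' \<in> {0..1}" using t' by (simp add: T_def)
          show False
          proof (cases "t = t'")
            case True then show ?thesis using ov[OF U(1) V t'01 nz, of a b t'] ab ne by auto
          next
            case False
            then have "min t t' < max t t'" by auto
            from ov[OF U(1) V t'01 nz this, of t'] int ne show ?thesis by simp
          qed
        qed
        then show ?thesis using z(3)[OF tV] t'(2) by simp
      qed
    qed
    then show ?thesis using z(1,2) by blast
  qed
  have "path h" using hc by (simp add: path_def)
  then obtain k where k: "arc k" "path_image k \<subseteq> path_image h" "pathstart k = x" "pathfinish k = y"
    using path_contains_arc[of h x y] hx hy ne by (auto simp: pathstart_def pathfinish_def)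
  have "allowable f (path_image k)" unfolding allowable_def bounded_Fatou_eq
  proof (intro conjI ballI)
    show "path_image k \<subseteq> K" using k(2) hK by (force simp: path_image_def)
    fix U assume "U \<in> comps"
    then obtain \<zeta> \<xi> where "norm \<zeta> = 1" "norm \<xi> = 1" "\<And>t. t \<in> {0..1} \<Longrightarrow> h t \<in> closure U \<Longrightarrow> fphi U (h t) \<in> disk_ray \<zeta> \<union> disk_ray \<xi>" using rays by metis
    moreover from this(3) have "fphi U ` (path_image k \<inter> closure U) \<subseteq> disk_ray \<zeta> \<union> disk_ray \<xi>"
    proof -
      assume r: "\<And>t. t \<in> {0..1} \<Longrightarrow> h t \<in> closure U \<Longrightarrow> fphi U (h t) \<in> disk_ray \<zeta> \<union> disk_ray \<xi>"
      show ?thesis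
      proof
        fix w assume "w \<in> fphi U ` (path_image k \<inter> closure U)"
        then obtain z where z: "z \<in> path_image k" "z \<in> closure U" "w = fphi U z" by blast
        then obtain t where "t \<in> {0..1}" "z = h t" using k(2) unfolding path_image_def by blast
        then show "w \<in> disk_ray \<zeta> \<union> disk_ray \<xi>" using r z by simp
      qed
    qed
    ultimately show "\<exists>\<zeta> \<xi>. norm \<zeta> = 1 \<and> norm \<xi> = 1 \<and> fphi U ` (path_image k \<inter> closure U) \<subseteq> disk_ray \<zeta> \<union> disk_ray \<xi>" by blast
  qed
  then show ?thesis using k by blast
qed

lemma allowable_good: assumes "allowable f S" shows "good S"
  unfolding good_def
proof (intro conjI ballI)
  show "S \<subseteq> K" using assms by (simp add: allowable_def)
  fix U assume "U \<in> comps"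
  then obtain \<zeta> \<xi> where "norm \<zeta> = 1" "norm \<xi> = 1" "fphi U ` (S \<inter> closure U) \<subseteq> disk_ray \<zeta> \<union> disk_ray \<xi>"
    using assms unfolding allowable_def bounded_Fatou_eq by blast
  then show "rayfin (fphi U ` (S \<inter> closure U))" using rayfin_mono[OF rayfin_Un[OF rayfin_ray rayfin_ray]] by blast
qed

lemma good_subset: "good S \<Longrightarrow> S' \<subseteq> S \<Longrightarrow> good S'"
  unfolding good_def by (meson Int_mono image_mono order_refl order_trans rayfin_mono)

sublocale arc_space "filled_Julia f" good
proof
  show "good S \<Longrightarrow> S' \<subseteq> S \<Longrightarrow> good S'" for S S' by (rule good_subset)
  show "good S \<Longrightarrow> good S' \<Longrightarrow> good (S \<union> S')" for S S' unfolding good_def by (auto simp: Int_Un_distrib2 image_Un intro: rayfin_Un)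
  show "good {x}" if "x \<in> K" for x unfolding good_def
  proof (intro conjI ballI)
    fix U assume U: "U \<in> comps"
    show "rayfin (fphi U ` ({x} \<inter> closure U))" using fphiD(3)[OF U] rayfin_sing rayfin_empty by (cases "x \<in> closure U") auto
  qed (use that in simp)
  show "good S \<Longrightarrow> S \<subseteq> K" for S by (simp add: good_def)
  show "good (path_image g) \<Longrightarrow> simple_path g \<Longrightarrow> pathfinish g \<noteq> pathstart g" for g by (rule no_good_loop)
  show "x \<in> K \<Longrightarrow> y \<in> K \<Longrightarrow> x \<noteq> y \<Longrightarrow> \<exists>g. arc g \<and> pathstart g = x \<and> pathfinish g = y \<and> good (path_image g)" for x y
    using allowable_arc_exists[of x y] allowable_good by blast
qed

text \<open>Allowable arcs are good, and good arcs are determined by their ends; so the definite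
  description is satisfied by exactly one set.\<close>

lemma allowable_arc_seg: assumes "x \<in> K" "y \<in> K" shows "allowable_arc f x y = seg x y"
proof (cases "x = y")
  case False
  obtain g where g: "arc g" "pathstart g = x" "pathfinish g = y" "allowable f (path_image g)" using allowable_arc_exists[OF assms False] by blast
  have "(THE \<Gamma>. allowable f \<Gamma> \<and> (\<exists>g. arc g \<and> path_image g = \<Gamma> \<and> pathstart g = x \<and> pathfinish g = y)) = seg x y"
  proof (rule the_equality)
    show "allowable f (seg x y) \<and> (\<exists>g. arc g \<and> path_image g = seg x y \<and> pathstart g = x \<and> pathfinish g = y)"
      using g seg_arc(1)[OF g(1) allowable_good[OF g(4)] g(2,3)] by metis
    show "\<Gamma> = seg x y" if "allowable f \<Gamma> \<and> (\<exists>g. arc g \<and> path_image g = \<Gamma> \<and> pathstart g = x \<and> pathfinish g = y)" for \<Gamma>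
      using that seg_arc(1) allowable_good by blast
  qed
  then show ?thesis using False by (simp add: allowable_arc_def)
qed (simp add: allowable_arc_def)

text \<open>In Fatou coordinates f is a power map, which sends rays to rays, and only finitely many
  components lie over U.\<close>

lemma good_image: assumes S: "good S" shows "good (poly f ` S)"
  unfolding good_def
proof (intro conjI ballI)
  show "poly f ` S \<subseteq> K" using S K_step by (auto simp: good_def)
  fix U assume U: "U \<in> comps"
  define I where "I = {V \<in> comps. poly f ` V = U}"
  have fin: "finite I" using finite_comp_fibre[of 1 U] by (simp add: I_def)
  have "\<exists>d. \<forall>V\<in>I. \<forall>z\<in>closure V. fphi U (poly f z) = fphi V z ^ d V" using fphi(3) unfolding I_def by (intro bchoice) fastforce
  then obtain d where d: "\<And>V z. V \<in> I \<Longrightarrow> z \<in> closure V \<Longrightarrow> fphi U (poly f z) = fphi V z ^ d V" by metis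
  have "fphi U ` (poly f ` S \<inter> closure U) \<subseteq> (\<Union>V\<in>I. (\<lambda>w. w ^ d V) ` (fphi V ` (S \<inter> closure V)))"
  proof
    fix w assume "w \<in> fphi U ` (poly f ` S \<inter> closure U)"
    then obtain z where z: "z \<in> S" "poly f z \<in> closure U" "w = fphi U (poly f z)" by auto
    obtain V where V: "V \<in> comps" "poly f ` V = U" "z \<in> closure V" using preimage_closure_comp[OF U, of 1 z] z(2) by auto
    then have "V \<in> I" by (simp add: I_def)
    then show "w \<in> (\<Union>V\<in>I. (\<lambda>w. w ^ d V) ` (fphi V ` (S \<inter> closure V)))" using d z V(3) by blast
  qed
  moreover have "rayfin (\<Union>V\<in>I. (\<lambda>w. w ^ d V) ` (fphi V ` (S \<inter> closure V)))"
    using S by (intro rayfin_UN fin rayfin_power) (auto simp: good_def I_def)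
  ultimately show "rayfin (fphi U ` (poly f ` S \<inter> closure U))" by (rule rayfin_mono[rotated])
qed

lemma good_preimage: assumes S: "good S" shows "good (poly f -` S)"
  unfolding good_def
proof (intro conjI ballI)
  show "poly f -` S \<subseteq> K" using S K_step by (auto simp: good_def)
  fix V assume V: "V \<in> comps"
  obtain d where d: "d \<ge> 1" "\<And>z. z \<in> closure V \<Longrightarrow> fphi (poly f ` V) (poly f z) = fphi V z ^ d" using fphi(3)[OF V] by blast
  have "fphi V ` (poly f -` S \<inter> closure V) \<subseteq> {w. norm w \<le> 1 \<and> w ^ d \<in> fphi (poly f ` V) ` (S \<inter> closure (poly f ` V))}"
  proof
    fix w assume "w \<in> fphi V ` (poly f -` S \<inter> closure V)"
    then obtain z where z: "poly f z \<in> S" "z \<in> closure V" "w = fphi V z" by auto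
    have "poly f z \<in> closure (poly f ` V)" using image_closure_comp[OF V z(2), of 1] by simp
    then show "w \<in> {w. norm w \<le> 1 \<and> w ^ d \<in> fphi (poly f ` V) ` (S \<inter> closure (poly f ` V))}"
      using z d(2)[OF z(2), symmetric] fphiD(3)[OF V z(2)] by auto
  qed
  moreover have "rayfin {w. norm w \<le> 1 \<and> w ^ d \<in> fphi (poly f ` V) ` (S \<inter> closure (poly f ` V))}"
    using S comps_image[OF V] d(1) by (intro rayfin_root) (auto simp: good_def)
  ultimately show "rayfin (fphi V ` (poly f -` S \<inter> closure V))" by (rule rayfin_mono[rotated])
qed

end

subsection \<open>The Hubbard tree and its preimages\<close>

text \<open>Minimises t - s over the pairs s < t with equal values. Local injectivity and the
  Lebesgue number \<delta> keep t - s at least \<delta> for these pairs, so they form a compact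
  set.\<close>

lemma minimal_loop:
  fixes p :: "real \<Rightarrow> complex"
  assumes cont: "continuous_on {a..b} p"
    and loc: "\<And>t. t \<in> {a..b} \<Longrightarrow> \<exists>e>0. inj_on p ({t - e<..<t + e} \<inter> {a..b})"
    and ninj: "\<not> inj_on p {a..b}"
  obtains s t where "a \<le> s" "s < t" "t \<le> b" "p s = p t"
    "\<And>u v. s \<le> u \<Longrightarrow> u < v \<Longrightarrow> v \<le> t \<Longrightarrow> p u = p v \<Longrightarrow> u = s \<and> v = t"
proof -
  obtain e where e: "\<And>t. t \<in> {a..b} \<Longrightarrow> e t > 0" "\<And>t. t \<in> {a..b} \<Longrightarrow> inj_on p ({t - e t<..<t + e t} \<inter> {a..b})" using loc by metis
  define G where "G = (\<lambda>t. {t - e t<..<t + e t}) ` {a..b}"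
  have cov: "{a..b} \<subseteq> \<Union>G"
  proof
    fix t assume t: "t \<in> {a..b}"
    then have "t \<in> {t - e t<..<t + e t}" using e(1) by simp
    then show "t \<in> \<Union>G" using t unfolding G_def by blast
  qed
  obtain \<delta> where \<delta>: "\<delta> > 0" "\<And>x. x \<in> {a..b} \<Longrightarrow> \<exists>B\<in>G. ball x \<delta> \<subseteq> B"
    by (rule Heine_Borel_lemma[of "{a..b}" G]) (use cov in \<open>auto simp: G_def\<close>)
  have uniq: "u = v" if uv: "u \<in> {a..b}" "v \<in> {a..b}" "\<bar>u - v\<bar> < \<delta>" "p u = p v" for u v
  proof -
    obtain t where t: "t \<in> {a..b}" "ball u \<delta> \<subseteq> {t - e t<..<t + e t}" using \<delta>(2)[OF uv(1)] unfolding G_def by blast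
    have "u \<in> ball u \<delta>" "v \<in> ball u \<delta>" using \<delta>(1) uv(3) by (auto simp: dist_real_def)
    then show ?thesis using e(2)[OF t(1)] t(2) uv(1,2,4) unfolding inj_on_def by blast
  qed
  define S where "S = {a..b} \<times> {a..b}"
  define D where "D = {z \<in> S. p (fst z) - p (snd z) = 0} \<inter> {z. snd z - fst z \<ge> \<delta>}"
  have S: "compact S" "closed S" unfolding S_def by (auto intro: compact_Times closed_Times)
  have "continuous_on S (\<lambda>z. p (fst z) - p (snd z))" unfolding S_def
    by (intro continuous_on_diff continuous_on_compose2[OF cont] continuous_intros) auto
  then have "closed {z \<in> S. p (fst z) - p (snd z) = 0}" using S(2) by (rule continuous_closed_preimage_constant)
  moreover have "closed {z :: real \<times> real. snd z - fst z \<ge> \<delta>}" by (intro closed_Collect_le continuous_intros)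
  ultimately have "closed D" unfolding D_def by blast
  moreover have "D \<subseteq> S" by (auto simp: D_def)
  ultimately have Dc: "compact D" using S(1) by (metis compact_Int_closed inf.absorb_iff2)
  obtain u v where uv: "u \<in> {a..b}" "v \<in> {a..b}" "u < v" "p u = p v" using ninj unfolding inj_on_def by (metis linorder_neqE)
  have inD: "(u, v) \<in> D" if "u \<in> {a..b}" "v \<in> {a..b}" "u < v" "p u = p v" for u v
  proof -
    have "\<not> \<bar>u - v\<bar> < \<delta>" using uniq[OF that(1,2) _ that(4)] that(3) by blast
    then show ?thesis using that by (auto simp: D_def S_def)
  qed
  have "D \<noteq> {}" using inD[OF uv] by blast
  then obtain z where z: "z \<in> D" "\<And>w. w \<in> D \<Longrightarrow> snd z - fst z \<le> snd w - fst w"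
    using continuous_attains_inf[OF Dc, of "\<lambda>z. snd z - fst z"] by (force intro: continuous_intros)
  show ?thesis
  proof (rule that[of "fst z" "snd z"])
    show "a \<le> fst z" "snd z \<le> b" "p (fst z) = p (snd z)" "fst z < snd z" using z(1) \<delta>(1) by (auto simp: D_def S_def)
    fix x y assume xy: "fst z \<le> x" "x < y" "y \<le> snd z" "p x = p y"
    then have "(x, y) \<in> D" using z(1) by (intro inD) (auto simp: D_def S_def)
    from z(2)[OF this] show "x = fst z \<and> y = snd z" using xy by simp
  qed
qed

context arc_space
begin

text \<open>A shortest loop of p would be a simple closed curve in a good set. Local injectivity is
  assumed only at inner times, so that critical points may sit at the ends; loops through the ends
  are therefore treated apart.\<close>

lemma locally_injective_arc:
  assumes p: "path p" "good (path_image p)"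
    and loc: "\<And>t. 0 < t \<Longrightarrow> t < 1 \<Longrightarrow> \<exists>e>0. inj_on p ({t - e<..<t + e} \<inter> {0..1})"
  shows "arc p"
proof -
  have pc: "continuous_on {0..1} p" using p(1) by (simp add: path_def)
  have nl: False if st: "0 \<le> s" "s < t" "t \<le> 1" "p s = p t"
    and u: "\<And>u v. s \<le> u \<Longrightarrow> u < v \<Longrightarrow> v \<le> t \<Longrightarrow> p u = p v \<Longrightarrow> u = s \<and> v = t" for s t
  proof -
    have st01: "s \<in> {0..1}" "t \<in> {0..1}" using st by auto
    have "simple_path (subpath s t p)" unfolding simple_path_subpath_eq
    proof (intro conjI allI impI)
      show "path (subpath s t p)" using path_subpath[OF p(1) st01] .
      show "s \<noteq> t" using st by simp
      fix x y assume xy: "x \<in> closed_segment s t \<and> y \<in> closed_segment s t \<and> p x = p y"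
      then show "x = y \<or> x = s \<and> y = t \<or> x = t \<and> y = s"
        using u[of x y] u[of y x] st(2) by (cases x y rule: linorder_cases) (auto simp: closed_segment_eq_real_ivl)
    qed
    moreover have "good (path_image (subpath s t p))" using good_sub[OF p(2) path_image_subpath_subset[OF st01]] .
    ultimately show False using noloop[of "subpath s t p"] st(4) by simp
  qed
  have inner: "u = v" if uv: "0 < u" "u < 1" "0 < v" "v < 1" "p u = p v" for u v
  proof -
    define a b where "a = min u v" and "b = max u v"
    have ab: "0 < a" "b < 1" "u \<in> {a..b}" "v \<in> {a..b}" using uv by (auto simp: a_def b_def)
    have "inj_on p {a..b}"
    proof (rule ccontr)
      assume ni: "\<not> inj_on p {a..b}"
      have c: "continuous_on {a..b} p" using ab by (intro continuous_on_subset[OF pc]) auto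
      have l: "\<exists>e>0. inj_on p ({t - e<..<t + e} \<inter> {a..b})" if t: "t \<in> {a..b}" for t
      proof -
        obtain e where "e > 0" "inj_on p ({t - e<..<t + e} \<inter> {0..1})" using loc[of t] t ab by auto
        moreover have "{t - e<..<t + e} \<inter> {a..b} \<subseteq> {t - e<..<t + e} \<inter> {0..1}" using ab by auto
        ultimately show ?thesis using inj_on_subset by blast
      qed
      obtain s t where "a \<le> s" "s < t" "t \<le> b" "p s = p t"
        "\<And>u v. s \<le> u \<Longrightarrow> u < v \<Longrightarrow> v \<le> t \<Longrightarrow> p u = p v \<Longrightarrow> u = s \<and> v = t" using minimal_loop[OF c l ni] by blast
      then show False using nl[of s t] ab by auto
    qed
    then show ?thesis using ab uv(5) by (simp add: inj_on_def)
  qed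
  have left: False if "0 < v" "v < 1" "p 0 = p v" for v
  proof (rule nl[of 0 v])
    show "x = 0 \<and> y = v" if xy: "0 \<le> x" "x < y" "y \<le> v" "p x = p y" for x y
    proof (cases "x = 0")
      case True then show ?thesis using inner[of y v] xy \<open>v < 1\<close> \<open>0 < v\<close> \<open>p 0 = p v\<close> by auto
    next
      case False then show ?thesis using inner[of x y] xy \<open>v < 1\<close> by auto
    qed
  qed (use that in auto)
  have right: False if "0 < u" "u < 1" "p u = p 1" for u
  proof (rule nl[of u 1])
    show "x = u \<and> y = 1" if xy: "u \<le> x" "x < y" "y \<le> 1" "p x = p y" for x y
    proof (cases "y = 1")
      case True then show ?thesis using inner[of x u] xy \<open>u < 1\<close> \<open>0 < u\<close> \<open>p u = p 1\<close> by auto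
    next
      case False then show ?thesis using inner[of x y] xy \<open>0 < u\<close> by auto
    qed
  qed (use that in auto)
  have ord: False if uv: "0 \<le> u" "u < v" "v \<le> 1" "p u = p v" for u v
  proof -
    consider "0 < u" "v < 1" | "u = 0" "v < 1" | "0 < u" "v = 1" | "u = 0" "v = 1" using uv by linarith
    then show False
    proof cases
      case 1 then show ?thesis using inner[of u v] uv by auto
    next
      case 2 then show ?thesis using left[of v] uv by auto
    next
      case 3 then show ?thesis using right[of u] uv by auto
    next
      case 4
      show ?thesis
      proof (rule nl[of 0 1])
        show "x = 0 \<and> y = 1" if xy: "0 \<le> x" "x < y" "y \<le> 1" "p x = p y" for x y
          using inner[of x y] left[of y] right[of x] xy by (cases "x = 0"; cases "y = 1") auto
      qed (use 4 uv in auto)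
    qed
  qed
  have "inj_on p {0..1}" unfolding inj_on_def using ord by (metis atLeastAtMost_iff linorder_neqE)
  then show ?thesis using p(1) by (simp add: arc_def)
qed

lemma edge_in_edge:
  assumes W: "finite W" "W \<subseteq> X" and br: "median_closed W"
    and e: "e \<in> Ed W" "x \<in> e" "x \<notin> W" and pq: "p \<in> W" "q \<in> W" "x \<in> seg p q"
  shows "e \<subseteq> seg p q"
proof -
  obtain e' where e': "e' \<in> Ed W" "x \<in> e'" "e' \<subseteq> seg p q" using edge_through[OF W(1,2) pq e(3)] .
  have "e = e'" by (rule Ed_unique[OF W(2) br e(1) e'(1) e(2) e'(2) e(3)])
  then show ?thesis using e'(3) by simp
qed

lemma Ed_interior: assumes "e \<in> Ed V" "V \<subseteq> X" obtains x where "x \<in> e" "x \<notin> V"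
proof -
  obtain u v where uv: "u \<in> V" "v \<in> V" "u \<noteq> v" "seg u v \<inter> V = {u, v}" "e = seg u v" using EdE[OF assms(1)] .
  then show ?thesis using seg_open_connected(2)[of u v] assms(2) that by blast
qed

lemma Ed_closure: assumes "e \<in> Ed V" "V \<subseteq> X" shows "closure (e - V) = e"
proof -
  obtain u v where uv: "u \<in> V" "v \<in> V" "u \<noteq> v" "seg u v \<inter> V = {u, v}" "e = seg u v" using EdE[OF assms(1)] .
  have "e - V = seg u v - {u, v}" using uv by blast
  then show ?thesis using seg_open_connected(3)[of u v] uv assms(2) by auto
qed

end

context pcf_poly
begin

text \<open>Off critical points f is locally injective, so the image of the arc is an arc by
  \<open>locally_injective_arc\<close>; being good, it is the segment between its ends.\<close>

lemma seg_image:
  assumes x: "x \<in> K" and y: "y \<in> K" and nc: "\<And>z. z \<in> seg x y \<Longrightarrow> poly (pderiv f) z = 0 \<Longrightarrow> z = x \<or> z = y"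
  shows "inj_on (poly f) (seg x y)" "poly f ` seg x y = seg (poly f x) (poly f y)"
proof -
  have "inj_on (poly f) (seg x y) \<and> poly f ` seg x y = seg (poly f x) (poly f y)"
  proof (cases "x = y")
    case True then show ?thesis by simp
  next
    case ne: False
    define g where "g = sarc x y"
    note sg = sarc[OF x y ne, folded g_def]
    have ginj: "inj_on g {0..1}" and gp: "path g" using sg(1) by (auto simp: arc_def)
    have g01: "g 0 = x" "g 1 = y" using sg by (auto simp: pathstart_def pathfinish_def)
    have gc: "continuous_on {0..1} g" using gp by (simp add: path_def)
    have "arc (poly f \<circ> g)"
    proof (rule locally_injective_arc)
      show "path (poly f \<circ> g)" using gp by (intro path_continuous_image continuous_intros)
      show "good (path_image (poly f \<circ> g))" unfolding path_image_compose by (rule good_image[OF sg(4)])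
      fix t :: real assume t: "0 < t" "t < 1"
      have "g t \<noteq> x" "g t \<noteq> y" using inj_onD[OF ginj, of t 0] inj_onD[OF ginj, of t 1] t g01 by auto
      moreover have "g t \<in> seg x y" using sg(5) t by (auto simp: path_image_def)
      ultimately have "poly (pderiv f) (g t) \<noteq> 0" using nc by blast
      then obtain r where r: "r > 0" "inj_on (poly f) (ball (g t) r)" using poly_locally_inj by blast
      obtain e where e: "e > 0" "\<And>s. s \<in> {0..1} \<Longrightarrow> dist s t < e \<Longrightarrow> dist (g s) (g t) < r"
        using gc t r(1) unfolding continuous_on_iff by (metis atLeastAtMost_iff less_imp_le)
      show "\<exists>e>0. inj_on (poly f \<circ> g) ({t - e<..<t + e} \<inter> {0..1})"
      proof (intro exI[of _ e] conjI e(1) comp_inj_on)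
        show "inj_on g ({t - e<..<t + e} \<inter> {0..1})" using ginj by (rule inj_on_subset) auto
        show "inj_on (poly f) (g ` ({t - e<..<t + e} \<inter> {0..1}))"
        proof (rule inj_on_subset[OF r(2)], rule image_subsetI)
          fix s assume "s \<in> {t - e<..<t + e} \<inter> {0..1}"
          then show "g s \<in> ball (g t) r" using e(2)[of s] by (auto simp: dist_commute dist_real_def)
        qed
      qed
    qed
    moreover from this have "path_image (poly f \<circ> g) = seg (poly f x) (poly f y)"
      using sg good_image[OF sg(4)] by (intro seg_arc(1)) (auto simp: path_image_compose pathstart_compose pathfinish_compose)
    moreover from \<open>arc (poly f \<circ> g)\<close> have "inj_on (poly f) (seg x y)"
      using inj_on_imageI[of "poly f" g "{0..1}"] sg(5) by (simp add: arc_def path_image_def)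
    ultimately show ?thesis using sg(5) by (simp add: path_image_compose)
  qed
  then show "inj_on (poly f) (seg x y)" "poly f ` seg x y = seg (poly f x) (poly f y)" by auto
qed

lemma seg_iter_image:
  assumes x: "x \<in> K" and y: "y \<in> K"
    and nc: "\<And>z j. z \<in> seg x y \<Longrightarrow> j < n \<Longrightarrow> poly (pderiv f) (iter f j z) = 0 \<Longrightarrow> z = x \<or> z = y"
  shows "inj_on (iter f n) (seg x y) \<and> iter f n ` seg x y = seg (iter f n x) (iter f n y)"
  using nc
proof (induction n)
  case (Suc n)
  have "inj_on (iter f n) (seg x y) \<and> iter f n ` seg x y = seg (iter f n x) (iter f n y)" by (rule Suc.IH, rule Suc.prems) auto
  then have IH: "inj_on (iter f n) (seg x y)" "iter f n ` seg x y = seg (iter f n x) (iter f n y)" by auto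
  have K: "iter f n x \<in> K" "iter f n y \<in> K" using x y by (simp_all add: K_iter)
  have "w = iter f n x \<or> w = iter f n y" if w: "w \<in> seg (iter f n x) (iter f n y)" "poly (pderiv f) w = 0" for w
  proof -
    have "w \<in> iter f n ` seg x y" using w(1) IH(2) by simp
    then obtain z where z: "z \<in> seg x y" "w = iter f n z" by (rule imageE)
    then have "z = x \<or> z = y" using Suc.prems[of z n] w(2) by simp
    then show ?thesis using z(2) by auto
  qed
  note si = seg_image[OF K this]
  have eq: "iter f (Suc n) = poly f \<circ> iter f n" by (simp add: fun_eq_iff)
  have "inj_on (poly f \<circ> iter f n) (seg x y)" using IH si(1) by (intro comp_inj_on) auto
  moreover have "(poly f \<circ> iter f n) ` seg x y = poly f ` (iter f n ` seg x y)" by (simp only: image_comp)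
  ultimately show ?case unfolding eq using IH(2) si(2) by (simp add: o_def)
qed auto

abbreviation "HT \<equiv> Hubbard_tree f"
abbreviation "VT \<equiv> Hubbard_vertices f"
abbreviation "ET \<equiv> Hubbard_edges f"

lemma HT_eq: "HT = hull_of P"
  unfolding Hubbard_tree_def hull_of_def using P_K by (intro SUP_cong refl allowable_arc_seg) auto

lemma VT_eq: "VT = P \<union> {z \<in> hull_of P. infinite (components (hull_of P - {z})) \<or> card (components (hull_of P - {z})) > 2}"
  by (simp add: Hubbard_vertices_def branching_points_def HT_eq)

lemma HT_facts: "convx HT" "good HT" "P \<subseteq> HT" "HT \<subseteq> K" "connected HT"
proof -
  show c: "convx HT" unfolding HT_eq by (rule hull_convx[OF P_K])
  show "good HT" unfolding HT_eq by (rule hull_good[OF P_finite P_K P_ne])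
  show "P \<subseteq> HT" unfolding HT_eq by (rule sub_hull[OF P_K])
  show "HT \<subseteq> K" using c by (simp add: convx_def)
  show "connected HT" using convx_connected[OF c] .
qed

lemma VT_facts: "finite VT" "VT \<subseteq> HT" "ET = Ed VT" "P \<subseteq> VT" "VT \<subseteq> K"
    "median_closed VT"
    "\<And>x. x \<in> HT \<Longrightarrow> x \<notin> VT \<Longrightarrow> \<exists>e\<in>ET. x \<in> e"
proof -
  note ec = edges_components[OF P_finite P_K P_ne VT_eq]
  show "finite VT" using ec(1) .
  show "VT \<subseteq> HT" using ec(2) by (simp only: HT_eq)
  then show "VT \<subseteq> K" using HT_facts(4) by blast
  show E: "ET = Ed VT" unfolding Hubbard_edges_def HT_eq using ec(3) .
  show "P \<subseteq> VT" by (simp add: Hubbard_vertices_def)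
  show "median_closed VT" using ec(4) .
  show "\<And>x. x \<in> HT \<Longrightarrow> x \<notin> VT \<Longrightarrow> \<exists>e\<in>ET. x \<in> e" using ec(5) unfolding HT_eq E by blast
qed

lemma ET_finite: "finite ET" using Ed_finite[OF VT_facts(1)] by (simp add: VT_facts(3))

text \<open>The arc is cut at the critical points; f maps each piece injectively onto a segment
  whose ends are points of C, since C contains the critical values.\<close>

lemma convx_preimage:
  assumes C: "convx C" and P: "P \<subseteq> C" shows "convx (poly f -` C)"
  unfolding convx_def
proof (intro conjI ballI)
  show sub: "poly f -` C \<subseteq> K" using C K_step by (auto simp: convx_def)
  fix x y assume xy: "x \<in> poly f -` C" "y \<in> poly f -` C"
  define Q where "Q = insert x (insert y {c. poly (pderiv f) c = 0})"
  have "poly f c \<in> C" if "poly (pderiv f) c = 0" for c using P P_step[OF crit_P[OF that]] by blast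
  then have QC: "Q \<subseteq> poly f -` C" using xy by (auto simp: Q_def)
  have Q: "finite Q" "Q \<subseteq> K" "x \<in> Q" "y \<in> Q" using crit_finite QC sub by (auto simp: Q_def)
  show "seg x y \<subseteq> poly f -` C"
  proof
    fix z assume z: "z \<in> seg x y"
    show "z \<in> poly f -` C"
    proof (cases "z \<in> Q")
      case True then show ?thesis using QC by blast
    next
      case False
      obtain e where e: "e \<in> Ed Q" "z \<in> e" using edge_through[OF Q z False] by metis
      obtain u v where uv: "u \<in> Q" "v \<in> Q" "u \<noteq> v" "seg u v \<inter> Q = {u, v}" "e = seg u v" using EdE[OF e(1)] .
      have "w = u \<or> w = v" if "w \<in> seg u v" "poly (pderiv f) w = 0" for w using that uv(4) by (auto simp: Q_def)
      then have "poly f ` seg u v = seg (poly f u) (poly f v)" using uv Q(2) by (intro seg_image(2)) auto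
      moreover have "seg (poly f u) (poly f v) \<subseteq> C" using C uv QC unfolding convx_def by blast
      ultimately show ?thesis using e(2) uv(5) by blast
    qed
  qed
qed

lemma HT_step: "z \<in> HT \<Longrightarrow> poly f z \<in> HT"
proof -
  assume z: "z \<in> HT"
  show "poly f z \<in> HT"
  proof (cases "z \<in> P")
    case True then show ?thesis using P_step HT_facts(3) by blast
  next
    case False
    obtain p q where pq: "p \<in> P" "q \<in> P" "z \<in> seg p q" using z unfolding HT_eq hull_of_def by blast
    obtain e where e: "e \<in> Ed P" "z \<in> e" using edge_through[OF P_finite P_K pq False] by metis
    obtain u v where uv: "u \<in> P" "v \<in> P" "u \<noteq> v" "seg u v \<inter> P = {u, v}" "e = seg u v" using EdE[OF e(1)] .
    have "w = u \<or> w = v" if "w \<in> seg u v" "poly (pderiv f) w = 0" for w using that uv(4) crit_P by blast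
    then have "poly f ` seg u v = seg (poly f u) (poly f v)" using uv P_K by (intro seg_image(2)) auto
    moreover have "seg (poly f u) (poly f v) \<subseteq> HT" using HT_facts(1,3) uv P_step unfolding convx_def by blast
    ultimately show ?thesis using e(2) uv(5) by blast
  qed
qed

text \<open>Replacing a, b, c by vertices next to w leaves no critical point of the iterate inside
  the three arcs between them; so the iterate is injective on each, and the image of w is still the
  median.\<close>

lemma median_image:
  assumes V: "finite V" "V \<subseteq> K" and nc: "\<And>z j. z \<in> K \<Longrightarrow> z \<notin> V \<Longrightarrow> j < n \<Longrightarrow> poly (pderiv f) (iter f j z) \<noteq> 0"
    and abc: "a \<in> V" "b \<in> V" "c \<in> V" and w: "w \<in> seg a b" "w \<in> seg b c" "w \<in> seg a c" "w \<notin> V"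
  obtains a' b' c' where "a' \<in> V" "b' \<in> V" "c' \<in> V" "iter f n w \<noteq> iter f n a'" "iter f n w \<noteq> iter f n b'" "iter f n w \<noteq> iter f n c'"
    "iter f n w \<in> seg (iter f n a') (iter f n b')" "iter f n w \<in> seg (iter f n b') (iter f n c')" "iter f n w \<in> seg (iter f n a') (iter f n c')"
proof -
  have K: "a \<in> K" "b \<in> K" "c \<in> K" using V abc by auto
  have wK: "w \<in> K" using seg_X[OF K(1,2)] w by blast
  have "\<exists>u. u \<in> V \<and> seg w u \<inter> V = {u} \<and> seg w u \<subseteq> seg w x" if x: "x \<in> V" for x by (rule nearest[OF V wK x]) blast
  then obtain n' where n': "\<And>x. x \<in> V \<Longrightarrow> n' x \<in> V" "\<And>x. x \<in> V \<Longrightarrow> seg w (n' x) \<inter> V = {n' x}" "\<And>x. x \<in> V \<Longrightarrow> seg w (n' x) \<subseteq> seg w x" by metis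
  have key: "iter f n w \<noteq> iter f n (n' x) \<and> iter f n w \<in> seg (iter f n (n' x)) (iter f n (n' y))"
    if xy: "x \<in> V" "y \<in> V" "w \<in> seg x y" for x y
  proof -
    have xyK: "x \<in> K" "y \<in> K" "n' x \<in> K" "n' y \<in> K" using xy n'(1) V(2) by auto
    have "seg x w \<inter> seg w y = {w}" using seg_split(2)[OF xyK(1,2) xy(3)] .
    then have "seg (n' x) w \<inter> seg w (n' y) \<subseteq> {w}" using n'(3)[OF xy(1)] n'(3)[OF xy(2)] seg_sym[OF wK xyK(1)] seg_sym[OF wK xyK(3)] by blast
    then have j: "seg (n' x) (n' y) = seg (n' x) w \<union> seg w (n' y)" "w \<in> seg (n' x) (n' y)" using seg_join[OF xyK(3,4) wK] by auto
    have "seg (n' x) (n' y) \<inter> V \<subseteq> {n' x, n' y}" using j(1) n'(2)[OF xy(1)] n'(2)[OF xy(2)] seg_sym[OF wK xyK(3)] by blast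
    then have "z = n' x \<or> z = n' y" if "z \<in> seg (n' x) (n' y)" "j < n" "poly (pderiv f) (iter f j z) = 0" for z j
      using nc[of z j] that seg_X[OF xyK(3,4)] by blast
    then have si: "inj_on (iter f n) (seg (n' x) (n' y))" "iter f n ` seg (n' x) (n' y) = seg (iter f n (n' x)) (iter f n (n' y))"
      using seg_iter_image[OF xyK(3,4), of n] by auto
    have "w \<noteq> n' x" using w(4) n'(1) xy(1) by metis
    then have "iter f n w \<noteq> iter f n (n' x)" using inj_onD[OF si(1) _ j(2)] seg_ends[OF xyK(3,4)] by metis
    then show ?thesis using j(2) si(2) by blast
  qed
  have sy: "w \<in> seg b a" "w \<in> seg c b" "w \<in> seg c a" using w seg_sym K by auto
  show ?thesis
    by (rule that[of "n' a" "n' b" "n' c"]) (use key[OF abc(1,2) w(1)] key[OF abc(2,3) w(2)] key[OF abc(1,3) w(3)] key[OF abc(3,1) sy(3)] n'(1) abc in auto)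
qed

text \<open>A branch point outside P keeps its three directions by \<open>median_image\<close>, so
  its image is again a branch point.\<close>

lemma VT_step: assumes z: "z \<in> VT" shows "poly f z \<in> VT"
proof (cases "z \<in> P")
  case True then show ?thesis using P_step VT_facts(4) by blast
next
  case False
  then have zb: "z \<in> hull_of P" "infinite (components (hull_of P - {z})) \<or> card (components (hull_of P - {z})) > 2" using z unfolding VT_eq by auto
  obtain a b c where abc: "a \<in> P" "b \<in> P" "c \<in> P" "z \<in> seg a b" "z \<in> seg b c" "z \<in> seg a c"
    using branchD[OF P_finite P_K P_ne zb] by blast
  obtain a' b' c' where m: "a' \<in> P" "b' \<in> P" "c' \<in> P" "iter f 1 z \<noteq> iter f 1 a'" "iter f 1 z \<noteq> iter f 1 b'" "iter f 1 z \<noteq> iter f 1 c'"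
    "iter f 1 z \<in> seg (iter f 1 a') (iter f 1 b')" "iter f 1 z \<in> seg (iter f 1 b') (iter f 1 c')" "iter f 1 z \<in> seg (iter f 1 a') (iter f 1 c')"
    by (rule median_image[OF P_finite P_K _ abc False, of 1]) (use crit_P in auto)
  have H: "poly f z \<in> hull_of P" "poly f a' \<in> hull_of P" "poly f b' \<in> hull_of P" "poly f c' \<in> hull_of P"
    using HT_step HT_facts(3) m zb(1) unfolding HT_eq by blast+
  have "card (components (hull_of P - {poly f z})) > 2" using branchI[OF P_finite P_K P_ne H] m(4-9) by simp
  then show ?thesis unfolding VT_eq using H(1) by blast
qed

abbreviation "Hs s \<equiv> preimage_tree f s"
abbreviation "Vs s \<equiv> preimage_vertices f s"

lemma Hs_Suc: "Hs (Suc s) = poly f -` Hs s" by (auto simp: preimage_tree_def funpow_swap1)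
lemma Hs_0: "Hs 0 = HT" by (auto simp: preimage_tree_def)

lemma HT_iter: "z \<in> HT \<Longrightarrow> iter f n z \<in> HT" by (induction n) (auto intro: HT_step)
lemma VT_iter: "z \<in> VT \<Longrightarrow> iter f n z \<in> VT" by (induction n) (auto intro: VT_step)

lemma Hs_mono: "t \<le> s \<Longrightarrow> Hs t \<subseteq> Hs s" "t \<le> s \<Longrightarrow> Vs t \<subseteq> Vs s"
proof -
  assume "t \<le> s"
  then obtain k where k: "s = k + t" using le_Suc_ex by (metis add.commute)
  show "Hs t \<subseteq> Hs s" "Vs t \<subseteq> Vs s" using HT_iter VT_iter by (auto simp: k preimage_tree_def preimage_vertices_def funpow_add)
qed

lemma HT_Hs: "HT \<subseteq> Hs s" using Hs_mono(1)[of 0 s] by (simp add: Hs_0)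
lemma VT_Vs: "VT \<subseteq> Vs s" using HT_iter VT_iter by (auto simp: preimage_vertices_def)

lemma Hs_convx: "convx (Hs s)"
proof (induction s)
  case 0 then show ?case using HT_facts(1) by (simp add: Hs_0)
next
  case (Suc s)
  have "P \<subseteq> Hs s" using HT_facts(3) HT_Hs by blast
  then show ?case unfolding Hs_Suc using convx_preimage[OF Suc] by blast
qed

lemma Hs_good: "good (Hs s)"
  by (induction s) (auto simp: Hs_0 Hs_Suc HT_facts intro: good_preimage)

lemma Hs_K: "Hs s \<subseteq> K" using Hs_good good_X by blast
lemma Vs_Hs: "Vs s \<subseteq> Hs s" using VT_facts(2) by (auto simp: preimage_vertices_def preimage_tree_def)
lemma Vs_K: "Vs s \<subseteq> K" using Vs_Hs Hs_K by blast

lemma Vs_finite: "finite (Vs s)"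
proof -
  have "Vs s = (\<Union>w\<in>VT. {z. iter f s z = w})" by (auto simp: preimage_vertices_def)
  then show ?thesis using VT_facts(1) finite_iter_fibre by simp
qed

lemma crit_Vs: "j < s \<Longrightarrow> poly (pderiv f) (iter f j z) = 0 \<Longrightarrow> iter f s z \<in> P"
proof -
  assume a: "j < s" "poly (pderiv f) (iter f j z) = 0"
  have "iter f s z = iter f (s - j) (iter f j z)" using a(1) by (simp flip: iter_add)
  then show ?thesis using P_iter[OF crit_P[OF a(2)]] by simp
qed

text \<open>A median outside \<open>Vs s\<close> would be mapped to a median of points of
  \<open>VT\<close>, which is median closed.\<close>

lemma Vs_median: "median_closed (Vs s)"
  unfolding median_closed_def
proof (intro ballI subsetI, rule ccontr)
  fix a b c w assume abc: "a \<in> Vs s" "b \<in> Vs s" "c \<in> Vs s"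
    and "w \<in> seg a b \<inter> seg b c \<inter> seg a c" and nw: "w \<notin> Vs s"
  then have w: "w \<in> seg a b" "w \<in> seg b c" "w \<in> seg a c" by auto
  have nc: "poly (pderiv f) (iter f j z) \<noteq> 0" if "z \<notin> Vs s" "j < s" for z j
  proof
    assume "poly (pderiv f) (iter f j z) = 0"
    then have "iter f s z \<in> VT" using crit_Vs[OF that(2)] VT_facts(4) by blast
    then show False using that(1) by (simp add: preimage_vertices_def)
  qed
  obtain a' b' c' where m: "a' \<in> Vs s" "b' \<in> Vs s" "c' \<in> Vs s"
    "iter f s w \<in> seg (iter f s a') (iter f s b')" "iter f s w \<in> seg (iter f s b') (iter f s c')" "iter f s w \<in> seg (iter f s a') (iter f s c')"
    by (rule median_image[OF Vs_finite Vs_K nc abc w nw]) simp_all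
  have "iter f s w \<in> VT" by (rule median_closedD[OF VT_facts(6) _ _ _ m(4,5,6)]) (use m(1-3) in \<open>simp_all add: preimage_vertices_def\<close>)
  then show False using nw by (simp add: preimage_vertices_def)
qed

text \<open>All critical points of the t-th iterate are vertices of level t + k, so no edge of this
  level has one in its interior.\<close>

lemma Ed_image:
  assumes e: "e \<in> Ed (Vs (t + k))"
  shows "inj_on (iter f t) e" "iter f t ` e \<in> Ed (Vs k)"
proof -
  obtain u v where uv: "u \<in> Vs (t + k)" "v \<in> Vs (t + k)" "u \<noteq> v" "seg u v \<inter> Vs (t + k) = {u, v}" "e = seg u v" using EdE[OF e] .
  have Vi: "z \<in> Vs (t + k) \<longleftrightarrow> iter f t z \<in> Vs k" for z by (simp add: preimage_vertices_def add.commute[of t k] funpow_add)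
  have K: "u \<in> K" "v \<in> K" using uv Vs_K by auto
  have "z = u \<or> z = v" if "z \<in> seg u v" "j < t" "poly (pderiv f) (iter f j z) = 0" for z j
  proof -
    have "iter f t z \<in> P" using crit_Vs that by blast
    then have "z \<in> Vs (t + k)" unfolding Vi using VT_facts(4) VT_Vs by blast
    then show ?thesis using that(1) uv(4) by blast
  qed
  then have si: "inj_on (iter f t) (seg u v)" "iter f t ` seg u v = seg (iter f t u) (iter f t v)"
    using seg_iter_image[OF K, of t] by auto
  show "inj_on (iter f t) e" using si(1) uv(5) by simp
  have uvs: "u \<in> seg u v" "v \<in> seg u v" using seg_ends[OF K] by auto
  have "iter f t u \<noteq> iter f t v" using inj_onD[OF si(1) _ uvs] uv(3) by blast
  moreover have "seg (iter f t u) (iter f t v) \<inter> Vs k = {iter f t u, iter f t v}"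
  proof -
    have "iter f t ` seg u v \<inter> Vs k = iter f t ` (seg u v \<inter> Vs (t + k))" using Vi by auto
    then show ?thesis using si(2) uv(4) by simp
  qed
  ultimately show "iter f t ` e \<in> Ed (Vs k)" using uv Vi unfolding Ed_def uv(5) si(2) by blast
qed

lemma Vs_0: "Vs 0 = VT" by (auto simp: preimage_vertices_def)

text \<open>A lift of an edge is an arc because its composition with the iterate is one, and it
  contains no further vertex because the edge below has none. Conversely \<open>Ed_image\<close>
  makes every edge in the sense of segments a lift.\<close>

lemma preimage_edges_eq: "preimage_edges f s = Ed (Vs s)"
proof
  show "preimage_edges f s \<subseteq> Ed (Vs s)"
  proof
    fix e assume "e \<in> preimage_edges f s"
    then obtain g where g: "e = path_image g" "path g" "path_image g \<subseteq> Hs s" "arc (iter f s \<circ> g)" "path_image (iter f s \<circ> g) \<in> ET"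
      "pathstart (iter f s \<circ> g) \<in> VT" "pathfinish (iter f s \<circ> g) \<in> VT" unfolding preimage_edges_def edge_parametrization_def by blast
    have inj: "inj_on (iter f s) (path_image g)" using g(4) inj_on_imageI[of "iter f s" g "{0..1}"] by (simp add: arc_def path_image_def)
    have ag: "arc g" using g(2,4) inj_on_imageI2[of "iter f s" g "{0..1}"] by (simp add: arc_def)
    define u v where "u = pathstart g" and "v = pathfinish g"
    have seg: "path_image g = seg u v" "u \<noteq> v" using seg_arc(1,2)[OF ag good_sub[OF Hs_good g(3)]] by (auto simp: u_def v_def)
    have uv: "u \<in> Vs s" "v \<in> Vs s" using g(6,7) by (auto simp: u_def v_def preimage_vertices_def pathstart_compose pathfinish_compose)
    have uve: "u \<in> path_image g" "v \<in> path_image g" unfolding u_def v_def by (rule pathstart_in_path_image pathfinish_in_path_image)+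
    obtain p q where pq: "seg p q \<inter> VT = {p, q}" "path_image (iter f s \<circ> g) = seg p q" using EdE[OF g(5)[unfolded VT_facts(3)]] by metis
    have im: "iter f s ` path_image g = seg p q" using pq(2) by (simp add: path_image_compose)
    have "iter f s u \<noteq> iter f s v" using inj_onD[OF inj _ uve] seg(2) by blast
    moreover have "iter f s u \<in> {p, q}" "iter f s v \<in> {p, q}" using uv uve im pq(1) by (auto simp: preimage_vertices_def)
    ultimately have pq2: "{p, q} = {iter f s u, iter f s v}" by auto
    have "seg u v \<inter> Vs s = {u, v}"
    proof
      show "seg u v \<inter> Vs s \<subseteq> {u, v}"
      proof
        fix w assume w: "w \<in> seg u v \<inter> Vs s"
        then have "iter f s w \<in> {p, q}" using im pq(1) seg(1) by (auto simp: preimage_vertices_def)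
        then have "iter f s w = iter f s u \<or> iter f s w = iter f s v" using pq2 by blast
        then show "w \<in> {u, v}" using inj_onD[OF inj] w uve seg(1) by blast
      qed
    qed (use uv uve seg in auto)
    then show "e \<in> Ed (Vs s)" unfolding Ed_def g(1) seg(1) using uv seg(2) by blast
  qed
  show "Ed (Vs s) \<subseteq> preimage_edges f s"
  proof
    fix e assume e: "e \<in> Ed (Vs s)"
    obtain u v where uv: "u \<in> Vs s" "v \<in> Vs s" "u \<noteq> v" "e = seg u v" using EdE[OF e] by metis
    have K: "u \<in> K" "v \<in> K" using uv Vs_K by auto
    note sg = sarc[OF K uv(3)]
    have ei: "inj_on (iter f s) e" "iter f s ` e \<in> ET" using Ed_image[of e s 0] e by (auto simp: Vs_0 VT_facts(3))
    show "e \<in> preimage_edges f s" unfolding preimage_edges_def edge_parametrization_def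
    proof (intro CollectI exI[of _ "sarc u v"] conjI)
      show "e = path_image (sarc u v)" using sg(5) uv(4) by simp
      show "path (sarc u v)" using sg(1) arc_imp_path by blast
      show "path_image (sarc u v) \<subseteq> Hs s" unfolding sg(5) using Hs_convx uv Vs_Hs unfolding convx_def by blast
      show "arc (iter f s \<circ> sarc u v)" using ei(1) sg(5) uv(4) by (intro arc_compose_inj sg(1) iter_cont) auto
      show "path_image (iter f s \<circ> sarc u v) \<in> ET" using ei(2) sg(5) uv(4) by (simp add: path_image_compose)
      show "pathstart (iter f s \<circ> sarc u v) \<in> VT" "pathfinish (iter f s \<circ> sarc u v) \<in> VT"
        using sg uv by (auto simp: pathstart_compose pathfinish_compose preimage_vertices_def)
    qed
  qed
qed

end

subsection \<open>Counting edges\<close>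

lemma pow_smult_mat:
  fixes A :: "complex mat"
  assumes "A \<in> carrier_mat n n" shows "(c \<cdot>\<^sub>m A) ^\<^sub>m k = c ^ k \<cdot>\<^sub>m (A ^\<^sub>m k)"
proof (induction k)
  case 0 show ?case using assms by auto
next
  case (Suc k)
  have Ak: "A ^\<^sub>m k \<in> carrier_mat n n" using assms by simp
  have "(c ^ k \<cdot>\<^sub>m A ^\<^sub>m k) * (c \<cdot>\<^sub>m A) = c ^ k \<cdot>\<^sub>m (A ^\<^sub>m k * (c \<cdot>\<^sub>m A))" by (rule mult_smult_assoc_mat[OF Ak]) (use assms in auto)
  also have "\<dots> = c ^ k \<cdot>\<^sub>m (c \<cdot>\<^sub>m (A ^\<^sub>m k * A))" using mult_smult_distrib[OF Ak assms, of c] by simp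
  also have "\<dots> = c ^ Suc k \<cdot>\<^sub>m (A ^\<^sub>m k * A)" by (rule eq_matI) (auto simp: mult.assoc mult.commute)
  finally show ?case using Suc by simp
qed

text \<open>After division by a number r above the spectral radius the powers are bounded: the gap
  absorbs the polynomial factors of Jordan blocks.\<close>

lemma mat_pow_growth:
  fixes A :: "complex mat"
  assumes A: "A \<in> carrier_mat n n" and n: "n > 0" and sr: "spectral_radius A < d"
  obtains r C where "0 < r" "r < d" "\<And>k i j. i < n \<Longrightarrow> j < n \<Longrightarrow> norm ((A ^\<^sub>m k) $$ (i, j)) \<le> C * r ^ k"
proof -
  have "spectral_radius A \<in> norm ` spectrum A" using spectral_radius_mem_max(1)[OF A n] .
  then have sr0: "0 \<le> spectral_radius A" by auto
  define r where "r = (spectral_radius A + d) / 2"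
  have r: "0 < r" "spectral_radius A < r" "r < d" using sr sr0 by (auto simp: r_def)
  define B where "B = (1 / complex_of_real r) \<cdot>\<^sub>m A"
  have B: "B \<in> carrier_mat n n" using A by (simp add: B_def)
  have "spectral_radius B \<in> norm ` spectrum B" using spectral_radius_mem_max(1)[OF B n] .
  then obtain ev where ev: "ev \<in> spectrum B" "spectral_radius B = norm ev" by auto
  then obtain v where v: "v \<in> carrier_vec n" "v \<noteq> 0\<^sub>v n" "B *\<^sub>v v = ev \<cdot>\<^sub>v v"
    using B by (auto simp: spectrum_def eigenvalue_def eigenvector_def)
  have "A *\<^sub>v v = (of_real r * ev) \<cdot>\<^sub>v v"
  proof -
    have "A = of_real r \<cdot>\<^sub>m B" unfolding B_def by (rule eq_matI) (use r in auto)
    moreover have "(of_real r \<cdot>\<^sub>m B) *\<^sub>v v = of_real r \<cdot>\<^sub>v (B *\<^sub>v v)"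
      by (rule eq_vecI) (use B v(1) in \<open>auto simp: scalar_prod_def sum_distrib_left mult.assoc\<close>)
    ultimately have "A *\<^sub>v v = of_real r \<cdot>\<^sub>v (B *\<^sub>v v)" by simp
    then show ?thesis using v(3) by (simp add: smult_smult_assoc)
  qed
  then have "eigenvector A v (of_real r * ev)" using v A by (simp add: eigenvector_def)
  then have "norm (of_real r * ev) \<le> spectral_radius A"
    using spectral_radius_mem_max(2)[OF A n] unfolding spectrum_def eigenvalue_def by blast
  then have "r * norm ev \<le> spectral_radius A" using r(1) by (simp add: norm_mult)
  then have "r * norm ev < r * 1" using r by linarith
  then have "spectral_radius B < 1" using r(1) ev(2) mult_less_cancel_left_pos by metis
  then obtain C where C: "\<And>k. norm_bound (B ^\<^sub>m k) C" using spectral_radius_jnf_norm_bound_less_1_upper_triangular[OF B] by blast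
  show ?thesis
  proof (rule that[OF r(1,3)])
    fix k i j assume ij: "i < n" "j < n"
    have "norm ((B ^\<^sub>m k) $$ (i, j)) \<le> C" using C[of k] ij B unfolding norm_bound_def by auto
    moreover have "(B ^\<^sub>m k) $$ (i, j) = (1 / of_real r) ^ k * (A ^\<^sub>m k) $$ (i, j)"
      unfolding B_def pow_smult_mat[OF A] using ij A by simp
    ultimately have "norm ((A ^\<^sub>m k) $$ (i, j)) / r ^ k \<le> C" using r(1) by (simp add: norm_mult norm_power norm_divide power_divide)
    then show "norm ((A ^\<^sub>m k) $$ (i, j)) \<le> C * r ^ k" using r(1) by (simp add: field_simps)
  qed
qed

context pcf_poly
begin

abbreviation "Es s \<equiv> Ed (Vs s)"

lemma Es_finite: "finite (Es s)" by (rule Ed_finite[OF Vs_finite])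

lemma Es_0: "Es 0 = ET" by (simp add: Vs_0 VT_facts(3))

lemma Es_unique: "e \<in> Es s \<Longrightarrow> e' \<in> Es s \<Longrightarrow> x \<in> e \<Longrightarrow> x \<in> e' \<Longrightarrow> x \<notin> Vs s \<Longrightarrow> e = e'"
  by (rule Ed_unique[OF Vs_K Vs_median])

text \<open>The vertices of the Hubbard tree are among those of level k, so its edge through x
  contains the level k edge through x.\<close>

lemma sub_edge:
  assumes e: "e \<in> Es k" "x \<in> e" "x \<notin> Vs k" and pq: "p \<in> VT" "q \<in> VT" "x \<in> seg p q"
  shows "\<exists>e'\<in>ET. e' \<subseteq> seg p q \<and> e \<subseteq> e'"
proof -
  have xV: "x \<notin> VT" using e(3) VT_Vs by blast
  obtain e' where e': "e' \<in> Ed VT" "x \<in> e'" "e' \<subseteq> seg p q" using edge_through[OF VT_facts(1,5) pq xV] .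
  obtain u v where uv: "u \<in> VT" "v \<in> VT" "e' = seg u v" using EdE[OF e'(1)] by metis
  have uvk: "u \<in> Vs k" "v \<in> Vs k" using uv VT_Vs by blast+
  have xuv: "x \<in> seg u v" using uv(3) e'(2) by simp
  have "e \<subseteq> seg u v" by (rule edge_in_edge[OF Vs_finite Vs_K Vs_median e uvk xuv])
  then show ?thesis using e' uv(3) VT_facts(3) by blast
qed

lemma sub_edge_HT: assumes "e \<in> Es k" "x \<in> e" "x \<notin> Vs k" "x \<in> HT" shows "\<exists>e'\<in>ET. e \<subseteq> e'"
proof -
  have "x \<notin> VT" using assms(3) VT_Vs by blast
  then obtain e' where e': "e' \<in> ET" "x \<in> e'" using VT_facts(7) assms(4) by blast
  obtain u v where uv: "u \<in> VT" "v \<in> VT" "e' = seg u v" using EdE[OF e'(1)[unfolded VT_facts(3)]] by metis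
  show ?thesis using sub_edge[OF assms(1-3) uv(1,2)] e'(2) uv(3) by blast
qed

definition "cnt k e' = card {e \<in> Es k. e \<subseteq> e'}"

lemma cnt_0: assumes "e' \<in> ET" shows "cnt 0 e' \<le> 1"
proof -
  have "{e \<in> Es 0. e \<subseteq> e'} \<subseteq> {e'}"
  proof
    fix e assume "e \<in> {e \<in> Es 0. e \<subseteq> e'}"
    then have e: "e \<in> Es 0" "e \<subseteq> e'" "e' \<in> Es 0" using assms by (simp_all add: Es_0)
    obtain x where x: "x \<in> e" "x \<notin> Vs 0" using Ed_interior[OF e(1) Vs_K] .
    have xe: "x \<in> e'" using x(1) e(2) by blast
    show "e \<in> {e'}" using Es_unique[OF e(1,3) x(1) xe x(2)] by simp
  qed
  then show ?thesis unfolding cnt_def using card_mono[of "{e'}"] by fastforce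
qed

text \<open>f is injective on e', so the edges of level k + 1 in e' are counted by their images;
  these are edges of level k, each inside an edge of the Hubbard tree covered by the image of
  e'.\<close>

lemma cnt_Suc:
  assumes e': "e' \<in> ET" shows "cnt (Suc k) e' \<le> (\<Sum>e''\<in>{e'' \<in> ET. e'' \<subseteq> poly f ` e'}. cnt k e'')"
proof -
  define A where "A = {e \<in> Es (Suc k). e \<subseteq> e'}"
  define S where "S = {e'' \<in> ET. e'' \<subseteq> poly f ` e'}"
  obtain u v where uv: "u \<in> VT" "v \<in> VT" "u \<noteq> v" "seg u v \<inter> VT = {u, v}" "e' = seg u v" using EdE[OF e'[unfolded VT_facts(3)]] .
  have K: "u \<in> K" "v \<in> K" using uv VT_facts(5) by auto
  have nc: "z = u \<or> z = v" if "z \<in> seg u v" "poly (pderiv f) z = 0" for z using that crit_P VT_facts(4) uv(4) by blast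
  note si = seg_image[OF K nc]
  have inj: "inj_on (poly f) e'" using si(1) uv(5) by simp
  have fS: "finite S" using ET_finite by (simp add: S_def)
  have sub: "(`) (poly f) ` A \<subseteq> (\<Union>e''\<in>S. {e \<in> Es k. e \<subseteq> e''})"
  proof clarify
    fix e assume "e \<in> A"
    then have e: "e \<in> Es (1 + k)" "e \<subseteq> e'" by (auto simp: A_def)
    have fe: "poly f ` e \<in> Es k" using Ed_image(2)[OF e(1)] by simp
    obtain x where x: "x \<in> poly f ` e" "x \<notin> Vs k" using Ed_interior[OF fe Vs_K] .
    have "x \<in> seg (poly f u) (poly f v)" using x(1) e(2) si(2) uv(5) by blast
    then have "\<exists>e''\<in>ET. e'' \<subseteq> seg (poly f u) (poly f v) \<and> poly f ` e \<subseteq> e''"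
      by (rule sub_edge[OF fe x VT_step[OF uv(1)] VT_step[OF uv(2)]])
    then show "poly f ` e \<in> (\<Union>e''\<in>S. {e \<in> Es k. e \<subseteq> e''})" using fe si(2) uv(5) by (auto simp: S_def)
  qed
  have "inj_on ((`) (poly f)) A" unfolding inj_on_def A_def using inj_on_image_eq_iff[OF inj] by blast
  then have "card A = card ((`) (poly f) ` A)" by (simp add: card_image)
  also have "\<dots> \<le> card (\<Union>e''\<in>S. {e \<in> Es k. e \<subseteq> e''})" using fS Es_finite by (intro card_mono[OF _ sub]) auto
  also have "\<dots> \<le> (\<Sum>e''\<in>S. card {e \<in> Es k. e \<subseteq> e''})" using fS by (rule card_UN_le)
  finally show ?thesis by (simp add: A_def S_def cnt_def)
qed

lemma edge_matrix_index:
  assumes ij: "i < card ET" "j < card ET"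
  shows "edge_matrix f $$ (i, j) = of_bool (from_nat_into ET i \<subseteq> poly f ` from_nat_into ET j)"
proof -
  have "from_nat_into ET i \<in> ET" using ij by (intro from_nat_into) auto
  moreover have "finite {e' \<in> ET. e' \<subseteq> poly f ` from_nat_into ET j}" using ET_finite by simp
  moreover have "(\<Sum>x\<in>S. of_int (if e = x then 1 else 0)) = (of_bool (e \<in> S) :: complex)" if "finite S" for S and e :: "complex set"
    using that by (simp add: of_bool_def if_distrib cong: if_cong)
  ultimately show ?thesis using ij unfolding edge_matrix_def edge_map_def Let_def by (simp add: lookup_sum)
qed

lemma edge_matrix_carrier: "edge_matrix f \<in> carrier_mat (card ET) (card ET)"
  by (simp add: edge_matrix_def Let_def)

text \<open>A column of the edge matrix lists the edges covered by an image, so each use of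
  \<open>cnt_Suc\<close> multiplies by this matrix on the right; the start is a column sum of the
  identity.\<close>

lemma cnt_matrix:
  assumes j: "j < card ET"
  shows "real (cnt k (from_nat_into ET j)) \<le> (\<Sum>i<card ET. Re ((edge_matrix f ^\<^sub>m k) $$ (i, j)))"
  using j
proof (induction k arbitrary: j)
  case 0
  have "from_nat_into ET j \<in> ET" using 0 by (intro from_nat_into) auto
  moreover have "(\<Sum>i<card ET. Re ((edge_matrix f ^\<^sub>m 0) $$ (i, j))) = (\<Sum>i<card ET. if i = j then 1 else 0)"
    using 0 edge_matrix_carrier by (intro sum.cong) auto
  ultimately show ?case using cnt_0 0 by simp
next
  case (Suc k)
  define n where "n = card ET"
  define M where "M = edge_matrix f"
  define e where "e = from_nat_into ET"
  have M: "M \<in> carrier_mat n n" using edge_matrix_carrier by (simp add: M_def n_def)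
  have bij: "bij_betw e {..<n} ET" unfolding e_def n_def by (rule bij_betw_from_nat_into_finite[OF ET_finite])
  have ej: "e j \<in> ET" using bij Suc.prems by (auto simp: bij_betw_def n_def)
  define b where "b i = (of_bool (e i \<subseteq> poly f ` e j) :: real)" for i
  have Mij: "M $$ (i, j) = of_real (b i)" if "i < n" for i
    using edge_matrix_index[of i j] that Suc.prems by (auto simp: M_def n_def e_def b_def)
  have b0: "b i \<ge> 0" for i by (simp add: b_def)
  have "real (cnt (Suc k) (e j)) \<le> (\<Sum>e''\<in>{e'' \<in> ET. e'' \<subseteq> poly f ` e j}. real (cnt k e''))"
    using cnt_Suc[OF ej, of k] by (simp flip: of_nat_sum)
  also have "\<dots> = (\<Sum>e''\<in>ET. if e'' \<subseteq> poly f ` e j then real (cnt k e'') else 0)" using ET_finite by (simp add: sum.inter_filter)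
  also have "\<dots> = (\<Sum>i<n. if e i \<subseteq> poly f ` e j then real (cnt k (e i)) else 0)" using sum.reindex_bij_betw[OF bij, symmetric] by blast
  also have "\<dots> = (\<Sum>i<n. b i * real (cnt k (e i)))" by (intro sum.cong) (auto simp: b_def)
  also have "\<dots> \<le> (\<Sum>i<n. b i * (\<Sum>l<n. Re ((M ^\<^sub>m k) $$ (l, i))))"
    using Suc.IH b0 by (intro sum_mono mult_left_mono) (auto simp: M_def n_def e_def)
  also have "\<dots> = (\<Sum>l<n. \<Sum>i<n. Re ((M ^\<^sub>m k) $$ (l, i)) * b i)" unfolding sum_distrib_left by (subst sum.swap) (simp add: mult.commute)
  also have "\<dots> = (\<Sum>l<n. Re ((M ^\<^sub>m Suc k) $$ (l, j)))"
  proof (intro sum.cong refl)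
    fix l assume "l \<in> {..<n}"
    then have "(M ^\<^sub>m Suc k) $$ (l, j) = (\<Sum>i<n. (M ^\<^sub>m k) $$ (l, i) * M $$ (i, j))"
      using M Suc.prems by (simp add: n_def scalar_prod_def atLeast0LessThan)
    also have "\<dots> = (\<Sum>i<n. (M ^\<^sub>m k) $$ (l, i) * of_real (b i))" using Mij by (intro sum.cong) auto
    finally show "(\<Sum>i<n. Re ((M ^\<^sub>m k) $$ (l, i)) * b i) = Re ((M ^\<^sub>m Suc k) $$ (l, j))" by simp
  qed
  finally show ?case by (simp add: M_def n_def e_def)
qed

lemma cnt_growth:
  assumes ne: "ET \<noteq> {}" and ent: "exp_core_entropy f < real (degree f)"
  obtains r C where "0 < r" "r < real (degree f)" "\<And>k e. e \<in> ET \<Longrightarrow> real (cnt k e) \<le> C * r ^ k"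
proof -
  define n where "n = card ET"
  have n: "n > 0" using ne ET_finite by (simp add: n_def card_gt_0_iff)
  have "spectral_radius (edge_matrix f) < real (degree f)" using ne ent by (simp add: exp_core_entropy_def)
  then obtain r C where rC: "0 < r" "r < real (degree f)" "\<And>k i j. i < n \<Longrightarrow> j < n \<Longrightarrow> norm ((edge_matrix f ^\<^sub>m k) $$ (i, j)) \<le> C * r ^ k"
    using mat_pow_growth[OF edge_matrix_carrier[folded n_def] n] by metis
  show ?thesis
  proof (rule that[OF rC(1,2)])
    fix k e assume "e \<in> ET"
    moreover have "bij_betw (from_nat_into ET) {..<n} ET" unfolding n_def by (rule bij_betw_from_nat_into_finite[OF ET_finite])
    ultimately obtain j where j: "j < n" "e = from_nat_into ET j" by (auto simp: bij_betw_def)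
    have "real (cnt k e) \<le> (\<Sum>i<n. Re ((edge_matrix f ^\<^sub>m k) $$ (i, j)))" using cnt_matrix[of j k] j by (simp add: n_def)
    also have "\<dots> \<le> (\<Sum>i<n. C * r ^ k)" using rC(3) j(1) complex_Re_le_cmod by (intro sum_mono) (meson lessThan_iff order_trans)
    finally show "real (cnt k e) \<le> (real n * C) * r ^ k" by (simp add: mult.assoc)
  qed
qed

text \<open>Lifts of an edge are separated by the preimages of one of its interior points.\<close>

lemma card_lifts:
  assumes B: "finite B" "B \<subseteq> Es k" and A: "A \<subseteq> Es (t + k)" "\<And>e. e \<in> A \<Longrightarrow> iter f t ` e \<in> B"
  shows "card A \<le> degree f ^ t * card B"
proof -
  have fA: "finite A" using A(1) Es_finite finite_subset by blast
  have fib: "card {e \<in> A. iter f t ` e = e'} \<le> degree f ^ t" if e': "e' \<in> B" for e'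
  proof -
    obtain x where x: "x \<in> e'" "x \<notin> Vs k" using Ed_interior[of e' "Vs k"] Vs_K B(2) e' by blast
    have "\<exists>z\<in>e. iter f t z = x" if "e \<in> A" "iter f t ` e = e'" for e using that x(1) by blast
    then obtain g where g: "\<And>e. e \<in> A \<Longrightarrow> iter f t ` e = e' \<Longrightarrow> g e \<in> e \<and> iter f t (g e) = x" by metis
    have "inj_on g {e \<in> A. iter f t ` e = e'}"
    proof (rule inj_onI)
      fix e1 e2 assume e: "e1 \<in> {e \<in> A. iter f t ` e = e'}" "e2 \<in> {e \<in> A. iter f t ` e = e'}" "g e1 = g e2"
      have E: "e1 \<in> Es (t + k)" "e2 \<in> Es (t + k)" "g e1 \<in> e1" "g e1 \<in> e2" using e g[of e1] g[of e2] A(1) by auto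
      have "iter f k (iter f t (g e1)) \<notin> VT" using g[of e1] e(1) x(2) by (auto simp: preimage_vertices_def)
      then have "g e1 \<notin> Vs (t + k)" by (simp add: preimage_vertices_def add.commute[of t] iter_add)
      then show "e1 = e2" using Es_unique[OF E] by simp
    qed
    moreover have "g ` {e \<in> A. iter f t ` e = e'} \<subseteq> {z. iter f t z = x}" using g by blast
    ultimately have "card {e \<in> A. iter f t ` e = e'} \<le> card {z. iter f t z = x}" using finite_iter_fibre by (intro card_inj_on_le) auto
    also have "{z. iter f t z = x} = {z. poly (ipoly f t - [:x:]) z = 0}" by (simp add: poly_ipoly)
    also have "card \<dots> \<le> degree (ipoly f t - [:x:])" by (intro card_poly_roots_bound poly_minus_const_nonzero deg_ipoly_pos)
    also have "\<dots> \<le> degree f ^ t" by (rule order_trans[OF degree_diff_le_max]) (simp add: degree_ipoly)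
    finally show ?thesis .
  qed
  have "A = (\<Union>e'\<in>B. {e \<in> A. iter f t ` e = e'})" using A(2) by blast
  then have "card A \<le> (\<Sum>e'\<in>B. card {e \<in> A. iter f t ` e = e'})" using card_UN_le[OF B(1)] by metis
  also have "\<dots> \<le> (\<Sum>e'\<in>B. degree f ^ t)" using fib by (rule sum_mono)
  finally show ?thesis by (simp add: mult.commute)
qed

end

section \<open>Convex hulls in the preimage trees\<close>

context pcf_poly
begin

lemma card_Es_le: "card (Es k) \<le> degree f ^ k * card ET"
proof -
  have "card (Es k) \<le> degree f ^ k * card (Es 0)"
  proof (rule card_lifts)
    show "Es k \<subseteq> Es (k + 0)" by simp
    show "iter f k ` e \<in> Es 0" if "e \<in> Es k" for e using Ed_image(2)[of e k 0] that by simp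
  qed (use Es_finite in auto)
  then show ?thesis by (simp add: Es_0)
qed

lemma hull_subtree:
  assumes Q: "Q \<subseteq> Vs s" shows "is_subtree f s (hull_of Q)"
proof -
  have QK: "Q \<subseteq> K" using Q Vs_K by blast
  define W where "W = hull_of Q \<inter> Vs s"
  define F where "F = {e \<in> Es s. e \<subseteq> hull_of Q}"
  have "hull_of Q = W \<union> \<Union>F"
  proof
    show "hull_of Q \<subseteq> W \<union> \<Union>F"
    proof
      fix x assume x: "x \<in> hull_of Q"
      show "x \<in> W \<union> \<Union>F"
      proof (cases "x \<in> Vs s")
        case True then show ?thesis using x by (simp add: W_def)
      next
        case False
        obtain p q where pq: "p \<in> Q" "q \<in> Q" "x \<in> seg p q" using x unfolding hull_of_def by blast
        then have pqV: "p \<in> Vs s" "q \<in> Vs s" using Q by auto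
        obtain e where e: "e \<in> Es s" "x \<in> e" "e \<subseteq> seg p q" using edge_through[OF Vs_finite Vs_K pqV pq(3) False] .
        then have "e \<in> F" using seg_sub_hull[OF pq(1,2)] by (auto simp: F_def)
        then show ?thesis using e(2) by blast
      qed
    qed
  qed (auto simp: W_def F_def)
  moreover have "connected (hull_of Q)" by (rule convx_connected[OF hull_convx[OF QK]])
  moreover have "W \<subseteq> Vs s" "F \<subseteq> preimage_edges f s" by (auto simp: W_def F_def preimage_edges_eq)
  ultimately show ?thesis unfolding is_subtree_def by blast
qed

text \<open>\<open>hull_of Q\<close> is one of the subtrees whose intersection is
  \<open>tree_hull\<close>; enlarging \<V> to Q is harmless for an upper bound.\<close>

lemma tree_hull_sub: "\<V> \<subseteq> Q \<Longrightarrow> Q \<subseteq> Vs s \<Longrightarrow> tree_hull f s \<V> \<subseteq> hull_of Q"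
proof -
  assume Q: "\<V> \<subseteq> Q" "Q \<subseteq> Vs s"
  then have "\<V> \<subseteq> hull_of Q" using sub_hull[of Q] Vs_K by blast
  then show ?thesis unfolding tree_hull_def by (intro hull_minimal hull_subtree[OF Q(2)])
qed

text \<open>These edges are lifts under the \<open>t\<close>-th iterate of level \<open>k\<close> edges inside the Hubbard tree.\<close>

lemma card_edges_in_tree:
  "card {e \<in> Es (t + k). \<exists>x\<in>e. x \<in> Hs t \<and> x \<notin> Vs (t + k)} \<le> degree f ^ t * (\<Sum>e\<in>ET. cnt k e)"
proof -
  define B where "B = (\<Union>e'\<in>ET. {e \<in> Es k. e \<subseteq> e'})"
  have fB: "finite B" using ET_finite Es_finite by (simp add: B_def)
  have "card {e \<in> Es (t + k). \<exists>x\<in>e. x \<in> Hs t \<and> x \<notin> Vs (t + k)} \<le> degree f ^ t * card B"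
  proof (rule card_lifts[OF fB])
    fix e assume "e \<in> {e \<in> Es (t + k). \<exists>x\<in>e. x \<in> Hs t \<and> x \<notin> Vs (t + k)}"
    then obtain x where e: "e \<in> Es (t + k)" and x: "x \<in> e" "x \<in> Hs t" "x \<notin> Vs (t + k)" by blast
    have "iter f t x \<in> HT" using x(2) by (simp add: preimage_tree_def)
    moreover have "iter f t x \<notin> Vs k" using x(3) by (simp add: preimage_vertices_def add.commute[of t] iter_add)
    ultimately have "\<exists>e'\<in>ET. iter f t ` e \<subseteq> e'" using sub_edge_HT[OF Ed_image(2)[OF e]] x(1) by blast
    then show "iter f t ` e \<in> B" using Ed_image(2)[OF e] by (auto simp: B_def)
  qed (auto simp: B_def)
  also have "card B \<le> (\<Sum>e\<in>ET. cnt k e)" unfolding B_def cnt_def using ET_finite by (rule card_UN_le)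
  finally show ?thesis by simp
qed

text \<open>The level \<open>t\<close> tree contains all critical points of the \<open>t\<close>-th iterate, so that iterate is
  injective on the arc from \<open>v\<close> to this tree.\<close>

lemma card_branch_edges:
  assumes v: "v \<in> K" and p: "p \<in> Hs t"
  shows "card {e \<in> Es (t + k). e \<subseteq> seg v p \<and> e \<inter> Hs t \<subseteq> Vs (t + k)} \<le> card (Es k)"
proof -
  define A where "A = {e \<in> Es (t + k). e \<subseteq> seg v p \<and> e \<inter> Hs t \<subseteq> Vs (t + k)}"
  have pK: "p \<in> K" using p Hs_K by blast
  \<comment> \<open>The point where the arc from v first reaches the level t tree. From there on the
    arc stays in the tree by convexity, so the edges to be counted lie before h.\<close>
  obtain h where h: "h \<in> Hs t" "h \<in> seg v p" "seg v h \<inter> Hs t \<subseteq> {h}"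
  proof (cases "v \<in> Hs t")
    case True
    show ?thesis by (rule that[OF True]) (use seg_ends[OF v pK] in auto)
  next
    case False
    then have vp: "v \<noteq> p" using p by blast
    define g where "g = sarc v p"
    note sg = sarc[OF v pK vp, folded g_def]
    have gc: "continuous_on {0..1} g" using sg(1) by (simp add: arc_def path_def)
    have cl: "closed (Hs t)"
    proof -
      have "closed HT" using compact_imp_closed[OF hull_compact[OF P_finite P_K]] by (simp add: HT_eq)
      then show ?thesis unfolding preimage_tree_def
        using iter_cont[of UNIV t] by (intro continuous_closed_vimage) (simp_all add: continuous_on_eq_continuous_at)
    qed
    have g1: "g 1 \<in> Hs t" using sg(3) p by (simp add: pathfinish_def)
    obtain a where a: "0 \<le> a" "a \<le> 1" "g a \<in> Hs t" "\<And>s. 0 \<le> s \<Longrightarrow> s < a \<Longrightarrow> g s \<notin> Hs t" using compact_first[OF gc cl _ _ g1, of 0] by auto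
    have a0: "a \<noteq> 0" using a(3) sg(2) False by (auto simp: pathstart_def)
    have sub: "path_image (subpath 0 a g) \<subseteq> path_image g" using a by (intro path_image_subpath_subset) auto
    have "path_image (subpath 0 a g) = seg v (g a)"
    proof (rule seg_arc(1))
      show "arc (subpath 0 a g)" using a a0 by (intro arc_subpath_arc[OF sg(1)]) auto
      show "good (path_image (subpath 0 a g))" using good_sub[OF sg(4) sub] .
      show "pathstart (subpath 0 a g) = v" using sg(2) unfolding pathstart_def[of g] by simp
    qed simp
    then have "seg v (g a) = g ` {0..a}" using a by (simp add: path_image_subpath)
    moreover have "g a \<in> seg v p" using a sg(5) by (auto simp: path_image_def)
    moreover have "g ` {0..a} \<inter> Hs t \<subseteq> {g a}" using a(4) by (force simp: le_less)
    ultimately show ?thesis using a(3) that[of "g a"] by simp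
  qed
  have hK: "h \<in> K" using h(1) Hs_K by blast
  have "z = v \<or> z = h" if "z \<in> seg v h" "j < t" "poly (pderiv f) (iter f j z) = 0" for z j
  proof -
    have "iter f t z \<in> HT" using crit_Vs[OF that(2,3)] HT_facts(3) by blast
    then have "z \<in> Hs t" by (simp add: preimage_tree_def)
    then show ?thesis using h(3) that(1) by blast
  qed
  then have inj: "inj_on (iter f t) (seg v h)" using seg_iter_image[OF v hK, of t] by blast
  have Ah: "e \<subseteq> seg v h" if e: "e \<in> A" for e
  proof -
    have e': "e \<in> Es (t + k)" "e \<subseteq> seg v p" "e \<inter> Hs t \<subseteq> Vs (t + k)" using e by (auto simp: A_def)
    have "seg h p \<subseteq> Hs t" using Hs_convx h(1) p unfolding convx_def by blast
    moreover have "seg v p = seg v h \<union> seg h p" using seg_split(1)[OF v pK h(2)] .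
    ultimately have "e - Vs (t + k) \<subseteq> seg v h" using e'(2,3) by blast
    then have "closure (e - Vs (t + k)) \<subseteq> seg v h" using seg_compact[OF v hK] by (intro closure_minimal compact_imp_closed)
    then show ?thesis using Ed_closure[OF e'(1) Vs_K] by simp
  qed
  have "inj_on ((`) (iter f t)) A" unfolding inj_on_def using inj_on_image_eq_iff[OF inj] Ah by blast
  moreover have "(`) (iter f t) ` A \<subseteq> Es k" using Ed_image(2) by (auto simp: A_def)
  ultimately show ?thesis unfolding A_def[symmetric] using Es_finite by (rule card_inj_on_le)
qed

text \<open>An edge of the hull with an interior point in the level t tree is counted by
  \<open>card_edges_in_tree\<close>. Any other edge lies on the arc from a point p of P to some v in
  \<V> and is counted by \<open>card_branch_edges\<close>.\<close>

lemma hull_edges_bound: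
  assumes V: "\<V> \<subseteq> Vs (t + k)" "finite \<V>"
  shows "card (subtree_edges f (t + k) (tree_hull f (t + k) \<V>))
    \<le> degree f ^ t * (\<Sum>e\<in>ET. cnt k e) + card \<V> * (degree f ^ k * card ET)"
proof -
  define s where "s = t + k"
  define A1 where "A1 = {e \<in> Es s. \<exists>x\<in>e. x \<in> Hs t \<and> x \<notin> Vs s}"
  obtain p where p: "p \<in> P" using P_ne by blast
  define A2 where "A2 v = {e \<in> Es s. e \<subseteq> seg v p \<and> e \<inter> Hs t \<subseteq> Vs s}" for v
  \<comment> \<open>Adding the vertices of level t puts p into Q; every point of Q off the level t
    tree still belongs to \<V>.\<close>
  define Q where "Q = Vs t \<union> \<V>"
  have Q: "Q \<subseteq> Vs s" using V(1) Hs_mono(2)[of t s] by (auto simp: Q_def s_def)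
  then have QK: "Q \<subseteq> K" using Vs_K by blast
  have pV: "p \<in> Vs t" using p VT_facts(4) VT_Vs by blast
  have pQ: "p \<in> Q" "p \<in> Vs s" "p \<in> K" using pV Q Vs_K by (auto simp: Q_def)
  have pH: "p \<in> Hs t" using pV Vs_Hs by blast
  have "subtree_edges f s (tree_hull f s \<V>) \<subseteq> A1 \<union> (\<Union>v\<in>\<V>. A2 v)"
  proof
    fix e assume "e \<in> subtree_edges f s (tree_hull f s \<V>)"
    then have e: "e \<in> Es s" "e \<subseteq> hull_of Q" using tree_hull_sub[of \<V> Q s] Q by (auto simp: subtree_edges_def preimage_edges_eq Q_def)
    show "e \<in> A1 \<union> (\<Union>v\<in>\<V>. A2 v)"
    proof (cases "e \<in> A1")
      case False
      then have eH: "e \<inter> Hs t \<subseteq> Vs s" using e(1) by (auto simp: A1_def)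
      obtain x where x: "x \<in> e" "x \<notin> Vs s" using Ed_interior[OF e(1) Vs_K] .
      then have "x \<in> hull_of Q" using e(2) by blast
      then obtain q where q: "q \<in> Q" "x \<in> seg p q" using hull_star1[OF QK pQ(3)] by blast
      have "x \<notin> Hs t" using x eH by blast
      then have "q \<notin> Hs t" using q(2) Hs_convx pH unfolding convx_def by blast
      then have qV: "q \<in> \<V>" using q(1) Vs_Hs by (auto simp: Q_def)
      obtain e' where e': "e' \<in> Es s" "x \<in> e'" "e' \<subseteq> seg p q" using edge_through[OF Vs_finite Vs_K pQ(2) _ q(2) x(2)] q(1) Q by blast
      have "e = e'" by (rule Es_unique[OF e(1) e'(1) x(1) e'(2) x(2)])
      moreover have "seg p q = seg q p" using seg_sym pQ(3) q(1) QK by blast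
      ultimately have "e \<in> A2 q" using e(1) e'(3) eH by (simp add: A2_def)
      then show ?thesis using qV by blast
    qed simp
  qed
  moreover have "finite A1" "finite (\<Union>v\<in>\<V>. A2 v)" using V(2) Es_finite by (auto simp: A1_def A2_def)
  ultimately have "card (subtree_edges f s (tree_hull f s \<V>)) \<le> card A1 + card (\<Union>v\<in>\<V>. A2 v)"
    by (meson card_Un_le card_mono finite_UnI order_trans)
  also have "card A1 \<le> degree f ^ t * (\<Sum>e\<in>ET. cnt k e)" using card_edges_in_tree[of t k] by (simp add: A1_def s_def)
  also have "card (\<Union>v\<in>\<V>. A2 v) \<le> (\<Sum>v\<in>\<V>. card (A2 v))" using V(2) by (rule card_UN_le)
  also have "\<dots> \<le> (\<Sum>v\<in>\<V>. degree f ^ k * card ET)"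
  proof (rule sum_mono)
    fix v assume "v \<in> \<V>"
    then have "v \<in> K" using V(1) Vs_K by blast
    then have "card (A2 v) \<le> card (Es k)" using card_branch_edges[OF _ pH, of v k] by (simp add: A2_def s_def)
    then show "card (A2 v) \<le> degree f ^ k * card ET" using card_Es_le[of k] by linarith
  qed
  finally show ?thesis by (simp add: s_def)
qed

lemma subtree_edges_empty: "subtree_edges f s (tree_hull f s {}) = {}"
proof -
  have "is_subtree f s {}" unfolding is_subtree_def by (auto intro!: exI[of _ "{}"])
  then have "tree_hull f s {} = {}" unfolding tree_hull_def using hull_minimal[of "{}" "{}" "is_subtree f s"] by auto
  moreover have "e \<noteq> {}" if "e \<in> Es s" for e using Ed_interior[OF that Vs_K] by blast
  ultimately show ?thesis by (auto simp: subtree_edges_def preimage_edges_eq)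
qed

lemma subtree_edges_finite: "finite (subtree_edges f s T)"
  unfolding subtree_edges_def preimage_edges_eq using Es_finite by simp

theorem hull_edges_fraction:
  assumes ent: "exp_core_entropy f < real (degree f)" and \<nu>: "\<nu> > 0"
  shows "\<exists>\<kappa>>0. \<forall>s \<V>. \<V> \<subseteq> Vs s \<and> finite \<V> \<and> real (card \<V>) \<le> \<kappa> * real (degree f) ^ s \<longrightarrow>
    real (card (subtree_edges f s (tree_hull f s \<V>))) \<le> \<nu> * real (degree f) ^ s"
proof (cases "ET = {}")
  case True
  have "Es s = {}" for s using card_Es_le[of s] Es_finite True by simp
  then show ?thesis using \<nu> by (intro exI[of _ 1]) (auto simp: subtree_edges_def preimage_edges_eq)
next
  case ne: False
  define d where "d = real (degree f)"
  define E where "E = real (card ET)"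
  have d: "d \<ge> 2" using deg2 by (simp add: d_def)
  obtain r C where rC: "0 < r" "r < d" "\<And>k e. e \<in> ET \<Longrightarrow> real (cnt k e) \<le> C * r ^ k" using cnt_growth[OF ne ent] by (metis d_def)
  \<comment> \<open>An upper bound for the first summand of \<open>hull_edges_bound\<close>, divided
    by d^s.\<close>
  have "(\<lambda>k. E * C * (r / d) ^ k) \<longlonglongrightarrow> E * C * 0" using rC(1,2) d by (intro tendsto_intros LIMSEQ_power_zero) auto
  then have "eventually (\<lambda>k. E * C * (r / d) ^ k < \<nu> / 2) sequentially"
    using order_tendstoD(2)[of _ "0::real" sequentially "\<nu> / 2"] \<nu> by simp
  then obtain k where k: "E * C * (r / d) ^ k < \<nu> / 2" by (auto simp: eventually_sequentially)
  \<comment> \<open>The first term bounds the second summand of \<open>hull_edges_bound\<close> by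
    \<nu> / 2 times d^s, with E + 1 keeping the denominator positive; the second term leaves no room
    for a vertex when s < k.\<close>
  define \<kappa> where "\<kappa> = min (\<nu> / (2 * d ^ k * (E + 1))) (1 / (2 * d ^ k))"
  have E0: "E \<ge> 0" by (simp add: E_def)
  have dk: "d ^ k > 0" using d by simp
  have \<kappa>: "\<kappa> > 0" using \<nu> dk E0 by (simp add: \<kappa>_def)
  have "real (card (subtree_edges f s (tree_hull f s \<V>))) \<le> \<nu> * d ^ s"
    if V: "\<V> \<subseteq> Vs s" "finite \<V>" "real (card \<V>) \<le> \<kappa> * d ^ s" for s \<V>
  proof (cases "s < k")
    \<comment> \<open>Below k there is no level s - k to split at, but \<kappa> makes \<V>
      empty.\<close>
    case True
    have "\<kappa> * d ^ s \<le> (1 / (2 * d ^ k)) * d ^ k" using True d dk by (intro mult_mono) (auto simp: \<kappa>_def intro: power_increasing)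
    also have "\<dots> < 1" using dk by simp
    finally have "card \<V> = 0" using V(3) by simp
    then have "\<V> = {}" using V(2) by simp
    then show ?thesis using subtree_edges_empty \<nu> d by simp
  next
    case False
    define t where "t = s - k"
    have s: "s = t + k" using False by (simp add: t_def)
    have ds: "d ^ s = d ^ t * d ^ k" by (simp add: s power_add)
    have "real (card (subtree_edges f s (tree_hull f s \<V>))) \<le> real (degree f ^ t * (\<Sum>e\<in>ET. cnt k e) + card \<V> * (degree f ^ k * card ET))"
      using hull_edges_bound[of \<V> t k] V by (simp only: s of_nat_le_iff)
    also have "\<dots> = d ^ t * (\<Sum>e\<in>ET. real (cnt k e)) + real (card \<V>) * (d ^ k * E)" by (simp add: d_def E_def)
    also have "\<dots> \<le> d ^ t * (\<Sum>e\<in>ET. C * r ^ k) + (\<kappa> * d ^ s) * (d ^ k * E)"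
      using rC(3) V(3) d E0 by (intro add_mono mult_left_mono mult_right_mono sum_mono) auto
    also have "d ^ t * (\<Sum>e\<in>ET. C * r ^ k) = d ^ s * (E * C * (r / d) ^ k)" using d by (simp add: E_def ds power_divide)
    also have "\<dots> \<le> d ^ s * (\<nu> / 2)" using k d by (intro mult_left_mono) auto
    also have "(\<kappa> * d ^ s) * (d ^ k * E) \<le> d ^ s * (\<nu> / 2)"
    proof -
      have "\<kappa> * (d ^ k * E) \<le> (\<nu> / (2 * d ^ k * (E + 1))) * (d ^ k * (E + 1))" using \<nu> dk E0 by (intro mult_mono) (auto simp: \<kappa>_def)
      also have "\<dots> = \<nu> / (2 * (d ^ k * (E + 1))) * (d ^ k * (E + 1))" by (simp only: mult.assoc)
      also have "\<dots> = \<nu> / 2"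
      proof -
        have "d ^ k * (E + 1) \<noteq> 0" using dk E0 by (smt (verit) mult_pos_pos)
        moreover have "\<nu> / (2 * X) * X = \<nu> / 2" if "X \<noteq> 0" for X :: real using that by simp
        ultimately show ?thesis by blast
      qed
      finally have "d ^ s * (\<kappa> * (d ^ k * E)) \<le> d ^ s * (\<nu> / 2)" using d by (intro mult_left_mono) auto
      then show ?thesis by (simp only: mult_ac)
    qed
    finally show ?thesis by (simp add: mult.commute)
  qed
  then show ?thesis using \<kappa> by (intro exI[of _ \<kappa>]) (auto simp: d_def)
qed

end

theorem corollary3p10:
  fixes f :: "complex poly"
  assumes "degree f \<ge> 2"
    and "postcritically_finite f"
    and "exp_core_entropy f < real (degree f)"
  shows "\<forall>\<nu>::real. \<nu> > 0 \<longrightarrow> (\<exists>\<kappa>::real. \<kappa> > 0 \<and>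
    (\<forall>(s::nat) \<V>. \<V> \<subseteq> preimage_vertices f s \<and> finite \<V> \<and>
        real (card \<V>) \<le> \<kappa> * real (degree f) ^ s \<longrightarrow>
      finite (subtree_edges f s (tree_hull f s \<V>)) \<and>
      real (card (subtree_edges f s (tree_hull f s \<V>))) \<le> \<nu> * real (degree f) ^ s))"
proof -
  interpret pcf_poly f using assms by unfold_locales
  show ?thesis using hull_edges_fraction[OF assms(3)] subtree_edges_finite by metis
qed

end
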